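(* Let $\Omega\subset\mathbb{R}^N$, $N\ge 2$, be a bounded smooth domain. For every $p>N$ let $q(p)\in[1,\infty)$ be given, and let $u_{p,q(p)}$ be a positive Sobolev extremal function corresponding to $\lambda_{p,q(p)}$. Suppose that $$\lim_{p\to\infty}q(p)=\infty .$$ Then $$\lim_{p\to\infty}\lambda_{p,q(p)}^{1/p}=\Lambda_\infty\qquad\text{and}\qquad \lim_{p\to\infty}\|u_{p,q(p)}\|_\infty=1 .$$ Moreover, for each sequence $p_n\to\infty$, the sequence $u_{p_n,q(p_n)}$ admits a subsequence that converges uniformly in $\overline\Omega$ to a function $u_\infty\in C_0(\overline\Omega)\cap W^{1,\infty}(\Omega)$ with the following properties: 1. $0\le u_\infty(x)\le \Lambda_\infty d_\Omega(x)$ for all $x\in\overline\Omega$. 2. $\|u_\infty\|_\infty=1$ and $\Lambda_\infty=\|\nabla u_\infty\|_\infty$. 3. $M:=\{x\in\Omega: u_\infty(x)=1\}\subseteq M_\Omega:=\{x\in\Omega: d_\Omega(x)=\|d_\Omega\|_\infty\}$. 4. $u_\infty$ is infinity superharmonic in $\Omega$ and (consequently) positive in $\Omega$.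
   Context: $\|\cdot\|_r$ is the standard norm of $L^r(\Omega)$, $1\le r\le\infty$. $C_0(\overline\Omega)$ is the set of continuous functions on $\overline\Omega$ vanishing on $\partial\Omega$. For $p>N$ and $1\le q<\infty$, $$\lambda_{p,q}:=\inf\{\|\nabla u\|_p^p: u\in W_0^{1,p}(\Omega),\ \|u\|_q=1\}.$$ The infimum is attained. A Sobolev extremal function corresponding to $\lambda_{p,q}$ is a positive minimizer $u_{p,q}$, i.e. $u_{p,q}\in W_0^{1,p}(\Omega)$, $u_{p,q}>0$ in $\Omega$, $\|u_{p,q}\|_q=1$ and $\|\nabla u_{p,q}\|_p^p=\lambda_{p,q}$ (it need not be unique when $q>p$; $u_{p,q(p)}$ denotes any choice). Functions in $W_0^{1,p}(\Omega)$, $p>N$, are identified with their continuous representatives on $\overline\Omega$. $d_\Omega(x):=\inf_{y\in\partial\Omega}|x-y|$, $x\in\overline\Omega$, is the distance to the boundary. $$\Lambda_\infty:=\inf\{\|\nabla u\|_\infty: u\in C_0(\overline\Omega)\cap W^{1,\infty}(\Omega),\ \|u\|_\infty=1\}=\|d_\Omega\|_\infty^{-1}.$$ The infinity Laplacian is $\Delta_\infty\phi:=\sum_{i,j=1}^N \phi_{x_i}\phi_{x_j}\phi_{x_ix_j}$. A function $u\in C(\Omega)$ is infinity superharmonic in $\Omega$ if it is a viscosity supersolution of $-\Delta_\infty u=0$: for each $x_0\in \Omega$, each ball $B(x_0)\subset \Omega$ centered at $x_0$, and each $\phi\in C^2(B(x_0))$ with $\phi(x)-u(x)<0=\phi(x_0)-u(x_0)$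 for all $x\in B(x_0)\setminus\{x_0\}$, one has $-\Delta_\infty\phi(x_0)\ge 0$. *)

theory Defs
  imports "HOL-Analysis.Analysis" "HOL-Probability.Essential_Supremum"
begin

definition partial :: "'n::finite \<Rightarrow> (real ^ 'n \<Rightarrow> real) \<Rightarrow> real ^ 'n \<Rightarrow> real" where
  "partial i f x = frechet_derivative f (at x) (axis i 1)"

text \<open>The class \<open>C\<^sup>k(S)\<close>, intended for open \<open>S\<close>.\<close>

primrec Ck_on :: "nat \<Rightarrow> (real ^ 'n::finite) set \<Rightarrow> (real ^ 'n \<Rightarrow> real) \<Rightarrow> bool" where
  "Ck_on 0 S f \<longleftrightarrow> continuous_on S f"
| "Ck_on (Suc k) S f \<longleftrightarrow>
     (\<forall>x\<in>S. f differentiable (at x)) \<and> (\<forall>i. Ck_on k S (partial i f))"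

definition smooth_on :: "(real ^ 'n::finite) set \<Rightarrow> (real ^ 'n \<Rightarrow> real) \<Rightarrow> bool" where
  "smooth_on S f \<longleftrightarrow> (\<forall>k. Ck_on k S f)"

text \<open>Near each boundary point, \<open>\<Omega>\<close> is the region above a smooth graph over the hyperplane
  orthogonal to a unit vector \<open>\<nu>\<close>; the function \<open>\<gamma>\<close> is only evaluated on that hyperplane.\<close>

definition smooth_boundary :: "(real ^ 'n::finite) set \<Rightarrow> bool" where
  "smooth_boundary \<Omega> \<longleftrightarrow>
     (\<forall>x0 \<in> frontier \<Omega>. \<exists>r>0. \<exists>\<nu> \<gamma>. norm \<nu> = 1 \<and> smooth_on UNIV \<gamma> \<and>
        (\<forall>x \<in> ball x0 r. x \<in> \<Omega> \<longleftrightarrow> \<gamma> (x - (x \<bullet> \<nu>) *\<^sub>R \<nu>) < x \<bullet> \<nu>))"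

definition bounded_smooth_domain :: "(real ^ 'n::finite) set \<Rightarrow> bool" where
  "bounded_smooth_domain \<Omega> \<longleftrightarrow>
     open \<Omega> \<and> connected \<Omega> \<and> \<Omega> \<noteq> {} \<and> bounded \<Omega> \<and> smooth_boundary \<Omega>"

text \<open>Membership in \<open>L\<^sup>r(\<Omega>)\<close> and its norm, \<open>1 \<le> r \<le> \<infinity>\<close>, for scalar and for vector-valued
  functions. Functions are total on the ambient space, but only their values on \<open>\<Omega>\<close> matter.
  The value of \<open>Lnorm\<close> carries no meaning outside \<open>L\<^sup>r(\<Omega>)\<close>.\<close>

definition in_L :: "ereal \<Rightarrow> (real ^ 'n::finite) set \<Rightarrow> (real ^ 'n \<Rightarrow> 'b::euclidean_space) \<Rightarrow> bool" where
  "in_L r \<Omega> f \<longleftrightarrow> f \<in> borel_measurable (lebesgue_on \<Omega>) \<and>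
     (if r = \<infinity> then esssup (lebesgue_on \<Omega>) (\<lambda>x. ereal (norm (f x))) < \<infinity>
      else integrable (lebesgue_on \<Omega>) (\<lambda>x. norm (f x) powr real_of_ereal r))"

definition Lnorm :: "ereal \<Rightarrow> (real ^ 'n::finite) set \<Rightarrow> (real ^ 'n \<Rightarrow> 'b::euclidean_space) \<Rightarrow> real" where
  "Lnorm r \<Omega> f =
     (if r = \<infinity> then real_of_ereal (esssup (lebesgue_on \<Omega>) (\<lambda>x. ereal (norm (f x))))
      else (\<integral>x. norm (f x) powr real_of_ereal r \<partial>lebesgue_on \<Omega>) powr (1 / real_of_ereal r))"

definition test_function :: "(real ^ 'n::finite) set \<Rightarrow> (real ^ 'n \<Rightarrow> real) \<Rightarrow> bool" where
  "test_function \<Omega> \<phi> \<longleftrightarrow> smooth_on UNIV \<phi> \<and>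
     compact (closure {x. \<phi> x \<noteq> 0}) \<and> closure {x. \<phi> x \<noteq> 0} \<subseteq> \<Omega>"

definition has_weak_grad ::
  "(real ^ 'n::finite) set \<Rightarrow> (real ^ 'n \<Rightarrow> real) \<Rightarrow> (real ^ 'n \<Rightarrow> real ^ 'n) \<Rightarrow> bool" where
  "has_weak_grad \<Omega> u g \<longleftrightarrow>
     (\<forall>K. compact K \<longrightarrow> K \<subseteq> \<Omega> \<longrightarrow> u absolutely_integrable_on K \<and> g absolutely_integrable_on K) \<and>
     (\<forall>\<phi> i. test_function \<Omega> \<phi> \<longrightarrow>
        (\<integral>x. u x * partial i \<phi> x \<partial>lebesgue_on \<Omega>) = - (\<integral>x. g x $ i * \<phi> x \<partial>lebesgue_on \<Omega>))"

text \<open>The weak gradient is unique up to null sets, so the choice does not affect its norms.\<close>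

definition weak_grad ::
  "(real ^ 'n::finite) set \<Rightarrow> (real ^ 'n \<Rightarrow> real) \<Rightarrow> real ^ 'n \<Rightarrow> real ^ 'n" where
  "weak_grad \<Omega> u = (SOME g. has_weak_grad \<Omega> u g)"

definition W1 :: "ereal \<Rightarrow> (real ^ 'n::finite) set \<Rightarrow> (real ^ 'n \<Rightarrow> real) set" where
  "W1 r \<Omega> = {u. in_L r \<Omega> u \<and> (\<exists>g. has_weak_grad \<Omega> u g \<and> in_L r \<Omega> g)}"

definition W1_norm :: "ereal \<Rightarrow> (real ^ 'n::finite) set \<Rightarrow> (real ^ 'n \<Rightarrow> real) \<Rightarrow> real" where
  "W1_norm r \<Omega> u = Lnorm r \<Omega> u + Lnorm r \<Omega> (weak_grad \<Omega> u)"

text \<open>The closure of the test functions in \<open>W\<^sup>1\<^sup>,\<^sup>r(\<Omega>)\<close>.\<close>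

definition W1_0 :: "ereal \<Rightarrow> (real ^ 'n::finite) set \<Rightarrow> (real ^ 'n \<Rightarrow> real) set" where
  "W1_0 r \<Omega> = {u \<in> W1 r \<Omega>. \<exists>\<phi>. (\<forall>k::nat. test_function \<Omega> (\<phi> k)) \<and>
     (\<lambda>k. W1_norm r \<Omega> (\<lambda>x. u x - \<phi> k x)) \<longlonglongrightarrow> 0}"

definition C_0 :: "(real ^ 'n::finite) set \<Rightarrow> (real ^ 'n \<Rightarrow> real) set" where
  "C_0 \<Omega> = {u. continuous_on (closure \<Omega>) u \<and> (\<forall>x \<in> frontier \<Omega>. u x = 0)}"

definition sobolev_lambda :: "(real ^ 'n::finite) set \<Rightarrow> real \<Rightarrow> real \<Rightarrow> real" where
  "sobolev_lambda \<Omega> p q =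
     Inf {Lnorm (ereal p) \<Omega> (weak_grad \<Omega> u) powr p | u.
            u \<in> W1_0 (ereal p) \<Omega> \<and> Lnorm (ereal q) \<Omega> u = 1}"

text \<open>Continuity on the closure selects the continuous representative.\<close>

definition sobolev_extremal ::
  "(real ^ 'n::finite) set \<Rightarrow> real \<Rightarrow> real \<Rightarrow> (real ^ 'n \<Rightarrow> real) \<Rightarrow> bool" where
  "sobolev_extremal \<Omega> p q u \<longleftrightarrow>
     u \<in> W1_0 (ereal p) \<Omega> \<and> continuous_on (closure \<Omega>) u \<and> (\<forall>x\<in>\<Omega>. u x > 0) \<and>
     Lnorm (ereal q) \<Omega> u = 1 \<and>
     Lnorm (ereal p) \<Omega> (weak_grad \<Omega> u) powr p = sobolev_lambda \<Omega> p q"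

definition boundary_dist :: "(real ^ 'n::finite) set \<Rightarrow> real ^ 'n \<Rightarrow> real" where
  "boundary_dist \<Omega> x = infdist x (frontier \<Omega>)"

definition Lambda_inf :: "(real ^ 'n::finite) set \<Rightarrow> real" where
  "Lambda_inf \<Omega> =
     Inf {Lnorm \<infinity> \<Omega> (weak_grad \<Omega> u) | u. u \<in> C_0 \<Omega> \<inter> W1 \<infinity> \<Omega> \<and> Lnorm \<infinity> \<Omega> u = 1}"

definition inf_laplacian :: "(real ^ 'n::finite \<Rightarrow> real) \<Rightarrow> real ^ 'n \<Rightarrow> real" where
  "inf_laplacian \<phi> x =
     (\<Sum>i\<in>UNIV. \<Sum>j\<in>UNIV. partial i \<phi> x * partial j \<phi> x * partial j (partial i \<phi>) x)"

definition inf_superharmonic :: "(real ^ 'n::finite) set \<Rightarrow> (real ^ 'n \<Rightarrow> real) \<Rightarrow> bool" where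
  "inf_superharmonic \<Omega> u \<longleftrightarrow> continuous_on \<Omega> u \<and>
     (\<forall>x0\<in>\<Omega>. \<forall>r>0. ball x0 r \<subseteq> \<Omega> \<longrightarrow>
        (\<forall>\<phi>. Ck_on 2 (ball x0 r) \<phi> \<and> \<phi> x0 - u x0 = 0 \<and>
              (\<forall>x \<in> ball x0 r - {x0}. \<phi> x - u x < 0) \<longrightarrow>
            - inf_laplacian \<phi> x0 \<ge> 0))"

end

theory Submission
  imports Defs "HOL-Complex_Analysis.Great_Picard"
begin

text \<open>A positive extremal is a uniform limit of test functions whose gradient norms converge to
  \<open>\<lambda>\<^sup>1\<^sup>/\<^sup>p\<close>, so every estimate is proved for test functions and passed to the limit. Averaging a test
  function over cubes gives both a Morrey estimate with constants bounded as \<open>p \<rightarrow> \<infinity>\<close> (hence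
  compactness) and, in the limit \<open>p \<rightarrow> \<infinity>\<close>, the sharp Lipschitz bound for the limit function. Smoothed cones
  over an inscribed ball of maximal radius \<open>R\<close> bound the limit superior of \<open>\<lambda>\<^sup>1\<^sup>/\<^sup>p\<close> by \<open>1/R\<close>, while the
  limit function is \<open>L\<close>-Lipschitz, vanishes on the boundary and has maximum at least \<open>1\<close>, which forces
  \<open>L \<ge> 1/R\<close>. No Euler-Lagrange equation is needed for superharmonicity: raising an extremal increases its
  \<open>L\<^sup>q\<close> norm and so cannot lower its energy, whereas raising it towards a strict \<open>p\<close>-subsolution would.\<close>

section \<open>Smooth functions\<close>

text \<open>Everything is arranged so that competitors stay test functions: truncating a Sobolev
  function would call for a chain rule for weak gradients, whereas composing with the smooth
  substitute \<open>softplus\<close> for the positive part only uses the classical one. The price is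
  an approximation error, so each comparison sets a gain fixed in advance against an error that is
  sent to 0 afterwards. With cubes of side r, translation by h changes the average of a test
  function by at most |h| G r^(-N/p), where G bounds the p-norm of its gradient. There is no
  dimensional constant, so p -> infinity at fixed r and then r -> 0 leave the sharp Lipschitz
  constant; the pointwise Morrey constant 1 + 2N/(1 - N/p) would be too large for that.
  Superharmonicity survives p -> infinity because the p-Laplacian is, up to a positive factor, p - 2
  times the infinity Laplacian plus a term that does not depend on p. At p = infinity two directions
  are required: a bounded weak gradient bounds u by the distance to the boundary (by mollification),
  and a Lipschitz function has a bounded weak gradient (by strong limits in L^2).\<close>

definition grad :: "(real ^ 'n::finite \<Rightarrow> real) \<Rightarrow> real ^ 'n \<Rightarrow> real ^ 'n" where
  "grad f x = (\<chi> i. partial i f x)"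

lemma has_derivative_grad:
  fixes f :: "real ^ 'n::finite \<Rightarrow> real"
  assumes "f differentiable (at x)"
  shows "(f has_derivative (\<lambda>v. grad f x \<bullet> v)) (at x)"
proof -
  let ?D = "frechet_derivative f (at x)"
  have D: "(f has_derivative ?D) (at x)"
    using assms frechet_derivative_works by blast
  interpret D: bounded_linear ?D using D by (rule has_derivative_bounded_linear)
  have "?D v = grad f x \<bullet> v" for v
  proof -
    have "?D v = ?D (\<Sum>i\<in>UNIV. v $ i *\<^sub>R axis i 1)"
      using basis_expansion[of v] by (simp add: scalar_mult_eq_scaleR)
    also have "\<dots> = (\<Sum>i\<in>UNIV. v $ i * partial i f x)"
      by (simp add: D.sum D.scaleR partial_def)
    also have "\<dots> = grad f x \<bullet> v"
      by (simp add: inner_vec_def grad_def mult.commute)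
    finally show ?thesis .
  qed
  then have "?D = (\<lambda>v. grad f x \<bullet> v)" by blast
  then show ?thesis using D by simp
qed

lemma grad_eqI:
  fixes f :: "real ^ 'n::finite \<Rightarrow> real"
  assumes "(f has_derivative (\<lambda>v. g \<bullet> v)) (at x)"
  shows "grad f x = g"
proof -
  have "frechet_derivative f (at x) = (\<lambda>v. g \<bullet> v)"
    using frechet_derivative_at[OF assms] by simp
  then show ?thesis
    by (simp add: grad_def partial_def vec_eq_iff inner_axis)
qed

lemma partial_eqI:
  assumes "(f has_derivative f') (at x)"
  shows "partial i f x = f' (axis i 1)"
  using frechet_derivative_at[OF assms] by (simp add: partial_def)

lemma partial_eq_grad: "partial i f x = grad f x $ i"
  by (simp add: grad_def)

text \<open>Holds for arbitrary functions: \<open>frechet_derivative\<close> chooses among all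
  derivatives at the point, and functions that agree near it have the same ones.\<close>

lemma partial_cong_open:
  assumes "open S" "x \<in> S" "\<And>y. y \<in> S \<Longrightarrow> f y = g y"
  shows "partial i f x = partial i g x"
proof -
  have "(f has_derivative D) (at x) \<longleftrightarrow> (g has_derivative D) (at x)" for D
    using has_derivative_transform_within_open[of f D x UNIV S g]
      has_derivative_transform_within_open[of g D x UNIV S f] assms by auto
  then show ?thesis by (simp add: partial_def frechet_derivative_def)
qed

lemma differentiable_cong_open:
  assumes "open S" "x \<in> S" "\<And>y. y \<in> S \<Longrightarrow> f y = g y" "f differentiable (at x)"
  shows "g differentiable (at x)"
  using assms has_derivative_transform_within_open[of f _ x UNIV S g]
  unfolding differentiable_def by auto

lemma Ck_on_cong:
  assumes "open S" "\<And>y. y \<in> S \<Longrightarrow> f y = g y" "Ck_on k S f"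
  shows "Ck_on k S g"
  using assms(2,3)
proof (induction k arbitrary: f g)
  case 0
  then show ?case by (simp cong: continuous_on_cong)
next
  case (Suc k)
  have "Ck_on k S (partial i g)" for i
    by (rule Suc.IH[of "partial i f"]) (use Suc.prems partial_cong_open[OF \<open>open S\<close>, of _ f g] in auto)
  then show ?case
    using Suc.prems differentiable_cong_open[OF \<open>open S\<close>, of _ f g] by auto
qed

lemma Ck_on_subset: "Ck_on k S f \<Longrightarrow> T \<subseteq> S \<Longrightarrow> Ck_on k T f"
  by (induction k arbitrary: f) (auto intro: continuous_on_subset)

lemma Ck_on_Un:
  "open S \<Longrightarrow> open T \<Longrightarrow> Ck_on k S f \<Longrightarrow> Ck_on k T f \<Longrightarrow> Ck_on k (S \<union> T) f"
  by (induction k arbitrary: f) (auto intro: continuous_on_open_Un)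

lemma Ck_on_Suc_imp: "Ck_on (Suc k) S f \<Longrightarrow> Ck_on k S f"
proof (induction k arbitrary: f)
  case 0
  then show ?case
    by (auto intro!: differentiable_imp_continuous_on differentiable_at_imp_differentiable_on)
next
  case (Suc k)
  then have "Ck_on k S (partial i f)" for i using Suc.IH[of "partial i f"] by simp
  then show ?case using Suc.prems by simp
qed

lemma Ck_on_const: "Ck_on k S (\<lambda>x::real ^ 'n::finite. c)"
proof (induction k arbitrary: c)
  case (Suc k)
  have "partial i (\<lambda>x::real^'n. c) = (\<lambda>x. 0)" for i
    using partial_eqI[OF has_derivative_const] by fastforce
  then show ?case using Suc by simp
qed simp

lemma Ck_on_linear:
  assumes "bounded_linear f"
  shows "Ck_on k S f"
proof (cases k)
  case 0
  then show ?thesis using linear_continuous_on[OF assms] by simp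
next
  case (Suc m)
  have d: "(f has_derivative f) (at x)" for x
    using assms by (rule bounded_linear_imp_has_derivative)
  have "partial i f = (\<lambda>x. f (axis i 1))" for i
    using partial_eqI[OF d] by fastforce
  then show ?thesis using Suc d Ck_on_const by (auto simp: differentiable_def)
qed

lemma Ck_on_add:
  assumes "open S" "Ck_on k S f" "Ck_on k S g"
  shows "Ck_on k S (\<lambda>x. f x + g x)"
  using assms(2,3)
proof (induction k arbitrary: f g)
  case 0
  then show ?case by (simp add: continuous_on_add)
next
  case (Suc k)
  have *: "partial i f x + partial i g x = partial i (\<lambda>x. f x + g x) x" if "x \<in> S" for i x
    using Suc.prems that has_derivative_grad
    by (subst partial_eqI[OF has_derivative_add, of f _ x g])
       (auto simp: partial_eq_grad cart_eq_inner_axis)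
  have "Ck_on k S (partial i (\<lambda>x. f x + g x))" for i
    by (rule Ck_on_cong[OF \<open>open S\<close> *  Suc.IH]) (use Suc.prems in auto)
  then show ?case using Suc.prems by auto
qed

lemma Ck_on_mult:
  assumes "open S" "Ck_on k S f" "Ck_on k S g"
  shows "Ck_on k S (\<lambda>x. f x * g x)"
  using assms(2,3)
proof (induction k arbitrary: f g)
  case 0
  then show ?case by (simp add: continuous_on_mult)
next
  case (Suc k)
  have *: "f x * partial i g x + partial i f x * g x = partial i (\<lambda>x. f x * g x) x" if "x \<in> S" for i x
    using Suc.prems that has_derivative_grad
    by (subst partial_eqI[OF has_derivative_mult, of f _ x g])
       (auto simp: partial_eq_grad cart_eq_inner_axis)
  have "Ck_on k S (partial i (\<lambda>x. f x * g x))" for i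
    by (rule Ck_on_cong[OF \<open>open S\<close> *  Ck_on_add[OF \<open>open S\<close> Suc.IH Suc.IH]])
       (use Suc.prems Ck_on_Suc_imp in auto)
  then show ?case using Suc.prems by auto
qed

text \<open>One-variable smoothness is encoded as a sequence \<open>D\<close> of successive
  derivatives on \<open>I\<close>. The induction on k keeps n arbitrary, since a partial derivative
  turns \<open>D n\<close> into \<open>D (Suc n)\<close> times a partial of f.\<close>

lemma Ck_on_compose:
  fixes f :: "real ^ 'n::finite \<Rightarrow> real" and D :: "nat \<Rightarrow> real \<Rightarrow> real"
  assumes "open S" and f: "\<And>k. Ck_on k S f" and fI: "\<And>x. x \<in> S \<Longrightarrow> f x \<in> I"
    and D: "\<And>n t. t \<in> I \<Longrightarrow> (D n has_real_derivative D (Suc n) t) (at t)"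
  shows "Ck_on k S (\<lambda>x. D n (f x))"
proof (induction k arbitrary: n)
  case 0
  have "continuous_on S f" using f[of 0] by simp
  moreover have "continuous_on (f ` S) (D n)"
    using D fI by (intro continuous_at_imp_continuous_on) (blast intro: DERIV_isCont)
  ultimately show ?case by (simp add: continuous_on_compose2)
next
  case (Suc k)
  have diff: "f differentiable (at x)" if "x \<in> S" for x using f[of "Suc 0"] that by simp
  have h: "((\<lambda>x. D n (f x)) has_derivative (\<lambda>v. (grad f x \<bullet> v) * D (Suc n) (f x))) (at x)" if "x \<in> S" for x
    by (rule DERIV_compose_FDERIV[OF D[OF fI[OF that]] has_derivative_grad[OF diff[OF that]]])
  have *: "D (Suc n) (f x) * partial i f x = partial i (\<lambda>x. D n (f x)) x" if "x \<in> S" for i x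
    by (subst partial_eqI[OF h[OF that]]) (simp add: partial_eq_grad cart_eq_inner_axis)
  have "Ck_on k S (partial i (\<lambda>x. D n (f x)))" for i
    by (rule Ck_on_cong[OF \<open>open S\<close> * Ck_on_mult[OF \<open>open S\<close> Suc.IH]]) (use f[of "Suc k"] in auto)
  moreover have "(\<lambda>x. D n (f x)) differentiable (at x)" if "x \<in> S" for x
    using h[OF that] differentiableI by blast
  ultimately show ?case by simp
qed

lemma smooth_on_const [simp]: "smooth_on S (\<lambda>x. c)"
  by (simp add: smooth_on_def Ck_on_const)

lemma smooth_on_linear: "bounded_linear f \<Longrightarrow> smooth_on S f"
  by (simp add: smooth_on_def Ck_on_linear)

lemma smooth_on_add: "open S \<Longrightarrow> smooth_on S f \<Longrightarrow> smooth_on S g \<Longrightarrow> smooth_on S (\<lambda>x. f x + g x)"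
  by (simp add: smooth_on_def Ck_on_add)

lemma smooth_on_mult: "open S \<Longrightarrow> smooth_on S f \<Longrightarrow> smooth_on S g \<Longrightarrow> smooth_on S (\<lambda>x. f x * g x)"
  by (simp add: smooth_on_def Ck_on_mult)

lemma smooth_on_uminus: "open S \<Longrightarrow> smooth_on S f \<Longrightarrow> smooth_on S (\<lambda>x. - f x)"
  using smooth_on_mult[of S "\<lambda>x. -1" f] by simp

lemma smooth_on_diff: "open S \<Longrightarrow> smooth_on S f \<Longrightarrow> smooth_on S g \<Longrightarrow> smooth_on S (\<lambda>x. f x - g x)"
  using smooth_on_add[of S f "\<lambda>x. - g x"] smooth_on_uminus[of S g] by simp

lemma smooth_on_sum:
  "finite A \<Longrightarrow> open S \<Longrightarrow> (\<And>a. a \<in> A \<Longrightarrow> smooth_on S (f a)) \<Longrightarrow> smooth_on S (\<lambda>x. \<Sum>a\<in>A. f a x)"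
  by (induction A rule: finite_induct) (auto intro!: smooth_on_add)

lemma smooth_on_prod:
  "finite A \<Longrightarrow> open S \<Longrightarrow> (\<And>a. a \<in> A \<Longrightarrow> smooth_on S (f a)) \<Longrightarrow> smooth_on S (\<lambda>x. \<Prod>a\<in>A. f a x)"
  by (induction A rule: finite_induct) (auto intro!: smooth_on_mult)

lemma smooth_on_Un: "open S \<Longrightarrow> open T \<Longrightarrow> smooth_on S f \<Longrightarrow> smooth_on T f \<Longrightarrow> smooth_on (S \<union> T) f"
  by (simp add: smooth_on_def Ck_on_Un)

lemma smooth_on_subset: "smooth_on S f \<Longrightarrow> T \<subseteq> S \<Longrightarrow> smooth_on T f"
  unfolding smooth_on_def using Ck_on_subset by blast

lemma smooth_on_cong: "open S \<Longrightarrow> (\<And>x. x \<in> S \<Longrightarrow> f x = g x) \<Longrightarrow> smooth_on S f \<Longrightarrow> smooth_on S g"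
  unfolding smooth_on_def using Ck_on_cong[of S f g] by blast

lemma smooth_on_compose:
  assumes "open S" "smooth_on S f" "\<And>x. x \<in> S \<Longrightarrow> f x \<in> I"
    and "\<And>n t. t \<in> I \<Longrightarrow> (D n has_real_derivative D (Suc n) t) (at t)"
  shows "smooth_on S (\<lambda>x. D n (f x))"
  using Ck_on_compose[of S f I D] assms by (simp add: smooth_on_def)

lemma smooth_on_differentiable: "smooth_on S f \<Longrightarrow> x \<in> S \<Longrightarrow> f differentiable (at x)"
  unfolding smooth_on_def using Ck_on.simps(2)[of _ S f] by blast

lemma smooth_on_continuous: "smooth_on S f \<Longrightarrow> continuous_on S f"
  unfolding smooth_on_def using Ck_on.simps(1)[of S f] by blast

lemma smooth_on_partial: "smooth_on S f \<Longrightarrow> smooth_on S (partial i f)"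
  unfolding smooth_on_def using Ck_on.simps(2)[of _ S f] by blast

lemma smooth_on_continuous_grad: "smooth_on S f \<Longrightarrow> continuous_on S (grad f)"
  unfolding grad_def[abs_def]
  by (intro continuous_on_vec_lambda smooth_on_continuous smooth_on_partial)

lemma smooth_on_has_derivative:
  "smooth_on S f \<Longrightarrow> x \<in> S \<Longrightarrow> (f has_derivative (\<lambda>v. grad f x \<bullet> v)) (at x)"
  by (intro has_derivative_grad smooth_on_differentiable)

section \<open>A smooth substitute for the positive part\<close>

text \<open>Smooth, zero for s <= 0, of slope between 0 and 1, and at most c below the positive part
  of s. The slope bounds keep cones 1-Lipschitz and make gradients of competitors convex
  combinations.\<close>

definition softplus :: "real \<Rightarrow> real \<Rightarrow> real" where
  "softplus c s = (if s > 0 then s * exp (- c / s) else 0)"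

definition softplus' :: "real \<Rightarrow> real \<Rightarrow> real" where
  "softplus' c s = (if s > 0 then (1 + c / s) * exp (- c / s) else 0)"

text \<open>The class of functions \<open>P(1/s) exp(-c/s)\<close> is closed under differentiation.\<close>

definition flat :: "real \<Rightarrow> real poly \<Rightarrow> real \<Rightarrow> real" where
  "flat c P s = (if s > 0 then poly P (1 / s) * exp (- c / s) else 0)"

lemma poly_exp_tendsto_0:
  fixes P :: "real poly" assumes "c > 0"
  shows "((\<lambda>s. poly P (1 / s) * exp (- c / s)) \<longlongrightarrow> 0) (at_right 0)"
proof -
  have 1: "((\<lambda>y. y ^ k * exp (- c * y)) \<longlongrightarrow> 0) at_top" for k :: nat
  proof -
    have "filterlim (\<lambda>y::real. c * y) at_top at_top"
      using assms by (auto intro!: filterlim_tendsto_pos_mult_at_top filterlim_ident)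
    then have "((\<lambda>y. (c * y) ^ k / exp (c * y)) \<longlongrightarrow> 0) at_top"
      by (rule filterlim_compose[OF tendsto_power_div_exp_0])
    then have "((\<lambda>y. (1 / c ^ k) * ((c * y) ^ k / exp (c * y))) \<longlongrightarrow> (1 / c ^ k) * 0) at_top"
      by (rule tendsto_mult_left)
    moreover have "(1 / c ^ k) * ((c * y) ^ k / exp (c * y)) = y ^ k * exp (- c * y)" for y
      using assms by (simp add: power_mult_distrib exp_minus field_simps)
    ultimately show ?thesis by simp
  qed
  have "((\<lambda>y. \<Sum>i\<le>degree P. coeff P i * (y ^ i * exp (- c * y))) \<longlongrightarrow> (\<Sum>i\<le>degree P. coeff P i * 0)) at_top"
    by (intro tendsto_sum tendsto_mult_left 1)
  then have "((\<lambda>y. poly P y * exp (- c * y)) \<longlongrightarrow> 0) at_top"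
    by (simp add: poly_altdef sum_distrib_right mult.assoc)
  from filterlim_compose[OF this filterlim_inverse_at_top_right]
  show ?thesis by (simp add: inverse_eq_divide)
qed

lemma DERIV_zero_left_flat:
  fixes f :: "real \<Rightarrow> real"
  assumes "((\<lambda>s. f s / s) \<longlongrightarrow> 0) (at_right 0)" "\<And>s. s \<le> 0 \<Longrightarrow> f s = 0"
  shows "(f has_real_derivative 0) (at 0)"
proof -
  have "((\<lambda>s. f s / s) \<longlongrightarrow> 0) (at_left 0)"
  proof (rule Lim_transform_eventually[OF tendsto_const])
    show "\<forall>\<^sub>F s in at_left 0. 0 = f s / s"
      unfolding eventually_at_filter using assms(2) by auto
  qed
  then have "((\<lambda>s. f s / s) \<longlongrightarrow> 0) (at 0)"
    using assms(1) by (simp add: filterlim_split_at)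
  then show ?thesis using assms(2)[of 0] by (simp add: DERIV_def)
qed

lemma flat_DERIV:
  assumes "c > 0"
  shows "(flat c P has_real_derivative flat c ([:0,0,1:] * (smult c P - pderiv P)) s) (at s)"
proof (cases s "0::real" rule: linorder_cases)
  case less
  have "((\<lambda>s. 0) has_real_derivative 0) (at s)" by simp
  then have "(flat c P has_real_derivative 0) (at s)"
    by (rule has_field_derivative_transform_within_open[where S="{..<0}"]) (use less in \<open>auto simp: flat_def\<close>)
  then show ?thesis using less by (simp add: flat_def)
next
  case equal
  have "((\<lambda>s. flat c P s / s) \<longlongrightarrow> 0) (at_right 0)"
  proof (rule Lim_transform_eventually[OF poly_exp_tendsto_0[OF assms, of "[:0,1:] * P"]])
    show "\<forall>\<^sub>F x in at_right 0. poly ([:0, 1:] * P) (1 / x) * exp (- c / x) = flat c P x / x"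
      unfolding eventually_at_filter by (auto simp: flat_def)
  qed
  then show ?thesis using DERIV_zero_left_flat[of "flat c P"] equal by (simp add: flat_def)
next
  case greater
  have "((\<lambda>s. poly P (1 / s) * exp (- c / s)) has_real_derivative
     (flat c ([:0,0,1:] * (smult c P - pderiv P)) s)) (at s)"
    using greater
    by (auto intro!: derivative_eq_intros simp: flat_def field_simps power2_eq_square)
  then show ?thesis
    by (rule has_field_derivative_transform_within_open[where S="{0<..}"]) (use greater in \<open>auto simp: flat_def\<close>)
qed

lemma softplus'_eq_flat: "softplus' c = flat c [:1, c:]"
  by (auto simp: softplus'_def flat_def fun_eq_iff)

lemma softplus_DERIV:
  assumes "c > 0"
  shows "(softplus c has_real_derivative softplus' c s) (at s)"
proof (cases s "0::real" rule: linorder_cases)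
  case less
  have "((\<lambda>s. 0) has_real_derivative 0) (at s)" by simp
  then have "(softplus c has_real_derivative 0) (at s)"
    by (rule has_field_derivative_transform_within_open[where S="{..<0}"]) (use less in \<open>auto simp: softplus_def\<close>)
  then show ?thesis using less by (simp add: softplus'_def)
next
  case equal
  have "((\<lambda>s. softplus c s / s) \<longlongrightarrow> 0) (at_right 0)"
  proof (rule Lim_transform_eventually[OF poly_exp_tendsto_0[OF assms, of "[:1:]"]])
    show "\<forall>\<^sub>F x in at_right 0. poly [:1:] (1 / x) * exp (- c / x) = softplus c x / x"
      unfolding eventually_at_filter by (auto simp: softplus_def)
  qed
  then show ?thesis using DERIV_zero_left_flat[of "softplus c"] equal by (simp add: softplus_def softplus'_def)
next
  case greater
  have "((\<lambda>s. s * exp (- c / s)) has_real_derivative softplus' c s) (at s)"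
    using greater
    by (auto intro!: derivative_eq_intros simp: softplus'_def field_simps power2_eq_square)
  then show ?thesis
    by (rule has_field_derivative_transform_within_open[where S="{0<..}"]) (use greater in \<open>auto simp: softplus_def\<close>)
qed

lemma softplus'_nonneg: "c > 0 \<Longrightarrow> 0 \<le> softplus' c s"
  by (simp add: softplus'_def)

lemma softplus'_le_1: "c > 0 \<Longrightarrow> softplus' c s \<le> 1"
proof (cases "s > 0")
  case True
  have "(1 + c / s) * exp (- c / s) \<le> exp (c / s) * exp (- c / s)"
    by (intro mult_right_mono exp_ge_add_one_self) auto
  also have "\<dots> = 1" by (simp flip: exp_add)
  finally show ?thesis using True by (simp add: softplus'_def)
qed (simp add: softplus'_def)

lemma softplus_nonneg: "0 \<le> softplus c s"
  by (simp add: softplus_def)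

lemma softplus_pos: "s > 0 \<Longrightarrow> 0 < softplus c s"
  by (simp add: softplus_def)

lemma softplus_nonpos [simp]: "s \<le> 0 \<Longrightarrow> softplus c s = 0"
  by (simp add: softplus_def)

lemma softplus_ge: "c > 0 \<Longrightarrow> s - c \<le> softplus c s"
proof (cases "s > 0")
  case True
  assume "c > 0"
  have "s * (1 + (- c / s)) \<le> s * exp (- c / s)"
    using True by (intro mult_left_mono exp_ge_add_one_self) auto
  also have "s * (1 + (- c / s)) = s - c" using True by (simp add: field_simps)
  finally show ?thesis using True by (simp add: softplus_def)
qed (simp add: softplus_def)

lemma softplus_mono: "c > 0 \<Longrightarrow> s \<le> t \<Longrightarrow> softplus c s \<le> softplus c t"
  by (rule DERIV_nonneg_imp_nondecreasing[of s t])
     (auto intro!: exI[of _ "softplus' c _"] softplus_DERIV softplus'_nonneg)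

lemma softplus_smooth_derivs:
  assumes "c > 0"
  obtains D where "D 0 = softplus c" "\<And>n t. (D n has_real_derivative D (Suc n) t) (at t)"
proof -
  \<comment> \<open>\<open>softplus c\<close> itself is not of the form \<open>flat c P\<close>,
    because its factor s is not a polynomial in 1/s; its first derivative is. Hence the shift by one
    in \<open>D\<close>: the polynomial \<open>P n\<close> describes the derivative of order n + 1,
    by the recursion in \<open>flat_DERIV\<close>.\<close>
  define P where "P = rec_nat [:1, c:] (\<lambda>n P. [:0,0,1:] * (smult c P - pderiv P))"
  define D where "D = case_nat (softplus c) (\<lambda>n. flat c (P n))"
  show thesis
  proof (rule that)
    show "D 0 = softplus c" by (simp add: D_def)
    show "(D n has_real_derivative D (Suc n) t) (at t)" for n t
    proof (cases n)
      case 0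
      then show ?thesis using softplus_DERIV[OF assms] by (simp add: D_def P_def softplus'_eq_flat)
    next
      case (Suc m)
      then show ?thesis using flat_DERIV[OF assms, of "P m"] by (simp add: D_def P_def)
    qed
  qed
qed

lemma smooth_on_softplus:
  assumes "c > 0" "open S" "smooth_on S f"
  shows "smooth_on S (\<lambda>x. softplus c (f x))"
proof -
  obtain D where D: "D 0 = softplus c" "\<And>n t. (D n has_real_derivative D (Suc n) t) (at t)"
    using softplus_smooth_derivs[OF assms(1)] by blast
  show ?thesis
    using smooth_on_compose[of S f UNIV D 0] assms D by simp
qed

lemma smooth_on_exp:
  assumes "open S" "smooth_on S f"
  shows "smooth_on S (\<lambda>x. exp (f x))"
  using smooth_on_compose[of S f UNIV "\<lambda>n. exp" 0] assms by (simp add: DERIV_exp)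

lemma smooth_on_powr:
  assumes "open S" "smooth_on S f" "\<And>x. x \<in> S \<Longrightarrow> f x > 0"
  shows "smooth_on S (\<lambda>x. f x powr a)"
proof -
  define D where "D = (\<lambda>n (t::real). (\<Prod>j<n. a - real j) * t powr (a - real n))"
  have "(D n has_real_derivative D (Suc n) t) (at t)" if "t \<in> {0<..}" for n t
    using that unfolding D_def
    by (auto intro!: derivative_eq_intros simp: algebra_simps)
  from smooth_on_compose[of S f "{0<..}" D 0, OF assms(1,2) _ this] assms(3)
  show ?thesis by (simp add: D_def)
qed

section \<open>Weak gradients\<close>

lemma continuous_compact_support_integrable:
  fixes f :: "'a::euclidean_space \<Rightarrow> 'b::euclidean_space"
  assumes "continuous_on UNIV f" "compact K" "\<And>x. x \<notin> K \<Longrightarrow> f x = 0"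
  shows "integrable lborel f"
proof -
  have "integrable lborel (\<lambda>x. indicator K x *\<^sub>R f x)"
    using assms by (intro borel_integrable_compact) (simp_all add: continuous_on_subset[OF assms(1)])
  moreover have "(\<lambda>x. indicator K x *\<^sub>R f x) = f"
    using assms(3) by (auto simp: indicator_def fun_eq_iff)
  ultimately show ?thesis by simp
qed

text \<open>Norms and weak gradients are defined with \<open>lebesgue_on\<close>, while translation
  invariance and the integrals of continuous functions of compact support are handled in
  \<open>lborel\<close>; this is the bridge between the two.\<close>

lemma
  fixes f :: "real ^ 'n::finite \<Rightarrow> 'b::euclidean_space"
  assumes f: "f \<in> borel_measurable borel" and S: "S \<in> sets lebesgue" and 0: "\<And>x. x \<notin> S \<Longrightarrow> f x = 0"
  shows integral_lebesgue_on_eq_lborel: "integral\<^sup>L (lebesgue_on S) f = integral\<^sup>L lborel f"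
    and integrable_lebesgue_on_iff_lborel: "integrable (lebesgue_on S) f \<longleftrightarrow> integrable lborel f"
proof -
  have *: "(\<lambda>x. indicator S x *\<^sub>R f x) = f"
    using 0 by (auto simp: indicator_def fun_eq_iff)
  show "integral\<^sup>L (lebesgue_on S) f = integral\<^sup>L lborel f"
    using S f by (simp add: integral_restrict_space * integral_completion)
  show "integrable (lebesgue_on S) f \<longleftrightarrow> integrable lborel f"
    using S f by (simp add: integrable_restrict_space * integrable_completion)
qed

lemma zero_outside_closed_derivative:
  fixes h h' :: "real ^ 'n::finite \<Rightarrow> real"
  assumes "closed K" "\<And>x. x \<notin> K \<Longrightarrow> h x = 0" "x \<notin> K"
    and der: "((\<lambda>t. h (x + t *\<^sub>R e)) has_real_derivative h' x) (at 0)"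
  shows "h' x = 0"
proof -
  have op: "open ((\<lambda>t. x + t *\<^sub>R e) -` (- K))"
    using assms(1) by (intro open_vimage) (auto intro!: continuous_intros)
  have "((\<lambda>t::real. 0) has_real_derivative h' x) (at 0)"
    by (rule has_field_derivative_transform_within_open[OF der op]) (use assms in auto)
  then show ?thesis using DERIV_unique DERIV_const by blast
qed

text \<open>By translation invariance the integral of h(x + t e) over x does not depend on t;
  differentiating under the integral sign at t = 0 gives the integral of h'. The classical
  integrations by parts below reduce to this.\<close>

lemma integral_directional_derivative:
  fixes h h' :: "real ^ 'n::finite \<Rightarrow> real"
  assumes der: "\<And>x. ((\<lambda>t. h (x + t *\<^sub>R e)) has_real_derivative h' x) (at 0)"
    and cont: "continuous_on UNIV h" "continuous_on UNIV h'"
    and K: "compact K" "\<And>x. x \<notin> K \<Longrightarrow> h x = 0"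
  shows "integral\<^sup>L lborel h' = 0"
proof -
  \<comment> \<open>\<open>J\<close> collects the support translated by -t e for all |t| <= 1, so
    that one box serves every such t and the Leibniz rule applies on a fixed domain.\<close>
  define J where "J = (\<lambda>(t, x). x - t *\<^sub>R e) ` (cbox (-1::real) 1 \<times> K)"
  have "compact J"
    unfolding J_def using K(1)
    by (intro compact_continuous_image compact_Times) (auto intro!: continuous_intros simp: case_prod_beta)
  then obtain a b where ab: "J \<subseteq> cbox a b"
    using compact_imp_bounded bounded_subset_cbox_symmetric by metis
  have zero: "h (x + t *\<^sub>R e) = 0" if "t \<in> {-1..1}" "x \<notin> cbox a b" for t x
  proof (rule K(2), rule)
    assume "x + t *\<^sub>R e \<in> K"
    then have "x \<in> J" using that by (force simp: J_def)
    then show False using that ab by auto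
  qed
  have h'0: "h' x = 0" if "x \<notin> K" for x
    by (rule zero_outside_closed_derivative[OF compact_imp_closed[OF K(1)], of h]) (use K(2) that der in auto)
  have hint: "integrable lborel h"
    by (rule continuous_compact_support_integrable[OF cont(1) K])
  have h'int: "integrable lborel h'"
    by (rule continuous_compact_support_integrable[OF cont(2) K(1) h'0])
  have contc: "continuous_on A (\<lambda>x. h (x + t *\<^sub>R e))" "continuous_on A (\<lambda>x. h' (x + t *\<^sub>R e))" for t A
    by (intro continuous_on_compose2[OF cont(1)] continuous_on_compose2[OF cont(2)]; auto intro!: continuous_intros)+
  have const: "integral (cbox a b) (\<lambda>x. h (x + t *\<^sub>R e)) = integral\<^sup>L lborel h" if t: "t \<in> {-1..1}" for t
  proof -
    have int: "integrable lborel (\<lambda>x. h (x + t *\<^sub>R e))"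
      by (rule continuous_compact_support_integrable[where K="cbox a b"])
         (use contc zero[OF t] in auto)
    have "integral (cbox a b) (\<lambda>x. h (x + t *\<^sub>R e)) = integral UNIV (\<lambda>x. h (x + t *\<^sub>R e))"
      by (rule integral_spike_set) (use zero[OF t] in \<open>auto intro!: negligible_subset[OF negligible_empty]\<close>)
    also have "\<dots> = integral\<^sup>L lborel (\<lambda>x. h (x + t *\<^sub>R e))"
      by (rule integral_lborel[OF int])
    also have "\<dots> = integral\<^sup>L (distr lborel borel ((+) (t *\<^sub>R e))) h"
      by (subst integral_distr) (use cont(1) in \<open>auto simp: add.commute borel_measurable_continuous_onI\<close>)
    finally show ?thesis by (simp add: lborel_distr_plus)
  qed
  have "((\<lambda>t. integral (cbox a b) (\<lambda>x. h (x + t *\<^sub>R e))) has_field_derivative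
      integral (cbox a b) (\<lambda>x. h' (x + 0 *\<^sub>R e))) (at 0 within {-1..1::real})"
  proof (rule leibniz_rule_field_derivative[where f="\<lambda>t x. h (x + t *\<^sub>R e)" and fx="\<lambda>t x. h' (x + t *\<^sub>R e)"])
    fix t :: real and x
    have "((\<lambda>s. h ((x + t *\<^sub>R e) + s *\<^sub>R e)) has_real_derivative h' (x + t *\<^sub>R e)) (at (t - t))"
      using der by simp
    then have "((\<lambda>s. h (x + s *\<^sub>R e)) has_real_derivative h' (x + t *\<^sub>R e)) (at t)"
      using DERIV_at_within_shift[of "\<lambda>s. h (x + s *\<^sub>R e)" "h' (x + t *\<^sub>R e)" t 0 UNIV]
      by (simp add: algebra_simps)
    then show "((\<lambda>t. h (x + t *\<^sub>R e)) has_real_derivative h' (x + t *\<^sub>R e)) (at t within {-1..1})"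
      by (rule has_field_derivative_at_within)
  next
    show "(\<lambda>x. h (x + t *\<^sub>R e)) integrable_on cbox a b" for t
      by (intro integrable_continuous contc)
    show "continuous_on ({- 1..1} \<times> cbox a b) (\<lambda>(t, x). h' (x + t *\<^sub>R e))"
      by (auto simp: case_prod_beta intro!: continuous_on_compose2[OF cont(2)] continuous_intros)
  qed auto
  then have "((\<lambda>t. integral (cbox a b) (\<lambda>x. h (x + t *\<^sub>R e))) has_field_derivative
      integral (cbox a b) h') (at 0)"
    by (simp add: at_within_interior[of 0 "{-1..1::real}"])
  then have "((\<lambda>t. integral\<^sup>L lborel h) has_field_derivative integral (cbox a b) h') (at 0)"
    by (rule has_field_derivative_transform_within_open[where S="{-1<..<1}"]) (use const in auto)
  then have "integral (cbox a b) h' = 0"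
    using DERIV_unique DERIV_const by blast
  moreover have "integral (cbox a b) h' = integral UNIV h'"
  proof (rule integral_spike_set)
    have "K \<subseteq> cbox a b"
    proof
      fix x assume "x \<in> K"
      then have "(\<lambda>(t, x). x - t *\<^sub>R e) (0::real, x) \<in> J" unfolding J_def by (intro imageI) auto
      then show "x \<in> cbox a b" using ab by auto
    qed
    then show "negligible {x \<in> UNIV - cbox a b. h' x \<noteq> 0}"
      using h'0 by (auto intro!: negligible_subset[OF negligible_empty])
  qed auto
  ultimately show ?thesis using integral_lborel[OF h'int] by simp
qed

lemma test_function_props:
  assumes "test_function \<Omega> \<phi>"
  obtains K where "compact K" "K \<subseteq> \<Omega>" "\<And>x. x \<notin> K \<Longrightarrow> \<phi> x = 0" "\<And>x. x \<notin> K \<Longrightarrow> grad \<phi> x = 0"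
proof -
  define K where "K = closure {x. \<phi> x \<noteq> 0}"
  have 0: "\<phi> x = 0" if "x \<notin> K" for x
    using that closure_subset[of "{x. \<phi> x \<noteq> 0}"] unfolding K_def by blast
  have K: "compact K" "K \<subseteq> \<Omega>" using assms by (auto simp: test_function_def K_def)
  have "grad \<phi> x = 0" if "x \<notin> K" for x
  proof (rule grad_eqI)
    have "((\<lambda>x. 0) has_derivative (\<lambda>v. 0 \<bullet> v)) (at x)" by simp
    then show "(\<phi> has_derivative (\<lambda>v. 0 \<bullet> v)) (at x)"
      by (rule has_derivative_transform_within_open[where s="- K"])
         (use that 0 K(1) in \<open>auto intro: compact_imp_closed\<close>)
  qed
  then show thesis using that K 0 by blast
qed

lemma test_functionI:
  assumes "smooth_on UNIV \<phi>" "compact K" "K \<subseteq> \<Omega>" "\<And>x. x \<notin> K \<Longrightarrow> \<phi> x = 0"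
  shows "test_function \<Omega> \<phi>"
proof -
  have "closure {x. \<phi> x \<noteq> 0} \<subseteq> K"
    using assms by (intro closure_minimal) (auto intro: compact_imp_closed)
  then show ?thesis
    using assms closed_Int_compact[of "closure {x. \<phi> x \<noteq> 0}" K]
    by (auto simp: test_function_def Int_absorb2 inf.absorb1)
qed

lemma test_function_smooth: "test_function \<Omega> \<phi> \<Longrightarrow> smooth_on UNIV \<phi>"
  by (simp add: test_function_def)

lemma test_function_continuous: "test_function \<Omega> \<phi> \<Longrightarrow> continuous_on A \<phi>"
  by (rule continuous_on_subset[OF smooth_on_continuous[OF test_function_smooth]]) simp_all

lemma test_function_continuous_grad: "test_function \<Omega> \<phi> \<Longrightarrow> continuous_on A (grad \<phi>)"
  by (rule continuous_on_subset[OF smooth_on_continuous_grad[OF test_function_smooth]]) simp_all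

lemma test_function_has_derivative:
  "test_function \<Omega> \<phi> \<Longrightarrow> (\<phi> has_derivative (\<lambda>v. grad \<phi> x \<bullet> v)) (at x)"
  by (rule smooth_on_has_derivative[of UNIV]) (auto simp: test_function_def)

lemma has_derivative_along_line:
  fixes f :: "real ^ 'n::finite \<Rightarrow> real"
  assumes "(f has_derivative (\<lambda>v. g \<bullet> v)) (at x)"
  shows "((\<lambda>t. f (x + t *\<^sub>R e)) has_real_derivative g \<bullet> e) (at 0)"
proof -
  have "((\<lambda>t::real. x + t *\<^sub>R e) has_derivative (\<lambda>t. t *\<^sub>R e)) (at 0)"
    by (auto intro!: derivative_eq_intros)
  then have "((\<lambda>t::real. f (x + t *\<^sub>R e)) has_derivative (\<lambda>t. g \<bullet> (t *\<^sub>R e))) (at 0)"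
    using assms by (intro has_derivative_compose[where f="\<lambda>t::real. x + t *\<^sub>R e" and g=f]) simp_all
  then show ?thesis by (simp add: has_field_derivative_def mult_commute_abs)
qed

lemma absolutely_integrable_continuous_compact:
  fixes f :: "'a::euclidean_space \<Rightarrow> 'b::euclidean_space"
  assumes "compact K" "continuous_on K f"
  shows "f absolutely_integrable_on K"
  unfolding set_integrable_def
  using borel_integrable_compact[OF assms] by (simp add: integrable_completion)

lemma absolutely_integrable_times_continuous:
  fixes w \<phi> :: "real ^ 'n::finite \<Rightarrow> real"
  assumes K: "compact K" "K \<subseteq> \<Omega>" and \<Omega>: "open \<Omega>"
    and w: "w absolutely_integrable_on K"
    and \<phi>: "continuous_on UNIV \<phi>" "\<And>x. x \<notin> K \<Longrightarrow> \<phi> x = 0"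
  shows "integrable (lebesgue_on \<Omega>) (\<lambda>x. w x * \<phi> x)"
proof -
  obtain B where B: "\<And>x. x \<in> K \<Longrightarrow> \<bar>\<phi> x\<bar> \<le> B"
    using compact_imp_bounded[OF compact_continuous_image[OF continuous_on_subset[OF \<phi>(1)] K(1)]]
    by (force simp: bounded_iff)
  have mw: "(\<lambda>x. indicator K x *\<^sub>R w x) \<in> borel_measurable lebesgue"
    using w by (auto simp: set_integrable_def)
  have m: "\<phi> \<in> borel_measurable lebesgue"
    using \<phi>(1) by (simp add: borel_measurable_continuous_onI measurable_completion)
  have "integrable lebesgue (\<lambda>x. (indicator K x *\<^sub>R w x) * \<phi> x)"
  proof (rule Bochner_Integration.integrable_bound)
    show "integrable lebesgue (\<lambda>x. B * (indicator K x *\<^sub>R w x))"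
      using w by (auto simp: set_integrable_def)
    show "AE x in lebesgue. norm ((indicator K x *\<^sub>R w x) * \<phi> x) \<le> norm (B * (indicator K x *\<^sub>R w x))"
    proof (rule AE_I2)
      fix x
      show "norm ((indicator K x *\<^sub>R w x) * \<phi> x) \<le> norm (B * (indicator K x *\<^sub>R w x))"
        using B[of x] by (auto simp: indicator_def abs_mult mult.commute intro!: mult_right_mono)
    qed
  qed (use mw m in measurable)
  moreover have "(\<lambda>x. (indicator K x *\<^sub>R w x) * \<phi> x) = (\<lambda>x. indicator \<Omega> x *\<^sub>R (w x * \<phi> x))"
    using \<phi>(2) K(2) by (auto simp: indicator_def fun_eq_iff)
  ultimately show ?thesis
    using \<Omega> by (simp add: integrable_restrict_space borel_open)
qed

text \<open>Apply \<open>integral_directional_derivative\<close> to the product of U and the test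
  function, which inherits compact support from the latter.\<close>

lemma has_weak_grad_C1:
  fixes U :: "real ^ 'n::finite \<Rightarrow> real"
  assumes \<Omega>: "open \<Omega>" and der: "\<And>x. (U has_derivative (\<lambda>v. G x \<bullet> v)) (at x)"
    and cont: "continuous_on UNIV G"
  shows "has_weak_grad \<Omega> U G"
  unfolding has_weak_grad_def
proof (intro conjI allI impI)
  have contU: "continuous_on UNIV U"
    using der by (intro continuous_at_imp_continuous_on ballI) (rule has_derivative_continuous)
  show "U absolutely_integrable_on K" "G absolutely_integrable_on K" if "compact K" for K
    using that by (auto intro!: absolutely_integrable_continuous_compact
        continuous_on_subset[OF cont] continuous_on_subset[OF contU])
  fix \<phi> and i :: 'n
  assume \<phi>: "test_function \<Omega> \<phi>"
  obtain K where K: "compact K" "K \<subseteq> \<Omega>" "\<And>x. x \<notin> K \<Longrightarrow> \<phi> x = 0" "\<And>x. x \<notin> K \<Longrightarrow> grad \<phi> x = 0"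
    using test_function_props[OF \<phi>] by blast
  have cp: "continuous_on UNIV (partial i \<phi>)"
    by (rule smooth_on_continuous[OF smooth_on_partial[OF test_function_smooth[OF \<phi>]]])
  have c\<phi>: "continuous_on UNIV \<phi>" using \<phi> by (rule test_function_continuous)
  have cG: "continuous_on UNIV (\<lambda>x. G x $ i)" using cont by (intro continuous_intros)
  have i1: "integrable lborel (\<lambda>x. U x * partial i \<phi> x)"
    by (rule continuous_compact_support_integrable[OF _ K(1)])
       (use cp contU K(4) in \<open>auto intro!: continuous_intros simp: partial_eq_grad\<close>)
  have i2: "integrable lborel (\<lambda>x. G x $ i * \<phi> x)"
    by (rule continuous_compact_support_integrable[OF _ K(1)])
       (use cont c\<phi> K(3) in \<open>auto intro!: continuous_intros\<close>)
  have "integral\<^sup>L lborel (\<lambda>x. U x * partial i \<phi> x + G x $ i * \<phi> x) = 0"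
  proof (rule integral_directional_derivative[OF _ _ _ K(1), where e="axis i 1"])
    show "((\<lambda>t. (\<lambda>x. U x * \<phi> x) (x + t *\<^sub>R axis i 1)) has_real_derivative
       (U x * partial i \<phi> x + G x $ i * \<phi> x)) (at 0)" for x
      using DERIV_mult[OF has_derivative_along_line[OF der[of x], of "axis i 1"]
         has_derivative_along_line[OF test_function_has_derivative[OF \<phi>, of x], of "axis i 1"]]
      by (simp add: inner_axis partial_eq_grad algebra_simps)
  qed (use cp contU K c\<phi> cG in \<open>auto intro!: continuous_intros\<close>)
  then have "integral\<^sup>L lborel (\<lambda>x. U x * partial i \<phi> x) = - integral\<^sup>L lborel (\<lambda>x. G x $ i * \<phi> x)"
    using i1 i2 by simp
  moreover have "integral\<^sup>L (lebesgue_on \<Omega>) (\<lambda>x. U x * partial i \<phi> x) = integral\<^sup>L lborel (\<lambda>x. U x * partial i \<phi> x)"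
    by (rule integral_lebesgue_on_eq_lborel)
       (use K(2,4) \<Omega> cp contU in \<open>force intro!: borel_measurable_continuous_onI continuous_on_mult simp: partial_eq_grad\<close>)+
  moreover have "integral\<^sup>L (lebesgue_on \<Omega>) (\<lambda>x. G x $ i * \<phi> x) = integral\<^sup>L lborel (\<lambda>x. G x $ i * \<phi> x)"
    by (rule integral_lebesgue_on_eq_lborel)
       (use K(2,3) \<Omega> cG c\<phi> in \<open>force intro!: borel_measurable_continuous_onI continuous_on_mult\<close>)+
  ultimately show "(\<integral>x. U x * partial i \<phi> x \<partial>lebesgue_on \<Omega>) = - (\<integral>x. G x $ i * \<phi> x \<partial>lebesgue_on \<Omega>)"
    by simp
qed

lemma test_function_has_weak_grad:
  assumes "open \<Omega>" "test_function \<Omega>' \<phi>"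
  shows "has_weak_grad \<Omega> \<phi> (grad \<phi>)"
  by (rule has_weak_grad_C1[OF assms(1)])
     (use test_function_has_derivative[OF assms(2)] test_function_continuous_grad[OF assms(2)] in auto)

text \<open>\<open>1 - exp (- m * box_bump c d x)\<close> tends to the indicator of the open box as \<open>m \<rightarrow> \<infinity>\<close>.\<close>

definition box_bump :: "real ^ 'n::finite \<Rightarrow> real ^ 'n \<Rightarrow> real ^ 'n \<Rightarrow> real" where
  "box_bump c d x = (\<Prod>i\<in>UNIV. softplus 1 (x $ i - c $ i) * softplus 1 (d $ i - x $ i))"

lemma smooth_box_bump: "smooth_on UNIV (box_bump c d)"
  unfolding box_bump_def[abs_def]
  by (intro smooth_on_prod smooth_on_mult smooth_on_softplus smooth_on_diff smooth_on_const
       smooth_on_linear bounded_linear_vec_nth) auto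

lemma box_bump_pos: "x \<in> box c d \<Longrightarrow> box_bump c d x > 0"
  unfolding box_bump_def by (intro prod_pos) (auto simp: mem_box_cart intro!: mult_pos_pos softplus_pos)

lemma box_bump_nonneg: "box_bump c d x \<ge> 0"
  unfolding box_bump_def by (intro prod_nonneg) (simp add: softplus_nonneg)

lemma box_bump_zero: "x \<notin> box c d \<Longrightarrow> box_bump c d x = 0"
proof -
  assume "x \<notin> box c d"
  then obtain i where "x $ i \<le> c $ i \<or> d $ i \<le> x $ i"
    by (auto simp: mem_box_cart not_less)
  then show ?thesis unfolding box_bump_def by (intro prod_zero bexI[of _ i]) auto
qed

lemma box_cutoff:
  assumes "cbox c d \<subseteq> \<Omega>"
  obtains \<phi> where "\<And>m::nat. test_function \<Omega> (\<phi> m)" "\<And>m x. 0 \<le> \<phi> m x \<and> \<phi> m x \<le> 1"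
    "\<And>x. (\<lambda>m. \<phi> m x) \<longlonglongrightarrow> indicator (box c d) x" "\<And>m x. x \<notin> box c d \<Longrightarrow> \<phi> m x = 0"
proof
  let ?\<phi> = "\<lambda>(m::nat) x. 1 - exp (- (real m * box_bump c d x))"
  show "test_function \<Omega> (?\<phi> m)" for m
  proof (rule test_functionI[where K="cbox c d"])
    show "smooth_on UNIV (?\<phi> m)"
      by (intro smooth_on_diff smooth_on_const smooth_on_exp smooth_on_uminus smooth_on_mult smooth_box_bump) auto
    show "?\<phi> m x = 0" if "x \<notin> cbox c d" for x
      using box_bump_zero[of x c d] that box_subset_cbox[of c d] by auto
  qed (use assms in auto)
  show "0 \<le> ?\<phi> m x \<and> ?\<phi> m x \<le> 1" for m x
    using box_bump_nonneg[of c d x] by simp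
  show "?\<phi> m x = 0" if "x \<notin> box c d" for m x
    using box_bump_zero[OF that] by simp
  show "(\<lambda>m. ?\<phi> m x) \<longlonglongrightarrow> indicator (box c d) x" for x
  proof (cases "x \<in> box c d")
    case True
    have "filterlim (\<lambda>m. real m * box_bump c d x) at_top sequentially"
      using box_bump_pos[OF True]
      by (intro filterlim_at_top_mult_tendsto_pos[OF tendsto_const] filterlim_real_sequentially)
    then have "(\<lambda>m. exp (- (real m * box_bump c d x))) \<longlonglongrightarrow> 0"
      using filterlim_compose[OF exp_at_bot] filterlim_uminus_at_bot_at_top filterlim_compose by blast
    then have "(\<lambda>m. 1 - exp (- (real m * box_bump c d x))) \<longlonglongrightarrow> 1 - 0"
      by (intro tendsto_intros)
    then show ?thesis using True by simp
  qed (simp add: box_bump_zero)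
qed

section \<open>Uniqueness of weak gradients\<close>

text \<open>The positive and the negative part of f define two measures that agree on open boxes, an
  intersection-stable generator of the Borel sets; so the measures, and then their densities,
  coincide.\<close>

lemma AE_zero_if_box_integrals_zero:
  fixes f :: "real ^ 'n::finite \<Rightarrow> real"
  assumes f: "integrable lborel f" and 0: "\<And>c d. (\<integral>x. f x * indicator (box c d) x \<partial>lborel) = 0"
  shows "AE x in lborel. f x = 0"
proof -
  have [measurable]: "f \<in> borel_measurable borel" using f by auto
  \<comment> \<open>\<open>ennreal\<close> sends negative numbers to 0, so \<open>M\<close> and
    \<open>N\<close> have the positive and the negative part of f as densities.\<close>
  define M where "M = density lborel (\<lambda>x. ennreal (f x))"
  define N where "N = density lborel (\<lambda>x. ennreal (- f x))"
  have e: "emeasure M (box c d) = emeasure N (box c d)" "emeasure M (box c d) \<noteq> \<infinity>" for c d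
  proof -
    let ?I = "indicator (box c d) :: real ^ 'n \<Rightarrow> real"
    have i1: "integrable lborel (\<lambda>x. max 0 (f x) * ?I x)" "integrable lborel (\<lambda>x. max 0 (- f x) * ?I x)"
      using f by (intro integrable_real_mult_indicator integrable_max integrable_zero; auto)+
    have "(\<integral>x. max 0 (f x) * ?I x \<partial>lborel) - (\<integral>x. max 0 (- f x) * ?I x \<partial>lborel) =
      (\<integral>x. max 0 (f x) * ?I x - max 0 (- f x) * ?I x \<partial>lborel)"
      using i1 by simp
    also have "\<dots> = (\<integral>x. f x * ?I x \<partial>lborel)"
      by (intro Bochner_Integration.integral_cong) (auto simp: max_def)
    finally have eq: "(\<integral>x. max 0 (f x) * ?I x \<partial>lborel) = (\<integral>x. max 0 (- f x) * ?I x \<partial>lborel)"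
      using 0 by simp
    have M: "emeasure M (box c d) = ennreal (\<integral>x. max 0 (f x) * ?I x \<partial>lborel)"
      unfolding M_def using i1(1)
      by (subst emeasure_density, simp, simp, subst nn_integral_eq_integral[symmetric])
         (auto intro!: nn_integral_cong simp: indicator_def ennreal_neg max_def)
    have N: "emeasure N (box c d) = ennreal (\<integral>x. max 0 (- f x) * ?I x \<partial>lborel)"
      unfolding N_def using i1(2)
      by (subst emeasure_density, simp, simp, subst nn_integral_eq_integral[symmetric])
         (auto intro!: nn_integral_cong simp: indicator_def ennreal_neg max_def)
    show "emeasure M (box c d) = emeasure N (box c d)" "emeasure M (box c d) \<noteq> \<infinity>"
      using M N eq by auto
  qed
  have "M = N"
  proof (rule measure_eqI_generator_eq)
    let ?E = "range (\<lambda>(a, b). box a b :: (real ^ 'n) set)"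
    show "Int_stable ?E"
      by (auto simp: Int_stable_def box_Int_box)
    show "?E \<subseteq> Pow UNIV" "sets M = sigma_sets UNIV ?E" "sets N = sigma_sets UNIV ?E"
      by (simp_all add: M_def N_def borel_eq_box)
    let ?A = "\<lambda>n::nat. box (- (real n *\<^sub>R One)) (real n *\<^sub>R One) :: (real ^ 'n) set"
    show "range ?A \<subseteq> ?E" "(\<Union>i. ?A i) = UNIV"
      unfolding UN_box_eq_UNIV by auto
    show "emeasure M (?A i) \<noteq> \<infinity>" for i by (rule e)
    show "emeasure M X = emeasure N X" if "X \<in> ?E" for X using that e by auto
  qed
  then have "AE x in lborel. ennreal (f x) = ennreal (- f x)"
    unfolding M_def N_def by (subst (asm) sigma_finite_measure.density_unique_iff[OF sigma_finite_lborel]) auto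
  then show ?thesis
  proof eventually_elim
    case (elim x)
    show ?case
    proof (cases "f x \<ge> 0")
      case True
      then show ?thesis using elim by (simp add: ennreal_neg ennreal_eq_0_iff)
    next
      case False
      then show ?thesis using elim by (simp add: ennreal_neg)
    qed
  qed
qed

text \<open>The fundamental lemma of the calculus of variations. On a closed box inside \<Omega> the
  function w is integrable; cut-offs converging to indicators of smaller boxes bring in
  \<open>AE_zero_if_box_integrals_zero\<close>, and countably many boxes exhaust \<Omega>.\<close>

lemma AE_zero_if_orthogonal_to_tests:
  fixes w :: "real ^ 'n::finite \<Rightarrow> real"
  assumes \<Omega>: "open \<Omega>" and w: "\<And>K. compact K \<Longrightarrow> K \<subseteq> \<Omega> \<Longrightarrow> w absolutely_integrable_on K"
    and 0: "\<And>\<phi>. test_function \<Omega> \<phi> \<Longrightarrow> (\<integral>x. w x * \<phi> x \<partial>lebesgue_on \<Omega>) = 0"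
  shows "AE x in lebesgue_on \<Omega>. w x = 0"
proof -
  have box: "AE x in lebesgue. x \<in> box a b \<longrightarrow> w x = 0" if ab: "cbox a b \<subseteq> \<Omega>" for a b
  proof -
    let ?f = "\<lambda>x. indicator (cbox a b) x *\<^sub>R w x"
    have f: "integrable lebesgue ?f"
      using w[OF compact_cbox ab] by (simp add: set_integrable_def)
    \<comment> \<open>w is only Lebesgue measurable; a Borel version makes the statements about
      \<open>lborel\<close> applicable.\<close>
    obtain g where g: "g \<in> borel_measurable lborel" "AE x in lborel. ?f x = g x"
      using completion_ex_borel_measurable_real[of ?f lborel] f by auto
    have g': "AE x in lebesgue. ?f x = g x" using g(2) by (rule AE_completion)
    have ig: "integrable lborel g"
    proof -
      have "integrable lebesgue g"
        by (rule integrable_cong_AE_imp[OF f measurable_completion[OF g(1)]]) (use g' in \<open>auto simp: eq_commute\<close>)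
      then show ?thesis using g(1) by (simp add: integrable_completion)
    qed
    let ?h = "\<lambda>x. g x * indicator (box a b) x :: real"
    have "AE x in lborel. ?h x = 0"
    proof (rule AE_zero_if_box_integrals_zero)
      show "integrable lborel ?h" using ig by (intro integrable_real_mult_indicator) auto
      fix c' d' :: "real ^ 'n"
      obtain c d where cd: "box a b \<inter> box c' d' = box c d" using box_Int_box by blast
      show "(\<integral>x. ?h x * indicator (box c' d') x \<partial>lborel) = 0"
      proof (cases "box c d = {}")
        case True
        then show ?thesis using cd by (auto simp: indicator_inter_arith[symmetric] mult.assoc)
      next
        case False
        have "box c d \<subseteq> box a b" using cd by auto
        then have cdab: "cbox c d \<subseteq> cbox a b"
          using False by (metis box_subset_cbox closure_box closure_minimal closed_cbox subset_trans)
        then have cd\<Omega>: "cbox c d \<subseteq> \<Omega>" using ab by blast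
        obtain \<phi> where \<phi>: "\<And>m::nat. test_function \<Omega> (\<phi> m)" "\<And>m x. 0 \<le> \<phi> m x \<and> \<phi> m x \<le> 1"
          "\<And>x. (\<lambda>m. \<phi> m x) \<longlonglongrightarrow> indicator (box c d) x" "\<And>m x. x \<notin> box c d \<Longrightarrow> \<phi> m x = 0"
          using box_cutoff[OF cd\<Omega>] by blast
        have [measurable]: "\<phi> m \<in> borel_measurable borel" for m
          using test_function_continuous[OF \<phi>(1)] by (rule borel_measurable_continuous_onI)
        have [measurable]: "g \<in> borel_measurable borel" using g(1) by simp
        have z: "(\<integral>x. g x * \<phi> m x \<partial>lborel) = 0" for m
        proof -
          have "0 = (\<integral>x. indicator \<Omega> x *\<^sub>R (w x * \<phi> m x) \<partial>lebesgue)"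
            using 0[OF \<phi>(1)] \<Omega> by (simp add: integral_restrict_space borel_open)
          also have "\<dots> = (\<integral>x. ?f x * \<phi> m x \<partial>lebesgue)"
            using \<phi>(4)[of _ m] cdab cd\<Omega> box_subset_cbox[of c d]
            by (intro Bochner_Integration.integral_cong) (auto simp: indicator_def subset_iff)
          also have "\<dots> = (\<integral>x. g x * \<phi> m x \<partial>lebesgue)"
          proof (rule integral_cong_AE)
            have "\<phi> m \<in> borel_measurable lebesgue" "g \<in> borel_measurable lebesgue"
              by (auto intro!: measurable_completion)
            then show "(\<lambda>x. ?f x * \<phi> m x) \<in> borel_measurable lebesgue" "(\<lambda>x. g x * \<phi> m x) \<in> borel_measurable lebesgue"
              using f by (auto intro!: borel_measurable_times)
            show "AE x in lebesgue. ?f x * \<phi> m x = g x * \<phi> m x"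
              using g' by eventually_elim simp
          qed
          finally show ?thesis by (simp add: integral_completion)
        qed
        have "(\<lambda>m. \<integral>x. g x * \<phi> m x \<partial>lborel) \<longlonglongrightarrow> (\<integral>x. g x * indicator (box c d) x \<partial>lborel)"
        proof (rule integral_dominated_convergence[where w="\<lambda>x. \<bar>g x\<bar>"])
          show "AE x in lborel. norm (g x * \<phi> m x) \<le> \<bar>g x\<bar>" for m
          proof (intro AE_I2)
            fix x show "norm (g x * \<phi> m x) \<le> \<bar>g x\<bar>"
              using \<phi>(2)[of m x] by (auto simp: abs_mult intro!: mult_left_le)
          qed
          show "AE x in lborel. (\<lambda>m. g x * \<phi> m x) \<longlonglongrightarrow> g x * indicator (box c d) x"
            using \<phi>(3) by (auto intro!: tendsto_intros)
        qed (use ig in auto)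
        then have "(\<integral>x. g x * indicator (box c d) x \<partial>lborel) = 0"
          by (simp add: z LIMSEQ_const_iff)
        then show ?thesis
          by (simp add: cd[symmetric] indicator_inter_arith mult.assoc)
      qed
    qed
    then have "AE x in lebesgue. ?h x = 0" by (rule AE_completion)
    with g' show ?thesis
    proof eventually_elim
      case (elim x)
      then show ?case using box_subset_cbox[of a b] by (auto simp: subset_iff)
    qed
  qed
  obtain D where D: "countable D" "D \<subseteq> Pow \<Omega>" "\<And>X. X \<in> D \<Longrightarrow> \<exists>a b. X = cbox a b" "\<Union>D = \<Omega>"
    using open_countable_Union_open_cbox[OF \<Omega>] by metis
  have "AE x in lebesgue. \<forall>X\<in>D. x \<in> X \<longrightarrow> w x = 0"
  proof (rule AE_ball_countable'[OF _ D(1)])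
    fix X assume "X \<in> D"
    then obtain a b where X: "X = cbox a b" "cbox a b \<subseteq> \<Omega>" using D by (metis Union_upper)
    have "AE x in lebesgue. x \<notin> cbox a b - box a b"
      by (rule AE_not_in) (use negligible_frontier_interval[of a b] in \<open>simp add: negligible_iff_null_sets\<close>)
    with box[OF X(2)] show "AE x in lebesgue. x \<in> X \<longrightarrow> w x = 0"
      unfolding X(1) by eventually_elim auto
  qed
  then have "AE x in lebesgue. x \<in> \<Omega> \<longrightarrow> w x = 0"
    unfolding D(4)[symmetric] by eventually_elim auto
  then show ?thesis
    using \<Omega> by (simp add: AE_restrict_space_iff borel_open)
qed

lemma absolutely_integrable_vec_nth:
  fixes g :: "'a::euclidean_space \<Rightarrow> real ^ 'n::finite"
  shows "g absolutely_integrable_on K \<Longrightarrow> (\<lambda>x. g x $ i) absolutely_integrable_on K"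
  by (simp only: cart_eq_inner_axis absolutely_integrable_component)

lemma has_weak_gradD:
  assumes "has_weak_grad \<Omega> u g"
  shows "compact K \<Longrightarrow> K \<subseteq> \<Omega> \<Longrightarrow> u absolutely_integrable_on K"
    and "compact K \<Longrightarrow> K \<subseteq> \<Omega> \<Longrightarrow> g absolutely_integrable_on K"
    and "test_function \<Omega> \<phi> \<Longrightarrow>
      (\<integral>x. u x * partial i \<phi> x \<partial>lebesgue_on \<Omega>) = - (\<integral>x. g x $ i * \<phi> x \<partial>lebesgue_on \<Omega>)"
  using assms unfolding has_weak_grad_def by simp_all

lemma has_weak_grad_unique:
  fixes u :: "real ^ 'n::finite \<Rightarrow> real"
  assumes \<Omega>: "open \<Omega>" and g: "has_weak_grad \<Omega> u g" and h: "has_weak_grad \<Omega> u h"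
  shows "AE x in lebesgue_on \<Omega>. g x = h x"
proof -
  have "AE x in lebesgue_on \<Omega>. (g x - h x) $ i = 0" for i
  proof (rule AE_zero_if_orthogonal_to_tests[OF \<Omega>])
    have ai: "(\<lambda>x. g x $ i) absolutely_integrable_on K" "(\<lambda>x. h x $ i) absolutely_integrable_on K"
      if "compact K" "K \<subseteq> \<Omega>" for K
      by (intro absolutely_integrable_vec_nth has_weak_gradD(2)[OF g that] has_weak_gradD(2)[OF h that])+
    show "(\<lambda>x. (g x - h x) $ i) absolutely_integrable_on K" if "compact K" "K \<subseteq> \<Omega>" for K
      unfolding vector_minus_component by (rule set_integral_diff(1)[OF ai[OF that]])
    fix \<phi> assume \<phi>: "test_function \<Omega> \<phi>"
    obtain K where K: "compact K" "K \<subseteq> \<Omega>" "\<And>x. x \<notin> K \<Longrightarrow> \<phi> x = 0" "\<And>x. x \<notin> K \<Longrightarrow> grad \<phi> x = 0"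
      using test_function_props[OF \<phi>] by blast
    have "integrable (lebesgue_on \<Omega>) (\<lambda>x. g x $ i * \<phi> x)" "integrable (lebesgue_on \<Omega>) (\<lambda>x. h x $ i * \<phi> x)"
      by (rule absolutely_integrable_times_continuous[OF K(1,2) \<Omega> _ test_function_continuous[OF \<phi>] K(3)];
          simp add: ai K(1,2))+
    moreover have "(\<integral>x. g x $ i * \<phi> x \<partial>lebesgue_on \<Omega>) = (\<integral>x. h x $ i * \<phi> x \<partial>lebesgue_on \<Omega>)"
      using has_weak_gradD(3)[OF g \<phi>, of i] has_weak_gradD(3)[OF h \<phi>, of i] by linarith
    ultimately show "(\<integral>x. (g x - h x) $ i * \<phi> x \<partial>lebesgue_on \<Omega>) = 0"
      by (simp add: left_diff_distrib)
  qed
  then have "AE x in lebesgue_on \<Omega>. \<forall>i. (g x - h x) $ i = 0"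
    by (simp add: AE_all_countable)
  then show ?thesis by eventually_elim (simp add: vec_eq_iff)
qed

lemma has_weak_grad_weak_grad: "has_weak_grad \<Omega> u g \<Longrightarrow> has_weak_grad \<Omega> u (weak_grad \<Omega> u)"
  unfolding weak_grad_def by (rule someI[of "has_weak_grad \<Omega> u"])

lemma weak_grad_AE_eq:
  assumes "open \<Omega>" "has_weak_grad \<Omega> u g"
  shows "AE x in lebesgue_on \<Omega>. g x = weak_grad \<Omega> u x"
  using has_weak_grad_unique[OF assms has_weak_grad_weak_grad[OF assms(2)]] .

text \<open>Membership in \<open>W1_0\<close> speaks about \<open>weak_grad\<close> of a difference,
  which is an arbitrary choice. Together with uniqueness this identifies that choice almost
  everywhere with the difference of gradients.\<close>

lemma has_weak_grad_diff_test:
  fixes u :: "real ^ 'n::finite \<Rightarrow> real"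
  assumes \<Omega>: "open \<Omega>" and u: "has_weak_grad \<Omega> u g" and \<phi>: "test_function \<Omega>' \<phi>"
  shows "has_weak_grad \<Omega> (\<lambda>x. u x - \<phi> x) (\<lambda>x. g x - grad \<phi> x)"
proof -
  have v: "has_weak_grad \<Omega> \<phi> (grad \<phi>)" by (rule test_function_has_weak_grad[OF \<Omega> \<phi>])
  show ?thesis
    unfolding has_weak_grad_def
  proof (intro conjI allI impI)
    show "(\<lambda>x. u x - \<phi> x) absolutely_integrable_on K" "(\<lambda>x. g x - grad \<phi> x) absolutely_integrable_on K"
      if "compact K" "K \<subseteq> \<Omega>" for K
      by (intro set_integral_diff(1) has_weak_gradD(1)[OF u that] has_weak_gradD(1)[OF v that]
          has_weak_gradD(2)[OF u that] has_weak_gradD(2)[OF v that])+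
    fix \<psi> and i :: 'n assume \<psi>: "test_function \<Omega> \<psi>"
    obtain K where K: "compact K" "K \<subseteq> \<Omega>" "\<And>x. x \<notin> K \<Longrightarrow> \<psi> x = 0" "\<And>x. x \<notin> K \<Longrightarrow> grad \<psi> x = 0"
      using test_function_props[OF \<psi>] by blast
    have cp: "continuous_on UNIV (partial i \<psi>)"
      by (rule smooth_on_continuous[OF smooth_on_partial[OF test_function_smooth[OF \<psi>]]])
    have c\<psi>: "continuous_on UNIV \<psi>" using \<psi> by (rule test_function_continuous)
    have I1: "integrable (lebesgue_on \<Omega>) (\<lambda>x. f x * partial i \<psi> x)" if "has_weak_grad \<Omega> f k" for f k
      by (rule absolutely_integrable_times_continuous[OF K(1,2) \<Omega> _ cp])
         (use has_weak_gradD(1)[OF that K(1,2)] K(4) in \<open>simp_all add: partial_eq_grad\<close>)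
    have I2: "integrable (lebesgue_on \<Omega>) (\<lambda>x. k x $ i * \<psi> x)" if "has_weak_grad \<Omega> f k" for f k
      by (rule absolutely_integrable_times_continuous[OF K(1,2) \<Omega> _ c\<psi> K(3)])
         (rule absolutely_integrable_vec_nth[OF has_weak_gradD(2)[OF that K(1,2)]])
    have "(\<integral>x. (u x - \<phi> x) * partial i \<psi> x \<partial>lebesgue_on \<Omega>) =
       (\<integral>x. u x * partial i \<psi> x \<partial>lebesgue_on \<Omega>) - (\<integral>x. \<phi> x * partial i \<psi> x \<partial>lebesgue_on \<Omega>)"
      using I1[OF u] I1[OF v] by (simp add: left_diff_distrib)
    also have "\<dots> = - ((\<integral>x. g x $ i * \<psi> x \<partial>lebesgue_on \<Omega>) - (\<integral>x. grad \<phi> x $ i * \<psi> x \<partial>lebesgue_on \<Omega>))"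
      using has_weak_gradD(3)[OF u \<psi>, of i] has_weak_gradD(3)[OF v \<psi>, of i] by simp
    also have "(\<integral>x. g x $ i * \<psi> x \<partial>lebesgue_on \<Omega>) - (\<integral>x. grad \<phi> x $ i * \<psi> x \<partial>lebesgue_on \<Omega>) =
      (\<integral>x. (g x - grad \<phi> x) $ i * \<psi> x \<partial>lebesgue_on \<Omega>)"
      using I2[OF u] I2[OF v] by (simp add: left_diff_distrib)
    finally show "(\<integral>x. (u x - \<phi> x) * partial i \<psi> x \<partial>lebesgue_on \<Omega>) =
      - (\<integral>x. (g x - grad \<phi> x) $ i * \<psi> x \<partial>lebesgue_on \<Omega>)" .
  qed
qed

text \<open>Rests on the completeness of Lebesgue measure: a change on a null set preserves
  measurability.\<close>

lemma AE_lebesgue_on_measurable: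
  fixes f g :: "real ^ 'n::finite \<Rightarrow> 'b::euclidean_space"
  assumes S: "S \<in> sets lebesgue" and f: "f \<in> borel_measurable (lebesgue_on S)"
    and ae: "AE x in lebesgue_on S. f x = g x"
  shows "g \<in> borel_measurable (lebesgue_on S)"
proof -
  have "(\<lambda>x. if x \<in> S then f x else 0) \<in> borel_measurable lebesgue"
    using f S by (simp add: borel_measurable_if)
  moreover have "AE x in lebesgue. (if x \<in> S then f x else 0) = (if x \<in> S then g x else 0)"
    using ae S by (simp add: AE_restrict_space_iff)
  ultimately have "(\<lambda>x. if x \<in> S then g x else 0) \<in> borel_measurable lebesgue"
    by (rule borel_measurable_AE)
  then show ?thesis using S by (simp add: borel_measurable_if)
qed

lemma Lnorm_cong_AE:
  fixes f g :: "real ^ 'n::finite \<Rightarrow> 'b::euclidean_space"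
  assumes S: "S \<in> sets lebesgue" and f: "f \<in> borel_measurable (lebesgue_on S)"
    and ae: "AE x in lebesgue_on S. f x = g x"
  shows "Lnorm r S f = Lnorm r S g" "in_L r S f \<longleftrightarrow> in_L r S g"
proof -
  have [measurable]: "g \<in> borel_measurable (lebesgue_on S)" "f \<in> borel_measurable (lebesgue_on S)"
    using AE_lebesgue_on_measurable[OF assms] f .
  have 1: "esssup (lebesgue_on S) (\<lambda>x. ereal (norm (f x))) = esssup (lebesgue_on S) (\<lambda>x. ereal (norm (g x)))"
    by (rule esssup_AE_cong) (use ae in \<open>auto elim: eventually_mono\<close>)
  have 2: "(\<integral>x. norm (f x) powr s \<partial>lebesgue_on S) = (\<integral>x. norm (g x) powr s \<partial>lebesgue_on S)" for s
    by (rule integral_cong_AE) (use ae in \<open>auto elim: eventually_mono\<close>)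
  have 3: "integrable (lebesgue_on S) (\<lambda>x. norm (f x) powr s) \<longleftrightarrow> integrable (lebesgue_on S) (\<lambda>x. norm (g x) powr s)" for s
    by (rule integrable_cong_AE) (use ae in \<open>auto elim: eventually_mono\<close>)
  show "Lnorm r S f = Lnorm r S g" by (simp add: Lnorm_def 1 2)
  show "in_L r S f \<longleftrightarrow> in_L r S g" by (simp add: in_L_def 1 3)
qed

lemma
  fixes u :: "real ^ 'n::finite \<Rightarrow> real"
  assumes "open \<Omega>" "has_weak_grad \<Omega> u g" "g \<in> borel_measurable (lebesgue_on \<Omega>)"
  shows Lnorm_weak_grad: "Lnorm r \<Omega> (weak_grad \<Omega> u) = Lnorm r \<Omega> g"
    and in_L_weak_grad: "in_L r \<Omega> (weak_grad \<Omega> u) \<longleftrightarrow> in_L r \<Omega> g"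
    and measurable_weak_grad: "weak_grad \<Omega> u \<in> borel_measurable (lebesgue_on \<Omega>)"
  using Lnorm_cong_AE[of \<Omega> g "weak_grad \<Omega> u" r] AE_lebesgue_on_measurable[of \<Omega> g "weak_grad \<Omega> u"]
    weak_grad_AE_eq[OF assms(1,2)] assms by (auto simp: borel_open)

section \<open>Lebesgue norms\<close>

text \<open>Dividing by b reduces the tangent inequality to Bernoulli's x^p >= 1 + p (x - 1), which
  is the weighted arithmetic-geometric mean inequality for x^p and 1 with weights 1/p and 1 -
  1/p.\<close>

lemma powr_ge_tangent:
  fixes a b p :: real
  assumes p: "p \<ge> 1" and "a \<ge> 0" "b > 0"
  shows "a powr p \<ge> b powr p + p * b powr (p - 1) * (a - b)"
proof (cases "a = 0")
  case True
  have "b powr p = b powr (p - 1) * b"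
    using assms powr_add[of b "p - 1" 1] by simp
  then have "b powr p + p * b powr (p - 1) * (a - b) = (1 - p) * (b powr (p - 1) * b)"
    using True by (simp add: algebra_simps)
  also have "\<dots> \<le> 0" using assms by (intro mult_nonpos_nonneg) auto
  finally show ?thesis using True by simp
next
  case False
  define x where "x = a / b"
  have x: "x > 0" using False assms by (simp add: x_def)
  have "(x powr p) powr (1 / p) * 1 powr (1 - 1 / p) \<le> (1 / p) * x powr p + (1 - 1 / p) * 1"
    using p x by (intro Youngs_inequality_0) auto
  then have "x \<le> x powr p / p + (1 - 1 / p)"
    using p x by (simp add: powr_powr)
  then have "p * x \<le> p * (x powr p / p + (1 - 1 / p))"
    using p by (intro mult_left_mono) auto
  also have "\<dots> = x powr p + p - 1"
    using p by (simp add: distrib_left right_diff_distrib)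
  finally have xp: "x powr p \<ge> 1 + p * (x - 1)"
    by (simp add: algebra_simps)
  have "b powr p = b powr (p - 1) * b"
    using assms powr_add[of b "p - 1" 1] by simp
  then have "b powr p + p * b powr (p - 1) * (a - b) = b powr p * (1 + p * (x - 1))"
    using assms by (simp add: x_def field_simps)
  also have "\<dots> \<le> b powr p * x powr p"
    by (intro mult_left_mono xp) simp
  also have "\<dots> = a powr p"
    using assms by (simp add: x_def flip: powr_mult)
  finally show ?thesis .
qed

text \<open>Both tangent inequalities are taken at the mean m; when they are averaged, the linear
  terms cancel. The case m = 0 is separate because the tangent needs a positive base point.\<close>

lemma powr_convex:
  fixes a b p t :: real
  assumes p: "p \<ge> 1" and ab: "a \<ge> 0" "b \<ge> 0" and t: "0 \<le> t" "t \<le> 1"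
  shows "((1 - t) * a + t * b) powr p \<le> (1 - t) * a powr p + t * b powr p"
proof -
  define m where "m = (1 - t) * a + t * b"
  have "m \<ge> 0" using assms by (simp add: m_def)
  show ?thesis
  proof (cases "m = 0")
    case True
    then show ?thesis using assms by (simp add: m_def)
  next
    case False
    then have m: "m > 0" using \<open>m \<ge> 0\<close> by simp
    define s where "s = p * m powr (p - 1)"
    have "(1 - t) * a powr p + t * b powr p \<ge> (1 - t) * (m powr p + s * (a - m)) + t * (m powr p + s * (b - m))"
      unfolding s_def using assms m by (intro add_mono mult_left_mono powr_ge_tangent) auto
    moreover have "(1 - t) * (m powr p + s * (a - m)) + t * (m powr p + s * (b - m)) =
        m powr p + s * ((1 - t) * a + t * b - m)"
      by (simp add: algebra_simps)
    ultimately show ?thesis by (simp add: m_def)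
  qed
qed

text \<open>The gradient of |v|^p at w is p |w|^(p-2) w; Cauchy-Schwarz reduces the claim to the
  scalar tangent inequality between the two norms.\<close>

lemma norm_powr_ge_tangent:
  fixes v w :: "'a::real_inner"
  assumes p: "p \<ge> 1" and w: "w \<noteq> 0"
  shows "norm v powr p \<ge> norm w powr p + p * norm w powr (p - 2) * (w \<bullet> (v - w))"
proof -
  have nw: "norm w > 0" using w by simp
  have e: "norm w powr (p - 1) = norm w powr (p - 2) * norm w"
    using nw powr_add[of "norm w" "p - 2" 1] by simp
  have "w \<bullet> (v - w) \<le> norm w * (norm v - norm w)"
    using norm_cauchy_schwarz[of w v] by (simp add: inner_diff_right right_diff_distrib dot_square_norm power2_eq_square)
  then have "p * norm w powr (p - 2) * (w \<bullet> (v - w)) \<le> p * norm w powr (p - 2) * (norm w * (norm v - norm w))"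
    using p by (intro mult_left_mono) auto
  also have "\<dots> = p * norm w powr (p - 1) * (norm v - norm w)"
    by (simp add: e)
  finally show ?thesis
    using powr_ge_tangent[OF p norm_ge_zero[of v] nw] by linarith
qed

lemma Lnorm_ereal: "Lnorm (ereal p) \<Omega> f = (\<integral>x. norm (f x) powr p \<partial>lebesgue_on \<Omega>) powr (1 / p)"
  by (simp add: Lnorm_def)

lemma in_L_ereal: "in_L (ereal p) \<Omega> f \<longleftrightarrow>
    f \<in> borel_measurable (lebesgue_on \<Omega>) \<and> integrable (lebesgue_on \<Omega>) (\<lambda>x. norm (f x) powr p)"
  by (simp add: in_L_def)

lemma Lnorm_ereal_nonneg: "Lnorm (ereal p) \<Omega> f \<ge> 0"
  by (simp add: Lnorm_ereal)

lemma Lnorm_ereal_powr: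
  "p > 0 \<Longrightarrow> Lnorm (ereal p) \<Omega> f powr p = (\<integral>x. norm (f x) powr p \<partial>lebesgue_on \<Omega>)"
  by (simp add: Lnorm_ereal powr_powr)

text \<open>Minkowski's inequality by convexity: f + g is A + B times a convex combination of f / A
  and g / B. Strict upper bounds A and B in place of the norms avoid division by a vanishing
  norm.\<close>

lemma Lnorm_triangle_aux:
  fixes f g :: "real ^ 'n::finite \<Rightarrow> 'b::euclidean_space"
  assumes p: "p \<ge> 1" and f: "in_L (ereal p) \<Omega> f" and g: "in_L (ereal p) \<Omega> g"
    and A: "A > Lnorm (ereal p) \<Omega> f" and B: "B > Lnorm (ereal p) \<Omega> g"
  shows "in_L (ereal p) \<Omega> (\<lambda>x. f x + g x) \<and> Lnorm (ereal p) \<Omega> (\<lambda>x. f x + g x) \<le> A + B"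
proof -
  let ?M = "lebesgue_on \<Omega>"
  have A0: "A > 0" and B0: "B > 0" using A B Lnorm_ereal_nonneg order_le_less_trans by blast+
  have fm [measurable]: "f \<in> borel_measurable ?M" "g \<in> borel_measurable ?M" using f g by (auto simp: in_L_ereal)
  have fi: "integrable ?M (\<lambda>x. norm (f x) powr p)" "integrable ?M (\<lambda>x. norm (g x) powr p)"
    using f g by (auto simp: in_L_ereal)
  define t where "t = B / (A + B)"
  have t: "0 \<le> t" "t \<le> 1" "1 - t = A / (A + B)" using A0 B0 by (auto simp: t_def field_simps)
  define h where "h = (\<lambda>x. (A + B) powr p * ((1 - t) * (norm (f x) powr p / A powr p) + t * (norm (g x) powr p / B powr p)))"
  have hi: "integrable ?M h" unfolding h_def using fi by auto
  have le: "norm (f x + g x) powr p \<le> h x" for x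
  proof -
    have "norm (f x + g x) \<le> (A + B) * ((1 - t) * (norm (f x) / A) + t * (norm (g x) / B))"
    proof -
      have "(A + B) * (1 - t) = A" "(A + B) * t = B" using A0 B0 unfolding t(3) by (simp_all add: t_def)
      then have "(A + B) * ((1 - t) * (norm (f x) / A) + t * (norm (g x) / B)) = A * (norm (f x) / A) + B * (norm (g x) / B)"
        by (metis distrib_left mult.assoc)
      then show ?thesis using norm_triangle_ineq[of "f x" "g x"] A0 B0 by simp
    qed
    then have "norm (f x + g x) powr p \<le> ((A + B) * ((1 - t) * (norm (f x) / A) + t * (norm (g x) / B))) powr p"
      using p by (intro powr_mono2) auto
    also have "\<dots> = (A + B) powr p * ((1 - t) * (norm (f x) / A) + t * (norm (g x) / B)) powr p"
      by (rule powr_mult)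
    also have "\<dots> \<le> (A + B) powr p * ((1 - t) * (norm (f x) / A) powr p + t * (norm (g x) / B) powr p)"
      using A0 B0 t p by (intro mult_left_mono powr_convex) auto
    also have "\<dots> = h x" using A0 B0 by (simp add: h_def powr_divide)
    finally show ?thesis .
  qed
  have int: "integrable ?M (\<lambda>x. norm (f x + g x) powr p)"
    by (rule Bochner_Integration.integrable_bound[OF hi]) (use le order_trans[OF _ abs_ge_self] in auto)
  have "(\<integral>x. norm (f x) powr p \<partial>?M) \<le> A powr p" "(\<integral>x. norm (g x) powr p \<partial>?M) \<le> B powr p"
    using p A B Lnorm_ereal_nonneg[of p \<Omega> f] Lnorm_ereal_nonneg[of p \<Omega> g]
    by (auto simp flip: Lnorm_ereal_powr intro!: powr_mono2)
  then have q: "(\<integral>x. norm (f x) powr p \<partial>?M) / A powr p \<le> 1" "(\<integral>x. norm (g x) powr p \<partial>?M) / B powr p \<le> 1"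
    using A0 B0 by simp_all
  have "(\<integral>x. norm (f x + g x) powr p \<partial>?M) \<le> integral\<^sup>L ?M h"
    by (rule integral_mono[OF int hi le])
  also have "\<dots> = (A + B) powr p * ((1 - t) * ((\<integral>x. norm (f x) powr p \<partial>?M) / A powr p)
      + t * ((\<integral>x. norm (g x) powr p \<partial>?M) / B powr p))"
    unfolding h_def using fi by simp
  also have "\<dots> \<le> (A + B) powr p * ((1 - t) * 1 + t * 1)"
    using t q by (intro mult_left_mono add_mono) auto
  finally have "(\<integral>x. norm (f x + g x) powr p \<partial>?M) \<le> (A + B) powr p" by simp
  then have "Lnorm (ereal p) \<Omega> (\<lambda>x. f x + g x) \<le> ((A + B) powr p) powr (1 / p)"
    unfolding Lnorm_ereal using p by (intro powr_mono2) auto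
  also have "\<dots> = A + B" using p A0 B0 by (simp add: powr_powr)
  finally show ?thesis using int by (simp add: in_L_ereal)
qed

lemma
  fixes f g :: "real ^ 'n::finite \<Rightarrow> 'b::euclidean_space"
  assumes p: "p \<ge> 1" and f: "in_L (ereal p) \<Omega> f" and g: "in_L (ereal p) \<Omega> g"
  shows in_L_add: "in_L (ereal p) \<Omega> (\<lambda>x. f x + g x)"
    and Lnorm_triangle: "Lnorm (ereal p) \<Omega> (\<lambda>x. f x + g x) \<le> Lnorm (ereal p) \<Omega> f + Lnorm (ereal p) \<Omega> g"
proof -
  let ?L = "Lnorm (ereal p) \<Omega>"
  show "in_L (ereal p) \<Omega> (\<lambda>x. f x + g x)"
    using Lnorm_triangle_aux[OF assms, of "?L f + 1" "?L g + 1"] by simp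
  show "?L (\<lambda>x. f x + g x) \<le> ?L f + ?L g"
  proof (rule field_le_epsilon)
    fix e :: real assume "e > 0"
    then show "?L (\<lambda>x. f x + g x) \<le> ?L f + ?L g + e"
      using Lnorm_triangle_aux[OF assms, of "?L f + e / 2" "?L g + e / 2"] by (simp add: field_simps)
  qed
qed

lemma
  fixes f :: "real ^ 'n::finite \<Rightarrow> 'b::euclidean_space"
  assumes p: "p \<ge> 1"
  shows Lnorm_scaleR: "Lnorm (ereal p) \<Omega> (\<lambda>x. c *\<^sub>R f x) = \<bar>c\<bar> * Lnorm (ereal p) \<Omega> f"
    and in_L_scaleR: "in_L (ereal p) \<Omega> f \<Longrightarrow> in_L (ereal p) \<Omega> (\<lambda>x. c *\<^sub>R f x)"
proof -
  have "(\<integral>x. norm (c *\<^sub>R f x) powr p \<partial>lebesgue_on \<Omega>) = \<bar>c\<bar> powr p * (\<integral>x. norm (f x) powr p \<partial>lebesgue_on \<Omega>)"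
    by (simp add: powr_mult)
  then show "Lnorm (ereal p) \<Omega> (\<lambda>x. c *\<^sub>R f x) = \<bar>c\<bar> * Lnorm (ereal p) \<Omega> f"
    using p by (simp add: Lnorm_ereal powr_mult powr_powr)
  show "in_L (ereal p) \<Omega> f \<Longrightarrow> in_L (ereal p) \<Omega> (\<lambda>x. c *\<^sub>R f x)"
    by (auto simp: in_L_ereal powr_mult)
qed

lemma
  fixes f g :: "real ^ 'n::finite \<Rightarrow> 'b::euclidean_space"
  assumes p: "p \<ge> 1" and f: "in_L (ereal p) \<Omega> f" and g: "in_L (ereal p) \<Omega> g"
  shows in_L_diff: "in_L (ereal p) \<Omega> (\<lambda>x. f x - g x)"
    and Lnorm_diff_le: "Lnorm (ereal p) \<Omega> (\<lambda>x. f x - g x) \<le> Lnorm (ereal p) \<Omega> f + Lnorm (ereal p) \<Omega> g"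
  using in_L_add[OF p f in_L_scaleR[OF p g, of "-1"]] Lnorm_triangle[OF p f in_L_scaleR[OF p g, of "-1"]]
    Lnorm_scaleR[OF p, of \<Omega> "-1" g] by simp_all

lemma Lnorm_minus_commute: "Lnorm (ereal p) \<Omega> (\<lambda>x. f x - g x) = Lnorm (ereal p) \<Omega> (\<lambda>x. g x - f x)"
  by (simp add: Lnorm_ereal norm_minus_commute)

lemma Lnorm_diff_ge:
  fixes f g :: "real ^ 'n::finite \<Rightarrow> 'b::euclidean_space"
  assumes p: "p \<ge> 1" and f: "in_L (ereal p) \<Omega> f" and g: "in_L (ereal p) \<Omega> g"
  shows "\<bar>Lnorm (ereal p) \<Omega> f - Lnorm (ereal p) \<Omega> g\<bar> \<le> Lnorm (ereal p) \<Omega> (\<lambda>x. f x - g x)"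
  using Lnorm_triangle[OF p in_L_diff[OF p f g] g] Lnorm_triangle[OF p in_L_diff[OF p g f] f]
    Lnorm_minus_commute[of p \<Omega> f g] by simp

lemma Lnorm_mono:
  fixes f :: "real ^ 'n::finite \<Rightarrow> 'b::euclidean_space" and g :: "real ^ 'n::finite \<Rightarrow> 'c::euclidean_space"
  assumes p: "p > 0" and f: "in_L (ereal p) \<Omega> f" and g: "in_L (ereal p) \<Omega> g"
    and le: "\<And>x. x \<in> \<Omega> \<Longrightarrow> norm (f x) \<le> norm (g x)"
  shows "Lnorm (ereal p) \<Omega> f \<le> Lnorm (ereal p) \<Omega> g"
  unfolding Lnorm_ereal using p f g le
  by (intro powr_mono2 integral_mono) (auto simp: in_L_ereal intro!: powr_mono2)

section \<open>Morrey estimates\<close>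

lemma norm_unit_cube_le:
  fixes z :: "real ^ 'n::finite"
  assumes "z \<in> cbox 0 One"
  shows "norm z \<le> real CARD('n)"
proof -
  have "\<bar>z $ i\<bar> \<le> 1" for i
  proof -
    have "\<forall>b\<in>Basis. 0 \<le> z \<bullet> b \<and> z \<bullet> b \<le> 1" using assms by (simp add: mem_box)
    moreover have "axis i (1::real) \<in> Basis" by (auto simp: Basis_vec_def)
    ultimately have "0 \<le> z $ i" "z $ i \<le> 1" by (auto simp: cart_eq_inner_axis)
    then show ?thesis by simp
  qed
  then have "(\<Sum>i\<in>UNIV. \<bar>z $ i\<bar>) \<le> of_nat CARD('n) * 1"
    by (intro sum_bounded_above) auto
  then show ?thesis using norm_le_l1_cart[of z] by simp
qed

text \<open>Pulling the cube with corner c and side r back to the unit cube turns c and r into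
  parameters of the integrand, in which one can differentiate, and lets r = 0 give the value at
  c.\<close>

definition cube_avg :: "(real ^ 'n::finite \<Rightarrow> real) \<Rightarrow> real ^ 'n \<Rightarrow> real \<Rightarrow> real" where
  "cube_avg f c r = integral (cbox 0 One) (\<lambda>z. f (c + r *\<^sub>R z))"

lemma continuous_on_affine_compose:
  fixes h :: "'a::real_normed_vector \<Rightarrow> 'b::topological_space"
  assumes "continuous_on UNIV h"
  shows "continuous_on A (\<lambda>z. h (c + r *\<^sub>R z))"
  by (rule continuous_on_compose2[OF assms]) (auto intro!: continuous_intros)

lemma cube_avg_0: "cube_avg f c 0 = f c"
  by (simp add: cube_avg_def)

text \<open>The corner moves with velocity v and the side changes with velocity s: s = 0 is the
  translation of a cube, v = 0 its growth from a point.\<close>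

lemma cube_avg_DERIV:
  fixes \<phi> :: "real ^ 'n::finite \<Rightarrow> real"
  assumes der: "\<And>x. (\<phi> has_derivative (\<lambda>v. grad \<phi> x \<bullet> v)) (at x)" and cont: "continuous_on UNIV (grad \<phi>)"
  shows "((\<lambda>t. cube_avg \<phi> (c + t *\<^sub>R v) (r + t * s)) has_real_derivative
     integral (cbox 0 One) (\<lambda>z. grad \<phi> (c + t *\<^sub>R v + (r + t * s) *\<^sub>R z) \<bullet> (v + s *\<^sub>R z))) (at t)"
  unfolding cube_avg_def
proof (rule leibniz_rule_field_derivative[where U=UNIV and f="\<lambda>t z. \<phi> (c + t *\<^sub>R v + (r + t * s) *\<^sub>R z)"
     and fx="\<lambda>t z. grad \<phi> (c + t *\<^sub>R v + (r + t * s) *\<^sub>R z) \<bullet> (v + s *\<^sub>R z)"])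
  fix t and z :: "real ^ 'n"
  have "((\<lambda>t. c + t *\<^sub>R v + (r + t * s) *\<^sub>R z) has_derivative (\<lambda>h. h *\<^sub>R (v + s *\<^sub>R z))) (at t)"
    by (auto intro!: derivative_eq_intros simp: algebra_simps)
  from has_derivative_compose[OF this der]
  show "((\<lambda>t. \<phi> (c + t *\<^sub>R v + (r + t * s) *\<^sub>R z)) has_real_derivative
     grad \<phi> (c + t *\<^sub>R v + (r + t * s) *\<^sub>R z) \<bullet> (v + s *\<^sub>R z)) (at t)"
    by (simp add: has_field_derivative_def mult_commute_abs)
next
  have "continuous_on UNIV \<phi>"
    using der by (intro continuous_at_imp_continuous_on ballI) (rule has_derivative_continuous)
  then show "(\<lambda>z. \<phi> (c + t *\<^sub>R v + (r + t * s) *\<^sub>R z)) integrable_on cbox 0 One" for t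
    by (intro integrable_continuous continuous_on_affine_compose)
  show "continuous_on (UNIV \<times> cbox 0 One) (\<lambda>(t, z). grad \<phi> (c + t *\<^sub>R v + (r + t * s) *\<^sub>R z) \<bullet> (v + s *\<^sub>R z))"
    unfolding case_prod_beta
    by (intro continuous_on_inner continuous_on_compose2[OF cont]) (auto intro!: continuous_intros)
qed auto

text \<open>Jensen's inequality for t^p on the unit cube, which has measure 1: integrate the tangent
  inequality at B = A + e. The e keeps the base point positive when A = 0.\<close>

lemma cube_mean_le:
  fixes h :: "real ^ 'n::finite \<Rightarrow> real"
  assumes h: "continuous_on (cbox 0 One) h" "\<And>z. h z \<ge> 0" and p: "p \<ge> 1" and A: "A \<ge> 0"
    and le: "integral (cbox 0 One) (\<lambda>z. h z powr p) \<le> A powr p"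
  shows "integral (cbox 0 One) h \<le> A"
proof (rule field_le_epsilon)
  fix e :: real assume e: "e > 0"
  define B where "B = A + e"
  have B: "B > 0" using A e by (simp add: B_def)
  have hp: "continuous_on (cbox 0 One) (\<lambda>z. h z powr p)"
    by (rule continuous_on_powr'[OF h(1) continuous_on_const]) (use h(2) p in auto)
  define s where "s = p * B powr (p - 1)"
  have s: "s > 0" using p B by (simp add: s_def)
  have "integral (cbox 0 One :: (real ^ 'n) set) (\<lambda>z. B powr p + s * (h z - B)) \<le> integral (cbox 0 One) (\<lambda>z. h z powr p)"
    unfolding s_def using h(2) B p
    by (intro integral_le integrable_continuous powr_ge_tangent hp continuous_on_add continuous_on_const
        continuous_on_mult continuous_on_diff h(1))
  also have "integral (cbox 0 One :: (real ^ 'n) set) (\<lambda>z. B powr p + s * (h z - B)) = B powr p + s * (integral (cbox 0 One) h - B)"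
  proof (rule integral_unique)
    have hc: "((\<lambda>z. c) has_integral c) (cbox 0 (One :: real ^ 'n))" for c :: real
      using has_integral_const[of c 0 "One :: real ^ 'n"] by simp
    show "((\<lambda>z. B powr p + s * (h z - B)) has_integral B powr p + s * (integral (cbox 0 One) h - B)) (cbox 0 One)"
      by (intro has_integral_add has_integral_mult_right has_integral_diff hc integrable_integral integrable_continuous h(1))
  qed
  also have "integral (cbox 0 One) (\<lambda>z. h z powr p) \<le> B powr p"
    using le powr_mono2[of p A B] p A e by (simp add: B_def)
  finally have "s * (integral (cbox 0 One) h - B) \<le> 0" by simp
  then show "integral (cbox 0 One) h \<le> A + e"
    using s by (simp add: mult_le_0_iff B_def)
qed

lemma cube_rescale_le:
  fixes h :: "real ^ 'n::finite \<Rightarrow> real"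
  assumes h: "continuous_on UNIV h" "\<And>z. h z \<ge> 0" "integrable lborel h" and r: "r > 0"
  shows "integral (cbox 0 One) (\<lambda>z. h (c + r *\<^sub>R z)) \<le> integral\<^sup>L lborel h / r ^ CARD('n)"
proof -
  let ?B = "cbox c (c + r *\<^sub>R One)"
  have hb: "h integrable_on ?B"
    by (intro integrable_continuous continuous_on_subset[OF h(1)]) simp
  have "((\<lambda>x. h (r *\<^sub>R x + c)) has_integral (integral ?B h /\<^sub>R r ^ DIM(real ^ 'n)))
           (cbox ((c - c) /\<^sub>R r) ((c + r *\<^sub>R One - c) /\<^sub>R r))"
    by (rule has_integral_affinity'[OF integrable_integral[OF hb] r])
  then have "integral (cbox 0 One) (\<lambda>z. h (c + r *\<^sub>R z)) = integral ?B h / r ^ CARD('n)"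
    using r by (intro integral_unique) (simp add: add.commute divide_inverse_commute)
  also have "integral ?B h \<le> integral UNIV h"
    using h(2) by (intro integral_subset_le hb integrable_on_lborel[OF h(3)]) auto
  also have "integral UNIV h = integral\<^sup>L lborel h"
    by (rule integral_lborel[OF h(3)])
  finally show ?thesis using r by (simp add: divide_right_mono)
qed

lemma test_grad_integrable:
  fixes \<phi> :: "real ^ 'n::finite \<Rightarrow> real"
  assumes \<Omega>: "open \<Omega>" and \<phi>: "test_function \<Omega> \<phi>" and p: "p > 0"
  shows "integrable lborel (\<lambda>x. norm (grad \<phi> x) powr p)"
    and "(\<integral>x. norm (grad \<phi> x) powr p \<partial>lborel) = Lnorm (ereal p) \<Omega> (grad \<phi>) powr p"
    and "in_L (ereal p) \<Omega> (grad \<phi>)" and "in_L (ereal p) \<Omega> \<phi>"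
proof -
  obtain K where K: "compact K" "K \<subseteq> \<Omega>" "\<And>x. x \<notin> K \<Longrightarrow> \<phi> x = 0" "\<And>x. x \<notin> K \<Longrightarrow> grad \<phi> x = 0"
    using test_function_props[OF \<phi>] by blast
  have z: "\<phi> x = 0" "grad \<phi> x = 0" if "x \<notin> \<Omega>" for x using K that by auto
  have c: "continuous_on UNIV (\<lambda>x. norm (grad \<phi> x) powr p)" "continuous_on UNIV (\<lambda>x. norm (\<phi> x) powr p)"
    by (rule continuous_on_powr'[OF continuous_on_norm[OF test_function_continuous_grad[OF \<phi>]] continuous_on_const]
        continuous_on_powr'[OF continuous_on_norm[OF test_function_continuous[OF \<phi>]] continuous_on_const];
        use p in simp)+
  note bm = borel_measurable_continuous_onI[OF c(1)] borel_measurable_continuous_onI[OF c(2)]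
    borel_measurable_continuous_onI[OF test_function_continuous[OF \<phi>]]
    borel_measurable_continuous_onI[OF test_function_continuous_grad[OF \<phi>]]
  have S: "\<Omega> \<in> sets lebesgue" using \<Omega> by (simp add: borel_open)
  show i: "integrable lborel (\<lambda>x. norm (grad \<phi> x) powr p)"
    using K(4) p by (intro continuous_compact_support_integrable[OF c(1) K(1)]) auto
  have i': "integrable lborel (\<lambda>x. norm (\<phi> x) powr p)"
    using K(3) p by (intro continuous_compact_support_integrable[OF c(2) K(1)]) auto
  show "(\<integral>x. norm (grad \<phi> x) powr p \<partial>lborel) = Lnorm (ereal p) \<Omega> (grad \<phi>) powr p"
    unfolding Lnorm_ereal_powr[OF p]
    by (rule integral_lebesgue_on_eq_lborel[symmetric, OF bm(1) S]) (use z p in auto)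
  show "in_L (ereal p) \<Omega> (grad \<phi>)"
    using i integrable_lebesgue_on_iff_lborel[OF bm(1) S] z p bm(4)
    by (auto simp: in_L_ereal intro!: measurable_restrict_space1 measurable_completion)
  show "in_L (ereal p) \<Omega> \<phi>"
    using i' integrable_lebesgue_on_iff_lborel[OF bm(2) S] z p bm(3)
    by (auto simp: in_L_ereal intro!: measurable_restrict_space1 measurable_completion)
qed

context
  fixes \<Omega> :: "(real ^ 'n::finite) set" and \<phi> :: "real ^ 'n \<Rightarrow> real" and p G :: real
  assumes \<Omega>: "open \<Omega>" and \<phi>: "test_function \<Omega> \<phi>" and p: "p \<ge> 1"
    and G: "Lnorm (ereal p) \<Omega> (grad \<phi>) \<le> G"
begin

lemma grad_bound_nonneg: "G \<ge> 0" using G Lnorm_ereal_nonneg order_trans by blast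

text \<open>Rescaling the cube costs r^(-N) inside the p-th power, and Jensen turns this into
  r^(-N/p); for fixed r this factor tends to 1 as p grows.\<close>

lemma grad_cube_mean_le:
  assumes r: "r > 0"
  shows "integral (cbox 0 One) (\<lambda>z. norm (grad \<phi> (c + r *\<^sub>R z))) \<le> G * r powr (- real CARD('n) / p)"
proof (rule cube_mean_le[OF _ _ p])
  have cont: "continuous_on UNIV (grad \<phi>)" by (rule test_function_continuous_grad[OF \<phi>])
  show "continuous_on (cbox 0 One) (\<lambda>z. norm (grad \<phi> (c + r *\<^sub>R z)))"
    by (intro continuous_on_norm continuous_on_affine_compose cont)
  show "0 \<le> G * r powr (- real CARD('n) / p)" using grad_bound_nonneg by simp
  have p0: "p > 0" using p by simp
  have "integral (cbox 0 One) (\<lambda>z. norm (grad \<phi> (c + r *\<^sub>R z)) powr p)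
     \<le> (\<integral>x. norm (grad \<phi> x) powr p \<partial>lborel) / r ^ CARD('n)"
    using p0 by (intro cube_rescale_le[OF _ _ test_grad_integrable(1)[OF \<Omega> \<phi> p0] r] continuous_on_powr'
       continuous_on_norm cont continuous_on_const) auto
  also have "\<dots> \<le> G powr p / r ^ CARD('n)"
    unfolding test_grad_integrable(2)[OF \<Omega> \<phi> p0]
    using r p0 G by (intro divide_right_mono powr_mono2) (auto simp: Lnorm_ereal_nonneg)
  also have "\<dots> = (G * r powr (- real CARD('n) / p)) powr p"
  proof -
    have "(G * r powr (- real CARD('n) / p)) powr p = G powr p * r powr (- real CARD('n))"
      using p0 by (simp add: powr_mult powr_powr)
    also have "r powr (- real CARD('n)) = inverse (r ^ CARD('n))"
      using r by (simp add: powr_minus powr_realpow)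
    finally show ?thesis by (simp add: divide_inverse)
  qed
  finally show "integral (cbox 0 One) (\<lambda>z. norm (grad \<phi> (c + r *\<^sub>R z)) powr p)
     \<le> (G * r powr (- real CARD('n) / p)) powr p" .
qed auto

lemma cube_avg_derivative_le:
  assumes r: "r > 0"
  shows "\<bar>integral (cbox 0 One) (\<lambda>z. grad \<phi> (c + r *\<^sub>R z) \<bullet> (v + s *\<^sub>R z))\<bar>
    \<le> (norm v + \<bar>s\<bar> * real CARD('n)) * (G * r powr (- real CARD('n) / p))"
proof -
  have cont: "continuous_on UNIV (grad \<phi>)" by (rule test_function_continuous_grad[OF \<phi>])
  let ?k = "norm v + \<bar>s\<bar> * real CARD('n)"
  have "norm (integral (cbox 0 One) (\<lambda>z. grad \<phi> (c + r *\<^sub>R z) \<bullet> (v + s *\<^sub>R z)))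
     \<le> integral (cbox 0 One) (\<lambda>z. ?k * norm (grad \<phi> (c + r *\<^sub>R z)))"
  proof (rule integral_norm_bound_integral)
    show "(\<lambda>z. grad \<phi> (c + r *\<^sub>R z) \<bullet> (v + s *\<^sub>R z)) integrable_on cbox 0 One"
      by (intro integrable_continuous continuous_on_inner continuous_on_affine_compose cont) (auto intro!: continuous_intros)
    show "(\<lambda>z. ?k * norm (grad \<phi> (c + r *\<^sub>R z))) integrable_on cbox 0 One"
      by (intro integrable_continuous continuous_on_mult continuous_on_const continuous_on_norm continuous_on_affine_compose cont)
    fix z :: "real ^ 'n" assume z: "z \<in> cbox 0 One"
    have "norm (v + s *\<^sub>R z) \<le> norm v + \<bar>s\<bar> * norm z"
      using norm_triangle_ineq[of v "s *\<^sub>R z"] by simp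
    also have "\<dots> \<le> ?k" using norm_unit_cube_le[OF z] by (intro add_left_mono mult_left_mono) auto
    finally have "norm (grad \<phi> (c + r *\<^sub>R z)) * norm (v + s *\<^sub>R z) \<le> norm (grad \<phi> (c + r *\<^sub>R z)) * ?k"
      by (intro mult_left_mono) auto
    then show "norm (grad \<phi> (c + r *\<^sub>R z) \<bullet> (v + s *\<^sub>R z)) \<le> ?k * norm (grad \<phi> (c + r *\<^sub>R z))"
      using Cauchy_Schwarz_ineq2[of "grad \<phi> (c + r *\<^sub>R z)" "v + s *\<^sub>R z"] by (simp add: mult.commute)
  qed
  also have "\<dots> = ?k * integral (cbox 0 One) (\<lambda>z. norm (grad \<phi> (c + r *\<^sub>R z)))"
    by simp
  also have "\<dots> \<le> ?k * (G * r powr (- real CARD('n) / p))"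
    by (intro mult_left_mono grad_cube_mean_le r) auto
  finally show ?thesis by simp
qed

text \<open>In contrast with the pointwise estimate, the coefficient of |h| G carries no dimensional
  constant and tends to 1 for fixed r as p grows. The sharp Lipschitz constant of the limit function
  comes from here.\<close>

lemma cube_avg_translate:
  assumes r: "r > 0"
  shows "\<bar>cube_avg \<phi> (c + h) r - cube_avg \<phi> c r\<bar> \<le> norm h * (G * r powr (- real CARD('n) / p))"
proof -
  let ?f = "\<lambda>t. cube_avg \<phi> (c + t *\<^sub>R h) (r + t * 0)"
  let ?B = "norm h * (G * r powr (- real CARD('n) / p))"
  have d: "(?f has_real_derivative integral (cbox 0 One) (\<lambda>z. grad \<phi> (c + t *\<^sub>R h + (r + t * 0) *\<^sub>R z) \<bullet> (h + 0 *\<^sub>R z))) (at t)" for t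
    by (rule cube_avg_DERIV[OF test_function_has_derivative[OF \<phi>] test_function_continuous_grad[OF \<phi>]])
  have b: "\<bar>integral (cbox 0 One) (\<lambda>z. grad \<phi> (c + t *\<^sub>R h + (r + t * 0) *\<^sub>R z) \<bullet> (h + 0 *\<^sub>R z))\<bar> \<le> ?B" for t
    using cube_avg_derivative_le[OF r, of "c + t *\<^sub>R h" h 0] by simp
  have "norm (?f 1 - ?f 0) \<le> ?B * norm (1 - 0 :: real)"
    by (rule field_differentiable_bound[OF convex_UNIV]) (use d b in auto)
  then show ?thesis by simp
qed

text \<open>Let the cube grow from the point c. The derivative in the side t is of order t^(-N/p),
  which is integrable at 0 because p > N, and its primitive is the comparison function
  \<open>?g\<close>.\<close>

lemma cube_avg_center:
  assumes pN: "p > real CARD('n)" and R: "R > 0"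
  shows "\<bar>cube_avg \<phi> c R - \<phi> c\<bar> \<le> real CARD('n) * G * (R powr (1 - real CARD('n) / p) / (1 - real CARD('n) / p))"
proof -
  define a where "a = 1 - real CARD('n) / p"
  have a: "a > 0" using pN p by (simp add: a_def field_simps)
  have ea: "a - 1 = - real CARD('n) / p" by (simp add: a_def)
  let ?f = "\<lambda>t. cube_avg \<phi> (c + t *\<^sub>R 0) (0 + t * 1)"
  let ?f' = "\<lambda>t. integral (cbox 0 One) (\<lambda>z. grad \<phi> (c + t *\<^sub>R 0 + (0 + t * 1) *\<^sub>R z) \<bullet> (0 + 1 *\<^sub>R z))"
  let ?g = "\<lambda>t. real CARD('n) * G * (t powr a / a)"
  have d: "(?f has_real_derivative ?f' t) (at t)" for t
    by (rule cube_avg_DERIV[OF test_function_has_derivative[OF \<phi>] test_function_continuous_grad[OF \<phi>]])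
  have "norm (?f R - ?f 0) \<le> ?g R - ?g 0"
  proof (rule differentiable_bound_general[OF R])
    show "continuous_on {0..R} ?f"
      by (intro continuous_at_imp_continuous_on ballI DERIV_isCont[OF d])
    show "continuous_on {0..R} ?g"
      by (intro continuous_on_mult continuous_on_const continuous_on_divide
           continuous_on_powr'[OF continuous_on_id continuous_on_const]) (use a in auto)
    show "(?f has_vector_derivative ?f' t) (at t)" if "0 < t" for t
      using d by (simp add: has_real_derivative_iff_has_vector_derivative)
    show "(?g has_vector_derivative real CARD('n) * (G * t powr (a - 1))) (at t)" if "0 < t" for t
      using that a by (auto intro!: derivative_eq_intros simp flip: has_real_derivative_iff_has_vector_derivative)
    show "norm (?f' t) \<le> real CARD('n) * (G * t powr (a - 1))" if "0 < t" for t
      using cube_avg_derivative_le[OF that, of c 0 1] by (simp add: ea)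
  qed
  then show ?thesis using a by (simp add: cube_avg_0 flip: a_def)
qed

lemma morrey_test:
  assumes pN: "p > real CARD('n)"
  shows "\<bar>\<phi> x - \<phi> y\<bar> \<le> (1 + 2 * real CARD('n) / (1 - real CARD('n) / p)) * G * norm (x - y) powr (1 - real CARD('n) / p)"
proof (cases "x = y")
  case True
  then show ?thesis by simp
next
  case False
  define R where "R = norm (x - y)"
  have R: "R > 0" using False by (simp add: R_def)
  define a where "a = 1 - real CARD('n) / p"
  \<comment> \<open>Go from x to the cube of side R = |x - y| at x, across to the cube at y, and
    down to y. At this scale all three terms are multiples of R^(1 - N/p).\<close>
  have "\<bar>\<phi> x - \<phi> y\<bar> \<le> \<bar>cube_avg \<phi> x R - \<phi> x\<bar> + \<bar>cube_avg \<phi> y R - \<phi> y\<bar> + \<bar>cube_avg \<phi> (y + (x - y)) R - cube_avg \<phi> y R\<bar>"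
    by simp
  also have "\<dots> \<le> real CARD('n) * G * (R powr a / a) + real CARD('n) * G * (R powr a / a) + R * (G * R powr (- real CARD('n) / p))"
    unfolding a_def using cube_avg_translate[OF R, of y "x - y"]
    by (intro add_mono cube_avg_center pN R) (simp add: R_def)
  also have "R * (G * R powr (- real CARD('n) / p)) = G * R powr a"
    using R powr_add[of R 1 "- real CARD('n) / p"] by (simp add: a_def)
  finally have "\<bar>\<phi> x - \<phi> y\<bar> \<le> (1 + 2 * real CARD('n) / a) * G * R powr a" by (simp add: algebra_simps)
  then show ?thesis by (simp add: a_def R_def)
qed

end

section \<open>Approximation of Sobolev functions\<close>

lemma open_AE_empty:
  fixes U :: "(real ^ 'n::finite) set"
  assumes "open U" "U \<subseteq> \<Omega>" "open \<Omega>" "AE x in lebesgue_on \<Omega>. x \<notin> U"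
  shows "U = {}"
proof -
  have "AE x in lebesgue. x \<notin> U"
    using assms by (simp add: AE_restrict_space_iff borel_open) (auto elim: eventually_mono)
  then have "U \<in> null_sets lebesgue"
    using assms(1) by (subst completion.null_sets_iff_AE) (auto simp: borel_open)
  then show ?thesis
    using open_not_negligible[OF assms(1)] by (auto simp: negligible_iff_null_sets)
qed

lemma AE_continuous_le:
  fixes f :: "real ^ 'n::finite \<Rightarrow> real"
  assumes \<Omega>: "open \<Omega>" and f: "continuous_on \<Omega> f" and ae: "AE x in lebesgue_on \<Omega>. f x \<le> B" and x: "x \<in> \<Omega>"
  shows "f x \<le> B"
proof -
  have "open (\<Omega> \<inter> f -` {B<..})"
    by (rule continuous_open_preimage[OF f \<Omega>]) simp
  then have "\<Omega> \<inter> f -` {B<..} = {}"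
    by (rule open_AE_empty[OF _ _ \<Omega>]) (use ae in \<open>auto elim: eventually_mono\<close>)
  then show ?thesis using x by (auto simp: not_less[symmetric])
qed

lemma measurable_lebesgue_on_continuous:
  fixes f :: "real ^ 'n::finite \<Rightarrow> 'b::euclidean_space"
  assumes "open \<Omega>" "continuous_on \<Omega> f"
  shows "f \<in> borel_measurable (lebesgue_on \<Omega>)"
  by (rule continuous_imp_measurable_on_sets_lebesgue[OF assms(2)]) (simp add: assms(1) borel_open)

lemma nonnull_open:
  fixes \<Omega> :: "(real ^ 'n::finite) set"
  assumes "open \<Omega>" "\<Omega> \<noteq> {}"
  shows "emeasure (lebesgue_on \<Omega>) (space (lebesgue_on \<Omega>)) \<noteq> 0"
proof -
  have "\<Omega> \<notin> null_sets lebesgue"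
    using open_not_negligible[OF assms] by (simp add: negligible_iff_null_sets)
  then show ?thesis
    using assms(1) by (auto simp: emeasure_restrict_space space_restrict_space null_sets_def borel_open)
qed

lemma measure_open_pos:
  fixes \<Omega> :: "(real ^ 'n::finite) set"
  assumes "open \<Omega>" "bounded \<Omega>" "\<Omega> \<noteq> {}"
  shows "measure lebesgue \<Omega> > 0"
  using open_not_negligible[OF assms(1,3)] lmeasurable_open[OF assms(2,1)]
  by (simp add: negligible_iff_measure zero_less_measure_iff)

lemma
  fixes f :: "real ^ 'n::finite \<Rightarrow> 'b::euclidean_space"
  assumes \<Omega>: "open \<Omega>" "\<Omega> \<noteq> {}" and f: "f \<in> borel_measurable (lebesgue_on \<Omega>)"
    and B: "AE x in lebesgue_on \<Omega>. norm (f x) \<le> B"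
  shows in_L_infI: "in_L \<infinity> \<Omega> f" and Lnorm_inf_le: "Lnorm \<infinity> \<Omega> f \<le> B"
proof -
  let ?e = "esssup (lebesgue_on \<Omega>) (\<lambda>x. ereal (norm (f x)))"
  have m: "(\<lambda>x. ereal (norm (f x))) \<in> borel_measurable (lebesgue_on \<Omega>)" using f by simp
  have le: "?e \<le> ereal B" using B by (intro esssup_I[OF m]) auto
  have "esssup (lebesgue_on \<Omega>) (\<lambda>x. 0) \<le> ?e"
    by (rule esssup_mono) auto
  then have ge: "0 \<le> ?e" by (simp add: esssup_const[OF nonnull_open[OF \<Omega>]])
  show "in_L \<infinity> \<Omega> f" using f le by (auto simp: in_L_def)
  show "Lnorm \<infinity> \<Omega> f \<le> B" using le ge by (cases ?e) (auto simp: Lnorm_def)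
qed

lemma
  fixes f :: "real ^ 'n::finite \<Rightarrow> 'b::euclidean_space"
  assumes \<Omega>: "open \<Omega>" "\<Omega> \<noteq> {}" and f: "in_L \<infinity> \<Omega> f"
  shows Lnorm_inf_AE: "AE x in lebesgue_on \<Omega>. norm (f x) \<le> Lnorm \<infinity> \<Omega> f"
    and Lnorm_inf_nonneg: "Lnorm \<infinity> \<Omega> f \<ge> 0"
proof -
  let ?e = "esssup (lebesgue_on \<Omega>) (\<lambda>x. ereal (norm (f x)))"
  have "esssup (lebesgue_on \<Omega>) (\<lambda>x. 0) \<le> ?e"
    by (rule esssup_mono) auto
  then have ge: "0 \<le> ?e" by (simp add: esssup_const[OF nonnull_open[OF \<Omega>]])
  then have eq: "?e = ereal (Lnorm \<infinity> \<Omega> f)"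
    using f by (cases ?e) (auto simp: Lnorm_def in_L_def)
  show "Lnorm \<infinity> \<Omega> f \<ge> 0" using ge eq by simp
  have "AE x in lebesgue_on \<Omega>. ereal (norm (f x)) \<le> ?e" by (rule esssup_AE)
  then show "AE x in lebesgue_on \<Omega>. norm (f x) \<le> Lnorm \<infinity> \<Omega> f" by (simp add: eq)
qed

lemma Lnorm_inf_ge:
  fixes f :: "real ^ 'n::finite \<Rightarrow> 'b::euclidean_space"
  assumes \<Omega>: "open \<Omega>" and f: "in_L \<infinity> \<Omega> f" "continuous_on \<Omega> f" and x: "x \<in> \<Omega>"
  shows "norm (f x) \<le> Lnorm \<infinity> \<Omega> f"
  by (rule AE_continuous_le[OF \<Omega> _ Lnorm_inf_AE[OF \<Omega> _ f(1)] x]) (use f x in \<open>auto intro: continuous_on_norm\<close>)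

lemma
  fixes f :: "real ^ 'n::finite \<Rightarrow> 'b::euclidean_space"
  assumes \<Omega>: "open \<Omega>" "bounded \<Omega>" and f: "f \<in> borel_measurable (lebesgue_on \<Omega>)"
    and B: "\<And>x. x \<in> \<Omega> \<Longrightarrow> norm (f x) \<le> B" and B0: "B \<ge> 0" and p: "p > 0"
  shows in_L_bounded: "in_L (ereal p) \<Omega> f"
    and Lnorm_bounded: "Lnorm (ereal p) \<Omega> f \<le> B * measure lebesgue \<Omega> powr (1 / p)"
proof -
  let ?M = "lebesgue_on \<Omega>"
  have lm: "\<Omega> \<in> lmeasurable" by (rule lmeasurable_open[OF \<Omega>(2,1)])
  have ic: "integrable ?M (\<lambda>x. B powr p)"
    by (rule finite_measure.integrable_const[OF finite_measure_lebesgue_on[OF lm]])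
  have int: "integrable ?M (\<lambda>x. norm (f x) powr p)"
  proof (rule Bochner_Integration.integrable_bound[OF ic])
    show "AE x in ?M. norm (norm (f x) powr p) \<le> norm (B powr p)"
      using B p by (intro AE_I2) (auto simp: space_restrict_space intro!: powr_mono2)
  qed (use f in measurable)
  then show "in_L (ereal p) \<Omega> f" using f by (simp add: in_L_ereal)
  have "(\<integral>x. norm (f x) powr p \<partial>?M) \<le> (\<integral>x. B powr p \<partial>?M)"
    by (rule integral_mono[OF int ic]) (use B p in \<open>auto simp: space_restrict_space intro!: powr_mono2\<close>)
  also have "\<dots> = B powr p * measure lebesgue \<Omega>"
    using lm by (simp add: measure_restrict_space space_restrict_space)
  finally have "Lnorm (ereal p) \<Omega> f \<le> (B powr p * measure lebesgue \<Omega>) powr (1 / p)"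
    unfolding Lnorm_ereal using p by (intro powr_mono2) auto
  also have "\<dots> = B * measure lebesgue \<Omega> powr (1 / p)"
    using p B0 by (simp add: powr_mult powr_powr)
  finally show "Lnorm (ereal p) \<Omega> f \<le> B * measure lebesgue \<Omega> powr (1 / p)" .
qed

lemma Lnorm_eq_0_AE:
  fixes f :: "real ^ 'n::finite \<Rightarrow> 'b::euclidean_space"
  assumes p: "p > 0" and f: "in_L (ereal p) \<Omega> f" and 0: "Lnorm (ereal p) \<Omega> f = 0"
  shows "AE x in lebesgue_on \<Omega>. f x = 0"
proof -
  have "(\<integral>x. norm (f x) powr p \<partial>lebesgue_on \<Omega>) = 0"
    using Lnorm_ereal_powr[OF p, of \<Omega> f] 0 by simp
  then have "AE x in lebesgue_on \<Omega>. norm (f x) powr p = 0"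
    using f by (subst (asm) integral_nonneg_eq_0_iff_AE) (auto simp: in_L_ereal)
  then show ?thesis by eventually_elim simp
qed

text \<open>Comparison with a point outside, where test functions vanish, turns a bound on
  oscillation into a bound on values; D makes it uniform in x.\<close>

lemma exit_point:
  fixes \<Omega> :: "(real ^ 'n::finite) set"
  assumes "bounded \<Omega>"
  obtains D where "D > 0" "\<And>x. x \<in> closure \<Omega> \<Longrightarrow> \<exists>y. y \<notin> \<Omega> \<and> norm (x - y) \<le> D"
proof -
  obtain r where r: "r > 0" "\<And>x. x \<in> closure \<Omega> \<Longrightarrow> norm x \<le> r"
    using bounded_closure[OF assms] by (auto simp: bounded_pos)
  show thesis
  proof (rule that[of "3 * r"])
    fix x assume x: "x \<in> closure \<Omega>"
    let ?e = "axis undefined 1 :: real ^ 'n"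
    have n: "norm ((3 * r) *\<^sub>R ?e) = 3 * r" using r(1) by simp
    have "norm (x + (3 * r) *\<^sub>R ?e) \<ge> 3 * r - norm x"
      using norm_triangle_ineq4[of "x + (3 * r) *\<^sub>R ?e" x] n by simp
    then have "norm (x + (3 * r) *\<^sub>R ?e) > r" using r(2)[OF x] r(1) by simp
    then have "x + (3 * r) *\<^sub>R ?e \<notin> \<Omega>" using r(2) closure_subset[of \<Omega>] by force
    moreover have "norm (x - (x + (3 * r) *\<^sub>R ?e)) \<le> 3 * r" using n by simp
    ultimately show "\<exists>y. y \<notin> \<Omega> \<and> norm (x - y) \<le> 3 * r" by blast
  qed (use r in auto)
qed

lemma test_function_zero_outside: "test_function \<Omega> \<phi> \<Longrightarrow> x \<notin> \<Omega> \<Longrightarrow> \<phi> x = 0"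
  using closure_subset[of "{x. \<phi> x \<noteq> 0}"] by (auto simp: test_function_def)

lemma test_function_diff:
  assumes "test_function \<Omega> \<phi>" "test_function \<Omega> \<psi>"
  shows "test_function \<Omega> (\<lambda>x. \<phi> x - \<psi> x)"
proof -
  obtain K where K: "compact K" "K \<subseteq> \<Omega>" "\<And>x. x \<notin> K \<Longrightarrow> \<phi> x = 0" "\<And>x. x \<notin> K \<Longrightarrow> grad \<phi> x = 0"
    using test_function_props[OF assms(1)] by blast
  obtain L where L: "compact L" "L \<subseteq> \<Omega>" "\<And>x. x \<notin> L \<Longrightarrow> \<psi> x = 0" "\<And>x. x \<notin> L \<Longrightarrow> grad \<psi> x = 0"
    using test_function_props[OF assms(2)] by blast
  show ?thesis
    by (rule test_functionI[where K="K \<union> L"])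
       (use K(1,2,3) L(1,2,3) in \<open>auto intro!: smooth_on_diff test_function_smooth[OF assms(1)] test_function_smooth[OF assms(2)]\<close>)
qed

lemma test_function_cmult:
  assumes "test_function \<Omega> \<phi>"
  shows "test_function \<Omega> (\<lambda>x. c * \<phi> x)"
proof -
  obtain K where K: "compact K" "K \<subseteq> \<Omega>" "\<And>x. x \<notin> K \<Longrightarrow> \<phi> x = 0" "\<And>x. x \<notin> K \<Longrightarrow> grad \<phi> x = 0"
    using test_function_props[OF assms(1)] by blast
  show ?thesis
    by (rule test_functionI[where K=K])
       (use K(1,2,3) in \<open>auto intro!: smooth_on_mult test_function_smooth[OF assms]\<close>)
qed

lemma grad_diff:
  assumes "f differentiable (at x)" "g differentiable (at x)"
  shows "grad (\<lambda>x. f x - g x) x = grad f x - grad g x"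
  by (rule grad_eqI) (use has_derivative_diff[OF has_derivative_grad[OF assms(1)] has_derivative_grad[OF assms(2)]]
      in \<open>simp add: inner_diff_left\<close>)

lemma grad_cmult:
  assumes "f differentiable (at x)"
  shows "grad (\<lambda>x. c * f x) x = c *\<^sub>R grad f x"
  by (rule grad_eqI) (use has_derivative_mult_right[OF has_derivative_grad[OF assms(1)], of c] in simp)

lemma test_function_differentiable: "test_function \<Omega> \<phi> \<Longrightarrow> \<phi> differentiable (at x)"
  by (rule smooth_on_differentiable[OF test_function_smooth UNIV_I])

definition morrey_const :: "real \<Rightarrow> real \<Rightarrow> real" where
  "morrey_const N p = 1 + 2 * N / (1 - N / p)"

lemma morrey_const_nonneg: "p > N \<Longrightarrow> N \<ge> 0 \<Longrightarrow> morrey_const N p \<ge> 0"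
  using divide_less_eq_1_pos[of p N] by (simp add: morrey_const_def)

context
  fixes \<Omega> :: "(real ^ 'n::finite) set"
  assumes \<Omega>: "open \<Omega>" "bounded \<Omega>" "\<Omega> \<noteq> {}"
begin

lemma test_function_W1_0:
  assumes \<phi>: "test_function \<Omega> \<phi>" and p: "p \<ge> 1"
  shows "\<phi> \<in> W1_0 (ereal p) \<Omega>"
    and "Lnorm (ereal p) \<Omega> (weak_grad \<Omega> \<phi>) = Lnorm (ereal p) \<Omega> (grad \<phi>)"
proof -
  have p0: "p > 0" using p by simp
  have wg: "has_weak_grad \<Omega> \<phi> (grad \<phi>)" by (rule test_function_has_weak_grad[OF \<Omega>(1) \<phi>])
  have inL: "in_L (ereal p) \<Omega> (grad \<phi>)" "in_L (ereal p) \<Omega> \<phi>"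
    by (rule test_grad_integrable(3)[OF \<Omega>(1) \<phi> p0] test_grad_integrable(4)[OF \<Omega>(1) \<phi> p0])+
  show "Lnorm (ereal p) \<Omega> (weak_grad \<Omega> \<phi>) = Lnorm (ereal p) \<Omega> (grad \<phi>)"
    using Lnorm_weak_grad[OF \<Omega>(1) wg] inL(1) by (simp add: in_L_ereal)
  have "has_weak_grad \<Omega> (\<lambda>x. \<phi> x - \<phi> x) (\<lambda>x. grad \<phi> x - grad \<phi> x)"
    by (rule has_weak_grad_diff_test[OF \<Omega>(1) wg \<phi>])
  then have "Lnorm (ereal p) \<Omega> (weak_grad \<Omega> (\<lambda>x. \<phi> x - \<phi> x)) = Lnorm (ereal p) \<Omega> (\<lambda>x. grad \<phi> x - grad \<phi> x)"
    by (rule Lnorm_weak_grad[OF \<Omega>(1)]) simp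
  then have 0: "W1_norm (ereal p) \<Omega> (\<lambda>x. \<phi> x - \<phi> x) = 0"
    by (simp add: W1_norm_def Lnorm_ereal)
  have "\<phi> \<in> W1 (ereal p) \<Omega>"
    unfolding W1_def using inL wg by blast
  moreover have "(\<lambda>k::nat. W1_norm (ereal p) \<Omega> (\<lambda>x. \<phi> x - \<phi> x)) \<longlonglongrightarrow> 0"
    unfolding 0 by simp
  ultimately show "\<phi> \<in> W1_0 (ereal p) \<Omega>"
    unfolding W1_0_def using \<phi> by (intro CollectI conjI exI[of _ "\<lambda>k. \<phi>"]) auto
qed

text \<open>Homogeneity removes the normalisation: w divided by its q-norm is admissible. The
  minimality of extremals is exploited only in the form of this inequality.\<close>

lemma sobolev_lambda_le:
  assumes w: "test_function \<Omega> w" and p: "p \<ge> 1" and q: "q \<ge> 1" and pos: "Lnorm (ereal q) \<Omega> w > 0"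
  shows "0 \<le> sobolev_lambda \<Omega> p q"
    and "sobolev_lambda \<Omega> p q powr (1 / p) * Lnorm (ereal q) \<Omega> w \<le> Lnorm (ereal p) \<Omega> (grad w)"
proof -
  let ?S = "{Lnorm (ereal p) \<Omega> (weak_grad \<Omega> u) powr p | u.
            u \<in> W1_0 (ereal p) \<Omega> \<and> Lnorm (ereal q) \<Omega> u = 1}"
  define c where "c = Lnorm (ereal q) \<Omega> w"
  have c: "c > 0" using pos by (simp add: c_def)
  define v where "v = (\<lambda>x. (1 / c) * w x)"
  have v: "test_function \<Omega> v" unfolding v_def by (rule test_function_cmult[OF w])
  have "grad v = (\<lambda>x. (1 / c) *\<^sub>R grad w x)"
    unfolding v_def using grad_cmult[OF test_function_differentiable[OF w]] by blast
  then have gv: "Lnorm (ereal p) \<Omega> (grad v) = Lnorm (ereal p) \<Omega> (grad w) / c"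
    using Lnorm_scaleR[OF p, of \<Omega> "1 / c" "grad w"] c by simp
  have "Lnorm (ereal q) \<Omega> v = 1"
    using Lnorm_scaleR[OF q, of \<Omega> "1 / c" w] c by (simp add: v_def c_def)
  then have mem: "(Lnorm (ereal p) \<Omega> (grad w) / c) powr p \<in> ?S"
    using test_function_W1_0[OF v p] gv by (intro CollectI exI[of _ v]) auto
  have bdd: "bdd_below ?S" by (rule bdd_belowI[of _ 0]) auto
  show l0: "0 \<le> sobolev_lambda \<Omega> p q"
    unfolding sobolev_lambda_def using mem by (intro cInf_greatest) auto
  have "sobolev_lambda \<Omega> p q \<le> (Lnorm (ereal p) \<Omega> (grad w) / c) powr p"
    unfolding sobolev_lambda_def by (rule cInf_lower[OF mem bdd])
  then have "sobolev_lambda \<Omega> p q powr (1 / p) \<le> ((Lnorm (ereal p) \<Omega> (grad w) / c) powr p) powr (1 / p)"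
    using l0 p by (intro powr_mono2) auto
  also have "\<dots> = Lnorm (ereal p) \<Omega> (grad w) / c"
    using p c Lnorm_ereal_nonneg[of p \<Omega> "grad w"] by (simp add: powr_powr)
  finally show "sobolev_lambda \<Omega> p q powr (1 / p) * Lnorm (ereal q) \<Omega> w \<le> Lnorm (ereal p) \<Omega> (grad w)"
    using c by (simp add: field_simps flip: c_def)
qed

text \<open>Morrey's estimate for the differences of approximating test functions turns convergence
  in the Sobolev norm into uniform convergence. The uniform limit v agrees with u almost everywhere,
  hence on the whole closure, as both are continuous there.\<close>

lemma W1_0_approx:
  assumes p: "p > real CARD('n)" and u: "u \<in> W1_0 (ereal p) \<Omega>" and cont: "continuous_on (closure \<Omega>) u"
  obtains \<phi> where "\<And>k::nat. test_function \<Omega> (\<phi> k)" "uniform_limit (closure \<Omega>) \<phi> u sequentially"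
    "(\<lambda>k. Lnorm (ereal p) \<Omega> (grad (\<phi> k))) \<longlonglongrightarrow> Lnorm (ereal p) \<Omega> (weak_grad \<Omega> u)"
proof -
  let ?L = "Lnorm (ereal p) \<Omega>"
  have N: "real CARD('n) \<ge> 1"
    using zero_less_card_finite[where 'a='n] by (metis One_nat_def Suc_leI of_nat_1 of_nat_le_iff)
  have p1: "p \<ge> 1" and p0: "p > 0" using p N by linarith+
  obtain \<phi> where \<phi>: "\<And>k::nat. test_function \<Omega> (\<phi> k)"
    and lim: "(\<lambda>k. W1_norm (ereal p) \<Omega> (\<lambda>x. u x - \<phi> k x)) \<longlonglongrightarrow> 0"
    using u unfolding W1_0_def by blast
  obtain g where uL: "in_L (ereal p) \<Omega> u" and g: "has_weak_grad \<Omega> u g" "in_L (ereal p) \<Omega> g"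
    using u unfolding W1_0_def W1_def by blast
  let ?G = "weak_grad \<Omega> u"
  have G: "has_weak_grad \<Omega> u ?G" by (rule has_weak_grad_weak_grad[OF g(1)])
  have gm: "g \<in> borel_measurable (lebesgue_on \<Omega>)" using g(2) by (simp add: in_L_ereal)
  have GL: "in_L (ereal p) \<Omega> ?G"
    using in_L_weak_grad[OF \<Omega>(1) g(1) gm] g(2) by simp
  have \<phi>L: "in_L (ereal p) \<Omega> (\<phi> k)" "in_L (ereal p) \<Omega> (grad (\<phi> k))" for k
    by (rule test_grad_integrable(4)[OF \<Omega>(1) \<phi> p0] test_grad_integrable(3)[OF \<Omega>(1) \<phi> p0])+
  define d where "d = (\<lambda>k. ?L (\<lambda>x. ?G x - grad (\<phi> k) x))"
  define e where "e = (\<lambda>k. ?L (\<lambda>x. u x - \<phi> k x))"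
  have d0: "d k \<ge> 0" and e0: "e k \<ge> 0" for k by (simp_all add: d_def e_def Lnorm_ereal_nonneg)
  have W: "W1_norm (ereal p) \<Omega> (\<lambda>x. u x - \<phi> k x) = e k + d k" for k
  proof -
    have "?L (weak_grad \<Omega> (\<lambda>x. u x - \<phi> k x)) = d k"
      unfolding d_def
      using in_L_diff[OF p1 GL \<phi>L(2)]
      by (intro Lnorm_weak_grad[OF \<Omega>(1) has_weak_grad_diff_test[OF \<Omega>(1) G \<phi>]]) (simp add: in_L_ereal)
    then show ?thesis by (simp add: W1_norm_def e_def)
  qed
  have lim': "(\<lambda>k. e k + d k) \<longlonglongrightarrow> 0" using lim by (simp add: W)
  have dlim: "d \<longlonglongrightarrow> 0"
    by (rule tendsto_sandwich[OF _ _ tendsto_const lim']) (use d0 e0 in auto)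
  have elim: "e \<longlonglongrightarrow> 0"
    by (rule tendsto_sandwich[OF _ _ tendsto_const lim']) (use d0 e0 in auto)
  have "(\<lambda>k. ?L (grad (\<phi> k)) - ?L ?G) \<longlonglongrightarrow> 0"
  proof (rule Lim_null_comparison[OF _ dlim])
    show "\<forall>\<^sub>F k in sequentially. norm (?L (grad (\<phi> k)) - ?L ?G) \<le> d k"
      using Lnorm_diff_ge[OF p1 GL \<phi>L(2)] by (auto simp: d_def abs_minus_commute)
  qed
  then have normlim: "(\<lambda>k. ?L (grad (\<phi> k))) \<longlonglongrightarrow> ?L ?G"
    by (simp add: LIM_zero_iff)
  obtain D where D: "D > 0" "\<And>x. x \<in> closure \<Omega> \<Longrightarrow> \<exists>y. y \<notin> \<Omega> \<and> norm (x - y) \<le> D"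
    using exit_point[OF \<Omega>(2)] by blast
  define a where "a = 1 - real CARD('n) / p"
  have a: "a > 0" using p p0 by (simp add: a_def field_simps)
  define C where "C = morrey_const (real CARD('n)) p * D powr a"
  have mc: "morrey_const (real CARD('n)) p \<ge> 0" by (rule morrey_const_nonneg[OF p]) simp
  have C: "C \<ge> 0" using mc by (simp add: C_def)
  have diff_le: "\<bar>\<phi> k x - \<phi> l x\<bar> \<le> C * (d k + d l)" if x: "x \<in> closure \<Omega>" for k l x
  proof -
    let ?\<psi> = "\<lambda>x. \<phi> k x - \<phi> l x"
    have t: "test_function \<Omega> ?\<psi>" by (rule test_function_diff[OF \<phi> \<phi>])
    have gd: "grad ?\<psi> = (\<lambda>x. grad (\<phi> k) x - grad (\<phi> l) x)"
      using grad_diff[OF test_function_differentiable[OF \<phi>] test_function_differentiable[OF \<phi>]] by blast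
    have "grad ?\<psi> = (\<lambda>x. (?G x - grad (\<phi> l) x) - (?G x - grad (\<phi> k) x))"
      unfolding gd by simp
    then have gn: "?L (grad ?\<psi>) \<le> d l + d k"
      using Lnorm_diff_le[OF p1 in_L_diff[OF p1 GL \<phi>L(2)[of l]] in_L_diff[OF p1 GL \<phi>L(2)[of k]]]
      by (simp add: d_def)
    obtain y where y: "y \<notin> \<Omega>" "norm (x - y) \<le> D" using D(2)[OF x] by blast
    have "\<bar>?\<psi> x - ?\<psi> y\<bar> \<le> morrey_const (real CARD('n)) p * (d l + d k) * norm (x - y) powr a"
      using morrey_test[OF \<Omega>(1) t p1 gn p, of x y] by (simp add: morrey_const_def a_def)
    also have "\<dots> \<le> morrey_const (real CARD('n)) p * (d l + d k) * D powr a"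
      using mc d0 y(2) a by (intro mult_left_mono powr_mono2) auto
    finally show ?thesis
      using test_function_zero_outside[OF t y(1)] by (simp add: C_def algebra_simps)
  qed
  have "uniformly_Cauchy_on (closure \<Omega>) \<phi>"
    unfolding uniformly_Cauchy_on_def
  proof (intro allI impI)
    fix \<epsilon> :: real assume \<epsilon>: "\<epsilon> > 0"
    define \<delta> where "\<delta> = \<epsilon> / (2 * (C + 1))"
    have \<delta>: "\<delta> > 0" using \<epsilon> C by (simp add: \<delta>_def)
    have "\<forall>\<^sub>F k in sequentially. d k < \<delta>" by (rule order_tendstoD(2)[OF dlim \<delta>])
    then obtain M where M: "\<And>k. k \<ge> M \<Longrightarrow> d k < \<delta>" by (auto simp: eventually_sequentially)
    show "\<exists>M. \<forall>x\<in>closure \<Omega>. \<forall>m\<ge>M. \<forall>n\<ge>M. dist (\<phi> m x) (\<phi> n x) < \<epsilon>"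
    proof (intro exI[of _ M] ballI allI impI)
      fix x m n assume x: "x \<in> closure \<Omega>" and mn: "M \<le> m" "M \<le> n"
      have "\<bar>\<phi> m x - \<phi> n x\<bar> \<le> C * (\<delta> + \<delta>)"
        using diff_le[OF x, of m n] M[OF mn(1)] M[OF mn(2)] C
        by (intro order_trans[OF diff_le[OF x]] mult_left_mono) auto
      also have "\<dots> < (C + 1) * (\<delta> + \<delta>)" using \<delta> by simp
      also have "\<dots> = \<epsilon>"
      proof -
        have "2 * (C + 1) \<noteq> 0" using C by simp
        then have "2 * (C + 1) * \<delta> = \<epsilon>" by (simp add: \<delta>_def)
        then show ?thesis by (simp add: algebra_simps)
      qed
      finally show "dist (\<phi> m x) (\<phi> n x) < \<epsilon>" by (simp add: dist_real_def)
    qed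
  qed
  then obtain v where v: "uniform_limit (closure \<Omega>) \<phi> v sequentially"
    using Cauchy_uniformly_convergent unfolding uniformly_convergent_on_def by blast
  have vc: "continuous_on (closure \<Omega>) v"
    by (rule uniform_limit_theorem[OF _ v]) (simp_all add: test_function_continuous[OF \<phi>])
  have cl: "\<Omega> \<subseteq> closure \<Omega>" by (rule closure_subset)
  have vm: "v \<in> borel_measurable (lebesgue_on \<Omega>)"
    by (rule measurable_lebesgue_on_continuous[OF \<Omega>(1) continuous_on_subset[OF vc cl]])
  have "bounded (v ` closure \<Omega>)"
    using compact_continuous_image[OF vc] \<Omega>(2) by (simp add: compact_imp_bounded)
  then obtain B where B: "B > 0" "\<And>x. x \<in> closure \<Omega> \<Longrightarrow> norm (v x) \<le> B"
    by (auto simp: bounded_pos)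
  have vL: "in_L (ereal p) \<Omega> v"
    by (rule in_L_bounded[OF \<Omega>(1,2) vm _ less_imp_le[OF B(1)] p0]) (use B cl in auto)
  let ?m = "measure lebesgue \<Omega> powr (1 / p)"
  \<comment> \<open>The approximants converge to u in the p-norm and uniformly to v, so on the
    bounded set \<Omega> they converge to v in the p-norm as well.\<close>
  have "?L (\<lambda>x. u x - v x) \<le> 0"
  proof (rule field_le_epsilon)
    fix \<epsilon> :: real assume \<epsilon>: "\<epsilon> > 0"
    define \<delta> where "\<delta> = \<epsilon> / (2 * (?m + 1))"
    have m0: "?m \<ge> 0" by simp
    have \<delta>: "\<delta> > 0" using \<epsilon> m0 by (simp add: \<delta>_def add_nonneg_pos)
    have "\<forall>\<^sub>F k in sequentially. \<forall>x\<in>closure \<Omega>. dist (\<phi> k x) (v x) < \<delta>"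
      using uniform_limitD[OF v \<delta>] .
    moreover have "\<forall>\<^sub>F k in sequentially. e k < \<epsilon> / 2"
      by (rule order_tendstoD(2)[OF elim]) (use \<epsilon> in simp)
    ultimately have "\<forall>\<^sub>F k in sequentially. (\<forall>x\<in>closure \<Omega>. dist (\<phi> k x) (v x) < \<delta>) \<and> e k < \<epsilon> / 2"
      by (rule eventually_conj)
    then obtain k where k0: "(\<forall>x\<in>closure \<Omega>. dist (\<phi> k x) (v x) < \<delta>) \<and> e k < \<epsilon> / 2"
      using eventually_happens'[OF sequentially_bot] by fast
    then have k: "\<And>x. x \<in> closure \<Omega> \<Longrightarrow> dist (\<phi> k x) (v x) < \<delta>" "e k < \<epsilon> / 2" by auto
    have "?L (\<lambda>x. u x - v x) = ?L (\<lambda>x. (u x - \<phi> k x) + (\<phi> k x - v x))" by simp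
    also have "\<dots> \<le> e k + ?L (\<lambda>x. \<phi> k x - v x)"
      unfolding e_def by (rule Lnorm_triangle[OF p1 in_L_diff[OF p1 uL \<phi>L(1)] in_L_diff[OF p1 \<phi>L(1) vL]])
    also have "?L (\<lambda>x. \<phi> k x - v x) \<le> \<delta> * ?m"
    proof (rule Lnorm_bounded[OF \<Omega>(1,2) _ _ less_imp_le[OF \<delta>] p0])
      show "(\<lambda>x. \<phi> k x - v x) \<in> borel_measurable (lebesgue_on \<Omega>)"
        using in_L_diff[OF p1 \<phi>L(1) vL] by (simp add: in_L_ereal)
      show "norm (\<phi> k x - v x) \<le> \<delta>" if "x \<in> \<Omega>" for x
        using k(1)[of x] that cl by (auto simp: dist_norm)
    qed
    also have "\<delta> * ?m \<le> \<delta> * (?m + 1)" using \<delta> by simp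
    also have "\<dots> = \<epsilon> / 2"
    proof -
      have "2 * (?m + 1) \<noteq> 0" using add_nonneg_pos[OF m0 zero_less_one] by simp
      then have "2 * (?m + 1) * \<delta> = \<epsilon>" by (simp add: \<delta>_def)
      then show ?thesis by (simp add: algebra_simps)
    qed
    finally show "?L (\<lambda>x. u x - v x) \<le> 0 + \<epsilon>" using k(2) by simp
  qed
  then have "?L (\<lambda>x. u x - v x) = 0" using Lnorm_ereal_nonneg antisym by blast
  then have ae: "AE x in lebesgue_on \<Omega>. u x - v x = 0"
    by (rule Lnorm_eq_0_AE[OF p0 in_L_diff[OF p1 uL vL]])
  have c: "continuous_on (closure \<Omega>) (\<lambda>x. u x - v x)"
    by (intro continuous_on_diff cont vc)
  have "\<bar>u x - v x\<bar> \<le> 0" if "x \<in> \<Omega>" for x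
  proof (rule AE_continuous_le[OF \<Omega>(1) _ _ that])
    show "continuous_on \<Omega> (\<lambda>x. \<bar>u x - v x\<bar>)"
      using continuous_on_norm[OF continuous_on_subset[OF c cl]] by simp
    show "AE x in lebesgue_on \<Omega>. \<bar>u x - v x\<bar> \<le> 0" using ae by eventually_elim simp
  qed
  then have "u x - v x = 0" if "x \<in> closure \<Omega>" for x
    using continuous_constant_on_closure[OF c _ that, of 0] by simp
  then have "uniform_limit (closure \<Omega>) \<phi> u sequentially"
    using v by (subst uniform_limit_cong'[where g=\<phi> and i=v]) auto
  then show thesis using that \<phi> normlim by blast
qed

end

section \<open>Cones and mollification\<close>

lemma smooth_on_norm_sq: "smooth_on UNIV (\<lambda>x :: real ^ 'n::finite. (x - a) \<bullet> (x - a))"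
  unfolding inner_vec_def vector_minus_component inner_real_def
  by (intro smooth_on_sum smooth_on_mult smooth_on_diff smooth_on_linear smooth_on_const bounded_linear_vec_nth) auto

lemma has_derivative_norm_sq: "((\<lambda>x. (x - a) \<bullet> (x - a)) has_derivative (\<lambda>v. (2 *\<^sub>R (x - a)) \<bullet> v)) (at x)"
  by (auto intro!: derivative_eq_intros simp: inner_commute)

text \<open>A cone of height R with rounded tip, R - sqrt(\<delta>^2 + |x - x0|^2), cut off smoothly
  by \<open>softplus\<close>. It vanishes already where |x - x0|^2 >= R^2 - \<delta>^2, so its
  support is a compact part of the open ball. Rounding and cutting off cost \<delta> each in height
  and keep the slope at most 1.\<close>

lemma near_cone_test_function:
  fixes x0 :: "real ^ 'n::finite"
  assumes \<delta>: "0 < \<delta>" "\<delta> < R" and ball: "ball x0 R \<subseteq> \<Omega>"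
  obtains \<phi> where "test_function \<Omega> \<phi>" "\<And>x. norm (grad \<phi> x) \<le> 1" "\<phi> x0 \<ge> R - 2 * \<delta>" "\<And>x. \<phi> x \<ge> 0"
proof -
  define s where "s = (\<lambda>x. \<delta>\<^sup>2 + (x - x0) \<bullet> (x - x0))"
  have s_pos: "s x > 0" for x using \<delta> by (simp add: s_def add_pos_nonneg)
  have sqrt_s: "s x powr (1/2) = sqrt (s x)" for x using s_pos[of x] by (simp add: powr_half_sqrt)
  have s_smooth: "smooth_on UNIV s" unfolding s_def by (intro smooth_on_add smooth_on_const smooth_on_norm_sq) auto
  define \<phi> where "\<phi> = (\<lambda>x. softplus \<delta> (R - s x powr (1/2)))"
  have sm: "smooth_on UNIV \<phi>"
    unfolding \<phi>_def by (intro smooth_on_softplus smooth_on_diff smooth_on_const smooth_on_powr s_smooth \<delta>(1) s_pos) auto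
  define \<rho> where "\<rho> = sqrt (R\<^sup>2 - \<delta>\<^sup>2)"
  have \<rho>: "0 \<le> \<rho>" "\<rho> < R"
  proof -
    have "\<delta>\<^sup>2 < R\<^sup>2" using \<delta> by (simp add: power_strict_mono)
    then show "0 \<le> \<rho>" by (simp add: \<rho>_def)
    have "\<rho> < sqrt (R\<^sup>2)" unfolding \<rho>_def using \<delta> by (intro real_sqrt_less_mono) simp
    then show "\<rho> < R" using \<delta> by simp
  qed
  have test: "test_function \<Omega> \<phi>"
  proof (rule test_functionI[OF sm, where K="cball x0 \<rho>"])
    show "cball x0 \<rho> \<subseteq> \<Omega>" using ball \<rho> by auto
    fix x assume "x \<notin> cball x0 \<rho>"
    then have "\<rho> < norm (x - x0)" by (simp add: dist_norm norm_minus_commute)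
    then have "\<rho>\<^sup>2 < (norm (x - x0))\<^sup>2" using \<rho> by (intro power_strict_mono) auto
    moreover have "\<rho>\<^sup>2 = R\<^sup>2 - \<delta>\<^sup>2"
      unfolding \<rho>_def using \<delta> by (intro real_sqrt_pow2) (simp add: power_mono)
    ultimately have "R\<^sup>2 \<le> s x" by (simp add: s_def power2_norm_eq_inner)
    then have "R \<le> sqrt (s x)" by (rule real_le_rsqrt)
    then show "\<phi> x = 0" by (simp add: \<phi>_def sqrt_s)
  qed simp
  have grad: "norm (grad \<phi> x) \<le> 1" for x
  proof -
    have "(s has_derivative (\<lambda>v. (2 *\<^sub>R (x - x0)) \<bullet> v)) (at x)"
      unfolding s_def using has_derivative_add[OF has_derivative_const[of "\<delta>\<^sup>2"] has_derivative_norm_sq[of x0 x]] by simp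
    moreover have "((\<lambda>t. R - t powr (1/2)) has_real_derivative - (1/2) * s x powr (-1/2)) (at (s x))"
      using s_pos[of x] by (auto intro!: derivative_eq_intros)
    ultimately have "((\<lambda>x. R - s x powr (1/2)) has_derivative (\<lambda>v. ((2 *\<^sub>R (x - x0)) \<bullet> v) * (- (1/2) * s x powr (-1/2)))) (at x)"
      using DERIV_compose_FDERIV by blast
    from DERIV_compose_FDERIV[OF softplus_DERIV[OF \<delta>(1)] this]
    have "(\<phi> has_derivative (\<lambda>v. ((2 *\<^sub>R (x - x0)) \<bullet> v) * (- (1/2) * s x powr (-1/2)) * softplus' \<delta> (R - s x powr (1/2)))) (at x)"
      unfolding \<phi>_def .
    moreover have "(\<lambda>v. ((2 *\<^sub>R (x - x0)) \<bullet> v) * (- (1/2) * s x powr (-1/2)) * softplus' \<delta> (R - s x powr (1/2))) =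
       (\<lambda>v. (- (s x powr (-1/2) * softplus' \<delta> (R - s x powr (1/2)))) *\<^sub>R (x - x0) \<bullet> v)"
      by (auto simp: algebra_simps)
    ultimately have "grad \<phi> x = (- (s x powr (-1/2) * softplus' \<delta> (R - s x powr (1/2)))) *\<^sub>R (x - x0)"
      by (intro grad_eqI) simp
    then have "norm (grad \<phi> x) = softplus' \<delta> (R - s x powr (1/2)) * (s x powr (-1/2) * norm (x - x0))"
      using softplus'_nonneg[OF \<delta>(1)] by (simp add: abs_mult)
    also have "\<dots> \<le> 1 * 1"
    proof (intro mult_mono softplus'_le_1 \<delta>(1))
      have "norm (x - x0) \<le> sqrt (s x)"
        by (rule real_le_rsqrt) (simp add: s_def power2_norm_eq_inner)
      then have le: "norm (x - x0) / sqrt (s x) \<le> 1" using s_pos[of x] by simp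
      have "s x powr (-1/2) = inverse (sqrt (s x))"
        using powr_minus[of "s x" "1/2"] by (simp only: sqrt_s minus_divide_left)
      then have "s x powr (-1/2) * norm (x - x0) = norm (x - x0) / sqrt (s x)"
        by (simp only: divide_inverse mult.commute)
      then show "s x powr (-1/2) * norm (x - x0) \<le> 1" using le by (simp only:)
    qed auto
    finally show ?thesis by simp
  qed
  have "s x0 powr (1/2) = \<delta>" using \<delta> by (simp add: sqrt_s) (simp add: s_def)
  then have "\<phi> x0 \<ge> R - 2 * \<delta>"
    using softplus_ge[OF \<delta>(1), of "R - \<delta>"] by (simp add: \<phi>_def)
  then show thesis using that[OF test grad] softplus_nonneg by (simp add: \<phi>_def)
qed

section \<open>Mollification\<close>

lemma has_derivative_translate:
  assumes "(f has_derivative f') (at (z - a))"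
  shows "((\<lambda>z. f (z - a)) has_derivative f') (at z)"
proof -
  have "((\<lambda>z. z - a) has_derivative (\<lambda>v. v)) (at z)" by (auto intro!: derivative_eq_intros)
  from has_derivative_compose[OF this assms] show ?thesis .
qed

lemma grad_translate:
  assumes "f differentiable (at (z - a))"
  shows "grad (\<lambda>z. f (z - a)) z = grad f (z - a)"
  by (rule grad_eqI[OF has_derivative_translate[OF has_derivative_grad[OF assms]]])

lemma Ck_on_translate:
  "Ck_on k UNIV f \<Longrightarrow> Ck_on k UNIV (\<lambda>z. f (z - a))"
proof (induction k arbitrary: f)
  case 0
  then show ?case
    by (auto intro!: continuous_on_compose2[of UNIV f] continuous_intros)
next
  case (Suc k)
  have d: "f differentiable (at z)" for z using Suc.prems by simp
  have "partial i (\<lambda>z. f (z - a)) = (\<lambda>z. partial i f (z - a))" for i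
    by (simp add: fun_eq_iff partial_eq_grad grad_translate[OF d])
  moreover have "(\<lambda>z. f (z - a)) differentiable (at z)" for z
    using has_derivative_translate[OF has_derivative_grad[OF d]] differentiableI by blast
  ultimately show ?case using Suc by simp
qed

lemma smooth_on_translate: "smooth_on UNIV f \<Longrightarrow> smooth_on UNIV (\<lambda>z. f (z - a))"
  by (simp add: smooth_on_def Ck_on_translate)

definition mollifier :: "real \<Rightarrow> (real ^ 'n::finite \<Rightarrow> real) \<Rightarrow> bool" where
  "mollifier \<epsilon> \<eta> \<longleftrightarrow> smooth_on UNIV \<eta> \<and> (\<forall>z. \<eta> z \<ge> 0) \<and> (\<forall>z. z \<notin> cball 0 \<epsilon> \<longrightarrow> \<eta> z = 0) \<and> integral\<^sup>L lborel \<eta> = 1"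

lemma mollifier_exists:
  assumes "\<epsilon> > 0"
  obtains \<eta> :: "real ^ 'n::finite \<Rightarrow> real" where "mollifier \<epsilon> \<eta>"
proof -
  define b where "b = (\<lambda>z :: real ^ 'n. softplus 1 (\<epsilon>\<^sup>2 - (z - 0) \<bullet> (z - 0)))"
  have sm: "smooth_on UNIV b"
    unfolding b_def by (intro smooth_on_softplus smooth_on_diff smooth_on_const smooth_on_norm_sq) auto
  have nn: "b z \<ge> 0" for z by (simp add: b_def softplus_nonneg)
  have zero: "b z = 0" if "z \<notin> cball 0 \<epsilon>" for z
  proof -
    have "\<epsilon>\<^sup>2 \<le> (norm z)\<^sup>2" using that assms by (intro power_mono) auto
    then show ?thesis by (simp add: b_def power2_norm_eq_inner)
  qed
  have cont: "continuous_on UNIV b" using sm by (rule smooth_on_continuous)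
  have int: "integrable lborel b"
    by (rule continuous_compact_support_integrable[OF cont compact_cball zero])
  have b0: "b 0 > 0" using assms by (simp add: b_def softplus_pos)
  have "integral\<^sup>L lborel b \<noteq> 0"
  proof
    assume "integral\<^sup>L lborel b = 0"
    then have "AE z in lborel. b z = 0"
      using nn by (subst (asm) integral_nonneg_eq_0_iff_AE[OF int]) auto
    then have "AE z in lebesgue. b z = 0" by (rule AE_completion)
    then have ae: "AE z in lebesgue_on UNIV. b z \<le> 0"
      by (subst AE_restrict_space_iff) (auto elim: eventually_mono)
    then have "b 0 \<le> 0" by (rule AE_continuous_le[OF open_UNIV cont]) simp
    then show False using b0 by simp
  qed
  moreover have "integral\<^sup>L lborel b \<ge> 0" using nn by (intro integral_nonneg_AE) auto
  ultimately have I: "integral\<^sup>L lborel b > 0" by simp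
  show thesis
  proof (rule that[of "\<lambda>z. (1 / integral\<^sup>L lborel b) * b z"])
    show "mollifier \<epsilon> (\<lambda>z. (1 / integral\<^sup>L lborel b) * b z)"
      unfolding mollifier_def using sm nn zero I int by (auto intro!: smooth_on_mult[of UNIV "\<lambda>z. 1 / integral\<^sup>L lborel b" b, simplified])
  qed
qed

text \<open>The kernel is taken at z - x, so that as a function of z it can serve directly as a test
  function around x. After translation this is the average of u(x + z) with weight
  \<eta>(z).\<close>

definition mollify :: "(real ^ 'n::finite \<Rightarrow> real) \<Rightarrow> (real ^ 'n \<Rightarrow> real) \<Rightarrow> real ^ 'n \<Rightarrow> real" where
  "mollify \<eta> u x = (\<integral>z. u z * \<eta> (z - x) \<partial>lborel)"

text \<open>The minus sign comes from differentiating \<eta>(z - x) in x. All derivatives fall on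
  the kernel, so continuity of u suffices.\<close>

definition mollify_grad :: "(real ^ 'n::finite \<Rightarrow> real) \<Rightarrow> (real ^ 'n \<Rightarrow> real) \<Rightarrow> real ^ 'n \<Rightarrow> real ^ 'n" where
  "mollify_grad \<eta> u x = - (\<integral>z. u z *\<^sub>R grad \<eta> (z - x) \<partial>lborel)"

lemma integral_lborel_cbox:
  fixes f :: "real ^ 'n::finite \<Rightarrow> 'b::euclidean_space"
  assumes "continuous_on UNIV f" "\<And>x. x \<notin> cbox a b \<Longrightarrow> f x = 0"
  shows "integral\<^sup>L lborel f = integral (cbox a b) f"
proof -
  have i: "integrable lborel f"
    by (rule continuous_compact_support_integrable[OF assms(1) compact_cbox assms(2)])
  have "integral (cbox a b) f = integral UNIV f"
  proof (rule integral_spike_set)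
    show "negligible {x \<in> UNIV - cbox a b. f x \<noteq> 0}"
      by (rule negligible_subset[OF negligible_empty]) (use assms(2) in auto)
  qed auto
  then show ?thesis using integral_lborel[OF i] by simp
qed

context
  fixes u :: "real ^ 'n::finite \<Rightarrow> real" and \<eta> :: "real ^ 'n \<Rightarrow> real" and S and \<epsilon> :: real
  assumes u: "continuous_on UNIV u" and S: "compact S" "\<And>x. x \<notin> S \<Longrightarrow> u x = 0" and \<eta>: "mollifier \<epsilon> \<eta>"
begin

lemma continuous_mollifier: "continuous_on UNIV \<eta>"
  using \<eta> smooth_on_continuous by (auto simp: mollifier_def)

lemma continuous_grad_mollifier: "continuous_on UNIV (grad \<eta>)"
  using \<eta> smooth_on_continuous_grad by (auto simp: mollifier_def)

lemma
  shows mollify_has_derivative: "(mollify \<eta> u has_derivative (\<lambda>v. mollify_grad \<eta> u x \<bullet> v)) (at x)"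
    and continuous_mollify_grad: "continuous_on UNIV (mollify_grad \<eta> u)"
proof -
  obtain a b where ab: "S \<subseteq> cbox a b"
    using compact_imp_bounded[OF S(1)] bounded_subset_cbox_symmetric by metis
  have z: "u x = 0" if "x \<notin> cbox a b" for x using S(2) that ab by blast
  have c1: "continuous_on A (\<lambda>z. u z * \<eta> (z - x))" for x A
    by (intro continuous_on_mult continuous_on_compose2[OF continuous_mollifier] continuous_on_subset[OF u])
       (auto intro!: continuous_intros)
  have c2: "continuous_on A (\<lambda>z. u z *\<^sub>R grad \<eta> (z - x))" for x A
    by (intro continuous_on_scaleR continuous_on_compose2[OF continuous_grad_mollifier] continuous_on_subset[OF u])
       (auto intro!: continuous_intros)
  have m: "mollify \<eta> u = (\<lambda>x. integral (cbox a b) (\<lambda>z. u z * \<eta> (z - x)))"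
    unfolding mollify_def by (intro ext integral_lborel_cbox c1) (simp add: z)
  have mg: "mollify_grad \<eta> u = (\<lambda>x. - integral (cbox a b) (\<lambda>z. u z *\<^sub>R grad \<eta> (z - x)))"
    unfolding mollify_grad_def by (intro ext arg_cong[where f=uminus] integral_lborel_cbox c2) (simp add: z)
  have c3: "continuous_on (UNIV \<times> cbox a b) (\<lambda>(x, z). u z *\<^sub>R grad \<eta> (z - x))"
    unfolding case_prod_beta
    by (intro continuous_on_scaleR continuous_on_compose2[OF continuous_grad_mollifier] continuous_on_compose2[OF u])
       (auto intro!: continuous_intros)
  show "continuous_on UNIV (mollify_grad \<eta> u)"
    unfolding mg by (intro continuous_on_minus integral_continuous_on_param c3)
  let ?fx = "\<lambda>x z. blinfun_inner_right (- (u z *\<^sub>R grad \<eta> (z - x)))"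
  have "((\<lambda>x. integral (cbox a b) (\<lambda>z. u z * \<eta> (z - x))) has_derivative integral (cbox a b) (?fx x)) (at x within UNIV)"
  proof (rule leibniz_rule[where f="\<lambda>x z. u z * \<eta> (z - x)" and fx="?fx"])
    fix x z :: "real ^ 'n"
    have "((\<lambda>x. z - x) has_derivative (\<lambda>v. - v)) (at x)"
      by (auto intro!: derivative_eq_intros)
    moreover have "(\<eta> has_derivative (\<lambda>v. grad \<eta> (z - x) \<bullet> v)) (at (z - x))"
      using \<eta> by (intro smooth_on_has_derivative[of UNIV]) (auto simp: mollifier_def)
    ultimately have "((\<lambda>x. \<eta> (z - x)) has_derivative (\<lambda>v. grad \<eta> (z - x) \<bullet> (- v))) (at x)"
      by (rule has_derivative_compose)
    from has_derivative_mult_right[OF this, of "u z"]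
    moreover have "(\<lambda>v. u z * (grad \<eta> (z - x) \<bullet> (- v))) = blinfun_apply (?fx x z)"
      by (simp add: fun_eq_iff)
    ultimately show "((\<lambda>x. u z * \<eta> (z - x)) has_derivative blinfun_apply (?fx x z)) (at x within UNIV)"
      by simp
  next
    show "(\<lambda>z. u z * \<eta> (z - x)) integrable_on cbox a b" for x
      by (intro integrable_continuous c1)
    show "continuous_on (UNIV \<times> cbox a b) (\<lambda>(x, t). ?fx x t)"
      using bounded_linear.continuous_on[OF bounded_linear_blinfun_inner_right continuous_on_minus[OF c3]]
      by (simp add: case_prod_beta)
  qed auto
  moreover have "integral (cbox a b) (?fx x) = blinfun_inner_right (mollify_grad \<eta> u x)"
  proof -
    have i: "(\<lambda>z. - (u z *\<^sub>R grad \<eta> (z - x))) integrable_on cbox a b"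
      by (intro integrable_continuous continuous_on_minus c2)
    show ?thesis
      using integral_linear[OF i bounded_linear_blinfun_inner_right] by (simp add: o_def mg)
  qed
  ultimately show "(mollify \<eta> u has_derivative (\<lambda>v. mollify_grad \<eta> u x \<bullet> v)) (at x)"
    by (simp add: m)
qed

lemma mollify_translate: "mollify \<eta> u x = (\<integral>z. u (x + z) * \<eta> z \<partial>lborel)"
proof -
  have "mollify \<eta> u x = integral\<^sup>L (distr lborel borel ((+) x)) (\<lambda>z. u z * \<eta> (z - x))"
    by (simp add: mollify_def lborel_distr_plus)
  also have "\<dots> = (\<integral>z. u (x + z) * \<eta> z \<partial>lborel)"
  proof (subst integral_distr)
    show "(\<lambda>z. u z * \<eta> (z - x)) \<in> borel_measurable borel"
      by (intro borel_measurable_continuous_onI continuous_on_mult u continuous_on_compose2[OF continuous_mollifier])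
         (auto intro!: continuous_intros)
  qed auto
  finally show ?thesis .
qed

lemma mollify_integrable: "integrable lborel (\<lambda>z. u (x + z) * \<eta> z)" "integrable lborel \<eta>"
proof -
  have z: "\<eta> z = 0" if "z \<notin> cball 0 \<epsilon>" for z using \<eta> that by (simp add: mollifier_def)
  show "integrable lborel (\<lambda>z. u (x + z) * \<eta> z)"
    by (rule continuous_compact_support_integrable[OF _ compact_cball[of 0 \<epsilon>]])
       (use z in \<open>auto intro!: continuous_on_mult continuous_mollifier continuous_on_compose2[OF u] continuous_intros\<close>)
  show "integrable lborel \<eta>"
    by (rule continuous_compact_support_integrable[OF continuous_mollifier compact_cball[of 0 \<epsilon>] z])
qed

lemma mollify_close:
  assumes "\<And>z. norm z \<le> \<epsilon> \<Longrightarrow> \<bar>u (x + z) - c\<bar> \<le> e"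
  shows "\<bar>mollify \<eta> u x - c\<bar> \<le> e"
proof -
  have nn: "\<eta> z \<ge> 0" for z using \<eta> by (simp add: mollifier_def)
  have z: "\<eta> z = 0" if "norm z > \<epsilon>" for z using \<eta> that by (simp add: mollifier_def)
  have "mollify \<eta> u x - c = (\<integral>z. u (x + z) * \<eta> z \<partial>lborel) - (\<integral>z. c * \<eta> z \<partial>lborel)"
    using \<eta> by (simp add: mollify_translate mollifier_def)
  also have "\<dots> = (\<integral>z. (u (x + z) - c) * \<eta> z \<partial>lborel)"
    using mollify_integrable by (simp add: left_diff_distrib)
  finally have eq: "mollify \<eta> u x - c = (\<integral>z. (u (x + z) - c) * \<eta> z \<partial>lborel)" .
  have i: "integrable lborel (\<lambda>z. (u (x + z) - c) * \<eta> z)"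
    using mollify_integrable by (simp add: left_diff_distrib)
  have "\<bar>\<integral>z. (u (x + z) - c) * \<eta> z \<partial>lborel\<bar> \<le> (\<integral>z. \<bar>(u (x + z) - c) * \<eta> z\<bar> \<partial>lborel)"
    by (rule integral_abs_bound)
  also have "\<dots> \<le> (\<integral>z. e * \<eta> z \<partial>lborel)"
  proof (rule integral_mono)
    show "\<bar>(u (x + z) - c) * \<eta> z\<bar> \<le> e * \<eta> z" for z
      using assms[of z] z[of z] nn[of z] by (cases "norm z \<le> \<epsilon>") (auto simp: abs_mult intro!: mult_right_mono)
  qed (use i mollify_integrable(2) in auto)
  also have "\<dots> = e" using \<eta> by (simp add: mollifier_def)
  finally show ?thesis by (simp add: eq)
qed

text \<open>Averaging preserves the Lipschitz bound, and difference quotients in the direction of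
  the gradient itself turn it into a bound on the norm of the gradient.\<close>

lemma mollify_lipschitz_grad:
  assumes lip: "\<And>x y. \<bar>u x - u y\<bar> \<le> L * norm (x - y)" and L: "L \<ge> 0"
  shows "norm (mollify_grad \<eta> u x) \<le> L"
proof -
  have nn: "\<eta> z \<ge> 0" for z using \<eta> by (simp add: mollifier_def)
  have lipm: "\<bar>mollify \<eta> u x - mollify \<eta> u y\<bar> \<le> L * norm (x - y)" for x y
  proof -
    have "mollify \<eta> u x - mollify \<eta> u y = (\<integral>z. (u (x + z) - u (y + z)) * \<eta> z \<partial>lborel)"
      using mollify_integrable by (simp add: mollify_translate left_diff_distrib)
    also have "\<bar>\<dots>\<bar> \<le> (\<integral>z. \<bar>(u (x + z) - u (y + z)) * \<eta> z\<bar> \<partial>lborel)"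
      by (rule integral_abs_bound)
    also have "\<dots> \<le> (\<integral>z. (L * norm (x - y)) * \<eta> z \<partial>lborel)"
    proof (rule integral_mono)
      show "\<bar>(u (x + z) - u (y + z)) * \<eta> z\<bar> \<le> (L * norm (x - y)) * \<eta> z" for z
        using lip[of "x + z" "y + z"] nn[of z] by (auto simp: abs_mult intro!: mult_right_mono)
      show "integrable lborel (\<lambda>z. \<bar>(u (x + z) - u (y + z)) * \<eta> z\<bar>)"
        using mollify_integrable by (simp add: left_diff_distrib)
    qed (use mollify_integrable(2) in auto)
    also have "\<dots> = L * norm (x - y)" using \<eta> by (simp add: mollifier_def)
    finally show ?thesis .
  qed
  let ?g = "mollify_grad \<eta> u x"
  have "((\<lambda>t. mollify \<eta> u (x + t *\<^sub>R ?g)) has_real_derivative ?g \<bullet> ?g) (at 0)"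
    by (rule has_derivative_along_line[OF mollify_has_derivative])
  then have "((\<lambda>t. (mollify \<eta> u (x + t *\<^sub>R ?g) - mollify \<eta> u x) / t) \<longlongrightarrow> ?g \<bullet> ?g) (at 0)"
    by (simp add: DERIV_def)
  then have "?g \<bullet> ?g \<le> L * norm ?g"
  proof (rule tendsto_upperbound)
    show "\<forall>\<^sub>F t in at 0. (mollify \<eta> u (x + t *\<^sub>R ?g) - mollify \<eta> u x) / t \<le> L * norm ?g"
      unfolding eventually_at_filter
    proof (intro always_eventually allI impI)
      fix t :: real assume t: "t \<noteq> 0"
      have "\<bar>(mollify \<eta> u (x + t *\<^sub>R ?g) - mollify \<eta> u x) / t\<bar> \<le> (L * (\<bar>t\<bar> * norm ?g)) / \<bar>t\<bar>"
        unfolding abs_divide using lipm[of "x + t *\<^sub>R ?g" x] by (intro divide_right_mono) auto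
      then have "\<bar>(mollify \<eta> u (x + t *\<^sub>R ?g) - mollify \<eta> u x) / t\<bar> \<le> L * norm ?g"
        using t by simp
      then show "(mollify \<eta> u (x + t *\<^sub>R ?g) - mollify \<eta> u x) / t \<le> L * norm ?g"
        by (rule order_trans[OF abs_ge_self])
    qed
  qed simp
  then have "norm ?g * norm ?g \<le> L * norm ?g" by (simp add: dot_square_norm power2_eq_square)
  then show ?thesis using L by (cases "norm ?g = 0") (auto simp: mult_le_cancel_right)
qed

text \<open>Since the closed \<epsilon>-ball around x lies in \<Omega>, the translated kernel is an
  admissible test function, and the gradient of the mollification is the average of the weak
  gradient with that kernel as weight.\<close>

lemma mollify_grad_weak:
  assumes \<Omega>: "open \<Omega>" and g: "has_weak_grad \<Omega> u g" and m: "g \<in> borel_measurable (lebesgue_on \<Omega>)"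
    and L: "AE z in lebesgue_on \<Omega>. norm (g z) \<le> L" and L0: "L \<ge> 0" and x: "cball x \<epsilon> \<subseteq> \<Omega>" and zero: "\<And>z. z \<notin> \<Omega> \<Longrightarrow> u z = 0"
  shows "norm (mollify_grad \<eta> u x) \<le> L"
proof -
  let ?\<phi> = "\<lambda>z. \<eta> (z - x)"
  have sm: "smooth_on UNIV \<eta>" and nn: "\<And>z. \<eta> z \<ge> 0" and z0: "\<And>z. z \<notin> cball 0 \<epsilon> \<Longrightarrow> \<eta> z = 0"
    using \<eta> by (auto simp: mollifier_def)
  have gr: "grad ?\<phi> z = grad \<eta> (z - x)" for z
    by (rule grad_translate[OF smooth_on_differentiable[OF sm UNIV_I]])
  have test: "test_function \<Omega> ?\<phi>"
  proof (rule test_functionI[OF smooth_on_translate[OF sm] compact_cball x])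
    fix z assume "z \<notin> cball x \<epsilon>"
    then show "\<eta> (z - x) = 0" by (intro z0) (auto simp: dist_norm norm_minus_commute)
  qed
  have c\<phi>: "continuous_on UNIV ?\<phi>" by (rule test_function_continuous[OF test])
  have \<Omega>s: "\<Omega> \<in> sets lebesgue" using \<Omega> by (simp add: borel_open)
  have c2: "continuous_on UNIV (\<lambda>z. u z *\<^sub>R grad \<eta> (z - x))"
    by (intro continuous_on_scaleR continuous_on_compose2[OF continuous_grad_mollifier] u)
       (auto intro!: continuous_intros)
  have i2: "integrable lborel (\<lambda>z. u z *\<^sub>R grad \<eta> (z - x))"
    by (rule continuous_compact_support_integrable[OF c2 S(1)]) (simp add: S(2))
  let ?v = "mollify_grad \<eta> u x"
  obtain K where K: "compact K" "K \<subseteq> \<Omega>" "\<And>x. x \<notin> K \<Longrightarrow> ?\<phi> x = 0" "\<And>x. x \<notin> K \<Longrightarrow> grad ?\<phi> x = 0"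
    using test_function_props[OF test] by blast
  have gi: "integrable (lebesgue_on \<Omega>) (\<lambda>z. g z $ i * ?\<phi> z)" for i
    by (rule absolutely_integrable_times_continuous[OF K(1,2) \<Omega> _ c\<phi> K(3)])
       (rule absolutely_integrable_vec_nth[OF has_weak_gradD(2)[OF g K(1,2)]])
  have comp: "?v $ i = (\<integral>z. g z $ i * ?\<phi> z \<partial>lebesgue_on \<Omega>)" for i
  proof -
    have "?v $ i = - (\<integral>z. u z * partial i ?\<phi> z \<partial>lborel)"
      unfolding mollify_grad_def partial_eq_grad gr
      using integral_bounded_linear[OF bounded_linear_vec_nth i2, of i] by simp
    also have "(\<integral>z. u z * partial i ?\<phi> z \<partial>lborel) = (\<integral>z. u z * partial i ?\<phi> z \<partial>lebesgue_on \<Omega>)"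
    proof (rule integral_lebesgue_on_eq_lborel[symmetric, OF _ \<Omega>s])
      show "(\<lambda>z. u z * partial i ?\<phi> z) \<in> borel_measurable borel"
        by (intro borel_measurable_continuous_onI continuous_on_mult u
             smooth_on_continuous[OF smooth_on_partial[OF test_function_smooth[OF test]]])
    qed (simp add: zero)
    also have "- \<dots> = (\<integral>z. g z $ i * ?\<phi> z \<partial>lebesgue_on \<Omega>)"
      using has_weak_gradD(3)[OF g test, of i] by simp
    finally show ?thesis .
  qed
  have \<phi>int: "integrable (lebesgue_on \<Omega>) ?\<phi>" "(\<integral>z. ?\<phi> z \<partial>lebesgue_on \<Omega>) = 1"
  proof -
    have m: "?\<phi> \<in> borel_measurable borel" by (rule borel_measurable_continuous_onI[OF c\<phi>])
    have z: "?\<phi> z = 0" if "z \<notin> \<Omega>" for z using K that by blast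
    show "integrable (lebesgue_on \<Omega>) ?\<phi>"
      using integrable_lebesgue_on_iff_lborel[OF m \<Omega>s z]
        continuous_compact_support_integrable[OF c\<phi> K(1,3)] by blast
    have "(\<integral>z. ?\<phi> z \<partial>lebesgue_on \<Omega>) = integral\<^sup>L (distr lborel borel ((+) x)) ?\<phi>"
      using integral_lebesgue_on_eq_lborel[OF m \<Omega>s z] by (simp add: lborel_distr_plus)
    also have "\<dots> = integral\<^sup>L lborel \<eta>"
      using m by (subst integral_distr) auto
    finally show "(\<integral>z. ?\<phi> z \<partial>lebesgue_on \<Omega>) = 1" using \<eta> by (simp add: mollifier_def)
  qed
  \<comment> \<open>Pairing the averaged vector with itself yields the bound L directly; estimating
    each component separately would lose a dimensional factor.\<close>
  have "?v \<bullet> ?v = (\<Sum>i\<in>UNIV. ?v $ i * (\<integral>z. g z $ i * ?\<phi> z \<partial>lebesgue_on \<Omega>))"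
    unfolding comp[symmetric] by (simp add: inner_vec_def)
  also have "\<dots> = (\<integral>z. (\<Sum>i\<in>UNIV. ?v $ i * (g z $ i * ?\<phi> z)) \<partial>lebesgue_on \<Omega>)"
    using gi by (subst Bochner_Integration.integral_sum) auto
  also have "\<dots> \<le> (\<integral>z. (norm ?v * L) * ?\<phi> z \<partial>lebesgue_on \<Omega>)"
  proof (rule integral_mono_AE)
    show "integrable (lebesgue_on \<Omega>) (\<lambda>z. \<Sum>i\<in>UNIV. ?v $ i * (g z $ i * ?\<phi> z))"
      using gi by (intro Bochner_Integration.integrable_sum) auto
    show "integrable (lebesgue_on \<Omega>) (\<lambda>z. (norm ?v * L) * ?\<phi> z)" using \<phi>int(1) by simp
    show "AE z in lebesgue_on \<Omega>. (\<Sum>i\<in>UNIV. ?v $ i * (g z $ i * ?\<phi> z)) \<le> (norm ?v * L) * ?\<phi> z"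
      using L
    proof eventually_elim
      case (elim z)
      have "(\<Sum>i\<in>UNIV. ?v $ i * (g z $ i * ?\<phi> z)) = (?v \<bullet> g z) * ?\<phi> z"
        by (simp add: inner_vec_def sum_distrib_right mult.assoc)
      also have "\<dots> \<le> (norm ?v * L) * ?\<phi> z"
        using norm_cauchy_schwarz[of ?v "g z"] mult_left_mono[OF elim norm_ge_zero[of ?v]] nn
        by (intro mult_right_mono) auto
      finally show ?case .
    qed
  qed
  also have "\<dots> = norm ?v * L" using \<phi>int(2) by simp
  finally have "norm ?v * norm ?v \<le> L * norm ?v" by (simp add: dot_square_norm power2_eq_square mult.commute)
  then show ?thesis using L0 by (cases "norm ?v = 0") (auto simp: mult_le_cancel_right)
qed

end

section \<open>The inradius and the limit constant\<close>

lemma Lnorm_inf_eq: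
  fixes f :: "real ^ 'n::finite \<Rightarrow> 'b::euclidean_space"
  assumes \<Omega>: "open \<Omega>" and f: "continuous_on \<Omega> f" and x0: "x0 \<in> \<Omega>" "\<And>x. x \<in> \<Omega> \<Longrightarrow> norm (f x) \<le> norm (f x0)"
  shows "Lnorm \<infinity> \<Omega> f = norm (f x0)" "in_L \<infinity> \<Omega> f"
proof -
  have ne: "\<Omega> \<noteq> {}" using x0 by auto
  have m: "f \<in> borel_measurable (lebesgue_on \<Omega>)" by (rule measurable_lebesgue_on_continuous[OF \<Omega> f])
  have ae: "AE x in lebesgue_on \<Omega>. norm (f x) \<le> norm (f x0)"
    using x0(2) by (intro AE_I2) (auto simp: space_restrict_space)
  show i: "in_L \<infinity> \<Omega> f" by (rule in_L_infI[OF \<Omega> ne m ae])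
  show "Lnorm \<infinity> \<Omega> f = norm (f x0)"
    using Lnorm_inf_le[OF \<Omega> ne m ae] Lnorm_inf_ge[OF \<Omega> i f x0(1)] by simp
qed

lemma has_weak_grad_cong:
  fixes u v :: "real ^ 'n::finite \<Rightarrow> real"
  assumes "has_weak_grad \<Omega> u g" "\<And>x. x \<in> \<Omega> \<Longrightarrow> u x = v x"
  shows "has_weak_grad \<Omega> v g"
  unfolding has_weak_grad_def
proof (intro conjI allI impI)
  fix K assume K: "compact K" "K \<subseteq> \<Omega>"
  show "v absolutely_integrable_on K"
    using has_weak_gradD(1)[OF assms(1) K] assms(2) K(2)
    by (subst set_integrable_cong[OF refl refl, of _ v u]) auto
  show "g absolutely_integrable_on K" by (rule has_weak_gradD(2)[OF assms(1) K])
next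
  fix \<phi> i assume "test_function \<Omega> \<phi>"
  from has_weak_gradD(3)[OF assms(1) this, of i]
  have "(\<integral>x. u x * partial i \<phi> x \<partial>lebesgue_on \<Omega>) = - (\<integral>x. g x $ i * \<phi> x \<partial>lebesgue_on \<Omega>)" .
  moreover have "(\<integral>x. v x * partial i \<phi> x \<partial>lebesgue_on \<Omega>) = (\<integral>x. u x * partial i \<phi> x \<partial>lebesgue_on \<Omega>)"
    using assms(2) by (intro Bochner_Integration.integral_cong) (auto simp: space_restrict_space)
  ultimately show "(\<integral>x. v x * partial i \<phi> x \<partial>lebesgue_on \<Omega>) = - (\<integral>x. g x $ i * \<phi> x \<partial>lebesgue_on \<Omega>)"
    by simp
qed

text \<open>Mollification and cube averages also evaluate functions outside the closure, where the
  values of u are arbitrary.\<close>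

definition zero_ext :: "'a set \<Rightarrow> ('a \<Rightarrow> real) \<Rightarrow> 'a \<Rightarrow> real" where
  "zero_ext \<Omega> u x = (if x \<in> \<Omega> then u x else 0)"

context
  fixes \<Omega> :: "(real ^ 'n::finite) set"
  assumes \<Omega>: "open \<Omega>" "bounded \<Omega>" "\<Omega> \<noteq> {}"
begin

lemma closure_eq_Un_frontier: "closure \<Omega> = \<Omega> \<union> frontier \<Omega>"
  using closure_Un_frontier[of \<Omega>] by simp

lemma frontier_disjoint: "x \<in> frontier \<Omega> \<Longrightarrow> x \<notin> \<Omega>"
  using \<Omega>(1) by (auto simp: frontier_def interior_open)

lemma frontier_nonempty: "frontier \<Omega> \<noteq> {}"
  using \<Omega>(2,3) not_bounded_UNIV by (auto simp: frontier_eq_empty)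

lemma boundary_dist_le: "y \<in> frontier \<Omega> \<Longrightarrow> boundary_dist \<Omega> x \<le> norm (x - y)"
  unfolding boundary_dist_def dist_norm[symmetric] by (rule infdist_le)

lemma boundary_dist_attained: "\<exists>y\<in>frontier \<Omega>. boundary_dist \<Omega> x = norm (x - y)"
  using infdist_attains_inf[OF frontier_closed frontier_nonempty, of x]
  by (auto simp: boundary_dist_def dist_norm)

lemma continuous_boundary_dist: "continuous_on A (boundary_dist \<Omega>)"
  unfolding boundary_dist_def[abs_def] by (intro continuous_on_infdist continuous_on_id)

lemma boundary_dist_pos: "x \<in> \<Omega> \<Longrightarrow> boundary_dist \<Omega> x > 0"
  using boundary_dist_attained[of x] frontier_disjoint by fastforce

lemma boundary_dist_frontier: "x \<in> frontier \<Omega> \<Longrightarrow> boundary_dist \<Omega> x = 0"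
  by (simp add: boundary_dist_def)

lemma boundary_dist_nonneg: "boundary_dist \<Omega> x \<ge> 0"
  by (simp add: boundary_dist_def infdist_nonneg)

text \<open>A ball is connected: if it also met the complement of \<Omega>, it would meet the
  frontier at less than the distance to it.\<close>

lemma ball_boundary_dist:
  assumes "x \<in> \<Omega>"
  shows "ball x (boundary_dist \<Omega> x) \<subseteq> \<Omega>"
proof (rule ccontr)
  let ?B = "ball x (boundary_dist \<Omega> x)"
  assume "\<not> ?B \<subseteq> \<Omega>"
  then have d: "?B - \<Omega> \<noteq> {}" by blast
  have "x \<in> ?B \<inter> \<Omega>" using boundary_dist_pos[OF assms] assms by simp
  then have i: "?B \<inter> \<Omega> \<noteq> {}" by blast
  have "?B \<inter> frontier \<Omega> \<noteq> {}"
    by (rule connected_Int_frontier[OF connected_ball i d])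
  then obtain y where y: "y \<in> ?B" "y \<in> frontier \<Omega>" by blast
  then show False using boundary_dist_le[OF y(2), of x] by (simp add: dist_norm)
qed

lemma inradius_point:
  obtains x0 where "x0 \<in> \<Omega>" "\<And>x. x \<in> closure \<Omega> \<Longrightarrow> boundary_dist \<Omega> x \<le> boundary_dist \<Omega> x0"
    "boundary_dist \<Omega> x0 > 0" "Lnorm \<infinity> \<Omega> (boundary_dist \<Omega>) = boundary_dist \<Omega> x0"
proof -
  have "compact (closure \<Omega>)" "closure \<Omega> \<noteq> {}" using \<Omega>(2,3) by auto
  then obtain x0 where x0: "x0 \<in> closure \<Omega>" "\<And>x. x \<in> closure \<Omega> \<Longrightarrow> boundary_dist \<Omega> x \<le> boundary_dist \<Omega> x0"
    using continuous_attains_sup[OF _ _ continuous_boundary_dist] by metis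
  obtain z where z: "z \<in> \<Omega>" using \<Omega>(3) by blast
  have pos: "boundary_dist \<Omega> x0 > 0"
    using x0(2)[of z] boundary_dist_pos[OF z] z closure_subset[of \<Omega>] by auto
  then have x0\<Omega>: "x0 \<in> \<Omega>" using x0(1) closure_eq_Un_frontier boundary_dist_frontier by auto
  have "Lnorm \<infinity> \<Omega> (boundary_dist \<Omega>) = norm (boundary_dist \<Omega> x0)"
    by (rule Lnorm_inf_eq[OF \<Omega>(1) continuous_boundary_dist x0\<Omega>])
       (use x0(2) closure_subset[of \<Omega>] boundary_dist_nonneg in auto)
  then show thesis using that[OF x0\<Omega> x0(2) pos] pos by simp
qed

lemma continuous_zero_ext:
  assumes "u \<in> C_0 \<Omega>"
  shows "continuous_on UNIV (zero_ext \<Omega> u)"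
proof -
  have "continuous_on (closure \<Omega> \<union> - \<Omega>) (zero_ext \<Omega> u)"
  proof (rule continuous_on_closed_Un)
    show "continuous_on (closure \<Omega>) (zero_ext \<Omega> u)"
    proof (rule continuous_on_eq[of _ u])
      show "continuous_on (closure \<Omega>) u" using assms by (simp add: C_0_def)
      show "u x = zero_ext \<Omega> u x" if "x \<in> closure \<Omega>" for x
        using that assms frontier_disjoint[of x] unfolding closure_eq_Un_frontier by (auto simp: zero_ext_def C_0_def)
    qed
    show "continuous_on (- \<Omega>) (zero_ext \<Omega> u)"
      by (rule continuous_on_eq[of _ "\<lambda>x. 0"]) (auto simp: zero_ext_def)
  qed (use \<Omega>(1) in auto)
  moreover have "closure \<Omega> \<union> - \<Omega> = UNIV" using closure_subset[of \<Omega>] by auto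
  ultimately show ?thesis by simp
qed

lemma zero_ext_closure: "u \<in> C_0 \<Omega> \<Longrightarrow> x \<in> closure \<Omega> \<Longrightarrow> zero_ext \<Omega> u x = u x"
  using frontier_disjoint[of x] unfolding closure_eq_Un_frontier by (auto simp: zero_ext_def C_0_def)

lemma zero_ext_outside: "x \<notin> closure \<Omega> \<Longrightarrow> zero_ext \<Omega> u x = 0"
  using closure_subset[of \<Omega>] by (auto simp: zero_ext_def)

text \<open>On a ball inside \<open>\<Omega>\<close> mollifying shows that \<open>u\<close> is \<open>L\<close>-Lipschitz; then walk to the nearest boundary point.\<close>

lemma weak_grad_bound_imp_boundary_dist_bound:
  assumes u: "u \<in> C_0 \<Omega>" and g: "has_weak_grad \<Omega> u g" "g \<in> borel_measurable (lebesgue_on \<Omega>)"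
    and L: "AE z in lebesgue_on \<Omega>. norm (g z) \<le> L" and L0: "L \<ge> 0" and x: "x \<in> \<Omega>"
  shows "\<bar>u x\<bar> \<le> L * boundary_dist \<Omega> x"
proof -
  let ?w = "zero_ext \<Omega> u"
  have cw: "continuous_on UNIV ?w" by (rule continuous_zero_ext[OF u])
  have S: "compact (closure \<Omega>)" using \<Omega>(2) by simp
  have Sz: "\<And>x. x \<notin> closure \<Omega> \<Longrightarrow> ?w x = 0" by (rule zero_ext_outside)
  have wg: "has_weak_grad \<Omega> ?w g" by (rule has_weak_grad_cong[OF g(1)]) (simp add: zero_ext_def)
  obtain y where y: "y \<in> frontier \<Omega>" "boundary_dist \<Omega> x = norm (x - y)"
    using boundary_dist_attained by blast
  define d where "d = norm (x - y)"
  have d: "d > 0" using boundary_dist_pos[OF x] y by (simp add: d_def)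
  have ball: "ball x d \<subseteq> \<Omega>" using ball_boundary_dist[OF x] y by (simp add: d_def)
  have step: "\<bar>?w x - ?w (x + t *\<^sub>R (y - x))\<bar> \<le> L * d" if t: "0 < t" "t < 1" for t
  proof (rule field_le_epsilon)
    fix e :: real assume e: "e > 0"
    let ?z = "x + t *\<^sub>R (y - x)"
    obtain \<delta>1 where \<delta>1: "\<delta>1 > 0" "\<And>z. dist z x < \<delta>1 \<Longrightarrow> dist (?w z) (?w x) < e / 2"
      using cw e unfolding continuous_on_iff by (metis UNIV_I half_gt_zero)
    obtain \<delta>2 where \<delta>2: "\<delta>2 > 0" "\<And>z. dist z ?z < \<delta>2 \<Longrightarrow> dist (?w z) (?w ?z) < e / 2"
      using cw e unfolding continuous_on_iff by (metis UNIV_I half_gt_zero)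
    \<comment> \<open>The first bound keeps the mollification balls along the segment inside the
      ball of radius d around x; the other two control the mollification error at its endpoints.
      Halving m makes the inequalities strict.\<close>
    define m where "m = min ((1 - t) * d) (min \<delta>1 \<delta>2)"
    define \<epsilon> where "\<epsilon> = m / 2"
    have \<epsilon>: "\<epsilon> > 0" "\<epsilon> < (1 - t) * d" "\<epsilon> < \<delta>1" "\<epsilon> < \<delta>2"
    proof -
      have "m \<le> (1 - t) * d" "m \<le> \<delta>1" "m \<le> \<delta>2" by (simp_all add: m_def)
      moreover have "m > 0" using t d \<delta>1(1) \<delta>2(1) by (simp add: m_def)
      ultimately show "\<epsilon> > 0" "\<epsilon> < (1 - t) * d" "\<epsilon> < \<delta>1" "\<epsilon> < \<delta>2"
        unfolding \<epsilon>_def by linarith+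
    qed
    obtain \<eta> :: "real ^ 'n \<Rightarrow> real" where \<eta>: "mollifier \<epsilon> \<eta>" using mollifier_exists[OF \<epsilon>(1)] by blast
    have "norm (mollify \<eta> ?w ?z - mollify \<eta> ?w x) \<le> L * norm (?z - x)"
    proof (rule differentiable_bound[of "closed_segment x ?z"])
      fix z assume z: "z \<in> closed_segment x ?z"
      then obtain s where s: "0 \<le> s" "s \<le> 1" "z = x + (s * t) *\<^sub>R (y - x)"
        by (auto simp: in_segment algebra_simps)
      have "norm (z - x) = s * (t * d)"
        using s t by (simp add: d_def norm_minus_commute[of x y])
      also have "\<dots> \<le> 1 * (t * d)" using s t d by (intro mult_right_mono) auto
      finally have zd: "norm (z - x) \<le> t * d" by simp
      have "cball z \<epsilon> \<subseteq> ball x d"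
      proof
        fix w assume "w \<in> cball z \<epsilon>"
        then have "norm (w - z) \<le> \<epsilon>" by (simp add: dist_norm norm_minus_commute)
        then have "norm (w - x) < d"
          using norm_triangle_ineq[of "w - z" "z - x"] zd \<epsilon>(2) by (simp add: algebra_simps)
        then show "w \<in> ball x d" by (simp add: dist_norm norm_minus_commute)
      qed
      then have zc: "cball z \<epsilon> \<subseteq> \<Omega>" using ball by blast
      have G: "norm (mollify_grad \<eta> ?w z) \<le> L"
        by (rule mollify_grad_weak[OF cw S Sz \<eta> \<Omega>(1) wg g(2) L L0 zc]) (auto simp: zero_ext_def)
      show "(mollify \<eta> ?w has_derivative (\<lambda>v. mollify_grad \<eta> ?w z \<bullet> v)) (at z within closed_segment x ?z)"
        by (rule has_derivative_at_withinI[OF mollify_has_derivative[OF cw S Sz \<eta>]])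
      show "onorm (\<lambda>v. mollify_grad \<eta> ?w z \<bullet> v) \<le> L"
      proof (rule onorm_bound[OF L0])
        fix v show "norm (mollify_grad \<eta> ?w z \<bullet> v) \<le> L * norm v"
          using Cauchy_Schwarz_ineq2[of "mollify_grad \<eta> ?w z" v] mult_right_mono[OF G norm_ge_zero[of v]] by simp
      qed
    qed auto
    also have "norm (?z - x) = t * d" using t by (simp add: d_def norm_minus_commute[of x y])
    also have "L * (t * d) \<le> L * d" using t d L0 by (intro mult_left_mono) auto
    finally have 1: "\<bar>mollify \<eta> ?w ?z - mollify \<eta> ?w x\<bar> \<le> L * d" by simp
    have 2: "\<bar>mollify \<eta> ?w x - ?w x\<bar> \<le> e / 2"
    proof (rule mollify_close[OF cw S Sz \<eta>])
      fix z :: "real ^ 'n" assume "norm z \<le> \<epsilon>"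
      then show "\<bar>?w (x + z) - ?w x\<bar> \<le> e / 2" using \<delta>1(2)[of "x + z"] \<epsilon>(3) by (simp add: dist_norm)
    qed
    have 3: "\<bar>mollify \<eta> ?w ?z - ?w ?z\<bar> \<le> e / 2"
    proof (rule mollify_close[OF cw S Sz \<eta>])
      fix z :: "real ^ 'n" assume "norm z \<le> \<epsilon>"
      then show "\<bar>?w (?z + z) - ?w ?z\<bar> \<le> e / 2" using \<delta>2(2)[of "?z + z"] \<epsilon>(4) by (simp add: dist_norm)
    qed
    show "\<bar>?w x - ?w ?z\<bar> \<le> L * d + e" using 1 2 3 by linarith
  qed
  \<comment> \<open>Mollification works only short of y, where the inscribed ball touches the
    boundary; continuity of the zero extension supplies t = 1.\<close>
  have "((\<lambda>t. ?w (x + t *\<^sub>R (y - x))) \<longlongrightarrow> ?w (x + 1 *\<^sub>R (y - x))) (at_left 1)"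
  proof (rule continuous_on_tendsto_compose[OF cw])
    show "((\<lambda>t. x + t *\<^sub>R (y - x)) \<longlongrightarrow> x + 1 *\<^sub>R (y - x)) (at_left 1)"
      by (intro tendsto_intros)
  qed auto
  then have "((\<lambda>t. \<bar>?w x - ?w (x + t *\<^sub>R (y - x))\<bar>) \<longlongrightarrow> \<bar>?w x - ?w y\<bar>) (at_left 1)"
    by (intro tendsto_intros) simp
  then have "\<bar>?w x - ?w y\<bar> \<le> L * d"
  proof (rule tendsto_upperbound)
    show "\<forall>\<^sub>F t in at_left 1. \<bar>?w x - ?w (x + t *\<^sub>R (y - x))\<bar> \<le> L * d"
      unfolding eventually_at_left_field using step by (intro exI[of _ 0]) auto
  qed simp
  then show ?thesis
    using x y frontier_disjoint[OF y(1)] by (simp add: zero_ext_def d_def)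
qed

lemma W1_inf_boundary_dist_bound:
  assumes u: "u \<in> C_0 \<Omega> \<inter> W1 \<infinity> \<Omega>" and x: "x \<in> \<Omega>"
  shows "\<bar>u x\<bar> \<le> Lnorm \<infinity> \<Omega> (weak_grad \<Omega> u) * boundary_dist \<Omega> x" "Lnorm \<infinity> \<Omega> (weak_grad \<Omega> u) \<ge> 0"
proof -
  obtain g where g: "has_weak_grad \<Omega> u g" "in_L \<infinity> \<Omega> g"
    using u unfolding W1_def by blast
  have gm: "g \<in> borel_measurable (lebesgue_on \<Omega>)" using g(2) by (simp add: in_L_def)
  have L: "in_L \<infinity> \<Omega> (weak_grad \<Omega> u)" using in_L_weak_grad[OF \<Omega>(1) g(1) gm] g(2) by simp
  have wm: "weak_grad \<Omega> u \<in> borel_measurable (lebesgue_on \<Omega>)" by (rule measurable_weak_grad[OF \<Omega>(1) g(1) gm])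
  show n: "Lnorm \<infinity> \<Omega> (weak_grad \<Omega> u) \<ge> 0" by (rule Lnorm_inf_nonneg[OF \<Omega>(1,3) L])
  show "\<bar>u x\<bar> \<le> Lnorm \<infinity> \<Omega> (weak_grad \<Omega> u) * boundary_dist \<Omega> x"
    by (rule weak_grad_bound_imp_boundary_dist_bound[OF _ has_weak_grad_weak_grad[OF g(1)] wm
        Lnorm_inf_AE[OF \<Omega>(1,3) L] n x]) (use u in auto)
qed

lemma Lambda_inf_bdd: "bdd_below {Lnorm \<infinity> \<Omega> (weak_grad \<Omega> u) | u. u \<in> C_0 \<Omega> \<inter> W1 \<infinity> \<Omega> \<and> Lnorm \<infinity> \<Omega> u = 1}"
proof -
  obtain x where x: "x \<in> \<Omega>" using \<Omega>(3) by blast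
  show ?thesis by (intro bdd_belowI[of _ 0]) (use W1_inf_boundary_dist_bound(2)[OF _ x] in auto)
qed

lemma C_0_in_L_inf:
  assumes "u \<in> C_0 \<Omega>"
  shows "in_L \<infinity> \<Omega> u"
proof -
  have c: "continuous_on (closure \<Omega>) u" using assms by (simp add: C_0_def)
  have "bounded (u ` closure \<Omega>)"
    using compact_continuous_image[OF c] \<Omega>(2) by (simp add: compact_imp_bounded)
  then obtain B where "\<And>x. x \<in> closure \<Omega> \<Longrightarrow> norm (u x) \<le> B" by (auto simp: bounded_iff)
  then show ?thesis
    using closure_subset[of \<Omega>]
    by (intro in_L_infI[OF \<Omega>(1,3) measurable_lebesgue_on_continuous[OF \<Omega>(1) continuous_on_subset[OF c]] AE_I2])
       (auto simp: space_restrict_space)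
qed

lemma test_function_C_0_W1:
  assumes \<phi>: "test_function \<Omega> \<phi>" and B: "\<And>x. norm (grad \<phi> x) \<le> B"
  shows "\<phi> \<in> C_0 \<Omega> \<inter> W1 \<infinity> \<Omega>" "Lnorm \<infinity> \<Omega> (weak_grad \<Omega> \<phi>) \<le> B"
proof -
  have c: "\<phi> \<in> C_0 \<Omega>"
    unfolding C_0_def using frontier_disjoint
    by (auto simp: test_function_continuous[OF \<phi>] test_function_zero_outside[OF \<phi>])
  have wg: "has_weak_grad \<Omega> \<phi> (grad \<phi>)" by (rule test_function_has_weak_grad[OF \<Omega>(1) \<phi>])
  have m: "grad \<phi> \<in> borel_measurable (lebesgue_on \<Omega>)"
    by (rule measurable_lebesgue_on_continuous[OF \<Omega>(1) test_function_continuous_grad[OF \<phi>]])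
  have ae: "AE x in lebesgue_on \<Omega>. norm (grad \<phi> x) \<le> B" using B by simp
  show "\<phi> \<in> C_0 \<Omega> \<inter> W1 \<infinity> \<Omega>"
    unfolding W1_def using c C_0_in_L_inf[OF c] wg in_L_infI[OF \<Omega>(1,3) m ae] by blast
  show "Lnorm \<infinity> \<Omega> (weak_grad \<Omega> \<phi>) \<le> B"
    unfolding Lnorm_weak_grad[OF \<Omega>(1) wg m] by (rule Lnorm_inf_le[OF \<Omega>(1,3) m ae])
qed

text \<open>Normalised smooth cones over a largest inscribed ball give the upper bound as \<delta>
  -> 0. Conversely an admissible u with gradient norm l satisfies |u| <= l R, R being the inradius,
  so sup norm 1 forces l >= 1/R.\<close>

lemma Lambda_inf_eq: "Lambda_inf \<Omega> = 1 / Lnorm \<infinity> \<Omega> (boundary_dist \<Omega>)"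
proof -
  obtain x0 where x0: "x0 \<in> \<Omega>" "\<And>x. x \<in> closure \<Omega> \<Longrightarrow> boundary_dist \<Omega> x \<le> boundary_dist \<Omega> x0"
    "boundary_dist \<Omega> x0 > 0" "Lnorm \<infinity> \<Omega> (boundary_dist \<Omega>) = boundary_dist \<Omega> x0"
    using inradius_point by blast
  define R where "R = boundary_dist \<Omega> x0"
  have R: "R > 0" using x0 by (simp add: R_def)
  let ?S = "{Lnorm \<infinity> \<Omega> (weak_grad \<Omega> u) | u. u \<in> C_0 \<Omega> \<inter> W1 \<infinity> \<Omega> \<and> Lnorm \<infinity> \<Omega> u = 1}"
  have upper: "?S \<noteq> {} \<and> Inf ?S \<le> 1 / (R - 2 * \<delta>)" if \<delta>: "0 < \<delta>" "2 * \<delta> < R" for \<delta>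
  proof -
    have ball: "ball x0 R \<subseteq> \<Omega>" using ball_boundary_dist[OF x0(1)] by (simp add: R_def)
    obtain \<phi> where \<phi>: "test_function \<Omega> \<phi>" "\<And>x. norm (grad \<phi> x) \<le> 1" "\<phi> x0 \<ge> R - 2 * \<delta>" "\<And>x. \<phi> x \<ge> 0"
      using near_cone_test_function[OF \<delta>(1) _ ball] \<delta> by auto
    define M where "M = Lnorm \<infinity> \<Omega> \<phi>"
    have in\<phi>: "in_L \<infinity> \<Omega> \<phi>" using C_0_in_L_inf test_function_C_0_W1(1)[OF \<phi>(1,2)] by blast
    have MR: "M \<ge> R - 2 * \<delta>"
      using Lnorm_inf_ge[OF \<Omega>(1) in\<phi> test_function_continuous[OF \<phi>(1)] x0(1)] \<phi>(3) by (simp add: M_def)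
    then have M: "M > 0" using \<delta> by simp
    define v where "v = (\<lambda>x. (1 / M) * \<phi> x)"
    have v: "test_function \<Omega> v" unfolding v_def by (rule test_function_cmult[OF \<phi>(1)])
    have gv: "norm (grad v x) \<le> 1 / M" for x
      unfolding v_def grad_cmult[OF test_function_differentiable[OF \<phi>(1)]]
      using \<phi>(2)[of x] M by (simp add: divide_right_mono)
    obtain xm where xm: "xm \<in> closure \<Omega>" "\<And>x. x \<in> closure \<Omega> \<Longrightarrow> norm (\<phi> x) \<le> norm (\<phi> xm)"
      using continuous_attains_sup[of "closure \<Omega>" "\<lambda>x. norm (\<phi> x)"] \<Omega>(2,3) x0(1) closure_subset[of \<Omega>]
        continuous_on_norm[OF test_function_continuous[OF \<phi>(1)]] by (metis closure_eq_empty compact_closure)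
    have "norm (\<phi> x0) > 0" using \<phi>(3) \<delta> by simp
    then have "\<phi> xm \<noteq> 0" using xm(2)[of x0] x0(1) closure_subset[of \<Omega>] by auto
    then have xm\<Omega>: "xm \<in> \<Omega>" using test_function_zero_outside[OF \<phi>(1)] by blast
    have "M = norm (\<phi> xm)"
      unfolding M_def by (rule Lnorm_inf_eq[OF \<Omega>(1) test_function_continuous[OF \<phi>(1)] xm\<Omega>])
         (use xm(2) closure_subset[of \<Omega>] in auto)
    then have v1: "norm (v xm) = 1" using M by (simp add: v_def)
    have "norm (v x) \<le> norm (v xm)" if "x \<in> \<Omega>" for x
      using xm(2)[of x] that closure_subset[of \<Omega>] M by (auto simp: v_def abs_mult divide_right_mono)
    then have "Lnorm \<infinity> \<Omega> v = norm (v xm)"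
      by (rule Lnorm_inf_eq(1)[OF \<Omega>(1) test_function_continuous[OF v] xm\<Omega>])
    with v1 have mem: "Lnorm \<infinity> \<Omega> (weak_grad \<Omega> v) \<in> ?S"
      using test_function_C_0_W1(1)[OF v gv] by auto
    have "Inf ?S \<le> Lnorm \<infinity> \<Omega> (weak_grad \<Omega> v)" by (rule cInf_lower[OF mem Lambda_inf_bdd])
    also have "\<dots> \<le> 1 / M" by (rule test_function_C_0_W1(2)[OF v gv])
    also have "\<dots> \<le> 1 / (R - 2 * \<delta>)" using MR M \<delta> by (intro divide_left_mono) auto
    finally show ?thesis using mem by blast
  qed
  have "Inf ?S \<le> 1 / R"
  proof -
    have "((\<lambda>\<delta>. 1 / (R - 2 * \<delta>)) \<longlongrightarrow> 1 / (R - 2 * 0)) (at_right 0)"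
      using R by (intro tendsto_intros) auto
    then have "Inf ?S \<le> 1 / (R - 2 * 0)"
    proof (rule tendsto_lowerbound)
      show "\<forall>\<^sub>F \<delta> in at_right 0. Inf ?S \<le> 1 / (R - 2 * \<delta>)"
        unfolding eventually_at_right_field using upper R by (intro exI[of _ "R / 2"]) auto
    qed simp
    then show ?thesis by simp
  qed
  moreover have "1 / R \<le> Inf ?S"
  proof (rule cInf_greatest)
    show "?S \<noteq> {}" using upper[of "R / 4"] R by simp
    fix l assume "l \<in> ?S"
    then obtain u where u: "u \<in> C_0 \<Omega> \<inter> W1 \<infinity> \<Omega>" "Lnorm \<infinity> \<Omega> u = 1" and l: "l = Lnorm \<infinity> \<Omega> (weak_grad \<Omega> u)" by blast
    have l0: "l \<ge> 0" using W1_inf_boundary_dist_bound(2)[OF u(1) x0(1)] l by simp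
    have "norm (u x) \<le> l * R" if x: "x \<in> \<Omega>" for x
    proof -
      have "\<bar>u x\<bar> \<le> l * boundary_dist \<Omega> x" using W1_inf_boundary_dist_bound(1)[OF u(1) x] l by simp
      also have "\<dots> \<le> l * R" using x0(2)[of x] x closure_subset[of \<Omega>] l0 by (intro mult_left_mono) (auto simp: R_def)
      finally show ?thesis by simp
    qed
    moreover have "u \<in> borel_measurable (lebesgue_on \<Omega>)" using C_0_in_L_inf u(1) by (auto simp: in_L_def)
    moreover have "AE x in lebesgue_on \<Omega>. norm (u x) \<le> l * R"
      using calculation(1) by (intro AE_I2) (simp add: space_restrict_space)
    ultimately have "1 \<le> l * R"
      using Lnorm_inf_le[OF \<Omega>(1,3), of u "l * R"] u(2) by simp
    then show "1 / R \<le> l" using R by (simp add: field_simps)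
  qed
  ultimately show ?thesis using x0(4) by (simp add: Lambda_inf_def R_def)
qed

end

section \<open>Lipschitz functions have weak gradients\<close>

lemma AE_summable_of_integrals:
  fixes f :: "nat \<Rightarrow> 'a \<Rightarrow> real"
  assumes f: "\<And>k. integrable M (f k)" "\<And>k x. f k x \<ge> 0" and s: "summable (\<lambda>k. integral\<^sup>L M (f k))"
  shows "AE x in M. summable (\<lambda>k. f k x)"
proof -
  have "(\<integral>\<^sup>+x. (\<Sum>k. ennreal (f k x)) \<partial>M) = (\<Sum>k. \<integral>\<^sup>+x. ennreal (f k x) \<partial>M)"
    using f by (intro nn_integral_suminf) auto
  also have "\<dots> = (\<Sum>k. ennreal (integral\<^sup>L M (f k)))"
    using f by (intro suminf_cong nn_integral_eq_integral) auto
  also have "\<dots> = ennreal (\<Sum>k. integral\<^sup>L M (f k))"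
    using s f(2) by (intro suminf_ennreal2) auto
  finally have "(\<integral>\<^sup>+x. (\<Sum>k. ennreal (f k x)) \<partial>M) \<noteq> \<infinity>" by simp
  moreover have "(\<lambda>x. \<Sum>k. ennreal (f k x)) \<in> borel_measurable M"
  proof -
    have [measurable]: "f k \<in> borel_measurable M" for k using f(1) by auto
    show ?thesis by measurable
  qed
  ultimately have "AE x in M. (\<Sum>k. ennreal (f k x)) \<noteq> \<infinity>"
    by (intro nn_integral_noteq_infinite)
  then show ?thesis
    by eventually_elim (use f(2) in \<open>auto intro: summable_suminf_not_top\<close>)
qed

lemma convergent_of_summable_diff:
  fixes F :: "nat \<Rightarrow> 'a::banach"
  assumes "summable (\<lambda>k. norm (F (Suc k) - F k))"
  shows "convergent F"
proof -
  have "summable (\<lambda>k. F (Suc k) - F k)" using assms by (rule summable_norm_cancel)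
  then have "convergent (\<lambda>n. \<Sum>k<n. F (Suc k) - F k)" by (simp add: summable_iff_convergent)
  then have "convergent (\<lambda>n. F n - F 0)" by (simp add: sum_lessThan_telescope)
  then have "convergent (\<lambda>n. (F n - F 0) + F 0)" by (intro convergent_add convergent_const)
  then show ?thesis by simp
qed

text \<open>Among the gradients of smooth approximations of \<open>u\<close>, near-minimisers of the \<open>L\<^sup>2\<close> norm form
  a Cauchy sequence by the parallelogram law, as in the proof of the Hilbert projection theorem;
  this replaces weak compactness.\<close>

lemma lipschitz_has_weak_grad:
  fixes \<Omega> :: "(real ^ 'n::finite) set"
  assumes \<Omega>: "open \<Omega>" "bounded \<Omega>" "\<Omega> \<noteq> {}" and lip: "\<And>x y. \<bar>u x - u y\<bar> \<le> L * norm (x - y)" and L: "L \<ge> 0"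
    and zero: "\<And>x. x \<notin> \<Omega> \<Longrightarrow> u x = 0"
  obtains g where "has_weak_grad \<Omega> u g" "g \<in> borel_measurable (lebesgue_on \<Omega>)" "AE x in lebesgue_on \<Omega>. norm (g x) \<le> L"
proof -
  let ?M = "lebesgue_on \<Omega>"
  have \<Omega>s: "\<Omega> \<in> sets lebesgue" using \<Omega>(1) by (simp add: borel_open)
  have fin: "finite_measure ?M"
    by (rule finite_measure_lebesgue_on[OF lmeasurable_open[OF \<Omega>(2,1)]])
  have uc: "continuous_on UNIV u"
  proof (rule continuous_onI)
    fix x and e :: real assume e: "e > 0"
    show "\<exists>d>0. \<forall>x'\<in>UNIV. dist x' x < d \<longrightarrow> dist (u x') (u x) \<le> e"
    proof (intro exI[of _ "e / (L + 1)"] conjI ballI impI)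
      show "e / (L + 1) > 0" using e L by simp
      fix x' assume "dist x' x < e / (L + 1)"
      then have "(L + 1) * norm (x' - x) < e" using L by (simp add: dist_norm field_simps)
      moreover have "L * norm (x' - x) \<le> (L + 1) * norm (x' - x)" by (intro mult_right_mono) auto
      ultimately show "dist (u x') (u x) \<le> e" using lip[of x' x] by (simp add: dist_real_def)
    qed
  qed
  \<comment> \<open>\<open>C n\<close> is the convex set of continuous gradients, bounded by L, of
    functions within 1/(n+1) of u. It is nonempty by mollification and decreases with n, so its
    infimal energy \<open>d n\<close> increases.\<close>
  define C where "C = (\<lambda>n::nat. {f. continuous_on UNIV f \<and> (\<forall>x. norm (f x) \<le> L) \<and>
     (\<exists>U. (\<forall>x. (U has_derivative (\<lambda>v. f x \<bullet> v)) (at x)) \<and> (\<forall>x. \<bar>U x - u x\<bar> \<le> 1 / real (Suc n)))})"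
  have CI: "f \<in> C n" if "continuous_on UNIV f" "\<And>x. norm (f x) \<le> L"
      "\<And>x. (U has_derivative (\<lambda>v. f x \<bullet> v)) (at x)" "\<And>x. \<bar>U x - u x\<bar> \<le> 1 / real (Suc n)" for f n U
    unfolding C_def using that by blast
  have Ccont: "continuous_on UNIV f" and Cle: "\<And>x. norm (f x) \<le> L" if "f \<in> C n" for f n
    using that unfolding C_def by blast+
  have Cne: "C n \<noteq> {}" for n
  proof -
    define \<epsilon> where "\<epsilon> = 1 / (real (Suc n) * (L + 1))"
    have \<epsilon>: "\<epsilon> > 0" using L by (simp add: \<epsilon>_def)
    have "L * \<epsilon> \<le> (L + 1) * \<epsilon>" using \<epsilon> by (intro mult_right_mono) auto
    also have "(L + 1) * \<epsilon> = 1 / real (Suc n)" using L by (simp add: \<epsilon>_def)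
    finally have L\<epsilon>: "L * \<epsilon> \<le> 1 / real (Suc n)" .
    obtain \<eta> :: "real ^ 'n \<Rightarrow> real" where \<eta>: "mollifier \<epsilon> \<eta>" using mollifier_exists[OF \<epsilon>] by blast
    have S: "compact (closure \<Omega>)" using \<Omega>(2) by simp
    have Sz: "\<And>x. x \<notin> closure \<Omega> \<Longrightarrow> u x = 0" using zero closure_subset[of \<Omega>] by blast
    have "mollify_grad \<eta> u \<in> C n"
    proof (rule CI)
      show "continuous_on UNIV (mollify_grad \<eta> u)" by (rule continuous_mollify_grad[OF uc S Sz \<eta>])
      show "norm (mollify_grad \<eta> u x) \<le> L" for x by (rule mollify_lipschitz_grad[OF uc S Sz \<eta> lip L])
      show "(mollify \<eta> u has_derivative (\<lambda>v. mollify_grad \<eta> u x \<bullet> v)) (at x)" for x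
        by (rule mollify_has_derivative[OF uc S Sz \<eta>])
      show "\<bar>mollify \<eta> u x - u x\<bar> \<le> 1 / real (Suc n)" for x
      proof (rule mollify_close[OF uc S Sz \<eta>])
        fix z :: "real ^ 'n" assume "norm z \<le> \<epsilon>"
        then have "L * norm z \<le> L * \<epsilon>" using L by (intro mult_left_mono) auto
        then show "\<bar>u (x + z) - u x\<bar> \<le> 1 / real (Suc n)" using lip[of "x + z" x] L\<epsilon> by simp
      qed
    qed
    then show ?thesis by blast
  qed
  have Cmono: "C m \<subseteq> C n" if "n \<le> m" for n m
  proof
    fix f assume f: "f \<in> C m"
    then obtain U where U: "\<And>x. (U has_derivative (\<lambda>v. f x \<bullet> v)) (at x)" "\<And>x. \<bar>U x - u x\<bar> \<le> 1 / real (Suc m)"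
      unfolding C_def by blast
    have "1 / real (Suc m) \<le> 1 / real (Suc n)" using that by (intro divide_left_mono) auto
    then show "f \<in> C n" by (intro CI[OF Ccont[OF f] Cle[OF f] U(1)] order_trans[OF U(2)])
  qed
  have Cmid: "(\<lambda>x. (1/2) *\<^sub>R (f x + h x)) \<in> C n" if f: "f \<in> C n" and h: "h \<in> C n" for f h n
  proof -
    obtain U where U: "\<And>x. (U has_derivative (\<lambda>v. f x \<bullet> v)) (at x)" "\<And>x. \<bar>U x - u x\<bar> \<le> 1 / real (Suc n)"
      using f unfolding C_def by blast
    obtain V where V: "\<And>x. (V has_derivative (\<lambda>v. h x \<bullet> v)) (at x)" "\<And>x. \<bar>V x - u x\<bar> \<le> 1 / real (Suc n)"
      using h unfolding C_def by blast
    show ?thesis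
    proof (rule CI)
      show "continuous_on UNIV (\<lambda>x. (1/2) *\<^sub>R (f x + h x))"
        using Ccont[OF f] Ccont[OF h] by (intro continuous_intros)
      show "norm ((1/2) *\<^sub>R (f x + h x)) \<le> L" for x
        using norm_triangle_ineq[of "f x" "h x"] Cle[OF f, of x] Cle[OF h, of x] by simp
      show "((\<lambda>x. (1/2) * (U x + V x)) has_derivative (\<lambda>v. (1/2) *\<^sub>R (f x + h x) \<bullet> v)) (at x)" for x
        using has_derivative_mult_right[OF has_derivative_add[OF U(1)[of x] V(1)[of x]], of "1/2"]
        by (simp add: inner_add_left)
      show "\<bar>(1/2) * (U x + V x) - u x\<bar> \<le> 1 / real (Suc n)" for x
      proof -
        have mid: "\<bar>(1/2) * (a + b) - c\<bar> \<le> e" if "\<bar>a - c\<bar> \<le> e" "\<bar>b - c\<bar> \<le> e" for a b c e :: real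
          using that by (auto simp: abs_le_iff field_simps)
        show ?thesis by (rule mid[OF U(2) V(2)])
      qed
    qed
  qed
  have meas: "f \<in> borel_measurable ?M" if "f \<in> C n" for f n
    by (rule measurable_lebesgue_on_continuous[OF \<Omega>(1)]) (rule continuous_on_subset[OF Ccont[OF that]], simp)
  have bint: "integrable ?M f" if "f \<in> borel_measurable ?M" "\<And>x. norm (f x) \<le> B" for f :: "real ^ 'n \<Rightarrow> real" and B
    by (rule finite_measure.integrable_const_bound[OF fin]) (use that in auto)
  define E where "E = (\<lambda>f :: real ^ 'n \<Rightarrow> real ^ 'n. \<integral>x. (norm (f x))\<^sup>2 \<partial>?M)"
  have int2: "integrable ?M (\<lambda>x. (norm (f x))\<^sup>2)" if "f \<in> C n" for f n
  proof (rule bint[where B="L\<^sup>2"])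
    show "(\<lambda>x. (norm (f x))\<^sup>2) \<in> borel_measurable ?M" using meas[OF that] by measurable
    show "norm ((norm (f x))\<^sup>2) \<le> L\<^sup>2" for x using Cle[OF that, of x] by (simp add: power_mono)
  qed
  have E0: "E f \<ge> 0" for f unfolding E_def by simp
  define d where "d = (\<lambda>n. Inf (E ` C n))"
  have bdd: "bdd_below (E ` C n)" for n using E0 by (intro bdd_belowI[of _ 0]) auto
  have d_le: "d n \<le> E f" if "f \<in> C n" for f n
    unfolding d_def by (rule cInf_lower[OF _ bdd]) (use that in auto)
  have dmono: "d n \<le> d m" if "n \<le> m" for n m
    unfolding d_def by (rule cInf_superset_mono) (use Cne Cmono[OF that] bdd in auto)
  have Ebound: "E f \<le> L\<^sup>2 * measure lebesgue \<Omega>" if "f \<in> C n" for f n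
  proof -
    have "E f \<le> (\<integral>x. L\<^sup>2 \<partial>?M)"
      unfolding E_def using Cle[OF that]
      by (intro integral_mono int2[OF that] finite_measure.integrable_const[OF fin]) (simp add: power_mono)
    also have "\<dots> = L\<^sup>2 * measure lebesgue \<Omega>"
      using \<Omega>s by (simp add: measure_restrict_space space_restrict_space)
    finally show ?thesis .
  qed
  have dub: "d n \<le> L\<^sup>2 * measure lebesgue \<Omega>" for n
  proof -
    obtain f where "f \<in> C n" using Cne by blast
    then show ?thesis using d_le Ebound order_trans by blast
  qed
  have "incseq d" using dmono by (auto simp: incseq_def)
  then obtain dl where dl: "d \<longlonglongrightarrow> dl" "\<And>n. d n \<le> dl"
    using incseq_convergent[of d "L\<^sup>2 * measure lebesgue \<Omega>"] dub by blast
  have "\<exists>f. f \<in> C n \<and> E f < d n + 1 / real (Suc n)" for n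
  proof -
    have "Inf (E ` C n) < d n + 1 / real (Suc n)" by (simp add: d_def)
    then show ?thesis using cInf_lessD[of "E ` C n"] Cne[of n] by blast
  qed
  then obtain f where fC: "\<And>n. f n \<in> C n" and fE: "\<And>n. E (f n) < d n + 1 / real (Suc n)" by metis
  \<comment> \<open>For n <= m the midpoint of \<open>f m\<close> and \<open>f n\<close> lies in
    \<open>C n\<close>, so the parallelogram law bounds the squared distance by 2 (d m + 1/(m+1)) +
    2 (d n + 1/(n+1)) - 4 d n, where \<open>d m\<close> is at most \<open>dl\<close>.\<close>
  define b where "b = (\<lambda>n. 2 * (dl - d n) + 4 * (1 / real (Suc n)))"
  have "(\<lambda>n. 1 / real (Suc n)) \<longlonglongrightarrow> 0" using LIMSEQ_inverse_real_of_nat by (simp add: inverse_eq_divide)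
  then have "b \<longlonglongrightarrow> 2 * (dl - dl) + 4 * 0"
    unfolding b_def by (intro tendsto_intros dl)
  then have b0: "b \<longlonglongrightarrow> 0" by simp
  have diff_le: "(\<integral>x. (norm (f m x - f n x))\<^sup>2 \<partial>?M) \<le> b n" if nm: "n \<le> m" for n m
  proof -
    have fm: "f m \<in> C n" using fC Cmono[OF nm] by blast
    let ?mid = "\<lambda>x. (1/2) *\<^sub>R (f m x + f n x)"
    have mid: "?mid \<in> C n" by (rule Cmid[OF fm fC])
    have "(norm (f m x - f n x))\<^sup>2 = 2 * (norm (f m x))\<^sup>2 + 2 * (norm (f n x))\<^sup>2 - 4 * (norm (?mid x))\<^sup>2" for x
      by (simp add: power2_norm_eq_inner inner_add inner_diff inner_commute field_simps)
    then have "(\<integral>x. (norm (f m x - f n x))\<^sup>2 \<partial>?M) = 2 * E (f m) + 2 * E (f n) - 4 * E ?mid"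
      unfolding E_def using int2[OF fm] int2[OF fC] int2[OF mid] by simp
    moreover have "1 / real (Suc m) \<le> 1 / real (Suc n)" using nm by (intro divide_left_mono) auto
    ultimately show ?thesis
      using fE[of m] fE[of n] d_le[OF mid] dl(2)[of m] unfolding b_def
      by (smt (verit))
  qed
  have "\<exists>N. \<forall>n\<ge>N. b n < (1/4) ^ k" for k :: nat
    using order_tendstoD(2)[OF b0, of "(1/4) ^ k"] by (simp add: eventually_sequentially)
  then obtain N where N: "\<And>k n. n \<ge> N k \<Longrightarrow> b n < (1/4) ^ k" by metis
  \<comment> \<open>Summing the thresholds makes \<open>s\<close> monotone with s k >= N k; the
    summand k also gives s k >= k, which puts \<open>F k\<close> into \<open>C k\<close>.
    Consecutive terms then differ by at most (1/4)^k in squared norm.\<close>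
  define s where "s = (\<lambda>k::nat. k + (\<Sum>j\<le>k. N j))"
  have sN: "s k \<ge> N k" for k
    using member_le_sum[of k "{..k}" N] by (simp add: s_def)
  have s_suc: "s k \<le> s (Suc k)" and s_ge: "k \<le> s k" for k by (simp_all add: s_def)
  define F where "F = (\<lambda>k. f (s k))"
  have FC: "F k \<in> C k" for k unfolding F_def using fC Cmono[OF s_ge] by blast
  define G where "G = (\<lambda>k x. norm (F (Suc k) x - F k x))"
  define \<mu> where "\<mu> = measure lebesgue \<Omega>"
  have Gm: "G k \<in> borel_measurable ?M" for k
    unfolding G_def using meas[OF FC[of k]] meas[OF FC[of "Suc k"]] by measurable
  have Gi: "integrable ?M (G k)" for k
  proof (rule bint[OF Gm])
    show "norm (G k x) \<le> 2 * L" for x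
      using norm_triangle_ineq4[of "F (Suc k) x" "F k x"] Cle[OF FC, of k x] Cle[OF FC, of "Suc k" x]
      by (simp add: G_def)
  qed
  have G2i: "integrable ?M (\<lambda>x. (G k x)\<^sup>2)" for k
  proof (rule bint[where B="(2 * L)\<^sup>2"])
    show "(\<lambda>x. (G k x)\<^sup>2) \<in> borel_measurable ?M" using Gm by measurable
    have "G k x \<le> 2 * L" "0 \<le> G k x" for x
      using norm_triangle_ineq4[of "F (Suc k) x" "F k x"] Cle[OF FC, of k x] Cle[OF FC, of "Suc k" x]
      by (simp_all add: G_def)
    then have "(G k x)\<^sup>2 \<le> (2 * L)\<^sup>2" for x by (intro power_mono)
    then show "norm ((G k x)\<^sup>2) \<le> (2 * L)\<^sup>2" for x by simp
  qed
  have G2: "(\<integral>x. (G k x)\<^sup>2 \<partial>?M) \<le> (1/4) ^ k" for k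
    using diff_le[OF s_suc[of k]] N[OF sN[of k]] unfolding G_def F_def by linarith
  \<comment> \<open>The inequality a <= 2^k a^2 + (1/2)^k trades the squared norm (1/4)^k for an L^1
    norm of order (1/2)^k on a set of finite measure. These are summable, which gives convergence of
    \<open>F\<close> almost everywhere.\<close>
  have Gint: "integral\<^sup>L ?M (G k) \<le> (1 + \<mu>) * (1/2) ^ k" for k
  proof -
    have "integral\<^sup>L ?M (G k) \<le> (\<integral>x. 2 ^ k * (G k x)\<^sup>2 + (1/2) ^ k \<partial>?M)"
    proof (rule integral_mono[OF Gi])
      show "integrable ?M (\<lambda>x. 2 ^ k * (G k x)\<^sup>2 + (1/2) ^ k)"
        using G2i finite_measure.integrable_const[OF fin, of "(1/2::real) ^ k"] by simp
      fix x
      define a where "a = G k x"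
      have a: "a \<ge> 0" by (simp add: a_def G_def)
      define t :: real where "t = 2 ^ k"
      have t: "t > 0" by (simp add: t_def)
      have "2 * (a * t) \<le> (a * t)\<^sup>2 + 1"
        using zero_le_power2[of "a * t - 1"] by (simp add: power2_diff)
      moreover have "a * t \<ge> 0" using a t by simp
      ultimately have "a * t \<le> (a * t)\<^sup>2 + 1" by linarith
      then have "a * t \<le> t * (t * a\<^sup>2 + 1 / t)" using t by (simp add: power2_eq_square algebra_simps)
      then have "a \<le> t * a\<^sup>2 + 1 / t" using t by (simp add: mult.commute[of a])
      then show "G k x \<le> 2 ^ k * (G k x)\<^sup>2 + (1/2) ^ k" by (simp add: a_def t_def power_one_over)
    qed
    also have "\<dots> = 2 ^ k * (\<integral>x. (G k x)\<^sup>2 \<partial>?M) + (1/2) ^ k * \<mu>"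
      using G2i finite_measure.integrable_const[OF fin, of "(1/2::real) ^ k"] \<Omega>s
      by (simp add: \<mu>_def measure_restrict_space space_restrict_space)
    also have "\<dots> \<le> 2 ^ k * (1/4) ^ k + (1/2) ^ k * \<mu>" using G2 by simp
    also have "2 ^ k * (1/4) ^ k = (1/2::real) ^ k" by (simp flip: power_mult_distrib)
    finally show ?thesis by (simp add: algebra_simps)
  qed
  have "AE x in ?M. summable (\<lambda>k. G k x)"
  proof (rule AE_summable_of_integrals[OF Gi])
    show "G k x \<ge> 0" for k x by (simp add: G_def)
    show "summable (\<lambda>k. integral\<^sup>L ?M (G k))"
    proof (rule summable_comparison_test')
      show "summable (\<lambda>k. (1 + \<mu>) * (1/2) ^ k)" by (intro summable_mult summable_geometric) simp
      show "norm (integral\<^sup>L ?M (G k)) \<le> (1 + \<mu>) * (1/2) ^ k" for k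
        using Gint[of k] by (simp add: G_def)
    qed
  qed
  then have Fconv: "AE x in ?M. convergent (\<lambda>k. F k x)"
    by eventually_elim (simp add: G_def convergent_of_summable_diff)
  define g where "g = (\<lambda>x. lim (\<lambda>k. F k x))"
  have gm: "g \<in> borel_measurable ?M"
    unfolding g_def by (intro borel_measurable_lim_metric meas[OF FC])
  have Fg: "AE x in ?M. (\<lambda>k. F k x) \<longlonglongrightarrow> g x"
    using Fconv by eventually_elim (simp add: g_def convergent_LIMSEQ_iff)
  have gL: "AE x in ?M. norm (g x) \<le> L"
    using Fg
  proof eventually_elim
    case (elim x)
    show ?case by (rule LIMSEQ_le_const2[OF tendsto_norm[OF elim]]) (use Cle[OF FC] in auto)
  qed
  have "\<exists>U. (\<forall>x. (U has_derivative (\<lambda>v. F k x \<bullet> v)) (at x)) \<and> (\<forall>x. \<bar>U x - u x\<bar> \<le> 1 / real (Suc k))" for k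
    using FC[of k] unfolding C_def by blast
  then obtain U where U: "\<And>k x. (U k has_derivative (\<lambda>v. F k x \<bullet> v)) (at x)" "\<And>k x. \<bar>U k x - u x\<bar> \<le> 1 / real (Suc k)"
    by metis
  have Ulim: "(\<lambda>k. U k x) \<longlonglongrightarrow> u x" for x
  proof -
    have "(\<lambda>k. U k x - u x) \<longlonglongrightarrow> 0"
      by (rule Lim_null_comparison[OF always_eventually[OF allI] \<open>(\<lambda>n. 1 / real (Suc n)) \<longlonglongrightarrow> 0\<close>])
         (use U(2) in auto)
    then show ?thesis by (simp add: LIM_zero_iff)
  qed
  have Uc: "continuous_on UNIV (U k)" for k
    using U(1) by (intro continuous_at_imp_continuous_on ballI) (rule has_derivative_continuous)
  obtain B where B: "\<And>x. x \<in> closure \<Omega> \<Longrightarrow> \<bar>u x\<bar> \<le> B"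
    using compact_imp_bounded[OF compact_continuous_image[OF continuous_on_subset[OF uc], of "closure \<Omega>"]] \<Omega>(2)
    by (auto simp: bounded_iff)
  have wgk: "has_weak_grad \<Omega> (U k) (F k)" for k
    by (rule has_weak_grad_C1[OF \<Omega>(1) U(1) Ccont[OF FC]])
  have gint: "integrable ?M g"
    by (rule finite_measure.integrable_const_bound[OF fin gL gm])
  \<comment> \<open>The identity for \<open>U k\<close> and \<open>F k\<close> passes to the limit
    by dominated convergence, with \<open>U k\<close> converging uniformly and \<open>F k\<close>
    almost everywhere under the bound L.\<close>
  have "has_weak_grad \<Omega> u g"
    unfolding has_weak_grad_def
  proof (intro conjI allI impI)
    fix K assume K: "compact K" "K \<subseteq> \<Omega>"
    show "u absolutely_integrable_on K"
      by (rule absolutely_integrable_continuous_compact[OF K(1) continuous_on_subset[OF uc]]) simp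
    have "set_integrable lebesgue \<Omega> g"
      using gint \<Omega>s by (simp add: set_integrable_def integrable_restrict_space)
    then show "g absolutely_integrable_on K"
      by (rule set_integrable_subset) (use K in \<open>auto simp: borel_compact\<close>)
  next
    fix \<phi> i assume \<phi>: "test_function \<Omega> \<phi>"
    obtain K where K: "compact K" "K \<subseteq> \<Omega>" "\<And>x. x \<notin> K \<Longrightarrow> \<phi> x = 0" "\<And>x. x \<notin> K \<Longrightarrow> grad \<phi> x = 0"
      using test_function_props[OF \<phi>] by blast
    have cp: "continuous_on UNIV (partial i \<phi>)"
      by (rule smooth_on_continuous[OF smooth_on_partial[OF test_function_smooth[OF \<phi>]]])
    have c\<phi>: "continuous_on UNIV \<phi>" by (rule test_function_continuous[OF \<phi>])
    have bd: "\<exists>B. \<forall>x. \<bar>h x\<bar> \<le> B" if "continuous_on UNIV h" "\<And>x. x \<notin> K \<Longrightarrow> h x = 0" for h :: "real ^ 'n \<Rightarrow> real"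
    proof -
      have "bounded (h ` K)" using compact_continuous_image[OF continuous_on_subset[OF that(1)] K(1)] compact_imp_bounded by auto
      then obtain B where B: "B > 0" "\<And>x. x \<in> K \<Longrightarrow> \<bar>h x\<bar> \<le> B" by (auto simp: bounded_pos)
      then have "\<bar>h x\<bar> \<le> B" for x using that(2)[of x] by (cases "x \<in> K") auto
      then show ?thesis by blast
    qed
    obtain B1 where B1: "\<And>x. \<bar>partial i \<phi> x\<bar> \<le> B1" using bd[OF cp] K(4) by (auto simp: partial_eq_grad)
    obtain B2 where B2: "\<And>x. \<bar>\<phi> x\<bar> \<le> B2" using bd[OF c\<phi> K(3)] by blast
    have cm: "h \<in> borel_measurable ?M" if "continuous_on UNIV h" for h :: "real ^ 'n \<Rightarrow> real"
      by (rule measurable_lebesgue_on_continuous[OF \<Omega>(1) continuous_on_subset[OF that]]) simp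
    have l1: "(\<lambda>k. \<integral>x. U k x * partial i \<phi> x \<partial>?M) \<longlonglongrightarrow> (\<integral>x. u x * partial i \<phi> x \<partial>?M)"
    proof (rule integral_dominated_convergence[where w="\<lambda>x. (B + 1) * B1"])
      show "integrable ?M (\<lambda>x. (B + 1) * B1)" by (rule finite_measure.integrable_const[OF fin])
      show "(\<lambda>x. u x * partial i \<phi> x) \<in> borel_measurable ?M" "(\<lambda>x. U k x * partial i \<phi> x) \<in> borel_measurable ?M" for k
        by (intro cm continuous_on_mult uc cp Uc)+
      show "AE x in ?M. (\<lambda>k. U k x * partial i \<phi> x) \<longlonglongrightarrow> u x * partial i \<phi> x"
        by (intro AE_I2 tendsto_mult Ulim tendsto_const)
      show "AE x in ?M. norm (U k x * partial i \<phi> x) \<le> (B + 1) * B1" for k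
      proof (rule AE_I2)
        fix x assume "x \<in> space ?M"
        then have "x \<in> closure \<Omega>" using closure_subset[of \<Omega>] by (auto simp: space_restrict_space)
        moreover have "1 / real (Suc k) \<le> 1" by simp
        ultimately have "\<bar>U k x\<bar> \<le> B + 1" using B[of x] U(2)[of k x] by (smt (verit))
        then show "norm (U k x * partial i \<phi> x) \<le> (B + 1) * B1"
          unfolding real_norm_def abs_mult using B1[of x] by (intro mult_mono) auto
      qed
    qed
    have l2: "(\<lambda>k. \<integral>x. F k x $ i * \<phi> x \<partial>?M) \<longlonglongrightarrow> (\<integral>x. g x $ i * \<phi> x \<partial>?M)"
    proof (rule integral_dominated_convergence[where w="\<lambda>x. L * B2"])
      show "integrable ?M (\<lambda>x. L * B2)" by (rule finite_measure.integrable_const[OF fin])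
      have vm: "(\<lambda>x. h x $ i * \<phi> x) \<in> borel_measurable ?M" if "h \<in> borel_measurable ?M" for h :: "real ^ 'n \<Rightarrow> real ^ 'n"
      proof -
        have "(\<lambda>x. h x \<bullet> axis i 1) \<in> borel_measurable ?M" using that by (intro borel_measurable_inner borel_measurable_const)
        then show ?thesis using cm[OF c\<phi>] by (simp add: cart_eq_inner_axis)
      qed
      show "(\<lambda>x. g x $ i * \<phi> x) \<in> borel_measurable ?M" "(\<lambda>x. F k x $ i * \<phi> x) \<in> borel_measurable ?M" for k
        by (rule vm[OF gm] vm[OF meas[OF FC]])+
      show "AE x in ?M. (\<lambda>k. F k x $ i * \<phi> x) \<longlonglongrightarrow> g x $ i * \<phi> x"
        using Fg by eventually_elim (intro tendsto_intros)
      show "AE x in ?M. norm (F k x $ i * \<phi> x) \<le> L * B2" for k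
      proof (rule AE_I2)
        fix x
        have "\<bar>F k x $ i\<bar> \<le> L" using component_le_norm_cart[of "F k x" i] Cle[OF FC, of k x] by linarith
        then show "norm (F k x $ i * \<phi> x) \<le> L * B2"
          unfolding real_norm_def abs_mult using B2[of x] L by (intro mult_mono) auto
      qed
    qed
    have "(\<lambda>k. \<integral>x. U k x * partial i \<phi> x \<partial>?M) \<longlonglongrightarrow> - (\<integral>x. g x $ i * \<phi> x \<partial>?M)"
      unfolding has_weak_gradD(3)[OF wgk \<phi>] by (intro tendsto_minus l2)
    then show "(\<integral>x. u x * partial i \<phi> x \<partial>?M) = - (\<integral>x. g x $ i * \<phi> x \<partial>?M)"
      using LIMSEQ_unique[OF l1] by blast
  qed
  then show thesis using that gm gL by blast
qed

section \<open>Competitors above extremals\<close>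

text \<open>The i-th component of |grad P|^(p-2) grad P. The power is put on the squared norm, which
  is a smooth function, so smoothness of the flux holds wherever the gradient does not
  vanish.\<close>

definition p_flux :: "real \<Rightarrow> (real ^ 'n::finite \<Rightarrow> real) \<Rightarrow> 'n \<Rightarrow> real ^ 'n \<Rightarrow> real" where
  "p_flux p P i x = (grad P x \<bullet> grad P x) powr ((p - 2) / 2) * partial i P x"

definition p_laplacian :: "real \<Rightarrow> (real ^ 'n::finite \<Rightarrow> real) \<Rightarrow> real ^ 'n \<Rightarrow> real" where
  "p_laplacian p P x = (\<Sum>i\<in>UNIV. partial i (p_flux p P i) x)"

lemma smooth_on_grad_sq: "open S \<Longrightarrow> smooth_on S P \<Longrightarrow> smooth_on S (\<lambda>x. grad P x \<bullet> grad P x)"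
  unfolding inner_vec_def inner_real_def partial_eq_grad[symmetric]
  by (intro smooth_on_sum smooth_on_mult smooth_on_partial) auto

lemma smooth_on_p_flux:
  assumes "open S" "smooth_on S P" "\<And>x. x \<in> S \<Longrightarrow> grad P x \<noteq> 0"
  shows "smooth_on S (p_flux p P i)"
  unfolding p_flux_def[abs_def]
  by (intro smooth_on_mult smooth_on_powr smooth_on_grad_sq smooth_on_partial assms) (use assms(3) in auto)

lemma continuous_p_laplacian:
  assumes "open S" "smooth_on S P" "\<And>x. x \<in> S \<Longrightarrow> grad P x \<noteq> 0"
  shows "continuous_on S (p_laplacian p P)"
  unfolding p_laplacian_def[abs_def]
  by (intro continuous_on_sum smooth_on_continuous smooth_on_partial smooth_on_p_flux assms)

text \<open>After the product and chain rules, splitting off |grad P|^(p-4) exhibits the infinity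
  Laplacian with the factor p - 2. Where it is nonzero, its sign decides that of the p-Laplacian for
  large p.\<close>

lemma p_laplacian_eq:
  fixes P :: "real ^ 'n::finite \<Rightarrow> real"
  assumes P: "smooth_on UNIV P" and nz: "grad P x \<noteq> 0"
  shows "p_laplacian p P x = (grad P x \<bullet> grad P x) powr ((p - 4) / 2) *
     ((p - 2) * inf_laplacian P x + (grad P x \<bullet> grad P x) * (\<Sum>i\<in>UNIV. partial i (partial i P) x))"
proof -
  define n where "n = (\<lambda>x. grad P x \<bullet> grad P x)"
  have n0: "n x > 0" using nz by (simp add: n_def)
  have dP: "(partial i P has_derivative (\<lambda>v. grad (partial i P) x \<bullet> v)) (at x)" for i
    by (rule smooth_on_has_derivative[OF smooth_on_partial[OF P] UNIV_I])
  have n_eq: "n = (\<lambda>x. \<Sum>j\<in>UNIV. partial j P x * partial j P x)"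
    by (simp add: n_def fun_eq_iff inner_vec_def partial_eq_grad)
  have dn: "(n has_derivative (\<lambda>v. \<Sum>j\<in>UNIV. partial j P x * (grad (partial j P) x \<bullet> v) + (grad (partial j P) x \<bullet> v) * partial j P x)) (at x)"
    unfolding n_eq by (intro has_derivative_sum has_derivative_mult dP)
  have dpow: "((\<lambda>x. n x powr ((p - 2) / 2)) has_derivative (\<lambda>v. (\<Sum>j\<in>UNIV. partial j P x * (grad (partial j P) x \<bullet> v) + (grad (partial j P) x \<bullet> v) * partial j P x) *
      ((p - 2) / 2 * n x powr ((p - 2) / 2 - 1)))) (at x)"
    by (rule DERIV_compose_FDERIV[OF has_real_derivative_powr[OF n0] dn])
  have flux: "partial i (p_flux p P i) x = n x powr ((p - 2) / 2) * partial i (partial i P) x +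
      (p - 2) * n x powr ((p - 4) / 2) * (\<Sum>j\<in>UNIV. partial j P x * partial i (partial j P) x * partial i P x)" for i
  proof -
    have "p_flux p P i = (\<lambda>x. n x powr ((p - 2) / 2) * partial i P x)"
      by (simp add: fun_eq_iff p_flux_def n_def)
    then have "partial i (p_flux p P i) x = n x powr ((p - 2) / 2) * (grad (partial i P) x \<bullet> axis i 1) +
        (\<Sum>j\<in>UNIV. partial j P x * (grad (partial j P) x \<bullet> axis i 1) + (grad (partial j P) x \<bullet> axis i 1) * partial j P x) *
        ((p - 2) / 2 * n x powr ((p - 2) / 2 - 1)) * partial i P x"
      using partial_eqI[OF has_derivative_mult[OF dpow dP]] by simp
    also have "\<dots> = n x powr ((p - 2) / 2) * partial i (partial i P) x +
        (\<Sum>j\<in>UNIV. 2 * (partial j P x * partial i (partial j P) x)) * ((p - 2) / 2 * n x powr ((p - 2) / 2 - 1)) * partial i P x"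
      by (simp add: inner_axis partial_eq_grad algebra_simps)
    also have "(p - 2) / 2 - 1 = (p - 4) / 2" by (simp add: field_simps)
    finally have *: "partial i (p_flux p P i) x = n x powr ((p - 2) / 2) * partial i (partial i P) x +
        (\<Sum>j\<in>UNIV. 2 * (partial j P x * partial i (partial j P) x)) * ((p - 2) / 2 * n x powr ((p - 4) / 2)) * partial i P x" .
    define S where "S = (\<Sum>j\<in>UNIV. partial j P x * partial i (partial j P) x)"
    have "(\<Sum>j\<in>UNIV. 2 * (partial j P x * partial i (partial j P) x)) = 2 * S"
      by (simp add: S_def sum_distrib_left)
    moreover have "(\<Sum>j\<in>UNIV. partial j P x * partial i (partial j P) x * partial i P x) = S * partial i P x"
      by (simp add: S_def sum_distrib_right)
    ultimately show ?thesis using * by (simp add: mult.assoc mult.left_commute)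
  qed
  have pw: "n x powr ((p - 2) / 2) = n x powr ((p - 4) / 2) * n x"
  proof -
    have "n x powr ((p - 4) / 2) * n x = n x powr ((p - 4) / 2) * n x powr 1" using n0 by simp
    also have "\<dots> = n x powr ((p - 4) / 2 + 1)" by (rule powr_add[symmetric])
    also have "(p - 4) / 2 + 1 = (p - 2) / 2" by (simp add: field_simps)
    finally show ?thesis by simp
  qed
  have il: "inf_laplacian P x = (\<Sum>i\<in>UNIV. \<Sum>j\<in>UNIV. partial j P x * partial i (partial j P) x * partial i P x)"
    unfolding inf_laplacian_def by (subst sum.swap) (simp add: mult_ac)
  define A where "A = n x powr ((p - 4) / 2)"
  define S where "S = (\<lambda>i. \<Sum>j\<in>UNIV. partial j P x * partial i (partial j P) x * partial i P x)"
  have "p_laplacian p P x = (\<Sum>i\<in>UNIV. (A * n x) * partial i (partial i P) x + ((p - 2) * A) * S i)"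
    unfolding p_laplacian_def flux pw A_def S_def ..
  also have "\<dots> = (A * n x) * (\<Sum>i\<in>UNIV. partial i (partial i P) x) + ((p - 2) * A) * (\<Sum>i\<in>UNIV. S i)"
    by (simp only: sum.distrib sum_distrib_left)
  also have "\<dots> = A * ((p - 2) * (\<Sum>i\<in>UNIV. S i) + n x * (\<Sum>i\<in>UNIV. partial i (partial i P) x))"
    by (simp only: algebra_simps)
  finally show ?thesis by (simp only: il S_def A_def n_def)
qed

text \<open>The ball and the complement of the concentric closed ball of half the radius are open
  and cover the space, and on their overlap the function is 0.\<close>

lemma smooth_zero_ext_ball:
  fixes f :: "real ^ 'n::finite \<Rightarrow> real"
  assumes f: "smooth_on (ball x0 r) f" and r: "0 < r" and z: "\<And>x. x \<in> ball x0 r \<Longrightarrow> r / 2 \<le> norm (x - x0) \<Longrightarrow> f x = 0"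
  shows "smooth_on UNIV (\<lambda>x. if x \<in> ball x0 r then f x else 0)"
proof -
  let ?g = "\<lambda>x. if x \<in> ball x0 r then f x else 0"
  have "smooth_on (ball x0 r \<union> - cball x0 (r / 2)) ?g"
  proof (rule smooth_on_Un)
    show "smooth_on (ball x0 r) ?g" by (rule smooth_on_cong[OF _ _ f]) auto
    show "smooth_on (- cball x0 (r / 2)) ?g"
      by (rule smooth_on_cong[OF _ _ smooth_on_const[of _ 0]]) (use z in \<open>auto simp: dist_norm norm_minus_commute\<close>)
  qed (auto simp: open_Compl)
  moreover have "ball x0 r \<union> - cball x0 (r / 2) = UNIV" using r by auto
  ultimately show ?thesis by simp
qed

lemma integral_cball_lower_bound:
  fixes h :: "real ^ 'n::finite \<Rightarrow> real"
  assumes h: "integrable lborel h" "\<And>x. h x \<ge> 0" and c: "\<And>x. x \<in> cball x0 \<rho> \<Longrightarrow> h x \<ge> c"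
  shows "c * measure lebesgue (cball x0 \<rho>) \<le> integral\<^sup>L lborel h"
proof -
  have m: "measure lebesgue (cball x0 \<rho>) = measure lborel (cball x0 \<rho>)" by (simp add: measure_completion)
  have f: "emeasure lborel (cball x0 \<rho>) < \<infinity>" by (rule emeasure_bounded_finite[OF bounded_cball])
  have i: "integrable lborel (\<lambda>x. c * indicator (cball x0 \<rho>) x)"
    using f by (intro integrable_mult_right integrable_real_indicator) auto
  have "c * measure lborel (cball x0 \<rho>) = (\<integral>x. c * indicator (cball x0 \<rho>) x \<partial>lborel)" by simp
  also have "\<dots> \<le> integral\<^sup>L lborel h"
    using c h(2) by (intro integral_mono i h(1)) (auto simp: indicator_def)
  finally show ?thesis by (simp add: m)
qed

text \<open>Raising \<open>\<phi>\<close> towards a strict \<open>p\<close>-subsolution \<open>P\<close> by a smooth version of \<open>max \<phi> P\<close>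
  lowers the \<open>p\<close>-energy; convexity of \<open>v \<mapsto> |v|\<^sup>p\<close> is used once for the competitor and
  once, as a tangent inequality, to bring in the \<open>p\<close>-Laplacian of \<open>P\<close>.\<close>

lemma subsolution_competitor:
  fixes \<Omega> :: "(real ^ 'n::finite) set"
  assumes \<Omega>: "open \<Omega>" and \<phi>: "test_function \<Omega> \<phi>" and P: "smooth_on UNIV P"
    and r: "0 < r" "cball x0 r \<subseteq> \<Omega>" and p: "p \<ge> 1"
    and nz: "\<And>x. x \<in> ball x0 r \<Longrightarrow> grad P x \<noteq> 0" and pl: "\<And>x. x \<in> ball x0 r \<Longrightarrow> p_laplacian p P x \<ge> 0"
    and ann: "\<And>x. x \<in> ball x0 r \<Longrightarrow> r / 2 \<le> norm (x - x0) \<Longrightarrow> P x \<le> \<phi> x"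
    and \<rho>: "\<rho> \<le> r / 2" and c: "c1 \<ge> 0" "c2 \<ge> 0" "\<And>x. x \<in> cball x0 \<rho> \<Longrightarrow> p_laplacian p P x \<ge> c1"
       "\<And>x. x \<in> cball x0 \<rho> \<Longrightarrow> softplus 1 (P x - \<phi> x) \<ge> c2"
  obtains w where "test_function \<Omega> w" "\<And>x. \<phi> x \<le> w x"
    "Lnorm (ereal p) \<Omega> (grad w) powr p \<le> Lnorm (ereal p) \<Omega> (grad \<phi>) powr p - p * (c1 * c2 * measure lebesgue (cball x0 \<rho>))"
proof -
  let ?B = "ball x0 r"
  have p0: "p > 0" using p by simp
  \<comment> \<open>\<Psi> is the increment from \<phi> to the competitor w. By \<open>ann\<close>
    it vanishes on the outer half of the ball, so the extension by 0 is smooth; \<open>a\<close> is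
    the slope factor in its gradient.\<close>
  define \<Psi> where "\<Psi> = (\<lambda>x. if x \<in> ?B then softplus 1 (P x - \<phi> x) else 0)"
  define a where "a = (\<lambda>x. if x \<in> ?B then softplus' 1 (P x - \<phi> x) else 0)"
  define w where "w = (\<lambda>x. \<phi> x + \<Psi> x)"
  have smB: "smooth_on ?B P" "smooth_on ?B \<phi>"
    using smooth_on_subset[OF P] smooth_on_subset[OF test_function_smooth[OF \<phi>]] by auto
  have sm\<Psi>: "smooth_on UNIV \<Psi>"
    unfolding \<Psi>_def
  proof (rule smooth_zero_ext_ball[OF _ r(1)])
    show "smooth_on ?B (\<lambda>x. softplus 1 (P x - \<phi> x))"
      by (intro smooth_on_softplus smooth_on_diff smB) auto
    show "softplus 1 (P x - \<phi> x) = 0" if "x \<in> ?B" "r / 2 \<le> norm (x - x0)" for x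
      using ann[OF that] by simp
  qed
  have \<Psi>0: "\<Psi> x = 0" if "x \<notin> cball x0 (r / 2)" for x
    using ann[of x] that by (auto simp: \<Psi>_def dist_norm norm_minus_commute)
  have \<Psi>nn: "\<Psi> x \<ge> 0" for x by (simp add: \<Psi>_def softplus_nonneg)
  have sub: "cball x0 (r / 2) \<subseteq> \<Omega>" using r by auto
  have subB: "cball x0 (r / 2) \<subseteq> ?B" using r by auto
  have test\<Psi>: "test_function \<Omega> \<Psi>" by (rule test_functionI[OF sm\<Psi> compact_cball sub \<Psi>0])
  have testw: "test_function \<Omega> w"
  proof -
    have "test_function \<Omega> (\<lambda>x. \<phi> x - (-1) * \<Psi> x)" by (rule test_function_diff[OF \<phi> test_function_cmult[OF test\<Psi>]])
    then show ?thesis by (simp add: w_def)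
  qed
  have grad\<Psi>: "grad \<Psi> x = a x *\<^sub>R (grad P x - grad \<phi> x)" for x
  proof (cases "x \<in> ?B")
    case True
    have "((\<lambda>x. P x - \<phi> x) has_derivative (\<lambda>v. (grad P x - grad \<phi> x) \<bullet> v)) (at x)"
      using has_derivative_diff[OF smooth_on_has_derivative[OF P UNIV_I, of x] test_function_has_derivative[OF \<phi>, of x]]
      by (simp add: inner_diff_left)
    from DERIV_compose_FDERIV[OF softplus_DERIV[OF zero_less_one] this]
    have "((\<lambda>x. softplus 1 (P x - \<phi> x)) has_derivative (\<lambda>v. (a x *\<^sub>R (grad P x - grad \<phi> x)) \<bullet> v)) (at x)"
      using True by (simp add: a_def mult.commute)
    then have "(\<Psi> has_derivative (\<lambda>v. (a x *\<^sub>R (grad P x - grad \<phi> x)) \<bullet> v)) (at x)"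
      by (rule has_derivative_transform_within_open[where s="?B"]) (use True in \<open>auto simp: \<Psi>_def\<close>)
    then show ?thesis by (rule grad_eqI)
  next
    case False
    then have x: "x \<in> - cball x0 (r / 2)" using subB by auto
    have "(\<Psi> has_derivative (\<lambda>v. 0 \<bullet> v)) (at x)"
      by (rule has_derivative_transform_within_open[where s="- cball x0 (r / 2)" and f="\<lambda>x. 0"])
         (use x \<Psi>0 in \<open>auto simp: open_Compl\<close>)
    then show ?thesis using False by (simp add: a_def grad_eqI)
  qed
  have a01: "0 \<le> a x" "a x \<le> 1" for x
    using softplus'_nonneg[of 1] softplus'_le_1[of 1] by (simp_all add: a_def)
  \<comment> \<open>As \<open>a\<close> lies between 0 and 1, the gradient of w is a pointwise
    convex combination of the gradients of \<phi> and P.\<close>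
  have gradw: "grad w x = (1 - a x) *\<^sub>R grad \<phi> x + a x *\<^sub>R grad P x" for x
  proof -
    have "grad w x = grad \<phi> x + grad \<Psi> x"
      unfolding w_def
      by (rule grad_eqI) (use has_derivative_add[OF test_function_has_derivative[OF \<phi>, of x] test_function_has_derivative[OF test\<Psi>, of x]]
          in \<open>simp add: inner_add_left\<close>)
    then show ?thesis by (simp add: grad\<Psi> algebra_simps)
  qed
  \<comment> \<open>The flux of P times \<Psi> has compact support, so its divergence integrates to
    0. Expanded, this says that the integral of flux times grad \<Psi> is minus the integral of
    \<Psi> times the p-Laplacian of P.\<close>
  define Y where "Y = (\<lambda>i x. if x \<in> ?B then p_flux p P i x * \<Psi> x else 0)"
  have smY: "smooth_on UNIV (Y i)" for i
    unfolding Y_def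
  proof (rule smooth_zero_ext_ball[OF _ r(1)])
    show "smooth_on ?B (\<lambda>x. p_flux p P i x * \<Psi> x)"
      by (intro smooth_on_mult smooth_on_p_flux smB nz smooth_on_subset[OF sm\<Psi>]) auto
    show "p_flux p P i x * \<Psi> x = 0" if "x \<in> ?B" "r / 2 \<le> norm (x - x0)" for x
      using ann[OF that] that by (simp add: \<Psi>_def)
  qed
  have Y0: "Y i x = 0" if "x \<notin> cball x0 (r / 2)" for i x using \<Psi>0[OF that] by (simp add: Y_def)
  have testY: "test_function \<Omega> (Y i)" for i by (rule test_functionI[OF smY compact_cball sub Y0])
  have cY: "continuous_on UNIV (partial i (Y i))" for i by (rule smooth_on_continuous[OF smooth_on_partial[OF smY]])
  have "integral\<^sup>L lborel (partial i (Y i)) = 0" for i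
  proof (rule integral_directional_derivative[OF _ smooth_on_continuous[OF smY] cY compact_cball Y0])
    show "((\<lambda>t. Y i (x + t *\<^sub>R axis i 1)) has_real_derivative partial i (Y i) x) (at 0)" for x
      using has_derivative_along_line[OF test_function_has_derivative[OF testY[of i], of x], of "axis i 1"]
      by (simp add: inner_axis partial_eq_grad)
  qed
  moreover have Yint: "integrable lborel (partial i (Y i))" for i
  proof (rule continuous_compact_support_integrable[OF cY compact_cball[of x0 "r/2"]])
    fix x assume x: "x \<notin> cball x0 (r / 2)"
    have "((\<lambda>t. Y i (x + t *\<^sub>R axis i 1)) has_real_derivative partial i (Y i) x) (at 0)"
      using has_derivative_along_line[OF test_function_has_derivative[OF testY[of i], of x], of "axis i 1"]
      by (simp add: inner_axis partial_eq_grad)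
    then show "partial i (Y i) x = 0"
      using zero_outside_closed_derivative[of "cball x0 (r / 2)" "Y i" x "axis i 1" "partial i (Y i)"] Y0 x by simp
  qed
  ultimately have divY0: "(\<integral>x. (\<Sum>i\<in>UNIV. partial i (Y i) x) \<partial>lborel) = 0" by simp
  define h where "h = (\<lambda>x. if x \<in> ?B then \<Psi> x * p_laplacian p P x else 0)"
  define X where "X = (\<lambda>x. if x \<in> ?B then \<Sum>i\<in>UNIV. p_flux p P i x * partial i \<Psi> x else 0)"
  have divY: "(\<Sum>i\<in>UNIV. partial i (Y i) x) = X x + h x" for x
  proof (cases "x \<in> ?B")
    case True
    have "partial i (Y i) x = p_flux p P i x * partial i \<Psi> x + partial i (p_flux p P i) x * \<Psi> x" for i
    proof -
      have "partial i (Y i) x = partial i (\<lambda>x. p_flux p P i x * \<Psi> x) x"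
        by (rule partial_cong_open[of ?B]) (use True in \<open>auto simp: Y_def\<close>)
      moreover have "(p_flux p P i has_derivative (\<lambda>v. grad (p_flux p P i) x \<bullet> v)) (at x)"
        by (rule smooth_on_has_derivative[OF smooth_on_p_flux[OF open_ball smB(1) nz] True])
      ultimately show ?thesis
        using partial_eqI[OF has_derivative_mult[OF _ test_function_has_derivative[OF test\<Psi>]]]
        by (simp add: inner_axis partial_eq_grad)
    qed
    then show ?thesis using True by (simp add: X_def h_def p_laplacian_def sum.distrib sum_distrib_left mult.commute)
  next
    case False
    then have x: "x \<in> - cball x0 (r / 2)" using subB by auto
    have "partial i (Y i) x = 0" for i
      using partial_cong_open[of "- cball x0 (r / 2)" x "Y i" "\<lambda>x. 0" i] x Y0 partial_eqI[OF has_derivative_const, of i 0 x]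
      by (simp add: open_Compl)
    then show ?thesis using False by (simp add: X_def h_def)
  qed
  have hnn: "h x \<ge> 0" for x using pl[of x] \<Psi>nn by (simp add: h_def)
  have contB: "continuous_on UNIV (\<lambda>x. if x \<in> ?B then \<Psi> x * k x else 0)" if "continuous_on ?B k" for k
  proof -
    have "continuous_on (?B \<union> - cball x0 (r / 2)) (\<lambda>x. if x \<in> ?B then \<Psi> x * k x else 0)"
    proof (rule continuous_on_open_Un)
      show "continuous_on ?B (\<lambda>x. if x \<in> ?B then \<Psi> x * k x else 0)"
        by (rule continuous_on_eq[OF continuous_on_mult[OF test_function_continuous[OF test\<Psi>] that]]) auto
      show "continuous_on (- cball x0 (r / 2)) (\<lambda>x. if x \<in> ?B then \<Psi> x * k x else 0)"
        by (rule continuous_on_eq[of _ "\<lambda>x. 0"]) (use \<Psi>0 in auto)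
    qed (auto simp: open_Compl)
    moreover have "?B \<union> - cball x0 (r / 2) = UNIV" using subB by auto
    ultimately show ?thesis by simp
  qed
  have hc: "continuous_on UNIV h"
    unfolding h_def by (rule contB[OF continuous_p_laplacian[OF open_ball smB(1) nz]])
  have hint: "integrable lborel h"
    by (rule continuous_compact_support_integrable[OF hc compact_cball[of x0 "r/2"]]) (simp add: h_def \<Psi>0)
  have Xeq: "X = (\<lambda>x. (\<Sum>i\<in>UNIV. partial i (Y i) x) - h x)" using divY by (simp add: fun_eq_iff)
  have Xint: "integrable lborel X" unfolding Xeq using Yint hint by simp
  have "integral\<^sup>L lborel X = - integral\<^sup>L lborel h" unfolding Xeq using Yint hint divY0 by simp
  moreover have "c1 * c2 * measure lebesgue (cball x0 \<rho>) \<le> integral\<^sup>L lborel h"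
  proof (rule integral_cball_lower_bound[OF hint hnn])
    fix x assume x: "x \<in> cball x0 \<rho>"
    then have "x \<in> cball x0 (r / 2)" using \<rho> by auto
    then have "x \<in> ?B" using subB by blast
    then have "h x = softplus 1 (P x - \<phi> x) * p_laplacian p P x" by (simp add: h_def \<Psi>_def)
    then show "c1 * c2 \<le> h x" using c(3,4)[OF x] c(1,2) mult_mono[OF c(4)[OF x] c(3)[OF x]]
      by (simp add: mult.commute softplus_nonneg)
  qed
  ultimately have Xle: "integral\<^sup>L lborel X \<le> - (c1 * c2 * measure lebesgue (cball x0 \<rho>))" by simp
  \<comment> \<open>Convexity bounds the energy density of w by that of \<phi> minus
    \<open>a\<close> times its excess over that of P. The tangent inequality at grad P bounds this
    excess below by p times the flux paired with grad \<phi> - grad P, and a (grad P - grad \<phi>)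
    is grad \<Psi>.\<close>
  have pw: "norm (grad w x) powr p \<le> norm (grad \<phi> x) powr p + p * X x" for x
  proof (cases "x \<in> ?B")
    case True
    have "norm (grad w x) \<le> (1 - a x) * norm (grad \<phi> x) + a x * norm (grad P x)"
      unfolding gradw using a01[of x] norm_triangle_ineq[of "(1 - a x) *\<^sub>R grad \<phi> x" "a x *\<^sub>R grad P x"] by simp
    then have "norm (grad w x) powr p \<le> ((1 - a x) * norm (grad \<phi> x) + a x * norm (grad P x)) powr p"
      using p by (intro powr_mono2) auto
    also have "\<dots> \<le> (1 - a x) * norm (grad \<phi> x) powr p + a x * norm (grad P x) powr p"
      using a01[of x] p by (intro powr_convex) auto
    finally have 1: "norm (grad w x) powr p \<le> norm (grad \<phi> x) powr p - a x * (norm (grad \<phi> x) powr p - norm (grad P x) powr p)"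
      by (simp add: algebra_simps)
    let ?G = "grad P x"
    have G: "?G \<noteq> 0" by (rule nz[OF True])
    have "a x * (norm ?G powr p + p * norm ?G powr (p - 2) * (?G \<bullet> (grad \<phi> x - ?G))) \<le> a x * norm (grad \<phi> x) powr p"
      by (intro mult_left_mono norm_powr_ge_tangent p G a01)
    then have 2: "- (p * (norm ?G powr (p - 2) * (?G \<bullet> (a x *\<^sub>R (?G - grad \<phi> x))))) \<le> a x * (norm (grad \<phi> x) powr p - norm ?G powr p)"
      by (simp add: inner_diff_right algebra_simps)
    have "(?G \<bullet> ?G) powr ((p - 2) / 2) = norm ?G powr (p - 2)"
    proof -
      have "(?G \<bullet> ?G) powr ((p - 2) / 2) = (norm ?G powr 2) powr ((p - 2) / 2)"
        using G by (simp add: dot_square_norm)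
      also have "\<dots> = norm ?G powr (2 * ((p - 2) / 2))" by (rule powr_powr)
      also have "2 * ((p - 2) / 2) = p - 2" by (simp only: times_divide_eq_right nonzero_mult_div_cancel_left zero_neq_numeral[symmetric] not_False_eq_True)
      finally show ?thesis .
    qed
    then have "X x = norm ?G powr (p - 2) * (?G \<bullet> grad \<Psi> x)"
      using True by (simp add: X_def p_flux_def inner_vec_def sum_distrib_left partial_eq_grad mult.assoc)
    then have "- (p * X x) \<le> a x * (norm (grad \<phi> x) powr p - norm ?G powr p)"
      using 2 by (simp only: grad\<Psi>)
    then show ?thesis using 1 by linarith
  next
    case False
    then show ?thesis by (simp add: gradw a_def X_def)
  qed
  note i\<phi> = test_grad_integrable(1)[OF \<Omega> \<phi> p0] and iw = test_grad_integrable(1)[OF \<Omega> testw p0]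
  have "(\<integral>x. norm (grad w x) powr p \<partial>lborel) \<le> (\<integral>x. norm (grad \<phi> x) powr p + p * X x \<partial>lborel)"
    by (rule integral_mono[OF iw _ pw]) (use i\<phi> Xint in auto)
  also have "\<dots> = (\<integral>x. norm (grad \<phi> x) powr p \<partial>lborel) + p * integral\<^sup>L lborel X"
    using i\<phi> Xint by simp
  also have "\<dots> \<le> (\<integral>x. norm (grad \<phi> x) powr p \<partial>lborel) - p * (c1 * c2 * measure lebesgue (cball x0 \<rho>))"
    using mult_left_mono[OF Xle, of p] p0 by simp
  finally have "Lnorm (ereal p) \<Omega> (grad w) powr p \<le> Lnorm (ereal p) \<Omega> (grad \<phi>) powr p - p * (c1 * c2 * measure lebesgue (cball x0 \<rho>))"
    unfolding test_grad_integrable(2)[OF \<Omega> \<phi> p0] test_grad_integrable(2)[OF \<Omega> testw p0] .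
  moreover have "\<phi> x \<le> w x" for x using \<Psi>nn by (simp add: w_def)
  ultimately show thesis using that[OF testw] by blast
qed

section \<open>Touching by smooth functions\<close>

text \<open>If P exceeded u at x0, lifting test functions within e of u towards P would lower the
  energy by a fixed amount c, while the q-norm drops by at most e m. As e -> 0 this contradicts
  minimality.\<close>

lemma extremal_above_subsolution:
  fixes \<Omega> :: "(real ^ 'n::finite) set"
  assumes \<Omega>: "open \<Omega>" "bounded \<Omega>" "\<Omega> \<noteq> {}" and ext: "sobolev_extremal \<Omega> p q u"
    and p: "p > real CARD('n)" and q: "q \<ge> 1"
    and P: "smooth_on UNIV P" and r: "0 < r" "cball x0 r \<subseteq> \<Omega>"
    and nz: "\<And>x. x \<in> ball x0 r \<Longrightarrow> grad P x \<noteq> 0" and pl: "\<And>x. x \<in> ball x0 r \<Longrightarrow> p_laplacian p P x > 0"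
    and \<kappa>: "\<kappa> > 0" and ann: "\<And>x. x \<in> ball x0 r \<Longrightarrow> r / 2 \<le> norm (x - x0) \<Longrightarrow> P x + \<kappa> \<le> u x"
  shows "P x0 \<le> u x0"
proof (rule ccontr)
  assume "\<not> P x0 \<le> u x0"
  then have gap: "P x0 - u x0 > 0" by simp
  have N: "real CARD('n) \<ge> 1"
    using zero_less_card_finite[where 'a='n] by (metis One_nat_def Suc_leI of_nat_1 of_nat_le_iff)
  have p1: "p \<ge> 1" and p0: "p > 0" and q0: "q > 0" using p N q by linarith+
  have uW: "u \<in> W1_0 (ereal p) \<Omega>" and uc: "continuous_on (closure \<Omega>) u" and upos: "\<And>x. x \<in> \<Omega> \<Longrightarrow> u x > 0"
    and uq: "Lnorm (ereal q) \<Omega> u = 1" and ulam: "Lnorm (ereal p) \<Omega> (weak_grad \<Omega> u) powr p = sobolev_lambda \<Omega> p q"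
    using ext by (auto simp: sobolev_extremal_def)
  define l where "l = Lnorm (ereal p) \<Omega> (weak_grad \<Omega> u)"
  have l0: "l \<ge> 0" by (simp add: l_def Lnorm_ereal_nonneg)
  have llam: "sobolev_lambda \<Omega> p q powr (1 / p) = l"
    using l0 p0 by (simp add: ulam[symmetric] powr_powr flip: l_def)
  obtain \<phi> where \<phi>: "\<And>k::nat. test_function \<Omega> (\<phi> k)" "uniform_limit (closure \<Omega>) \<phi> u sequentially"
    "(\<lambda>k. Lnorm (ereal p) \<Omega> (grad (\<phi> k))) \<longlonglongrightarrow> l"
    unfolding l_def using W1_0_approx[OF \<Omega> p uW uc] by blast
  \<comment> \<open>A quarter of the gap: P - u >= 2 \<theta> near x0 by continuity, and an
    approximant within \<theta> of u still leaves a gap of \<theta> to P, whence the lower bound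
    \<open>c2\<close>.\<close>
  define \<theta> where "\<theta> = (P x0 - u x0) / 4"
  have \<theta>: "\<theta> > 0" using gap by (simp add: \<theta>_def)
  have B1: "ball x0 r \<subseteq> \<Omega>" using ball_subset_cball r(2) by blast
  have Bcl: "ball x0 r \<subseteq> \<Omega>" "ball x0 r \<subseteq> closure \<Omega>" using B1 closure_subset[of \<Omega>] by blast+
  have "continuous_on (ball x0 r) (\<lambda>x. P x - u x)"
    by (intro continuous_on_diff continuous_on_subset[OF smooth_on_continuous[OF P]] continuous_on_subset[OF uc] Bcl) simp
  then obtain \<delta> where \<delta>: "\<delta> > 0" "\<And>x. x \<in> ball x0 r \<Longrightarrow> dist x x0 < \<delta> \<Longrightarrow> dist (P x - u x) (P x0 - u x0) < 2 * \<theta>"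
    unfolding continuous_on_iff using r(1) \<theta> by (metis centre_in_ball mult_pos_pos zero_less_numeral)
  define \<rho> where "\<rho> = min \<delta> r / 2"
  have \<rho>: "\<rho> > 0" "\<rho> < \<delta>" "\<rho> \<le> r / 2" using \<delta>(1) r(1) by (auto simp: \<rho>_def min_def)
  have \<rho>B: "cball x0 \<rho> \<subseteq> ball x0 r" using \<rho> r(1) by auto
  have near: "P x - u x \<ge> 2 * \<theta>" if "x \<in> cball x0 \<rho>" for x
  proof -
    have "dist x x0 < \<delta>" using that \<rho>(2) by (simp add: dist_commute)
    then have "\<bar>(P x - u x) - (P x0 - u x0)\<bar> < 2 * \<theta>" using \<delta>(2)[of x] that \<rho>B by (auto simp: dist_real_def)
    then have "- ((P x - u x) - (P x0 - u x0)) < 2 * \<theta>" unfolding abs_less_iff by blast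
    moreover have "P x0 - u x0 = 4 * \<theta>" by (simp add: \<theta>_def)
    ultimately show ?thesis by linarith
  qed
  have "continuous_on (cball x0 \<rho>) (p_laplacian p P)"
    by (rule continuous_on_subset[OF continuous_p_laplacian[OF open_ball smooth_on_subset[OF P] nz] \<rho>B]) auto
  then obtain xm where xm: "xm \<in> cball x0 \<rho>" "\<And>x. x \<in> cball x0 \<rho> \<Longrightarrow> p_laplacian p P xm \<le> p_laplacian p P x"
    using continuous_attains_inf[of "cball x0 \<rho>" "p_laplacian p P"] \<rho>(1) by auto
  define c1 where "c1 = p_laplacian p P xm"
  have c1: "c1 > 0" using pl xm(1) \<rho>B by (auto simp: c1_def)
  define c2 where "c2 = softplus 1 \<theta>"
  have c2: "c2 > 0" using \<theta> by (simp add: c2_def softplus_pos)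
  define c where "c = p * (c1 * c2 * measure lebesgue (cball x0 \<rho>))"
  have c: "c > 0"
  proof -
    have "measure lebesgue (cball x0 \<rho>) > 0"
      using content_cball_pos[OF \<rho>(1), of x0] by (simp add: measure_completion)
    then show ?thesis using p0 c1 c2 by (simp add: c_def)
  qed
  define m where "m = measure lebesgue \<Omega> powr (1 / q)"
  have m: "m \<ge> 0" by (simp add: m_def)
  \<comment> \<open>Errors below \<open>e0\<close> respect the margin \<kappa> on the annulus and
    the gap \<theta> near x0, and keep 1 - e m positive.\<close>
  define e0 where "e0 = min (min \<kappa> \<theta>) (1 / (m + 1))"
  have e0: "e0 > 0" using \<kappa> \<theta> m by (simp add: e0_def)
  have main: "l powr p * (1 - e * m) powr p \<le> l powr p + e - c" if e: "0 < e" "e < e0" for e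
  proof -
    have e': "e < \<kappa>" "e < \<theta>" "e < 1 / (m + 1)" using e by (simp_all add: e0_def)
    have em: "1 - e * m > 0"
    proof -
      have "e * m \<le> e * (m + 1)" using e by simp
      also have "\<dots> < 1" using e'(3) m by (simp add: field_simps)
      finally show ?thesis by simp
    qed
    have "(\<lambda>k. Lnorm (ereal p) \<Omega> (grad (\<phi> k)) powr p) \<longlonglongrightarrow> l powr p"
      by (rule tendsto_powr'[OF \<phi>(3) tendsto_const]) (use p0 in \<open>auto simp: Lnorm_ereal_nonneg\<close>)
    then have ev1: "\<forall>\<^sub>F k in sequentially. Lnorm (ereal p) \<Omega> (grad (\<phi> k)) powr p < l powr p + e"
      by (rule order_tendstoD) (use e in simp)
    have ev2: "\<forall>\<^sub>F k in sequentially. \<forall>x\<in>closure \<Omega>. dist (\<phi> k x) (u x) < e"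
      by (rule uniform_limitD[OF \<phi>(2) e(1)])
    obtain k where k1: "Lnorm (ereal p) \<Omega> (grad (\<phi> k)) powr p < l powr p + e"
      and k2: "\<forall>x\<in>closure \<Omega>. dist (\<phi> k x) (u x) < e"
      using eventually_happens'[OF sequentially_bot eventually_conj[OF ev1 ev2]] by fast
    have close: "\<bar>\<phi> k x - u x\<bar> < e" if "x \<in> closure \<Omega>" for x using k2 that by (simp add: dist_real_def)
    obtain w where w: "test_function \<Omega> w" "\<And>x. \<phi> k x \<le> w x"
       "Lnorm (ereal p) \<Omega> (grad w) powr p \<le> Lnorm (ereal p) \<Omega> (grad (\<phi> k)) powr p - p * (c1 * c2 * measure lebesgue (cball x0 \<rho>))"
    proof (rule subsolution_competitor[OF \<Omega>(1) \<phi>(1)[of k] P r p1 nz less_imp_le[OF pl] _ \<rho>(3)])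
      show "P x \<le> \<phi> k x" if "x \<in> ball x0 r" "r / 2 \<le> norm (x - x0)" for x
        using ann[OF that] close[of x] that Bcl(2) e'(1) by (auto simp: subset_iff)
      show "c1 \<le> p_laplacian p P x" if "x \<in> cball x0 \<rho>" for x using xm(2)[OF that] by (simp add: c1_def)
      show "c2 \<le> softplus 1 (P x - \<phi> k x)" if x: "x \<in> cball x0 \<rho>" for x
      proof -
        have "x \<in> closure \<Omega>" using x \<rho>B Bcl by blast
        then have "\<theta> \<le> P x - \<phi> k x" using near[OF x] close[of x] e'(2) by linarith
        then show ?thesis unfolding c2_def by (intro softplus_mono) auto
      qed
    qed (use c1 c2 in auto)
    have wL: "in_L (ereal q) \<Omega> w" by (rule test_grad_integrable(4)[OF \<Omega>(1) w(1) q0])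
    have wL': "in_L (ereal q) \<Omega> (\<lambda>x. \<bar>w x\<bar>)" "Lnorm (ereal q) \<Omega> (\<lambda>x. \<bar>w x\<bar>) = Lnorm (ereal q) \<Omega> w"
      using wL by (auto simp: in_L_ereal Lnorm_ereal)
    have um: "u \<in> borel_measurable (lebesgue_on \<Omega>)"
      by (rule measurable_lebesgue_on_continuous[OF \<Omega>(1) continuous_on_subset[OF uc closure_subset]])
    obtain B where B: "\<And>x. x \<in> closure \<Omega> \<Longrightarrow> norm (u x) \<le> B"
      using compact_imp_bounded[OF compact_continuous_image[OF uc]] \<Omega>(2) by (auto simp: bounded_iff)
    have "u x \<le> \<bar>B\<bar>" if "x \<in> \<Omega>" for x using B[of x] closure_subset[of \<Omega>] that by force
    then have uL: "in_L (ereal q) \<Omega> u"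
      by (intro in_L_bounded[OF \<Omega>(1,2) um _ _ q0, of "\<bar>B\<bar>"]) (use upos in \<open>auto simp: less_imp_le abs_of_pos\<close>)
    have eL: "in_L (ereal q) \<Omega> (\<lambda>x. e)" "Lnorm (ereal q) \<Omega> (\<lambda>x. e) \<le> e * m"
      unfolding m_def using e
      by (auto intro!: in_L_bounded[OF \<Omega>(1,2), where B=e] Lnorm_bounded[OF \<Omega>(1,2), where B=e] q0)
    \<comment> \<open>On \<Omega> one has 0 < u < \<phi> + e <= w + e, with \<phi> the k-th
      approximant; the absolute value covers places where w is negative.\<close>
    have "1 \<le> Lnorm (ereal q) \<Omega> (\<lambda>x. \<bar>w x\<bar> + e)"
      unfolding uq[symmetric]
    proof (rule Lnorm_mono[OF q0 uL in_L_add[OF q wL'(1) eL(1)]])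
      fix x assume x: "x \<in> \<Omega>"
      then have "x \<in> closure \<Omega>" using closure_subset by blast
      then show "norm (u x) \<le> norm (\<bar>w x\<bar> + e)" using close[of x] w(2)[of x] upos[OF x] e by simp
    qed
    also have "\<dots> \<le> Lnorm (ereal q) \<Omega> w + e * m"
      using Lnorm_triangle[OF q wL'(1) eL(1)] eL(2) wL'(2) by simp
    finally have wq: "1 - e * m \<le> Lnorm (ereal q) \<Omega> w" by simp
    then have wpos: "Lnorm (ereal q) \<Omega> w > 0" using em by simp
    have "l * (1 - e * m) \<le> l * Lnorm (ereal q) \<Omega> w" by (intro mult_left_mono wq l0)
    also have "\<dots> \<le> Lnorm (ereal p) \<Omega> (grad w)"
      using sobolev_lambda_le(2)[OF \<Omega> w(1) p1 q wpos] by (simp add: llam)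
    finally have "(l * (1 - e * m)) powr p \<le> Lnorm (ereal p) \<Omega> (grad w) powr p"
      using l0 em p0 by (intro powr_mono2) auto
    then have "l powr p * (1 - e * m) powr p \<le> Lnorm (ereal p) \<Omega> (grad w) powr p"
      by (simp add: powr_mult)
    then show ?thesis using w(3) k1 unfolding c_def by linarith
  qed
  have t1: "((\<lambda>e. l powr p * (1 - e * m) powr p) \<longlongrightarrow> l powr p * (1 - 0 * m) powr p) (at_right 0)"
    by (intro tendsto_intros) auto
  have t2: "((\<lambda>e. l powr p + e - c) \<longlongrightarrow> l powr p + 0 - c) (at_right 0)"
    by (intro tendsto_intros)
  have "l powr p * (1 - 0 * m) powr p \<le> l powr p + 0 - c"
  proof (rule tendsto_le[OF trivial_limit_at_right_real t2 t1])
    show "\<forall>\<^sub>F e in at_right 0. l powr p * (1 - e * m) powr p \<le> l powr p + e - c"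
      unfolding eventually_at_right_field using main e0 by (intro exI[of _ e0]) auto
  qed
  then show False using c by simp
qed

lemma partial_add_const: "partial i (\<lambda>x. P x + c) = partial i P"
proof
  fix x
  have "((\<lambda>x. P x + c) has_derivative D) (at x) \<longleftrightarrow> (P has_derivative D) (at x)" for D
    using has_derivative_add_const[of P D "at x" c] has_derivative_add_const[of "\<lambda>x. P x + c" D "at x" "- c"] by auto
  then show "partial i (\<lambda>x. P x + c) x = partial i P x" by (simp add: partial_def frechet_derivative_def)
qed

lemma continuous_inf_laplacian: "smooth_on UNIV P \<Longrightarrow> continuous_on UNIV (inf_laplacian P)"
  unfolding inf_laplacian_def[abs_def]
  by (intro continuous_on_sum continuous_on_mult smooth_on_continuous smooth_on_partial)

text \<open>P raised by a small m exceeds v at x0 but, thanks to the quadratic gap, stays below v by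
  a margin on the outer half of a small ball. For large p a positive infinity Laplacian makes it a
  strict p-subsolution there, so \<open>extremal_above_subsolution\<close> puts it below an extremal
  that is uniformly close to v, a contradiction at x0.\<close>

lemma touching_smooth:
  fixes \<Omega> :: "(real ^ 'n::finite) set" and u :: "nat \<Rightarrow> real ^ 'n \<Rightarrow> real"
  assumes \<Omega>: "open \<Omega>" "bounded \<Omega>" "\<Omega> \<noteq> {}"
    and p: "\<And>k. p k > real CARD('n)" "filterlim p at_top sequentially" and q: "\<And>k. q k \<ge> 1"
    and ext: "\<And>k. sobolev_extremal \<Omega> (p k) (q k) (u k)"
    and lim: "uniform_limit (closure \<Omega>) u v sequentially"
    and P: "smooth_on UNIV P" and x0: "P x0 = v x0" and r0: "r0 > 0" "ball x0 r0 \<subseteq> \<Omega>" and \<epsilon>: "\<epsilon> > 0"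
    and touch: "\<And>x. x \<in> ball x0 r0 \<Longrightarrow> P x + \<epsilon> * (norm (x - x0))\<^sup>2 \<le> v x"
  shows "inf_laplacian P x0 \<le> 0"
proof (rule ccontr)
  assume "\<not> inf_laplacian P x0 \<le> 0"
  then have pos: "inf_laplacian P x0 > 0" by simp
  define c where "c = inf_laplacian P x0 / 2"
  have c: "c > 0" using pos by (simp add: c_def)
  have nz0: "grad P x0 \<noteq> 0"
  proof
    assume "grad P x0 = 0"
    then have "inf_laplacian P x0 = 0" by (simp add: inf_laplacian_def partial_eq_grad)
    then show False using pos by simp
  qed
  let ?lap = "\<lambda>x. (grad P x \<bullet> grad P x) * (\<Sum>i\<in>UNIV. partial i (partial i P) x)"
  have clap: "continuous_on UNIV ?lap"
    by (intro continuous_on_mult smooth_on_continuous smooth_on_grad_sq smooth_on_sum smooth_on_partial P) auto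
  have cgrad: "continuous_on UNIV (grad P)" by (rule smooth_on_continuous_grad[OF P])
  have nh: "(f \<longlongrightarrow> f x0) (nhds x0)" if "continuous_on UNIV f" for f :: "real ^ 'n \<Rightarrow> 'b::topological_space"
    using that unfolding continuous_on_def tendsto_at_iff_tendsto_nhds by blast
  have e1: "\<forall>\<^sub>F x in nhds x0. inf_laplacian P x > c"
    by (rule order_tendstoD(1)[OF nh[OF continuous_inf_laplacian[OF P]]]) (use pos in \<open>simp add: c_def\<close>)
  have e2: "\<forall>\<^sub>F x in nhds x0. ?lap x > ?lap x0 - 1"
    by (rule order_tendstoD(1)[OF nh[OF clap]]) simp
  have e3: "\<forall>\<^sub>F x in nhds x0. grad P x \<noteq> 0"
    by (rule tendsto_imp_eventually_ne[OF nh[OF cgrad] nz0])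
  obtain r1 where r1: "r1 > 0" "\<And>x. dist x x0 < r1 \<Longrightarrow> inf_laplacian P x > c \<and> ?lap x > ?lap x0 - 1 \<and> grad P x \<noteq> 0"
    using eventually_conj[OF e1 eventually_conj[OF e2 e3]] unfolding eventually_nhds_metric by blast
  define r where "r = min r0 r1 / 2"
  have r: "r > 0" "r < r0" "r < r1" using r0 r1 by (auto simp: r_def min_def)
  have B: "dist x x0 < r1 \<and> x \<in> ball x0 r0" if "x \<in> ball x0 r" for x
    using that r by (auto simp: dist_commute)
  \<comment> \<open>Where |x - x0| >= r/2 the gap \<epsilon> |x - x0|^2 is at least 4 m: m is spent
    on raising P, m on the margin \<kappa>, and less than m/2 on the distance between the extremal
    and v.\<close>
  define m where "m = \<epsilon> * (r / 2)\<^sup>2 / 4"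
  have m: "m > 0" using \<epsilon> r by (simp add: m_def)
  define P' where "P' = (\<lambda>x. P x + m)"
  have part: "partial i P' = partial i P" for i unfolding P'_def by (rule partial_add_const)
  have P': "smooth_on UNIV P'" unfolding P'_def by (intro smooth_on_add P smooth_on_const) auto
  have gradP': "grad P' = grad P" by (simp add: fun_eq_iff vec_eq_iff grad_def part)
  have ilP': "inf_laplacian P' = inf_laplacian P" by (simp add: fun_eq_iff inf_laplacian_def part)
  \<comment> \<open>Beyond \<open>p0\<close> one has (p - 2) c > 1 - \<open>?lap x0\<close>, while
    the remaining term stays above \<open>?lap x0\<close> - 1 near x0; so the sum is
    positive.\<close>
  define p0 where "p0 = 2 + (1 - ?lap x0) / c"
  have ev1: "\<forall>\<^sub>F k in sequentially. p k > p0 \<and> p k > 2"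
    using p(2) by (intro eventually_conj) (auto simp: filterlim_at_top_dense)
  have "m / 2 > 0" using m by simp
  then have ev2: "\<forall>\<^sub>F k in sequentially. \<forall>x\<in>closure \<Omega>. dist (u k x) (v x) < m / 2"
    by (rule uniform_limitD[OF lim])
  obtain k where k1: "p k > p0" "p k > 2" and k2: "\<forall>x\<in>closure \<Omega>. dist (u k x) (v x) < m / 2"
    using eventually_happens'[OF sequentially_bot eventually_conj[OF ev1 ev2]] by fast
  have close: "\<bar>u k x - v x\<bar> < m / 2" if "x \<in> \<Omega>" for x using k2 that closure_subset[of \<Omega>] by (auto simp: dist_real_def)
  have "P' x0 \<le> u k x0"
  proof (rule extremal_above_subsolution[OF \<Omega> ext[of k] p(1) q P' r(1)])
    show "cball x0 r \<subseteq> \<Omega>" using r r0 by auto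
    fix x assume x: "x \<in> ball x0 r"
    then have f: "inf_laplacian P x > c" "?lap x > ?lap x0 - 1" "grad P x \<noteq> 0" using B[OF x] r1(2)[of x] by auto
    show nz: "grad P' x \<noteq> 0" using f(3) by (simp add: gradP')
    have "(p k - 2) * c > 1 - ?lap x0"
    proof -
      have "(1 - ?lap x0) / c < p k - 2" using k1(1) by (simp add: p0_def)
      then show ?thesis using c by (simp add: field_simps)
    qed
    moreover have "(p k - 2) * inf_laplacian P x \<ge> (p k - 2) * c" using f(1) k1(2) by (intro mult_left_mono) auto
    ultimately have "(p k - 2) * inf_laplacian P x + ?lap x > 0" using f(2) by linarith
    then have "(grad P x \<bullet> grad P x) powr ((p k - 4) / 2) * ((p k - 2) * inf_laplacian P x + ?lap x) > 0"
      using f(3) by (intro mult_pos_pos) auto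
    then show "p_laplacian (p k) P' x > 0"
      unfolding p_laplacian_eq[OF P' nz] gradP' ilP' part .
    show "P' x + m \<le> u k x" if rx: "r / 2 \<le> norm (x - x0)"
    proof -
      have "(r / 2)\<^sup>2 \<le> (norm (x - x0))\<^sup>2" using rx r by (intro power_mono) auto
      then have "4 * m \<le> \<epsilon> * (norm (x - x0))\<^sup>2" using \<epsilon> by (simp add: m_def)
      moreover have "\<bar>u k x - v x\<bar> < m / 2" using B[OF x] r0 by (intro close) blast
      moreover have "P x + \<epsilon> * (norm (x - x0))\<^sup>2 \<le> v x" using B[OF x] by (intro touch) blast
      ultimately show ?thesis using m unfolding P'_def by linarith
    qed
  qed (use m in auto)
  moreover have "x0 \<in> \<Omega>" using r0 by auto
  ultimately show False using close[of x0] x0 m by (simp add: P'_def)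
qed

section \<open>Viscosity supersolutions and positivity\<close>

lemma has_derivative_coordinate:
  "((\<lambda>x :: real ^ 'n::finite. (x - x0) $ i) has_derivative (\<lambda>v. v $ i)) (at x)"
  unfolding vector_minus_component
  using has_derivative_diff[OF bounded_linear_imp_has_derivative[OF bounded_linear_vec_nth] has_derivative_const]
  by fastforce

lemma axis_component: "axis k (1::real) $ i = (if i = k then 1 else 0)"
  by (simp add: axis_def)

lemma DERIV_along_line:
  fixes f :: "real ^ 'n::finite \<Rightarrow> real"
  assumes "f differentiable (at (x + t *\<^sub>R y))"
  shows "((\<lambda>t. f (x + t *\<^sub>R y)) has_real_derivative (\<Sum>i\<in>UNIV. partial i f (x + t *\<^sub>R y) * y $ i)) (at t)"
proof -
  have "((\<lambda>t::real. x + t *\<^sub>R y) has_derivative (\<lambda>s. s *\<^sub>R y)) (at t)"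
    by (auto intro!: derivative_eq_intros)
  from has_derivative_compose[OF this has_derivative_grad[OF assms]]
  have "((\<lambda>t. f (x + t *\<^sub>R y)) has_real_derivative grad f (x + t *\<^sub>R y) \<bullet> y) (at t)"
    by (simp add: has_field_derivative_def mult_commute_abs)
  then show ?thesis by (simp add: inner_vec_def partial_eq_grad)
qed

text \<open>Taylor's formula along the segment has its second derivatives at an intermediate point.
  These are merely continuous, so moving them to x0 leaves an error that is an arbitrarily small
  multiple of |x - x0|^2.\<close>

lemma second_order_taylor_lower:
  fixes \<phi> :: "real ^ 'n::finite \<Rightarrow> real"
  assumes \<phi>: "Ck_on 2 (ball x0 r) \<phi>" and r: "r > 0" and \<epsilon>: "\<epsilon> > 0"
  obtains s where "s > 0" "s \<le> r" "\<And>x. x \<in> ball x0 s \<Longrightarrow> \<phi> x \<ge> \<phi> x0 + (\<Sum>i\<in>UNIV. partial i \<phi> x0 * (x - x0) $ i) +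
    (1/2) * (\<Sum>i\<in>UNIV. \<Sum>j\<in>UNIV. partial j (partial i \<phi>) x0 * (x - x0) $ i * (x - x0) $ j) - \<epsilon> * (norm (x - x0))\<^sup>2"
proof -
  have d1: "\<phi> differentiable (at x)" and d2: "partial i \<phi> differentiable (at x)" if "x \<in> ball x0 r" for x i
    using \<phi> that by (auto simp: numeral_2_eq_2)
  have cont: "continuous_on (ball x0 r) (partial j (partial i \<phi>))" for i j
    using \<phi> by (auto simp: numeral_2_eq_2)
  define N where "N = real CARD('n)"
  have N: "N > 0" by (simp add: N_def)
  \<comment> \<open>Each of the N^2 second derivatives contributes at most \<delta> |x - x0|^2, in
    total 2 \<epsilon> |x - x0|^2; the factor 1/2 in Taylor's formula leaves \<epsilon>.\<close>
  define \<delta> where "\<delta> = 2 * \<epsilon> / N\<^sup>2"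
  have \<delta>: "\<delta> > 0" using \<epsilon> N by (simp add: \<delta>_def)
  have "\<forall>\<^sub>F x in nhds x0. \<forall>i j. \<bar>partial j (partial i \<phi>) x - partial j (partial i \<phi>) x0\<bar> < \<delta>"
  proof (intro eventually_all_finite)
    fix i j
    have "isCont (partial j (partial i \<phi>)) x0"
      using cont r by (auto simp: continuous_on_eq_continuous_at)
    then have "(partial j (partial i \<phi>) \<longlongrightarrow> partial j (partial i \<phi>) x0) (nhds x0)"
      unfolding continuous_at tendsto_at_iff_tendsto_nhds .
    from tendstoD[OF this \<delta>]
    show "\<forall>\<^sub>F x in nhds x0. \<bar>partial j (partial i \<phi>) x - partial j (partial i \<phi>) x0\<bar> < \<delta>"
      by (simp add: dist_real_def)
  qed
  then obtain s0 where s0: "s0 > 0" "\<And>x i j. dist x x0 < s0 \<Longrightarrow> \<bar>partial j (partial i \<phi>) x - partial j (partial i \<phi>) x0\<bar> < \<delta>"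
    unfolding eventually_nhds_metric by blast
  show thesis
  proof (rule that[of "min s0 r"])
    fix x assume x: "x \<in> ball x0 (min s0 r)"
    define y where "y = x - x0"
    have line: "x0 + t *\<^sub>R y \<in> ball x0 r" "dist (x0 + t *\<^sub>R y) x0 < s0" if "0 \<le> t" "t \<le> 1" for t
    proof -
      have "norm (t *\<^sub>R y) \<le> 1 * norm y" unfolding norm_scaleR using that by (intro mult_right_mono) auto
      moreover have "norm y < s0" "norm y < r" using x by (auto simp: y_def dist_norm norm_minus_commute)
      ultimately show "x0 + t *\<^sub>R y \<in> ball x0 r" "dist (x0 + t *\<^sub>R y) x0 < s0" by (auto simp: dist_norm)
    qed
    define D where "D = (\<lambda>m t. if m = 0 then \<phi> (x0 + t *\<^sub>R y) else if m = Suc 0 then (\<Sum>i\<in>UNIV. partial i \<phi> (x0 + t *\<^sub>R y) * y $ i)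
      else (\<Sum>i\<in>UNIV. (\<Sum>j\<in>UNIV. partial j (partial i \<phi>) (x0 + t *\<^sub>R y) * y $ j) * y $ i))"
    have DD: "\<forall>m t. m < 2 \<and> 0 \<le> t \<and> t \<le> 1 \<longrightarrow> (D m has_real_derivative D (Suc m) t) (at t)"
    proof (intro allI impI)
      fix m :: nat and t :: real assume mt: "m < 2 \<and> 0 \<le> t \<and> t \<le> 1"
      then consider "m = 0" | "m = Suc 0" by linarith
      then show "(D m has_real_derivative D (Suc m) t) (at t)"
      proof cases
        case 1
        then show ?thesis using DERIV_along_line[OF d1[OF line(1)]] mt by (simp add: D_def)
      next
        case 2
        have "((\<lambda>t. \<Sum>i\<in>UNIV. partial i \<phi> (x0 + t *\<^sub>R y) * y $ i) has_real_derivative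
           (\<Sum>i\<in>UNIV. (\<Sum>j\<in>UNIV. partial j (partial i \<phi>) (x0 + t *\<^sub>R y) * y $ j) * y $ i)) (at t)"
          by (intro DERIV_sum DERIV_cmult_right DERIV_along_line d2 line(1)) (use mt in auto)
        then show ?thesis using 2 by (simp add: D_def)
      qed
    qed
    obtain t where t: "0 < t" "t < 1" "D 0 1 = (\<Sum>m<2. D m 0 / fact m * 1 ^ m) + D 2 t / fact 2 * 1 ^ 2"
      using Maclaurin[OF zero_less_one _ refl DD] by auto
    have taylor: "\<phi> x = \<phi> x0 + (\<Sum>i\<in>UNIV. partial i \<phi> x0 * y $ i) + (1/2) * D 2 t"
      using t(3) by (simp add: D_def numeral_2_eq_2 y_def)
    let ?A0 = "\<Sum>i\<in>UNIV. \<Sum>j\<in>UNIV. partial j (partial i \<phi>) x0 * y $ i * y $ j"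
    have "\<bar>D 2 t - ?A0\<bar> \<le> (\<Sum>i\<in>(UNIV::'n set). \<Sum>j\<in>(UNIV::'n set). \<delta> * (norm y)\<^sup>2)"
    proof -
      have "D 2 t - ?A0 = (\<Sum>i\<in>UNIV. \<Sum>j\<in>UNIV. (partial j (partial i \<phi>) (x0 + t *\<^sub>R y) - partial j (partial i \<phi>) x0) * (y $ i * y $ j))"
        by (simp add: D_def sum_distrib_left sum_distrib_right algebra_simps flip: sum_subtractf)
      also have "\<bar>\<dots>\<bar> \<le> (\<Sum>i\<in>UNIV. \<Sum>j\<in>UNIV. \<bar>(partial j (partial i \<phi>) (x0 + t *\<^sub>R y) - partial j (partial i \<phi>) x0) * (y $ i * y $ j)\<bar>)"
        by (rule order_trans[OF sum_abs sum_mono[OF sum_abs]])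
      also have "\<dots> \<le> (\<Sum>i\<in>(UNIV::'n set). \<Sum>j\<in>(UNIV::'n set). \<delta> * (norm y)\<^sup>2)"
      proof (intro sum_mono)
        fix i j
        have le1: "\<bar>y $ i\<bar> * \<bar>y $ j\<bar> \<le> norm y * norm y"
          by (intro mult_mono component_le_norm_cart) auto
        have le2: "\<bar>partial j (partial i \<phi>) (x0 + t *\<^sub>R y) - partial j (partial i \<phi>) x0\<bar> \<le> \<delta>"
          using s0(2)[OF line(2), of t j i] t by simp
        show "\<bar>(partial j (partial i \<phi>) (x0 + t *\<^sub>R y) - partial j (partial i \<phi>) x0) * (y $ i * y $ j)\<bar> \<le> \<delta> * (norm y)\<^sup>2"
          unfolding abs_mult power2_eq_square by (rule mult_mono[OF le2 le1]) (use \<delta> in simp_all)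
      qed
      finally show ?thesis .
    qed
    also have "\<dots> = 2 * \<epsilon> * (norm y)\<^sup>2"
      using N by (simp add: \<delta>_def power2_eq_square flip: N_def)
    finally have "D 2 t \<ge> ?A0 - 2 * \<epsilon> * (norm y)\<^sup>2" by linarith
    then show "\<phi> x \<ge> \<phi> x0 + (\<Sum>i\<in>UNIV. partial i \<phi> x0 * (x - x0) $ i) +
      (1/2) * (\<Sum>i\<in>UNIV. \<Sum>j\<in>UNIV. partial j (partial i \<phi>) x0 * (x - x0) $ i * (x - x0) $ j) - \<epsilon> * (norm (x - x0))\<^sup>2"
      unfolding taylor y_def[symmetric] by simp
  qed (use s0(1) r in auto)
qed

text \<open>For a general matrix \<open>A\<close> the symmetrisation appears. The infinity Laplacian
  only sees the symmetric part, as an exchange of the summation indices shows when this is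
  applied.\<close>

lemma quadratic_derivatives:
  fixes A :: "'n::finite \<Rightarrow> 'n \<Rightarrow> real" and b :: "'n \<Rightarrow> real"
  assumes Q: "Q = (\<lambda>x :: real ^ 'n. c + (\<Sum>i\<in>UNIV. b i * (x - x0) $ i) + (1/2) * (\<Sum>i\<in>UNIV. \<Sum>j\<in>UNIV. A i j * (x - x0) $ i * (x - x0) $ j)
     - \<epsilon> * ((x - x0) \<bullet> (x - x0)))"
  shows "smooth_on UNIV Q" "partial k Q x0 = b k"
    "partial l (partial k Q) x0 = (A k l + A l k) / 2 - (if k = l then 2 * \<epsilon> else 0)"
proof -
  show "smooth_on UNIV Q"
    unfolding Q vector_minus_component
    by (intro smooth_on_add smooth_on_diff smooth_on_mult smooth_on_sum smooth_on_const smooth_on_norm_sq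
        smooth_on_linear bounded_linear_vec_nth) auto
  have pk: "partial k Q = (\<lambda>x. b k + (\<Sum>j\<in>UNIV. (A k j + A j k) / 2 * (x - x0) $ j) - 2 * \<epsilon> * (x - x0) $ k)" for k
  proof
    fix x :: "real ^ 'n"
    note di = has_derivative_coordinate[of x0 _ x]
    have "(Q has_derivative (\<lambda>v. 0 + (\<Sum>i\<in>UNIV. b i * v $ i) +
       (1/2) * (\<Sum>i\<in>UNIV. \<Sum>j\<in>UNIV. A i j * (x - x0) $ i * v $ j + A i j * v $ i * (x - x0) $ j) - \<epsilon> * ((2 *\<^sub>R (x - x0)) \<bullet> v))) (at x)"
      unfolding Q
      by (intro has_derivative_add has_derivative_diff has_derivative_mult_right has_derivative_sum has_derivative_mult
          has_derivative_const di has_derivative_norm_sq)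
    from partial_eqI[OF this, of k]
    have r: "partial k Q x = 0 + (\<Sum>i\<in>UNIV. b i * axis k 1 $ i) +
       (1/2) * (\<Sum>i\<in>UNIV. \<Sum>j\<in>UNIV. A i j * (x - x0) $ i * axis k 1 $ j + A i j * axis k 1 $ i * (x - x0) $ j)
         - \<epsilon> * ((2 *\<^sub>R (x - x0)) \<bullet> axis k 1)" .
    have s1: "(\<Sum>i\<in>UNIV. b i * axis k 1 $ i) = b k"
      by (simp add: axis_component if_distrib[of "\<lambda>z. _ * z"] cong: if_cong)
    have s2: "(\<Sum>i\<in>UNIV. \<Sum>j\<in>UNIV. A i j * (x - x0) $ i * axis k 1 $ j) = (\<Sum>i\<in>UNIV. A i k * (x - x0) $ i)"
      by (simp add: axis_component if_distrib[of "\<lambda>z. _ * z"] cong: if_cong)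
    have "(\<Sum>i\<in>UNIV. \<Sum>j\<in>UNIV. A i j * axis k 1 $ i * (x - x0) $ j) = (\<Sum>i\<in>UNIV. (\<Sum>j\<in>UNIV. A i j * (x - x0) $ j) * axis k 1 $ i)"
      by (simp only: sum_distrib_right) (simp add: mult_ac)
    also have "\<dots> = (\<Sum>j\<in>UNIV. A k j * (x - x0) $ j)"
      by (simp add: axis_component if_distrib[of "\<lambda>z. _ * z"] del: vector_minus_component cong: if_cong)
    finally have s3: "(\<Sum>i\<in>UNIV. \<Sum>j\<in>UNIV. A i j * axis k 1 $ i * (x - x0) $ j) = (\<Sum>j\<in>UNIV. A k j * (x - x0) $ j)" .
    have "partial k Q x = b k + (1/2) * ((\<Sum>i\<in>UNIV. A i k * (x - x0) $ i) + (\<Sum>j\<in>UNIV. A k j * (x - x0) $ j)) - \<epsilon> * (2 * (x - x0) $ k)"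
      unfolding r s1 sum.distrib s2 s3 by (simp add: inner_axis)
    then show "partial k Q x = b k + (\<Sum>j\<in>UNIV. (A k j + A j k) / 2 * (x - x0) $ j) - 2 * \<epsilon> * (x - x0) $ k"
      by (simp add: sum.distrib add_divide_distrib distrib_right sum_divide_distrib sum_distrib_left)
  qed
  show "partial k Q x0 = b k" by (simp add: pk)
  note di = has_derivative_coordinate[of x0 _ x0]
  have "((\<lambda>x. b k + (\<Sum>j\<in>UNIV. (A k j + A j k) / 2 * (x - x0) $ j) - 2 * \<epsilon> * (x - x0) $ k) has_derivative
     (\<lambda>v. 0 + (\<Sum>j\<in>UNIV. (A k j + A j k) / 2 * v $ j) - 2 * \<epsilon> * v $ k)) (at x0)"
    by (intro has_derivative_add has_derivative_diff has_derivative_mult_right has_derivative_sum has_derivative_const di)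
  from partial_eqI[OF this, of l]
  show "partial l (partial k Q) x0 = (A k l + A l k) / 2 - (if k = l then 2 * \<epsilon> else 0)"
    unfolding pk by (simp add: axis_component if_distrib[of "\<lambda>z. _ * z"] cong: if_cong)
qed

text \<open>The second-order Taylor polynomial of \<phi> lowered by \<epsilon> |x - x0|^2 is smooth
  and, the Taylor error being \<epsilon>/2 |x - x0|^2, touches v from below with a quadratic gap.
  The lowering changes the infinity Laplacian at x0 by -2 \<epsilon> |grad \<phi>|^2, which
  disappears as \<epsilon> -> 0.\<close>

lemma touching_C2:
  fixes v :: "real ^ 'n::finite \<Rightarrow> real"
  assumes core: "\<And>P \<epsilon> r0. smooth_on UNIV P \<Longrightarrow> P x0 = v x0 \<Longrightarrow> r0 > 0 \<Longrightarrow> ball x0 r0 \<subseteq> \<Omega> \<Longrightarrow> \<epsilon> > 0 \<Longrightarrow>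
       (\<And>x. x \<in> ball x0 r0 \<Longrightarrow> P x + \<epsilon> * (norm (x - x0))\<^sup>2 \<le> v x) \<Longrightarrow> inf_laplacian P x0 \<le> 0"
    and \<phi>: "Ck_on 2 (ball x0 r) \<phi>" "r > 0" "ball x0 r \<subseteq> \<Omega>" "\<phi> x0 = v x0" "\<And>x. x \<in> ball x0 r \<Longrightarrow> \<phi> x \<le> v x"
  shows "inf_laplacian \<phi> x0 \<le> 0"
proof -
  define b where "b = (\<lambda>i. partial i \<phi> x0)"
  define A where "A = (\<lambda>i j. partial j (partial i \<phi>) x0)"
  have step: "inf_laplacian \<phi> x0 - 2 * \<epsilon> * (\<Sum>i\<in>UNIV. b i * b i) \<le> 0" if \<epsilon>: "\<epsilon> > 0" for \<epsilon>
  proof -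
    define Q where "Q = (\<lambda>x :: real ^ 'n. \<phi> x0 + (\<Sum>i\<in>UNIV. b i * (x - x0) $ i) + (1/2) * (\<Sum>i\<in>UNIV. \<Sum>j\<in>UNIV. A i j * (x - x0) $ i * (x - x0) $ j)
      - \<epsilon> * ((x - x0) \<bullet> (x - x0)))"
    note Qd = quadratic_derivatives[OF Q_def]
    have \<epsilon>2: "\<epsilon> / 2 > 0" using \<epsilon> by simp
    obtain s where s: "s > 0" "s \<le> r" and sx: "\<And>x. x \<in> ball x0 s \<Longrightarrow> \<phi> x \<ge> \<phi> x0 + (\<Sum>i\<in>UNIV. b i * (x - x0) $ i) +
    (1/2) * (\<Sum>i\<in>UNIV. \<Sum>j\<in>UNIV. A i j * (x - x0) $ i * (x - x0) $ j) - \<epsilon> / 2 * (norm (x - x0))\<^sup>2"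
      using second_order_taylor_lower[OF \<phi>(1,2) \<epsilon>2] unfolding A_def b_def by blast
    have "inf_laplacian Q x0 \<le> 0"
    proof (rule core[OF Qd(1) _ s(1) _ \<epsilon>2])
      show "Q x0 = v x0" using \<phi>(4) by (simp add: Q_def)
      show "ball x0 s \<subseteq> \<Omega>" using s \<phi>(3) by (meson subset_ball subset_trans)
      fix x assume x: "x \<in> ball x0 s"
      then have "\<phi> x \<le> v x" using s by (intro \<phi>(5)) auto
      then show "Q x + \<epsilon> / 2 * (norm (x - x0))\<^sup>2 \<le> v x"
        using sx[OF x] by (simp add: Q_def power2_norm_eq_inner)
    qed
    moreover have "inf_laplacian Q x0 = inf_laplacian \<phi> x0 - 2 * \<epsilon> * (\<Sum>i\<in>UNIV. b i * b i)"
    proof -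
      have "inf_laplacian Q x0 = (\<Sum>i\<in>UNIV. \<Sum>j\<in>UNIV. b i * b j * ((A i j + A j i) / 2) - b i * b j * (if i = j then 2 * \<epsilon> else 0))"
        unfolding inf_laplacian_def Qd(2,3) by (simp only: right_diff_distrib)
      also have "\<dots> = (\<Sum>i\<in>UNIV. \<Sum>j\<in>UNIV. b i * b j * ((A i j + A j i) / 2)) - (\<Sum>i\<in>UNIV. \<Sum>j\<in>UNIV. b i * b j * (if i = j then 2 * \<epsilon> else 0))"
        by (simp only: sum_subtractf)
      also have "(\<Sum>i\<in>UNIV. \<Sum>j\<in>UNIV. b i * b j * (if i = j then 2 * \<epsilon> else 0)) = 2 * \<epsilon> * (\<Sum>i\<in>UNIV. b i * b i)"
        by (simp add: if_distrib[of "\<lambda>z. _ * z"] sum_distrib_left mult.commute cong: if_cong)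
      also have "(\<Sum>i\<in>UNIV. \<Sum>j\<in>UNIV. b i * b j * ((A i j + A j i) / 2)) =
         (1/2) * (\<Sum>i\<in>UNIV. \<Sum>j\<in>UNIV. b i * b j * A i j) + (1/2) * (\<Sum>i\<in>UNIV. \<Sum>j\<in>UNIV. b i * b j * A j i)"
        by (simp add: sum_distrib_left sum.distrib[symmetric] add_divide_distrib distrib_left)
      also have "(\<Sum>i\<in>UNIV. \<Sum>j\<in>UNIV. b i * b j * A j i) = (\<Sum>i\<in>UNIV. \<Sum>j\<in>UNIV. b i * b j * A i j)"
        by (subst sum.swap) (simp add: mult.commute)
      finally show ?thesis by (simp add: inf_laplacian_def A_def b_def)
    qed
    ultimately show ?thesis by simp
  qed
  have "((\<lambda>\<epsilon>. inf_laplacian \<phi> x0 - 2 * \<epsilon> * (\<Sum>i\<in>UNIV. b i * b i)) \<longlongrightarrow> inf_laplacian \<phi> x0 - 2 * 0 * (\<Sum>i\<in>UNIV. b i * b i)) (at_right 0)"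
    by (intro tendsto_intros)
  then have "inf_laplacian \<phi> x0 - 2 * 0 * (\<Sum>i\<in>UNIV. b i * b i) \<le> 0"
  proof (rule tendsto_upperbound)
    show "\<forall>\<^sub>F \<epsilon> in at_right 0. inf_laplacian \<phi> x0 - 2 * \<epsilon> * (\<Sum>i\<in>UNIV. b i * b i) \<le> 0"
      unfolding eventually_at_right_field using step by (intro exI[of _ 1]) auto
  qed simp
  then show ?thesis by simp
qed

section \<open>The strong minimum principle\<close>

text \<open>For c > 0 this radial barrier decreases in |x - y| up to the radius sqrt(K), and its
  infinity Laplacian is positive where K/3 < |x - y|^2 < K: a strict subsolution in an
  annulus.\<close>

lemma barrier_derivatives:
  fixes y :: "real ^ 'n::finite"
  assumes \<phi>: "\<phi> = (\<lambda>x. c * (K - (x - y) \<bullet> (x - y))\<^sup>2 + m)"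
  shows "smooth_on UNIV \<phi>"
    "inf_laplacian \<phi> x = 64 * c ^ 3 * (K - (x - y) \<bullet> (x - y))\<^sup>2 * ((x - y) \<bullet> (x - y)) * (3 * ((x - y) \<bullet> (x - y)) - K)"
proof -
  define s where "s = (\<lambda>x. (x - y) \<bullet> (x - y))"
  show "smooth_on UNIV \<phi>"
    unfolding \<phi> power2_eq_square
    by (intro smooth_on_add smooth_on_mult smooth_on_diff smooth_on_const smooth_on_norm_sq) auto
  have ds: "(s has_derivative (\<lambda>v. (2 *\<^sub>R (x - y)) \<bullet> v)) (at x)" for x
    unfolding s_def by (rule has_derivative_norm_sq)
  have p1: "partial i \<phi> = (\<lambda>x. (-4 * c) * ((K - s x) * (x - y) $ i))" for i
  proof
    fix x
    have "((\<lambda>x. c * ((K - s x) * (K - s x)) + m) has_derivative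
       (\<lambda>v. c * ((K - s x) * (0 - (2 *\<^sub>R (x - y)) \<bullet> v) + (0 - (2 *\<^sub>R (x - y)) \<bullet> v) * (K - s x)) + 0)) (at x)"
      by (intro has_derivative_add has_derivative_mult_right has_derivative_mult has_derivative_diff has_derivative_const ds)
    from partial_eqI[OF this, of i]
    show "partial i \<phi> x = (-4 * c) * ((K - s x) * (x - y) $ i)"
      unfolding \<phi> power2_eq_square s_def[symmetric] by (simp add: inner_axis algebra_simps s_def)
  qed
  have p2: "partial j (partial i \<phi>) x = 8 * c * ((x - y) $ i * (x - y) $ j) - 4 * c * (K - s x) * (if i = j then 1 else 0)" for i j
  proof -
    have "((\<lambda>x. (-4 * c) * ((K - s x) * (x - y) $ i)) has_derivative
       (\<lambda>v. (-4 * c) * ((K - s x) * v $ i + (0 - (2 *\<^sub>R (x - y)) \<bullet> v) * (x - y) $ i))) (at x)"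
      by (intro has_derivative_mult_right has_derivative_mult has_derivative_diff has_derivative_const ds
          has_derivative_coordinate)
    from partial_eqI[OF this, of j]
    have r: "partial j (\<lambda>x. (-4 * c) * ((K - s x) * (x - y) $ i)) x =
      (-4 * c) * ((K - s x) * axis j 1 $ i + (0 - (2 *\<^sub>R (x - y)) \<bullet> axis j 1) * (x - y) $ i)" .
    show ?thesis unfolding p1 r by (simp add: inner_axis axis_component algebra_simps)
  qed
  define z where "z = x - y"
  define k where "k = K - s x"
  have sz: "s x = (\<Sum>i\<in>UNIV. z $ i * z $ i)" by (simp add: s_def z_def inner_vec_def)
  have "inf_laplacian \<phi> x = (\<Sum>i\<in>UNIV. \<Sum>j\<in>UNIV. 128 * c ^ 3 * k\<^sup>2 * ((z $ i * z $ i) * (z $ j * z $ j))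
      - 64 * c ^ 3 * k ^ 3 * ((if i = j then z $ i * z $ i else 0)))"
    unfolding inf_laplacian_def p2 unfolding p1 z_def[symmetric] k_def[symmetric]
    by (intro sum.cong refl) (simp add: power2_eq_square power3_eq_cube algebra_simps)
  also have "\<dots> = 128 * c ^ 3 * k\<^sup>2 * (s x * s x) - 64 * c ^ 3 * k ^ 3 * s x"
    unfolding sz by (simp add: sum_subtractf sum_distrib_left[symmetric] sum_product)
  also have "\<dots> = 64 * c ^ 3 * k\<^sup>2 * s x * (2 * s x - k)"
    by (simp add: power2_eq_square power3_eq_cube algebra_simps)
  also have "2 * s x - k = 3 * s x - K" by (simp add: k_def)
  finally show "inf_laplacian \<phi> x = 64 * c ^ 3 * (K - (x - y) \<bullet> (x - y))\<^sup>2 * ((x - y) \<bullet> (x - y)) * (3 * ((x - y) \<bullet> (x - y)) - K)"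
    by (simp add: k_def s_def)
qed

text \<open>Strong minimum principle, by comparison with a barrier in an annulus around a point where
  \<open>v > 0\<close> whose inscribed positivity ball touches the zero set.\<close>

lemma positive_of_touching:
  fixes v :: "real ^ 'n::finite \<Rightarrow> real"
  assumes \<Omega>: "open \<Omega>" "connected \<Omega>" and v: "continuous_on \<Omega> v" "\<And>x. x \<in> \<Omega> \<Longrightarrow> v x \<ge> 0"
    and a: "a \<in> \<Omega>" "v a > 0"
    and touch: "\<And>\<phi> x0 r. Ck_on 2 (ball x0 r) \<phi> \<Longrightarrow> r > 0 \<Longrightarrow> ball x0 r \<subseteq> \<Omega> \<Longrightarrow> \<phi> x0 = v x0 \<Longrightarrow>
       (\<And>x. x \<in> ball x0 r \<Longrightarrow> \<phi> x \<le> v x) \<Longrightarrow> inf_laplacian \<phi> x0 \<le> 0"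
    and x: "x \<in> \<Omega>"
  shows "v x > 0"
proof (rule ccontr)
  assume nx: "\<not> v x > 0"
  define Pp where "Pp = \<Omega> \<inter> v -` {0<..}"
  have Po: "open Pp" unfolding Pp_def by (rule continuous_open_preimage[OF v(1) \<Omega>(1)]) simp
  have Z: "v z = 0" if "z \<in> \<Omega> - Pp" for z using that v(2)[of z] by (auto simp: Pp_def)
  have "\<not> open (\<Omega> - Pp)"
  proof
    assume "open (\<Omega> - Pp)"
    then have "Pp \<inter> \<Omega> = {} \<or> (\<Omega> - Pp) \<inter> \<Omega> = {}"
      by (intro connectedD[OF \<Omega>(2) Po]) auto
    then show False using a x nx by (auto simp: Pp_def)
  qed
  then obtain z where z: "z \<in> \<Omega> - Pp" "\<And>e. e > 0 \<Longrightarrow> \<not> ball z e \<subseteq> \<Omega> - Pp"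
    unfolding open_contains_ball by blast
  obtain R where R: "R > 0" "ball z R \<subseteq> \<Omega>" using \<Omega>(1) z(1) open_contains_ball by blast
  \<comment> \<open>A quarter leaves room: y lies within \<rho> of z, the outer radius around y is
    below 6/5 \<rho>, and zeros are looked for within 2 \<rho> of z, all inside the ball of radius
    R.\<close>
  define \<rho> where "\<rho> = R / 4"
  have \<rho>: "\<rho> > 0" using R by (simp add: \<rho>_def)
  have "ball z \<rho> \<subseteq> \<Omega>" using R by (auto simp: \<rho>_def)
  then obtain y where y: "y \<in> ball z \<rho>" "y \<in> Pp" using z(2)[OF \<rho>] by blast
  \<comment> \<open>Restricting to a closed ball inside \<Omega> makes this set of zeros closed, so
    a nearest point to y exists. Points within s < \<rho> of y stay in that ball, so none of them
    can be a zero.\<close>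
  define T where "T = cball z (2 * \<rho>) - Pp"
  have T\<Omega>: "cball z (2 * \<rho>) \<subseteq> \<Omega>" using R(1) by (intro order_trans[OF _ R(2)]) (auto simp: \<rho>_def)
  have Tc: "closed T" unfolding T_def using Po by (intro closed_Diff) auto
  have zT: "z \<in> T" using z \<rho> by (auto simp: T_def)
  then have Tne: "T \<noteq> {}" by blast
  obtain z' where z': "z' \<in> T" "infdist y T = dist y z'"
    using infdist_attains_inf[OF Tc Tne] by blast
  define s where "s = dist y z'"
  have s_min: "s \<le> dist y t" if "t \<in> T" for t using infdist_le[OF that, of y] z'(2) by (simp add: s_def)
  have s_lt: "s < \<rho>" using s_min[OF zT] y(1) by (simp add: dist_commute)
  have "z' \<noteq> y" using z'(1) y(2) by (auto simp: T_def)
  then have s0: "s > 0" by (simp add: s_def)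
  have vz': "v z' = 0" using z'(1) T\<Omega> by (intro Z) (auto simp: T_def)
  have inside: "w \<in> Pp" if "dist y w < s" for w
  proof (rule ccontr)
    assume "w \<notin> Pp"
    moreover have "dist z w \<le> 2 * \<rho>" using dist_triangle[of z w y] y(1) that s_lt by simp
    ultimately have "w \<in> T" by (simp add: T_def)
    then show False using s_min that by force
  qed
  have big: "cball y (6/5 * s) \<subseteq> \<Omega>"
  proof
    fix w assume "w \<in> cball y (6/5 * s)"
    then have "dist z w < R" using dist_triangle[of z w y] y(1) s_lt R(1) by (simp add: \<rho>_def)
    then show "w \<in> \<Omega>" using R(2) by auto
  qed
  \<comment> \<open>The annulus around y has radii 9/10 s and 6/5 s and contains the zero
    \<open>z'\<close> at distance s. The barrier vanishes on the outer sphere, and 3 (9/10)^2 >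
    (6/5)^2 puts the open annulus where its infinity Laplacian is positive.\<close>
  define K where "K = (6/5 * s)\<^sup>2"
  define n2 where "n2 = (\<lambda>x. (x - y) \<bullet> (x - y))"
  have n2: "n2 x = (dist y x)\<^sup>2" for x by (simp add: n2_def dist_norm norm_minus_commute power2_norm_eq_inner)
  define S where "S = sphere y (9/10 * s)"
  have SP: "S \<subseteq> Pp" using inside s0 by (auto simp: S_def)
  have Sv: "continuous_on S v" by (rule continuous_on_subset[OF v(1)]) (use SP in \<open>auto simp: Pp_def\<close>)
  have Sne: "S \<noteq> {}" using s0 by (simp add: S_def)
  obtain x\<mu> where x\<mu>: "x\<mu> \<in> S" "\<And>w. w \<in> S \<Longrightarrow> v x\<mu> \<le> v w"
    using continuous_attains_inf[OF _ Sne Sv] by (auto simp: S_def)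
  \<comment> \<open>Scaled so that on the inner sphere the barrier is half the minimum of v
    there.\<close>
  define c where "c = v x\<mu> / (2 * (K - (9/10 * s)\<^sup>2)\<^sup>2)"
  have Kpos: "K - (9/10 * s)\<^sup>2 > 0" using s0 by (simp add: K_def power2_eq_square)
  have \<mu>: "v x\<mu> > 0" using x\<mu>(1) SP by (auto simp: Pp_def)
  have c: "c > 0" using \<mu> Kpos by (simp add: c_def)
  define \<psi> where "\<psi> = (\<lambda>x. c * (K - n2 x)\<^sup>2)"
  define A where "A = cball y (6/5 * s) - ball y (9/10 * s)"
  have Ac: "compact A" unfolding A_def by (intro compact_diff) auto
  have z'A: "z' \<in> A" using s0 by (simp add: A_def flip: s_def)
  have A\<Omega>: "A \<subseteq> \<Omega>" using big by (auto simp: A_def)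
  have c\<psi>: "continuous_on A \<psi>" unfolding \<psi>_def n2_def by (intro continuous_intros)
  obtain x1 where x1: "x1 \<in> A" "\<And>w. w \<in> A \<Longrightarrow> v x1 - \<psi> x1 \<le> v w - \<psi> w"
    using continuous_attains_inf[OF Ac _ continuous_on_diff[OF continuous_on_subset[OF v(1) A\<Omega>] c\<psi>]] z'A by auto
  define m where "m = v x1 - \<psi> x1"
  have \<psi>z': "\<psi> z' > 0"
  proof -
    have "n2 z' = s\<^sup>2" by (simp add: n2 s_def)
    then have "K - n2 z' > 0" using s0 by (simp add: K_def power2_eq_square)
    then show ?thesis using c by (simp add: \<psi>_def)
  qed
  \<comment> \<open>v - \<psi> is negative at \<open>z'\<close>, but nonnegative on the outer
    sphere, where \<psi> = 0, and positive on the inner one. So its minimum is attained inside the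
    annulus, where the barrier shifted by m touches v from below.\<close>
  have m: "m < 0" using x1(2)[OF z'A] vz' \<psi>z' by (simp add: m_def)
  have d1: "dist y x1 \<noteq> 6/5 * s"
  proof
    assume d: "dist y x1 = 6/5 * s"
    have "\<psi> x1 = 0" unfolding \<psi>_def n2 K_def d by simp
    then show False using m v(2)[of x1] x1(1) A\<Omega> by (auto simp: m_def)
  qed
  have d2: "dist y x1 \<noteq> 9/10 * s"
  proof
    assume d: "dist y x1 = 9/10 * s"
    then have "v x\<mu> \<le> v x1" by (intro x\<mu>(2)) (simp add: S_def)
    moreover have "\<psi> x1 = v x\<mu> / 2" unfolding \<psi>_def n2 d c_def using Kpos by simp
    ultimately show False using m \<mu> by (simp add: m_def)
  qed
  have d: "9/10 * s < dist y x1" "dist y x1 < 6/5 * s" using x1(1) d1 d2 by (auto simp: A_def)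
  define U where "U = ball y (6/5 * s) - cball y (9/10 * s)"
  have "open U" "x1 \<in> U" using d by (auto simp: U_def)
  then obtain r where r: "r > 0" "ball x1 r \<subseteq> U" using open_contains_ball by blast
  have UA: "U \<subseteq> A" by (auto simp: U_def A_def)
  define \<phi> where "\<phi> = (\<lambda>x. c * (K - (x - y) \<bullet> (x - y))\<^sup>2 + m)"
  note bd = barrier_derivatives[OF \<phi>_def]
  have \<phi>\<psi>: "\<phi> x = \<psi> x + m" for x by (simp add: \<phi>_def \<psi>_def n2_def)
  have "inf_laplacian \<phi> x1 \<le> 0"
  proof (rule touch[OF _ r(1)])
    show "Ck_on 2 (ball x1 r) \<phi>"
      using smooth_on_subset[OF bd(1), of "ball x1 r"] by (simp add: smooth_on_def)
    show "ball x1 r \<subseteq> \<Omega>" using r(2) UA A\<Omega> by blast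
    show "\<phi> x1 = v x1" by (simp add: \<phi>\<psi> m_def)
    fix w assume "w \<in> ball x1 r"
    then have "w \<in> A" using r(2) UA by blast
    then show "\<phi> w \<le> v w" using x1(2)[of w] by (simp add: \<phi>\<psi> m_def)
  qed
  moreover have "inf_laplacian \<phi> x1 > 0"
  proof -
    have "n2 x1 > (9/10 * s)\<^sup>2" unfolding n2 using d s0 by (intro power_strict_mono) auto
    then have l: "n2 x1 > 81/100 * s\<^sup>2" by (simp add: power2_eq_square)
    have s2: "s\<^sup>2 > 0" using s0 by simp
    have K': "K = 36/25 * s\<^sup>2" by (simp add: K_def power2_eq_square)
    have "n2 x1 < K" unfolding n2 K_def using d s0 by (intro power_strict_mono) auto
    then have "(K - n2 x1)\<^sup>2 > 0" by simp
    moreover have "n2 x1 > 0" "3 * n2 x1 - K > 0" using l K' s2 by linarith+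
    moreover have "(x1 - y) \<bullet> (x1 - y) = n2 x1" by (simp add: n2_def)
    ultimately show ?thesis
      unfolding bd(2) using c by (intro mult_pos_pos) auto
  qed
  ultimately show False by simp
qed

section \<open>Limits of extremals\<close>

lemma Lnorm_ge_measure:
  fixes f :: "real ^ 'n::finite \<Rightarrow> real"
  assumes \<Omega>: "open \<Omega>" "bounded \<Omega>" and q: "q > 0" and f: "in_L (ereal q) \<Omega> f" and A: "open A" "A \<subseteq> \<Omega>" and a: "a \<ge> 0" "\<And>x. x \<in> A \<Longrightarrow> a \<le> \<bar>f x\<bar>"
  shows "a * measure lebesgue A powr (1 / q) \<le> Lnorm (ereal q) \<Omega> f"
proof -
  let ?M = "lebesgue_on \<Omega>"
  have As: "A \<in> sets ?M" "A \<inter> \<Omega> = A" using \<Omega> A by (auto simp: sets_restrict_space_iff borel_open)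
  have fin: "finite_measure ?M" by (rule finite_measure_lebesgue_on[OF lmeasurable_open[OF \<Omega>(2,1)]])
  have mA: "measure ?M A = measure lebesgue A" using \<Omega> A by (simp add: measure_restrict_space borel_open)
  have i: "integrable ?M (\<lambda>x. a powr q * indicator A x)"
    using As(1) finite_measure.emeasure_finite[OF fin, of A]
    by (intro integrable_mult_right integrable_real_indicator) (auto simp: less_top)
  have "a powr q * measure lebesgue A = (\<integral>x. a powr q * indicator A x \<partial>?M)"
    using As by (simp add: mA space_restrict_space)
  also have "\<dots> \<le> (\<integral>x. norm (f x) powr q \<partial>?M)"
    using f a q by (intro integral_mono i) (auto simp: in_L_ereal indicator_def intro!: powr_mono2)
  finally have "(a powr q * measure lebesgue A) powr (1 / q) \<le> Lnorm (ereal q) \<Omega> f"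
    unfolding Lnorm_ereal using q by (intro powr_mono2) auto
  then show ?thesis using a q by (simp add: powr_mult powr_powr)
qed

lemma tendsto_powr_inverse:
  fixes c :: real
  assumes "c > 0" "filterlim p at_top F"
  shows "((\<lambda>k. c powr (1 / p k)) \<longlongrightarrow> 1) F"
proof -
  have "((\<lambda>k. 1 / p k) \<longlongrightarrow> 0) F"
    using tendsto_inverse_0_at_top[OF assms(2)] by (simp add: inverse_eq_divide)
  then have "((\<lambda>k. c powr (1 / p k)) \<longlongrightarrow> c powr 0) F"
    using assms(1) by (intro tendsto_powr tendsto_const) auto
  then show ?thesis using assms(1) by simp
qed

lemma CARD_ge_1: "real CARD('n::finite) \<ge> 1"
  using zero_less_card_finite[where 'a='n] by (metis One_nat_def Suc_leI of_nat_1 of_nat_le_iff)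

lemma tendsto_cube_avg:
  fixes w :: "real ^ 'n::finite \<Rightarrow> real"
  assumes "continuous_on UNIV w"
  shows "(cube_avg w c \<longlongrightarrow> w c) (at_right 0)"
proof -
  have "continuous_on UNIV (cube_avg w c)"
    unfolding cube_avg_def[abs_def]
    by (rule integral_continuous_on_param)
       (auto simp: case_prod_beta intro!: continuous_on_compose2[OF assms] continuous_intros)
  then have "(cube_avg w c \<longlongrightarrow> cube_avg w c 0) (at 0)" by (simp add: continuous_on_def)
  then show ?thesis by (simp add: cube_avg_0 filterlim_at_split)
qed

lemma uniform_limit_cube_avg:
  fixes w :: "real ^ 'n::finite \<Rightarrow> real"
  assumes "uniform_limit UNIV f w F" "\<And>k. continuous_on UNIV (f k)" "F \<noteq> bot"
  shows "((\<lambda>k. cube_avg (f k) c r) \<longlongrightarrow> cube_avg w c r) F"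
proof -
  have ul: "uniform_limit (cbox 0 One) (\<lambda>k z. f k (c + r *\<^sub>R z)) (\<lambda>z. w (c + r *\<^sub>R z)) F"
    unfolding uniform_limit_iff
  proof (intro allI impI)
    fix e :: real assume "e > 0"
    from uniform_limitD[OF assms(1) this]
    show "\<forall>\<^sub>F k in F. \<forall>z\<in>cbox 0 One. dist (f k (c + r *\<^sub>R z)) (w (c + r *\<^sub>R z)) < e"
      by eventually_elim simp
  qed
  have co: "\<And>k. continuous_on (cbox 0 One) (\<lambda>z. f k (c + r *\<^sub>R z))"
    by (rule continuous_on_affine_compose[OF assms(2)])
  obtain I J where IJ: "\<And>k. ((\<lambda>z. f k (c + r *\<^sub>R z)) has_integral I k) (cbox 0 One)"
    "((\<lambda>z. w (c + r *\<^sub>R z)) has_integral J) (cbox 0 One)" "(I \<longlongrightarrow> J) F"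
    using uniform_limit_integral_cbox[OF ul co assms(3)] by blast
  have "cube_avg (f k) c r = I k" "cube_avg w c r = J" for k
    unfolding cube_avg_def by (rule integral_unique[OF IJ(1)] integral_unique[OF IJ(2)])+
  then show ?thesis using IJ(3) by simp
qed

context
  fixes \<Omega> :: "(real ^ 'n::finite) set"
  assumes \<Omega>: "open \<Omega>" "bounded \<Omega>" "\<Omega> \<noteq> {}"
begin

lemma uniform_limit_zero_ext:
  assumes lim: "uniform_limit (closure \<Omega>) f v F"
  shows "uniform_limit UNIV (\<lambda>k. zero_ext \<Omega> (f k)) (zero_ext \<Omega> v) F"
  unfolding uniform_limit_iff
proof (intro allI impI)
  fix e :: real assume e: "e > 0"
  show "\<forall>\<^sub>F k in F. \<forall>x\<in>UNIV. dist (zero_ext \<Omega> (f k) x) (zero_ext \<Omega> v x) < e"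
    using uniform_limitD[OF lim e]
  proof eventually_elim
    case (elim k)
    then show ?case using e closure_subset[of \<Omega>] by (auto simp: zero_ext_def)
  qed
qed

lemma extremal_root:
  assumes ext: "sobolev_extremal \<Omega> p q u" and p: "p > 0"
  shows "sobolev_lambda \<Omega> p q powr (1 / p) = Lnorm (ereal p) \<Omega> (weak_grad \<Omega> u)"
  using ext p Lnorm_ereal_nonneg[of p \<Omega> "weak_grad \<Omega> u"]
  by (auto simp: sobolev_extremal_def powr_powr simp del: not_gr_zero dest!: sym[of _ "sobolev_lambda \<Omega> p q"])

text \<open>The estimates for test functions pass to the limit along \<open>W1_0_approx\<close>,
  whose gradient norms tend to the p-th root of \<lambda>. The averaged estimate is recorded besides
  the pointwise one because it alone has a sharp constant.\<close>

lemma extremal_regularity: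
  assumes ext: "sobolev_extremal \<Omega> p q u" and p: "p > real CARD('n)"
  shows "u \<in> C_0 \<Omega>"
    and "\<bar>zero_ext \<Omega> u x - zero_ext \<Omega> u y\<bar> \<le> morrey_const (real CARD('n)) p * (sobolev_lambda \<Omega> p q powr (1 / p)) * norm (x - y) powr (1 - real CARD('n) / p)"
    and "r > 0 \<Longrightarrow> \<bar>cube_avg (zero_ext \<Omega> u) (c + h) r - cube_avg (zero_ext \<Omega> u) c r\<bar>
       \<le> norm h * ((sobolev_lambda \<Omega> p q powr (1 / p)) * r powr (- real CARD('n) / p))"
proof -
  have p1: "p \<ge> 1" and p0: "p > 0" using p CARD_ge_1[where 'n='n] by linarith+
  have uW: "u \<in> W1_0 (ereal p) \<Omega>" and uc: "continuous_on (closure \<Omega>) u"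
    using ext by (auto simp: sobolev_extremal_def)
  obtain \<phi> where \<phi>: "\<And>k::nat. test_function \<Omega> (\<phi> k)" and ul: "uniform_limit (closure \<Omega>) \<phi> u sequentially"
    and gl: "(\<lambda>k. Lnorm (ereal p) \<Omega> (grad (\<phi> k))) \<longlonglongrightarrow> Lnorm (ereal p) \<Omega> (weak_grad \<Omega> u)"
    using W1_0_approx[OF \<Omega> p uW uc] by blast
  define l where "l = sobolev_lambda \<Omega> p q powr (1 / p)"
  have gl': "(\<lambda>k. Lnorm (ereal p) \<Omega> (grad (\<phi> k))) \<longlonglongrightarrow> l"
    using gl by (simp add: l_def extremal_root[OF ext p0])
  have "zero_ext \<Omega> (\<phi> k) = \<phi> k" for k
    using test_function_zero_outside[OF \<phi>[of k]] by (auto simp: zero_ext_def fun_eq_iff)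
  then have ulU: "uniform_limit UNIV \<phi> (zero_ext \<Omega> u) sequentially"
    using uniform_limit_zero_ext[OF ul] by simp
  then have pw: "(\<lambda>k. \<phi> k x) \<longlonglongrightarrow> zero_ext \<Omega> u x" for x
    by (rule tendsto_uniform_limitI) simp
  have "u x = 0" if x: "x \<in> frontier \<Omega>" for x
  proof -
    have "x \<in> closure \<Omega>" using x by (simp add: frontier_def)
    then have "(\<lambda>k. \<phi> k x) \<longlonglongrightarrow> u x" by (rule tendsto_uniform_limitI[OF ul])
    moreover have "\<phi> k x = 0" for k
      using test_function_zero_outside[OF \<phi>] frontier_disjoint[OF \<Omega> x] by blast
    ultimately show "u x = 0" by (simp add: LIMSEQ_const_iff)
  qed
  then show "u \<in> C_0 \<Omega>" using uc by (simp add: C_0_def)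
  show "\<bar>zero_ext \<Omega> u x - zero_ext \<Omega> u y\<bar> \<le> morrey_const (real CARD('n)) p * (sobolev_lambda \<Omega> p q powr (1 / p)) * norm (x - y) powr (1 - real CARD('n) / p)"
    unfolding l_def[symmetric]
  proof (rule LIMSEQ_le)
    show "(\<lambda>k. \<bar>\<phi> k x - \<phi> k y\<bar>) \<longlonglongrightarrow> \<bar>zero_ext \<Omega> u x - zero_ext \<Omega> u y\<bar>"
      by (intro tendsto_rabs tendsto_diff pw)
    show "(\<lambda>k. morrey_const (real CARD('n)) p * Lnorm (ereal p) \<Omega> (grad (\<phi> k)) * norm (x - y) powr (1 - real CARD('n) / p))
      \<longlonglongrightarrow> morrey_const (real CARD('n)) p * l * norm (x - y) powr (1 - real CARD('n) / p)"
      by (intro tendsto_mult tendsto_const gl')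
    show "\<exists>N. \<forall>n\<ge>N. \<bar>\<phi> n x - \<phi> n y\<bar> \<le> morrey_const (real CARD('n)) p * Lnorm (ereal p) \<Omega> (grad (\<phi> n)) * norm (x - y) powr (1 - real CARD('n) / p)"
      unfolding morrey_const_def using morrey_test[OF \<Omega>(1) \<phi> p1 order_refl p] by blast
  qed
  assume r: "r > 0"
  show "\<bar>cube_avg (zero_ext \<Omega> u) (c + h) r - cube_avg (zero_ext \<Omega> u) c r\<bar>
       \<le> norm h * ((sobolev_lambda \<Omega> p q powr (1 / p)) * r powr (- real CARD('n) / p))"
    unfolding l_def[symmetric]
  proof (rule LIMSEQ_le)
    show "(\<lambda>k. \<bar>cube_avg (\<phi> k) (c + h) r - cube_avg (\<phi> k) c r\<bar>) \<longlonglongrightarrow> \<bar>cube_avg (zero_ext \<Omega> u) (c + h) r - cube_avg (zero_ext \<Omega> u) c r\<bar>"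
      by (intro tendsto_rabs tendsto_diff uniform_limit_cube_avg[OF ulU] test_function_continuous[OF \<phi>] sequentially_bot)
    show "(\<lambda>k. norm h * (Lnorm (ereal p) \<Omega> (grad (\<phi> k)) * r powr (- real CARD('n) / p))) \<longlonglongrightarrow> norm h * (l * r powr (- real CARD('n) / p))"
      by (intro tendsto_mult tendsto_const gl')
    show "\<exists>N. \<forall>n\<ge>N. \<bar>cube_avg (\<phi> n) (c + h) r - cube_avg (\<phi> n) c r\<bar> \<le> norm h * (Lnorm (ereal p) \<Omega> (grad (\<phi> n)) * r powr (- real CARD('n) / p))"
      using cube_avg_translate[OF \<Omega>(1) \<phi> p1 order_refl r] by blast
  qed
qed

text \<open>A near-cone exceeds R - 3 \<delta> on an open set \<open>A\<close> of positive measure,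
  so its q-norm is at least (R - 3 \<delta>) |A|^(1/q), while its gradient norm is at most
  |\<Omega>|^(1/p). Both measure factors tend to 1 as p and q grow.\<close>

lemma eventually_sobolev_root_less:
  assumes p: "filterlim p at_top sequentially" "\<And>k. p k > real CARD('n)" and q: "filterlim q at_top sequentially" "\<And>k. q k \<ge> 1"
    and L: "L > Lambda_inf \<Omega>"
  shows "\<forall>\<^sub>F k in sequentially. sobolev_lambda \<Omega> (p k) (q k) powr (1 / p k) < L"
proof -
  obtain x0 where x0: "x0 \<in> \<Omega>" "boundary_dist \<Omega> x0 > 0" "Lnorm \<infinity> \<Omega> (boundary_dist \<Omega>) = boundary_dist \<Omega> x0"
    using inradius_point[OF \<Omega>] by blast
  define R where "R = boundary_dist \<Omega> x0"
  have R: "R > 0" using x0 by (simp add: R_def)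
  have LR: "L > 1 / R" using L x0(3) by (simp add: Lambda_inf_eq[OF \<Omega>] R_def)
  then have L0: "L > 0" using R by (meson divide_pos_pos less_trans zero_less_one)
  have "1 / L < R" using LR R L0 by (simp add: field_simps)
  \<comment> \<open>This makes R - 3 \<delta> the midpoint of R and 1/L. Two of the three \<delta>
    are the loss in \<open>near_cone_test_function\<close>, the third opens up the set
    \<open>A\<close>.\<close>
  define \<delta> where "\<delta> = (R - 1 / L) / 6"
  have \<delta>: "\<delta> > 0" using \<open>1 / L < R\<close> by (simp add: \<delta>_def)
  have R\<delta>: "R - 3 * \<delta> > 1 / L" using \<open>1 / L < R\<close> by (simp add: \<delta>_def field_simps)
  have invL: "1 / L > 0" using L0 by simp
  have "\<delta> < R" using R\<delta> invL \<delta> by linarith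
  then obtain \<phi> where \<phi>: "test_function \<Omega> \<phi>" "\<And>x. norm (grad \<phi> x) \<le> 1" "\<phi> x0 \<ge> R - 2 * \<delta>" "\<And>x. \<phi> x \<ge> 0"
    using near_cone_test_function[OF \<delta> _ ball_boundary_dist[OF \<Omega> x0(1)]] by (auto simp: R_def)
  define A where "A = \<Omega> \<inter> \<phi> -` {R - 3 * \<delta><..}"
  have A: "open A" unfolding A_def by (rule continuous_open_preimage[OF test_function_continuous[OF \<phi>(1)] \<Omega>(1)]) simp
  have Asub: "A \<subseteq> \<Omega>" by (auto simp: A_def)
  have "x0 \<in> A" using x0(1) \<phi>(3) \<delta> by (simp add: A_def)
  then have mA: "measure lebesgue A > 0"
    using measure_open_pos[OF A bounded_subset[OF \<Omega>(2) Asub]] by blast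
  have m\<Omega>: "measure lebesgue \<Omega> > 0" by (rule measure_open_pos[OF \<Omega>])
  let ?g = "\<lambda>k. measure lebesgue \<Omega> powr (1 / p k) / ((R - 3 * \<delta>) * measure lebesgue A powr (1 / q k))"
  have "?g \<longlonglongrightarrow> 1 / ((R - 3 * \<delta>) * 1)"
    using R\<delta> invL by (intro tendsto_divide tendsto_mult tendsto_const tendsto_powr_inverse m\<Omega> mA p q) auto
  moreover have "1 / ((R - 3 * \<delta>) * 1) < L"
  proof -
    have "0 < R - 3 * \<delta>" using R\<delta> invL by linarith
    moreover have "1 < (R - 3 * \<delta>) * L" using R\<delta> L0 by (simp add: pos_divide_less_eq)
    ultimately show ?thesis by (simp add: pos_divide_less_eq mult.commute)
  qed
  ultimately have "\<forall>\<^sub>F k in sequentially. ?g k < L" by (rule order_tendstoD)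
  then show ?thesis
  proof eventually_elim
    case (elim k)
    have pk: "p k \<ge> 1" "p k > 0" and qk: "q k > 0" using p(2)[of k] CARD_ge_1[where 'n='n] q(2)[of k] by linarith+
    have a: "0 < R - 3 * \<delta>" using R\<delta> invL by linarith
    have lq: "(R - 3 * \<delta>) * measure lebesgue A powr (1 / q k) \<le> Lnorm (ereal (q k)) \<Omega> \<phi>"
      by (rule Lnorm_ge_measure[OF \<Omega>(1,2) qk test_grad_integrable(4)[OF \<Omega>(1) \<phi>(1) qk] A Asub])
         (use a in \<open>auto simp: A_def\<close>)
    have pos: "(R - 3 * \<delta>) * measure lebesgue A powr (1 / q k) > 0" using a mA by simp
    have "Lnorm (ereal (p k)) \<Omega> (grad \<phi>) \<le> 1 * measure lebesgue \<Omega> powr (1 / p k)"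
      using test_grad_integrable(3)[OF \<Omega>(1) \<phi>(1) pk(2)] \<phi>(2) pk
      by (intro Lnorm_bounded[OF \<Omega>(1,2)]) (auto simp: in_L_ereal)
    then have "sobolev_lambda \<Omega> (p k) (q k) powr (1 / p k) * Lnorm (ereal (q k)) \<Omega> \<phi> \<le> measure lebesgue \<Omega> powr (1 / p k)"
      using sobolev_lambda_le(2)[OF \<Omega> \<phi>(1) pk(1) q(2)[of k]] lq pos by linarith
    moreover have "sobolev_lambda \<Omega> (p k) (q k) powr (1 / p k) * ((R - 3 * \<delta>) * measure lebesgue A powr (1 / q k))
       \<le> sobolev_lambda \<Omega> (p k) (q k) powr (1 / p k) * Lnorm (ereal (q k)) \<Omega> \<phi>"
      by (intro mult_left_mono lq) simp
    ultimately have "sobolev_lambda \<Omega> (p k) (q k) powr (1 / p k) \<le> ?g k"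
      using pos by (simp add: pos_le_divide_eq)
    then show ?case using elim by simp
  qed
qed

lemma Lnorm_inf_close:
  fixes f g :: "real ^ 'n \<Rightarrow> real"
  assumes f: "f \<in> C_0 \<Omega>" and g: "g \<in> C_0 \<Omega>" and e: "\<And>x. x \<in> \<Omega> \<Longrightarrow> \<bar>f x - g x\<bar> \<le> e"
  shows "Lnorm \<infinity> \<Omega> f \<le> Lnorm \<infinity> \<Omega> g + e"
proof (rule Lnorm_inf_le[OF \<Omega>(1,3)])
  show "f \<in> borel_measurable (lebesgue_on \<Omega>)" using C_0_in_L_inf[OF \<Omega> f] by (simp add: in_L_def)
  have gc: "continuous_on \<Omega> g" using g closure_subset[of \<Omega>] by (auto simp: C_0_def elim: continuous_on_subset)
  show "AE x in lebesgue_on \<Omega>. norm (f x) \<le> Lnorm \<infinity> \<Omega> g + e"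
  proof (rule AE_I2)
    fix x assume "x \<in> space (lebesgue_on \<Omega>)"
    then have x: "x \<in> \<Omega>" by (simp add: space_restrict_space)
    show "norm (f x) \<le> Lnorm \<infinity> \<Omega> g + e"
      using Lnorm_inf_ge[OF \<Omega>(1) C_0_in_L_inf[OF \<Omega> g] gc x] e[OF x] by simp
  qed
qed

text \<open>A bound for infinitely many k is enough, so that the lemma also applies to a
  hypothetical L below \<open>Lambda_inf\<close>. At a fixed side r the factor r^(-N/p) tends to 1;
  only afterwards r tends to 0.\<close>

lemma extremal_limit_lipschitz:
  assumes p: "filterlim p at_top sequentially" "\<And>k. p k > real CARD('n)"
    and ext: "\<And>k. sobolev_extremal \<Omega> (p k) (q k) (u k)"
    and lim: "uniform_limit (closure \<Omega>) u v sequentially" and v: "v \<in> C_0 \<Omega>"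
    and L: "\<exists>\<^sub>F k in sequentially. sobolev_lambda \<Omega> (p k) (q k) powr (1 / p k) \<le> L"
  shows "\<bar>zero_ext \<Omega> v x - zero_ext \<Omega> v y\<bar> \<le> L * norm (x - y)"
proof -
  let ?w = "\<lambda>k. zero_ext \<Omega> (u k)" and ?W = "zero_ext \<Omega> v"
  let ?l = "\<lambda>k. sobolev_lambda \<Omega> (p k) (q k) powr (1 / p k)"
  \<comment> \<open>The filter of large k among those satisfying the bound: proper by the frequency
    hypothesis, and inheriting every limit along the full sequence.\<close>
  define F where "F = inf sequentially (principal {k. ?l k \<le> L})"
  have Fbot: "F \<noteq> bot"
    using L unfolding F_def trivial_limit_def frequently_def by (simp add: eventually_inf_principal)
  have Fle: "F \<le> sequentially" by (simp add: F_def)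
  have evL: "\<forall>\<^sub>F k in F. ?l k \<le> L" by (simp add: F_def eventually_inf_principal)
  have wc: "continuous_on UNIV (?w k)" for k
    by (rule continuous_zero_ext[OF \<Omega> extremal_regularity(1)[OF ext p(2)]])
  have Wc: "continuous_on UNIV ?W" by (rule continuous_zero_ext[OF \<Omega> v])
  have ul: "uniform_limit UNIV ?w ?W F"
    using uniform_limit_zero_ext[OF lim] Fle by (rule filterlim_mono[OF _ order_refl])
  have avg: "\<bar>cube_avg ?W x r - cube_avg ?W y r\<bar> \<le> norm (x - y) * L" if r: "r > 0" for r
  proof (rule tendsto_le[OF Fbot])
    show "((\<lambda>k. \<bar>cube_avg (?w k) x r - cube_avg (?w k) y r\<bar>) \<longlongrightarrow> \<bar>cube_avg ?W x r - cube_avg ?W y r\<bar>) F"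
      by (intro tendsto_rabs tendsto_diff uniform_limit_cube_avg[OF ul wc Fbot])
    have "((\<lambda>k. 1 / p k) \<longlongrightarrow> 0) sequentially"
      using tendsto_inverse_0_at_top[OF p(1)] by (simp add: inverse_eq_divide)
    then have "((\<lambda>k. - real CARD('n) * (1 / p k)) \<longlongrightarrow> - real CARD('n) * 0) F"
      by (intro tendsto_mult tendsto_const) (rule tendsto_mono[OF Fle])
    then have "((\<lambda>k. r powr (- real CARD('n) / p k)) \<longlongrightarrow> r powr 0) F"
      using r by (intro tendsto_powr tendsto_const) auto
    then have "((\<lambda>k. norm (x - y) * (L * r powr (- real CARD('n) / p k))) \<longlongrightarrow> norm (x - y) * (L * r powr 0)) F"
      by (intro tendsto_mult tendsto_const)
    then show "((\<lambda>k. norm (x - y) * (L * r powr (- real CARD('n) / p k))) \<longlongrightarrow> norm (x - y) * L) F"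
      using r by simp
    show "\<forall>\<^sub>F k in F. \<bar>cube_avg (?w k) x r - cube_avg (?w k) y r\<bar> \<le> norm (x - y) * (L * r powr (- real CARD('n) / p k))"
      using evL
    proof eventually_elim
      case (elim k)
      have "\<bar>cube_avg (?w k) (y + (x - y)) r - cube_avg (?w k) y r\<bar> \<le> norm (x - y) * (?l k * r powr (- real CARD('n) / p k))"
        by (rule extremal_regularity(3)[OF ext p(2) r])
      also have "\<dots> \<le> norm (x - y) * (L * r powr (- real CARD('n) / p k))"
        by (intro mult_left_mono mult_right_mono elim) auto
      finally show ?case by simp
    qed
  qed
  have "\<bar>?W x - ?W y\<bar> \<le> norm (x - y) * L"
  proof (rule tendsto_upperbound)
    show "((\<lambda>r. \<bar>cube_avg ?W x r - cube_avg ?W y r\<bar>) \<longlongrightarrow> \<bar>?W x - ?W y\<bar>) (at_right 0)"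
      by (intro tendsto_rabs tendsto_diff tendsto_cube_avg Wc)
    show "\<forall>\<^sub>F r in at_right 0. \<bar>cube_avg ?W x r - cube_avg ?W y r\<bar> \<le> norm (x - y) * L"
      unfolding eventually_at_right_field using avg by (intro exI[of _ 1]) auto
  qed simp
  then show ?thesis by (simp add: mult.commute)
qed

text \<open>Equicontinuity has to be uniform although the Hoelder exponent 1 - N/p varies; p >= 2N
  keeps it between 1/2 and 1. The bounds hold only from \<open>k0\<close> on, hence the shifted
  index in the application of Arzela-Ascoli.\<close>

lemma extremal_subsequence:
  assumes p: "filterlim p at_top sequentially" "\<And>k. p k > real CARD('n)" and q: "filterlim q at_top sequentially" "\<And>k. q k \<ge> 1"
    and ext: "\<And>k. sobolev_extremal \<Omega> (p k) (q k) (u k)"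
  obtains s v where "strict_mono (s :: nat \<Rightarrow> nat)" "continuous_on (closure \<Omega>) v" "uniform_limit (closure \<Omega>) (\<lambda>k. u (s k)) v sequentially"
proof -
  let ?N = "real CARD('n)"
  let ?l = "\<lambda>k. sobolev_lambda \<Omega> (p k) (q k) powr (1 / p k)"
  define L where "L = \<bar>Lambda_inf \<Omega>\<bar> + 1"
  have L: "L > 0" "L > Lambda_inf \<Omega>" by (simp_all add: L_def)
  have "\<forall>\<^sub>F k in sequentially. ?l k < L \<and> p k \<ge> 2 * ?N"
    using eventually_sobolev_root_less[OF p q L(2)] p(1) by (intro eventually_conj) (auto simp: filterlim_at_top)
  then obtain k0 where k0: "\<And>k. k \<ge> k0 \<Longrightarrow> ?l k < L \<and> p k \<ge> 2 * ?N"
    by (auto simp: eventually_sequentially)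
  \<comment> \<open>An exponent 1 - N/p of at least 1/2 bounds the Morrey constant 1 + 2N/(1 - N/p)
    by 1 + 4N, and L bounds the roots of \<lambda>.\<close>
  define C where "C = (1 + 4 * ?N) * L"
  have C: "C > 0" using L(1) by (simp add: C_def add_pos_nonneg)
  have N0: "?N > 0" by simp
  have hoelder: "\<bar>zero_ext \<Omega> (u (k + k0)) x - zero_ext \<Omega> (u (k + k0)) y\<bar> \<le> C * norm (x - y) powr (1 - ?N / p (k + k0))"
    and half: "1/2 \<le> 1 - ?N / p (k + k0)" "1 - ?N / p (k + k0) \<le> 1" for k x y
  proof -
    let ?k = "k + k0"
    have pk: "p ?k \<ge> 2 * ?N" "?l ?k < L" using k0[of ?k] by auto
    have p0: "p ?k > 0" using pk(1) N0 by linarith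
    show h: "1/2 \<le> 1 - ?N / p ?k" using pk(1) p0 by (simp add: field_simps)
    show "1 - ?N / p ?k \<le> 1" using p0 by simp
    have pos: "1 - ?N / p ?k > 0" using h by linarith
    have "2 * ?N / (1 - ?N / p ?k) \<le> 2 * ?N / (1/2)"
      by (rule divide_left_mono[OF h _ mult_pos_pos[OF pos]]) auto
    then have mc: "morrey_const ?N (p ?k) \<le> 1 + 4 * ?N" by (simp add: morrey_const_def)
    have "\<bar>zero_ext \<Omega> (u ?k) x - zero_ext \<Omega> (u ?k) y\<bar> \<le> morrey_const ?N (p ?k) * ?l ?k * norm (x - y) powr (1 - ?N / p ?k)"
      by (rule extremal_regularity(2)[OF ext p(2)])
    also have "\<dots> \<le> C * norm (x - y) powr (1 - ?N / p ?k)"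
      unfolding C_def using mc pk(2) by (intro mult_right_mono mult_mono) auto
    finally show "\<bar>zero_ext \<Omega> (u ?k) x - zero_ext \<Omega> (u ?k) y\<bar> \<le> C * norm (x - y) powr (1 - ?N / p ?k)" .
  qed
  have uz: "zero_ext \<Omega> (u k) x = u k x" if "x \<in> closure \<Omega>" for k x
    by (rule zero_ext_closure[OF \<Omega> extremal_regularity(1)[OF ext p(2)] that])
  obtain D where D: "D > 0" "\<And>x. x \<in> closure \<Omega> \<Longrightarrow> \<exists>y. y \<notin> \<Omega> \<and> norm (x - y) \<le> D"
    using exit_point[OF \<Omega>(2)] by blast
  \<comment> \<open>With a base of at least 1, powers with exponent at most 1 are bounded by the
    base itself, uniformly in p.\<close>
  define D' where "D' = max 1 D"
  obtain v s where vs: "continuous_on (closure \<Omega>) v" "strict_mono (s :: nat \<Rightarrow> nat)"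
    "\<And>e. 0 < e \<Longrightarrow> \<exists>N. \<forall>n x. n \<ge> N \<and> x \<in> closure \<Omega> \<longrightarrow> norm (u (s n + k0) x - v x) < e"
  proof (rule Arzela_Ascoli[of "closure \<Omega>" "\<lambda>n. u (n + k0)" "C * D'"])
    show "compact (closure \<Omega>)" using \<Omega>(2) by simp
    fix n :: nat and x assume x: "x \<in> closure \<Omega>"
    obtain y where y: "y \<notin> \<Omega>" "norm (x - y) \<le> D" using D(2)[OF x] by blast
    have "norm (x - y) powr (1 - ?N / p (n + k0)) \<le> D' powr (1 - ?N / p (n + k0))"
    proof (rule powr_mono2)
      show "0 \<le> 1 - ?N / p (n + k0)" using half(1)[of n] by linarith
    qed (use y(2) in \<open>auto simp: D'_def\<close>)
    also have "\<dots> \<le> D' powr 1" using half(2)[of n] by (intro powr_mono) (auto simp: D'_def)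
    also have "\<dots> = D'" by (simp add: D'_def)
    finally have "C * norm (x - y) powr (1 - ?N / p (n + k0)) \<le> C * D'" using C by (intro mult_left_mono) auto
    then show "norm (u (n + k0) x) \<le> C * D'"
      using hoelder[of n x y] y(1) uz[OF x] by (simp add: zero_ext_def[of _ _ y])
  next
    fix x and e :: real assume x: "x \<in> closure \<Omega>" and e: "0 < e"
    define d where "d = min 1 ((e / C)\<^sup>2)"
    have d: "d > 0" using e C by (simp add: d_def)
    show "\<exists>d. 0 < d \<and> (\<forall>n y. y \<in> closure \<Omega> \<and> norm (x - y) < d \<longrightarrow> norm (u (n + k0) x - u (n + k0) y) < e)"
    proof (intro exI[of _ d] conjI d allI impI)
      fix n y assume y: "y \<in> closure \<Omega> \<and> norm (x - y) < d"
      then have n1: "norm (x - y) \<le> 1" "norm (x - y) < (e / C)\<^sup>2" by (auto simp: d_def)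
      have "norm (x - y) powr (1 - ?N / p (n + k0)) \<le> norm (x - y) powr (1/2)"
        using n1(1) half(1)[of n] by (intro powr_mono') auto
      also have "\<dots> = sqrt (norm (x - y))" by (simp add: powr_half_sqrt)
      also have "\<dots> < e / C" using n1(2) e C by (intro real_less_lsqrt) auto
      finally have "C * norm (x - y) powr (1 - ?N / p (n + k0)) < e" using C by (simp add: field_simps)
      then show "norm (u (n + k0) x - u (n + k0) y) < e"
        using hoelder[of n x y] uz[OF x] uz y by simp
    qed
  qed blast
  have "strict_mono (\<lambda>k. s k + k0)" using vs(2) by (simp add: strict_mono_def)
  moreover have "uniform_limit (closure \<Omega>) (\<lambda>k. u (s k + k0)) v sequentially"
    unfolding uniform_limit_sequentially_iff
  proof (intro allI impI)
    fix e :: real assume "e > 0"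
    from vs(3)[OF this] show "\<exists>N. \<forall>n\<ge>N. \<forall>x\<in>closure \<Omega>. dist (u (s n + k0) x) (v x) < e"
      by (simp add: dist_norm) blast
  qed
  ultimately show thesis using that vs(1) by blast
qed

text \<open>Everything meets at the maximum of v: the normalisation in the q-norm forces it to be at
  least 1, and v <= \<Lambda> dist forces it to be at most 1. Equality in both pins down the limit
  of the roots, the gradient norm and the location of maximum points.\<close>

lemma extremal_sequence_limit:
  assumes conn: "connected \<Omega>"
    and p: "filterlim p at_top sequentially" "\<And>k. p k > real CARD('n)" and q: "filterlim q at_top sequentially" "\<And>k. q k \<ge> 1"
    and ext: "\<And>k. sobolev_extremal \<Omega> (p k) (q k) (u k)"
    and vc: "continuous_on (closure \<Omega>) v" and lim: "uniform_limit (closure \<Omega>) u v sequentially"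
  shows "(\<lambda>k. sobolev_lambda \<Omega> (p k) (q k) powr (1 / p k)) \<longlonglongrightarrow> Lambda_inf \<Omega>"
    and "(\<lambda>k. Lnorm \<infinity> \<Omega> (u k)) \<longlonglongrightarrow> 1"
    and "v \<in> C_0 \<Omega> \<inter> W1 \<infinity> \<Omega> \<and> (\<forall>x \<in> closure \<Omega>. 0 \<le> v x \<and> v x \<le> Lambda_inf \<Omega> * boundary_dist \<Omega> x) \<and>
         Lnorm \<infinity> \<Omega> v = 1 \<and> Lambda_inf \<Omega> = Lnorm \<infinity> \<Omega> (weak_grad \<Omega> v) \<and>
         {x \<in> \<Omega>. v x = 1} \<subseteq> {x \<in> \<Omega>. boundary_dist \<Omega> x = Lnorm \<infinity> \<Omega> (boundary_dist \<Omega>)} \<and>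
         inf_superharmonic \<Omega> v \<and> (\<forall>x\<in>\<Omega>. v x > 0)"
proof -
  let ?l = "\<lambda>k. sobolev_lambda \<Omega> (p k) (q k) powr (1 / p k)"
  let ?\<Lambda> = "Lambda_inf \<Omega>"
  obtain x0 where x0: "x0 \<in> \<Omega>" "\<And>x. x \<in> closure \<Omega> \<Longrightarrow> boundary_dist \<Omega> x \<le> boundary_dist \<Omega> x0"
    "boundary_dist \<Omega> x0 > 0" "Lnorm \<infinity> \<Omega> (boundary_dist \<Omega>) = boundary_dist \<Omega> x0"
    using inradius_point[OF \<Omega>] by blast
  define R where "R = boundary_dist \<Omega> x0"
  have R: "R > 0" using x0 by (simp add: R_def)
  have \<Lambda>: "?\<Lambda> = 1 / R" using x0(4) by (simp add: Lambda_inf_eq[OF \<Omega>] R_def)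
  have \<Lambda>0: "?\<Lambda> > 0" using R by (simp add: \<Lambda>)
  have cl: "\<Omega> \<subseteq> closure \<Omega>" by (rule closure_subset)
  have uC: "u k \<in> C_0 \<Omega>" for k by (rule extremal_regularity(1)[OF ext p(2)])
  have upos: "u k x > 0" if "x \<in> \<Omega>" for k x using ext[of k] that by (simp add: sobolev_extremal_def)
  have unn: "u k x \<ge> 0" if "x \<in> closure \<Omega>" for k x
    using upos[of x k] uC[of k] that unfolding closure_eq_Un_frontier[OF \<Omega>] by (auto simp: C_0_def less_imp_le)
  have pw: "(\<lambda>k. u k x) \<longlonglongrightarrow> v x" if "x \<in> closure \<Omega>" for x by (rule tendsto_uniform_limitI[OF lim that])
  have vnn: "v x \<ge> 0" if "x \<in> closure \<Omega>" for x
    by (rule LIMSEQ_le_const[OF pw[OF that]]) (use unn[OF that] in blast)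
  have "v x = 0" if x: "x \<in> frontier \<Omega>" for x
  proof -
    have "x \<in> closure \<Omega>" using x by (simp add: frontier_def)
    from pw[OF this] show ?thesis using uC x by (simp add: C_0_def LIMSEQ_const_iff)
  qed
  then have vC: "v \<in> C_0 \<Omega>" using vc by (simp add: C_0_def)
  have lip: "\<bar>zero_ext \<Omega> v x - zero_ext \<Omega> v y\<bar> \<le> L * norm (x - y)" if "\<exists>\<^sub>F k in sequentially. ?l k \<le> L" for L x y
    by (rule extremal_limit_lipschitz[OF p ext lim vC that])
  have dist_bound: "v x \<le> L * boundary_dist \<Omega> x" if L: "\<exists>\<^sub>F k in sequentially. ?l k \<le> L" and x: "x \<in> closure \<Omega>" for L x
  proof -
    obtain y where y: "y \<in> frontier \<Omega>" "boundary_dist \<Omega> x = norm (x - y)" using boundary_dist_attained[OF \<Omega>] by blast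
    have "zero_ext \<Omega> v y = 0" using frontier_disjoint[OF \<Omega> y(1)] by (simp add: zero_ext_def)
    then show ?thesis using lip[OF L, of x y] zero_ext_closure[OF \<Omega> vC x] y(2) by simp
  qed
  \<comment> \<open>Only constants L above \<Lambda> are available at first; the two estimates that
    follow reach \<Lambda> itself by letting L decrease to it.\<close>
  have freq: "\<exists>\<^sub>F k in sequentially. ?l k \<le> L" if "L > ?\<Lambda>" for L
    using eventually_sobolev_root_less[OF p q that]
    by (intro eventually_frequently sequentially_bot) (auto elim: eventually_mono)
  have lip\<Lambda>: "\<bar>zero_ext \<Omega> v x - zero_ext \<Omega> v y\<bar> \<le> ?\<Lambda> * norm (x - y)" for x y
  proof (rule tendsto_lowerbound)
    show "((\<lambda>L. L * norm (x - y)) \<longlongrightarrow> ?\<Lambda> * norm (x - y)) (at_right ?\<Lambda>)" by (intro tendsto_intros)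
    show "\<forall>\<^sub>F L in at_right ?\<Lambda>. \<bar>zero_ext \<Omega> v x - zero_ext \<Omega> v y\<bar> \<le> L * norm (x - y)"
      unfolding eventually_at_right_field using lip[OF freq] by (intro exI[of _ "?\<Lambda> + 1"]) auto
  qed simp
  have bound: "v x \<le> ?\<Lambda> * boundary_dist \<Omega> x" if x: "x \<in> closure \<Omega>" for x
  proof (rule tendsto_lowerbound)
    show "((\<lambda>L. L * boundary_dist \<Omega> x) \<longlongrightarrow> ?\<Lambda> * boundary_dist \<Omega> x) (at_right ?\<Lambda>)" by (intro tendsto_intros)
    show "\<forall>\<^sub>F L in at_right ?\<Lambda>. v x \<le> L * boundary_dist \<Omega> x"
      unfolding eventually_at_right_field using dist_bound[OF freq x] by (intro exI[of _ "?\<Lambda> + 1"]) auto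
  qed simp
  have v1: "v x \<le> 1" if x: "x \<in> closure \<Omega>" for x
  proof -
    have "v x \<le> ?\<Lambda> * R"
      using bound[OF x] mult_left_mono[OF x0(2)[OF x] less_imp_le[OF \<Lambda>0]] by (simp add: R_def)
    then show ?thesis using R by (simp add: \<Lambda>)
  qed
  obtain xm where xm: "xm \<in> closure \<Omega>" "\<And>x. x \<in> closure \<Omega> \<Longrightarrow> v x \<le> v xm"
    using continuous_attains_sup[OF _ _ vc] \<Omega>(2,3) by auto
  \<comment> \<open>The q-norm of \<open>u k\<close> is 1 and at most (max v + e) |\<Omega>|^(1/q);
    the measure factor tends to 1 because q -> infinity.\<close>
  have vxm: "v xm = 1"
  proof (rule antisym[OF v1[OF xm(1)]], rule field_le_epsilon)
    fix e :: real assume e: "e > 0"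
    have "measure lebesgue \<Omega> > 0" by (rule measure_open_pos[OF \<Omega>])
    from tendsto_powr_inverse[OF this q(1)]
    have "(\<lambda>k. (v xm + e) * measure lebesgue \<Omega> powr (1 / q k)) \<longlonglongrightarrow> (v xm + e) * 1"
      by (intro tendsto_mult tendsto_const)
    then have "1 \<le> (v xm + e) * 1"
    proof (rule tendsto_lowerbound)
      show "\<forall>\<^sub>F k in sequentially. 1 \<le> (v xm + e) * measure lebesgue \<Omega> powr (1 / q k)"
        using uniform_limitD[OF lim e]
      proof eventually_elim
        case (elim k)
        have um: "u k \<in> borel_measurable (lebesgue_on \<Omega>)" using C_0_in_L_inf[OF \<Omega> uC[of k]] by (simp add: in_L_def)
        have "Lnorm (ereal (q k)) \<Omega> (u k) \<le> (v xm + e) * measure lebesgue \<Omega> powr (1 / q k)"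
        proof (rule Lnorm_bounded[OF \<Omega>(1,2) um])
          fix x assume "x \<in> \<Omega>"
          then have x: "x \<in> closure \<Omega>" using cl by blast
          then have "\<bar>u k x - v x\<bar> < e" using elim by (simp add: dist_real_def)
          then show "norm (u k x) \<le> v xm + e" using xm(2)[OF x] unn[OF x, of k] by simp
        next
          show "0 \<le> v xm + e" using vnn[OF xm(1)] e by simp
          show "0 < q k" using q(2)[of k] by simp
        qed
        then show ?case using ext[of k] by (simp add: sobolev_extremal_def)
      qed
    qed simp
    then show "1 \<le> v xm + e" by simp
  qed
  have xm\<Omega>: "xm \<in> \<Omega>" using xm(1) vxm vC unfolding closure_eq_Un_frontier[OF \<Omega>] by (auto simp: C_0_def)
  have vc\<Omega>: "continuous_on \<Omega> v" by (rule continuous_on_subset[OF vc cl])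
  have vnorm: "Lnorm \<infinity> \<Omega> v = 1"
    using Lnorm_inf_eq(1)[OF \<Omega>(1) vc\<Omega> xm\<Omega>] xm(2) vnn cl vxm by (auto simp: subset_iff)
  show "?l \<longlonglongrightarrow> ?\<Lambda>"
  proof (rule order_tendstoI)
    fix L assume "L > ?\<Lambda>"
    then show "\<forall>\<^sub>F k in sequentially. ?l k < L" by (rule eventually_sobolev_root_less[OF p q])
  next
    fix L assume L: "L < ?\<Lambda>"
    show "\<forall>\<^sub>F k in sequentially. L < ?l k"
    proof (rule ccontr)
      assume "\<not> (\<forall>\<^sub>F k in sequentially. L < ?l k)"
      \<comment> \<open>A smaller L along infinitely many indices would give v <= L dist, hence v <
        1 at the maximum point \<open>xm\<close>, where v = 1.\<close>
      then have f: "\<exists>\<^sub>F k in sequentially. ?l k \<le> L" by (simp add: not_eventually not_less)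
      have "boundary_dist \<Omega> xm > 0" by (rule boundary_dist_pos[OF \<Omega> xm\<Omega>])
      have "1 \<le> L * boundary_dist \<Omega> xm" using dist_bound[OF f xm(1)] vxm by simp
      also have "\<dots> < ?\<Lambda> * boundary_dist \<Omega> xm" using L \<open>boundary_dist \<Omega> xm > 0\<close> by simp
      also have "\<dots> \<le> ?\<Lambda> * R" using x0(2)[OF xm(1)] \<Lambda>0 by (simp add: R_def)
      also have "\<dots> = 1" using R by (simp add: \<Lambda>)
      finally show False by simp
    qed
  qed
  show "(\<lambda>k. Lnorm \<infinity> \<Omega> (u k)) \<longlonglongrightarrow> 1"
  proof (rule tendstoI)
    fix e :: real assume "e > 0"
    then have e: "e / 2 > 0" by simp
    show "\<forall>\<^sub>F k in sequentially. dist (Lnorm \<infinity> \<Omega> (u k)) 1 < e"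
      using uniform_limitD[OF lim e]
    proof eventually_elim
      case (elim k)
      have "\<bar>u k x - v x\<bar> \<le> e / 2" if "x \<in> \<Omega>" for x
        using elim that cl by (force simp: dist_real_def)
      then have "Lnorm \<infinity> \<Omega> (u k) \<le> Lnorm \<infinity> \<Omega> v + e / 2" "Lnorm \<infinity> \<Omega> v \<le> Lnorm \<infinity> \<Omega> (u k) + e / 2"
        by (intro Lnorm_inf_close uC vC; simp add: abs_minus_commute)+
      then show ?case using e by (simp add: vnorm dist_real_def)
    qed
  qed
  have zo: "zero_ext \<Omega> v x = 0" if "x \<notin> \<Omega>" for x using that by (simp add: zero_ext_def)
  obtain g where g0: "has_weak_grad \<Omega> (zero_ext \<Omega> v) g" and gm: "g \<in> borel_measurable (lebesgue_on \<Omega>)"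
     and gL: "AE x in lebesgue_on \<Omega>. norm (g x) \<le> ?\<Lambda>"
    using lipschitz_has_weak_grad[OF \<Omega> lip\<Lambda> less_imp_le[OF \<Lambda>0] zo] by blast
  have g: "has_weak_grad \<Omega> v g" by (rule has_weak_grad_cong[OF g0]) (simp add: zero_ext_def)
  have vW: "v \<in> W1 \<infinity> \<Omega>"
    unfolding W1_def using C_0_in_L_inf[OF \<Omega> vC] g in_L_infI[OF \<Omega>(1,3) gm gL] by blast
  have grad_le: "Lnorm \<infinity> \<Omega> (weak_grad \<Omega> v) \<le> ?\<Lambda>"
    unfolding Lnorm_weak_grad[OF \<Omega>(1) g gm] by (rule Lnorm_inf_le[OF \<Omega>(1,3) gm gL])
  \<comment> \<open>v is itself admissible in the infimum defining \<open>Lambda_inf\<close>; with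
    the Lipschitz bound it becomes a minimiser.\<close>
  have grad_ge: "?\<Lambda> \<le> Lnorm \<infinity> \<Omega> (weak_grad \<Omega> v)"
    unfolding Lambda_inf_def by (rule cInf_lower[OF _ Lambda_inf_bdd[OF \<Omega>]]) (use vC vW vnorm in blast)
  have touch: "inf_laplacian \<phi> y \<le> 0" if "Ck_on 2 (ball y r) \<phi>" "r > 0" "ball y r \<subseteq> \<Omega>" "\<phi> y = v y"
      "\<And>x. x \<in> ball y r \<Longrightarrow> \<phi> x \<le> v x" for \<phi> y r
  proof (rule touching_C2[OF _ that])
    fix P \<epsilon> r0
    assume "smooth_on UNIV P" "P y = v y" "r0 > 0" "ball y r0 \<subseteq> \<Omega>" "\<epsilon> > 0"
      "\<And>x. x \<in> ball y r0 \<Longrightarrow> P x + \<epsilon> * (norm (x - y))\<^sup>2 \<le> v x"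
    then show "inf_laplacian P y \<le> 0"
      using touching_smooth[OF \<Omega> p(2,1) q(2) ext lim] by blast
  qed
  have sh: "inf_superharmonic \<Omega> v"
    unfolding inf_superharmonic_def
  proof (intro conjI vc\<Omega> ballI allI impI)
    fix y r \<phi>
    assume y: "y \<in> \<Omega>" "r > 0" "ball y r \<subseteq> \<Omega>"
      and \<phi>: "Ck_on 2 (ball y r) \<phi> \<and> \<phi> y - v y = 0 \<and> (\<forall>x\<in>ball y r - {y}. \<phi> x - v x < 0)"
    have "\<phi> x \<le> v x" if "x \<in> ball y r" for x
      using \<phi> that by (cases "x = y") force+
    then have "inf_laplacian \<phi> y \<le> 0" using \<phi> y by (intro touch[of y r \<phi>]) auto
    then show "- inf_laplacian \<phi> y \<ge> 0" by simp
  qed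
  have pos: "v x > 0" if "x \<in> \<Omega>" for x
  proof (rule positive_of_touching[OF \<Omega>(1) conn vc\<Omega> _ xm\<Omega> _ touch that])
    show "v x \<ge> 0" if "x \<in> \<Omega>" for x using vnn that cl by blast
    show "v xm > 0" by (simp add: vxm)
  qed
  have max: "boundary_dist \<Omega> x = R" if x: "x \<in> \<Omega>" "v x = 1" for x
  proof -
    have xc: "x \<in> closure \<Omega>" using x cl by blast
    have "R \<le> boundary_dist \<Omega> x" using bound[OF xc] x(2) R by (simp add: \<Lambda> field_simps)
    then show ?thesis using x0(2)[OF xc] by (simp add: R_def)
  qed
  show "v \<in> C_0 \<Omega> \<inter> W1 \<infinity> \<Omega> \<and> (\<forall>x \<in> closure \<Omega>. 0 \<le> v x \<and> v x \<le> Lambda_inf \<Omega> * boundary_dist \<Omega> x) \<and>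
         Lnorm \<infinity> \<Omega> v = 1 \<and> Lambda_inf \<Omega> = Lnorm \<infinity> \<Omega> (weak_grad \<Omega> v) \<and>
         {x \<in> \<Omega>. v x = 1} \<subseteq> {x \<in> \<Omega>. boundary_dist \<Omega> x = Lnorm \<infinity> \<Omega> (boundary_dist \<Omega>)} \<and>
         inf_superharmonic \<Omega> v \<and> (\<forall>x\<in>\<Omega>. v x > 0)"
    using vC vW vnn bound vnorm grad_le grad_ge sh pos max x0(4) by (auto simp: R_def intro: antisym)
qed

end

text \<open>If convergence failed, points p n > max(n, N) with values outside a fixed neighbourhood
  of y would form a sequence tending to infinity, and no selection from it could converge to
  y.\<close>

lemma tendsto_at_top_by_subsequences:
  fixes f :: "real \<Rightarrow> real"
  assumes "\<And>p. (\<And>n. p n > N) \<Longrightarrow> filterlim p at_top sequentially \<Longrightarrow> \<exists>s :: nat \<Rightarrow> nat. (\<lambda>k. f (p (s k))) \<longlonglongrightarrow> y"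
  shows "(f \<longlongrightarrow> y) at_top"
proof (rule ccontr)
  assume "\<not> (f \<longlongrightarrow> y) at_top"
  then obtain e where e: "e > 0" "\<not> (\<forall>\<^sub>F p in at_top. dist (f p) y < e)" unfolding tendsto_iff by blast
  then have "\<exists>p > max (real n) N. \<not> dist (f p) y < e" for n :: nat
    unfolding eventually_at_top_dense by blast
  then obtain p where p: "\<And>n :: nat. p n > max (real n) N" "\<And>n. \<not> dist (f (p n)) y < e" by metis
  have "filterlim p at_top sequentially"
    by (rule filterlim_at_top_mono[OF filterlim_real_sequentially]) (use p(1) in \<open>auto intro!: always_eventually less_imp_le\<close>)
  then obtain s :: "nat \<Rightarrow> nat" where s: "(\<lambda>k. f (p (s k))) \<longlonglongrightarrow> y" using assms[of p] p(1) by auto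
  have "\<forall>\<^sub>F k in sequentially. dist (f (p (s k))) y < e" by (rule tendstoD[OF s e(1)])
  then show False using p(2) by (simp add: eventually_sequentially)
qed

theorem theorem1p1:
  fixes \<Omega> :: "(real ^ 'n::finite) set"
    and q :: "real \<Rightarrow> real"
    and u :: "real \<Rightarrow> real ^ 'n \<Rightarrow> real"
  assumes dim: "CARD('n) \<ge> 2"
    and dom: "bounded_smooth_domain \<Omega>"
    and q_ge: "\<And>p. p > real CARD('n) \<Longrightarrow> q p \<ge> 1"
    and extremal: "\<And>p. p > real CARD('n) \<Longrightarrow> sobolev_extremal \<Omega> p (q p) (u p)"
    and q_lim: "filterlim q at_top at_top"
  shows "((\<lambda>p. sobolev_lambda \<Omega> p (q p) powr (1 / p)) \<longlongrightarrow> Lambda_inf \<Omega>) at_top \<and>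
    ((\<lambda>p. Lnorm \<infinity> \<Omega> (u p)) \<longlongrightarrow> 1) at_top \<and>
    (\<forall>p :: nat \<Rightarrow> real. (\<forall>n. p n > real CARD('n)) \<longrightarrow> filterlim p at_top sequentially \<longrightarrow>
      (\<exists>s u_inf. strict_mono s \<and>
         uniform_limit (closure \<Omega>) (\<lambda>k. u (p (s k))) u_inf sequentially \<and>
         u_inf \<in> C_0 \<Omega> \<inter> W1 \<infinity> \<Omega> \<and>
         (\<forall>x \<in> closure \<Omega>. 0 \<le> u_inf x \<and> u_inf x \<le> Lambda_inf \<Omega> * boundary_dist \<Omega> x) \<and>
         Lnorm \<infinity> \<Omega> u_inf = 1 \<and> Lambda_inf \<Omega> = Lnorm \<infinity> \<Omega> (weak_grad \<Omega> u_inf) \<and>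
         {x \<in> \<Omega>. u_inf x = 1} \<subseteq> {x \<in> \<Omega>. boundary_dist \<Omega> x = Lnorm \<infinity> \<Omega> (boundary_dist \<Omega>)} \<and>
         inf_superharmonic \<Omega> u_inf \<and> (\<forall>x\<in>\<Omega>. u_inf x > 0)))"
proof -
  have \<Omega>: "open \<Omega>" "bounded \<Omega>" "\<Omega> \<noteq> {}" and conn: "connected \<Omega>"
    using dom by (auto simp: bounded_smooth_domain_def)
  \<comment> \<open>The two limits along the subsequence are kept in the claim because they give the
    full limits in p through \<open>tendsto_at_top_by_subsequences\<close>.\<close>
  have main: "\<exists>s v. strict_mono s \<and> uniform_limit (closure \<Omega>) (\<lambda>k. u (p (s k))) v sequentially \<and>
      (\<lambda>k. sobolev_lambda \<Omega> (p (s k)) (q (p (s k))) powr (1 / p (s k))) \<longlonglongrightarrow> Lambda_inf \<Omega> \<and>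
      (\<lambda>k. Lnorm \<infinity> \<Omega> (u (p (s k)))) \<longlonglongrightarrow> 1 \<and>
      v \<in> C_0 \<Omega> \<inter> W1 \<infinity> \<Omega> \<and> (\<forall>x \<in> closure \<Omega>. 0 \<le> v x \<and> v x \<le> Lambda_inf \<Omega> * boundary_dist \<Omega> x) \<and>
      Lnorm \<infinity> \<Omega> v = 1 \<and> Lambda_inf \<Omega> = Lnorm \<infinity> \<Omega> (weak_grad \<Omega> v) \<and>
      {x \<in> \<Omega>. v x = 1} \<subseteq> {x \<in> \<Omega>. boundary_dist \<Omega> x = Lnorm \<infinity> \<Omega> (boundary_dist \<Omega>)} \<and>
      inf_superharmonic \<Omega> v \<and> (\<forall>x\<in>\<Omega>. v x > 0)"
    if p: "\<And>n. p n > real CARD('n)" "filterlim p at_top sequentially" for p :: "nat \<Rightarrow> real"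
  proof -
    have q': "filterlim (\<lambda>k. q (p k)) at_top sequentially" "\<And>k. q (p k) \<ge> 1"
      using filterlim_compose[OF q_lim p(2)] q_ge[OF p(1)] by auto
    have ext: "\<And>k. sobolev_extremal \<Omega> (p k) (q (p k)) (u (p k))" by (rule extremal[OF p(1)])
    obtain s v where s: "strict_mono (s :: nat \<Rightarrow> nat)" and v: "continuous_on (closure \<Omega>) v"
      "uniform_limit (closure \<Omega>) (\<lambda>k. u (p (s k))) v sequentially"
      using extremal_subsequence[OF \<Omega> p(2,1) q' ext] by blast
    have fs: "filterlim s sequentially sequentially" by (rule filterlim_subseq[OF s])
    note lim = extremal_sequence_limit[OF \<Omega> conn filterlim_compose[OF p(2) fs] p(1)
        filterlim_compose[OF q'(1) fs] q'(2) ext v]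
    show ?thesis by (intro exI[of _ s] exI[of _ v] conjI s v(2) lim(1,2)) (use lim(3) in blast)+
  qed
  have "((\<lambda>p. sobolev_lambda \<Omega> p (q p) powr (1 / p)) \<longlongrightarrow> Lambda_inf \<Omega>) at_top"
    by (rule tendsto_at_top_by_subsequences[of "real CARD('n)"]) (use main in blast)
  moreover have "((\<lambda>p. Lnorm \<infinity> \<Omega> (u p)) \<longlongrightarrow> 1) at_top"
    by (rule tendsto_at_top_by_subsequences[of "real CARD('n)"]) (use main in blast)
  ultimately show ?thesis using main by blast
qed

end
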